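(* Let $A$, $B$, $C$, and $D$ be non-empty posets such that $C$, $D$, and $A^C$ are finite and connected and $A^C\cong B^D$. Then there exist posets $E$, $X$, $Y$, and $Z$ such that $A\cong E^X$, $B\cong E^Y$, $C\cong Y\times Z$, and $D\cong X\times Z$.
   Context: For posets $E$ and $X$, $E^X$ denotes the poset of all order-preserving maps from $X$ to $E$, ordered pointwise: for $f,g\in E^X$, $f\le g$ if and only if $f(x)\le g(x)$ in $E$ for all $x\in X$. The product $Y\times Z$ of posets carries the componentwise order. The symbol $\cong$ denotes order-isomorphism. Connectedness of a poset is in the usual order-theoretic sense: any two elements are joined by a finite sequence of elements in which consecutive elements are comparable. *)

theory Defs
  imports Main "HOL-Library.FuncSet"
begin

text \<open>
  A poset is a relation \<open>r\<close> with \<open>Partial_order r\<close>. By reflexivity its carrier is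
  \<open>Field r\<close>, so \<open>r\<close> alone determines the poset; the empty poset is the empty relation.
\<close>

definition mono_maps :: "'x rel \<Rightarrow> 'e rel \<Rightarrow> ('x \<Rightarrow> 'e) set" where
  "mono_maps X E =
     {f \<in> Field X \<rightarrow>\<^sub>E Field E.
        monotone_on (Field X) (\<lambda>x y. (x, y) \<in> X) (\<lambda>a b. (a, b) \<in> E) f}"

text \<open>
  \<open>poset_exp E X\<close> is the poset \<open>E\<^sup>X\<close>. Maps are extensional (\<open>undefined\<close> outside
  \<open>Field X\<close>), so equality in HOL coincides with equality of maps from \<open>X\<close> to \<open>E\<close>.
\<close>

definition poset_exp :: "'e rel \<Rightarrow> 'x rel \<Rightarrow> ('x \<Rightarrow> 'e) rel" where
  "poset_exp E X =
     {(f, g). f \<in> mono_maps X E \<and> g \<in> mono_maps X E \<and> (\<forall>x\<in>Field X. (f x, g x) \<in> E)}"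

definition poset_prod :: "'y rel \<Rightarrow> 'z rel \<Rightarrow> ('y \<times> 'z) rel" where
  "poset_prod Y Z = {((y, z), (y', z')). (y, y') \<in> Y \<and> (z, z') \<in> Z}"

definition poset_iso :: "'a rel \<Rightarrow> 'b rel \<Rightarrow> bool" where
  "poset_iso r s \<longleftrightarrow>
     (\<exists>f. bij_betw f (Field r) (Field s) \<and>
          (\<forall>x\<in>Field r. \<forall>y\<in>Field r. (x, y) \<in> r \<longleftrightarrow> (f x, f y) \<in> s))"

definition poset_connected :: "'a rel \<Rightarrow> bool" where
  "poset_connected r \<longleftrightarrow> (\<forall>x\<in>Field r. \<forall>y\<in>Field r. (x, y) \<in> (r \<union> r\<inverse>)\<^sup>*)"

lemma Field_poset_exp:
  assumes "Partial_order E"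
  shows "Field (poset_exp E X) = mono_maps X E"
proof
  show "Field (poset_exp E X) \<subseteq> mono_maps X E"
    by (auto simp: Field_def poset_exp_def)
  show "mono_maps X E \<subseteq> Field (poset_exp E X)"
  proof
    fix f assume f: "f \<in> mono_maps X E"
    hence "\<forall>x\<in>Field X. f x \<in> Field E" by (auto simp: mono_maps_def)
    hence "\<forall>x\<in>Field X. (f x, f x) \<in> E"
      using assms by (auto simp: order_on_defs refl_on_def)
    hence "(f, f) \<in> poset_exp E X" using f by (simp add: poset_exp_def)
    thus "f \<in> Field (poset_exp E X)" by (rule FieldI1)
  qed
qed

lemma Partial_order_poset_exp:
  assumes "Partial_order E"
  shows "Partial_order (poset_exp E X)"
proof -
  have tr: "trans E" and an: "antisym E" and rf: "refl_on (Field E) E"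
    using assms by (auto simp: order_on_defs)
  have "refl_on (mono_maps X E) (poset_exp E X)"
    using rf by (fastforce simp: refl_on_def poset_exp_def mono_maps_def)
  moreover have "trans (poset_exp E X)"
    using tr unfolding trans_def poset_exp_def by blast
  moreover have "antisym (poset_exp E X)"
  proof (rule antisymI)
    fix f g assume "(f, g) \<in> poset_exp E X" "(g, f) \<in> poset_exp E X"
    hence "f \<in> Field X \<rightarrow>\<^sub>E Field E" "g \<in> Field X \<rightarrow>\<^sub>E Field E"
      "\<forall>x\<in>Field X. f x = g x"
      using an by (auto simp: poset_exp_def mono_maps_def antisym_def)
    thus "f = g" by (metis PiE_ext)
  qed
  moreover have "poset_exp E X \<subseteq> mono_maps X E \<times> mono_maps X E"
    by (auto simp: poset_exp_def)
  ultimately show ?thesis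
    unfolding Field_poset_exp[OF assms] by (simp add: order_on_defs)
qed

lemma Field_poset_prod:
  assumes "Partial_order Y" "Partial_order Z"
  shows "Field (poset_prod Y Z) = Field Y \<times> Field Z"
proof
  show "Field (poset_prod Y Z) \<subseteq> Field Y \<times> Field Z"
    by (auto simp: Field_def poset_prod_def)
  show "Field Y \<times> Field Z \<subseteq> Field (poset_prod Y Z)"
  proof clarify
    fix y z assume "y \<in> Field Y" "z \<in> Field Z"
    hence "((y, z), (y, z)) \<in> poset_prod Y Z"
      using assms by (auto simp: poset_prod_def order_on_defs refl_on_def)
    thus "(y, z) \<in> Field (poset_prod Y Z)" by (rule FieldI1)
  qed
qed

lemma Partial_order_poset_prod:
  assumes "Partial_order Y" "Partial_order Z"
  shows "Partial_order (poset_prod Y Z)"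
proof -
  have "refl_on (Field Y \<times> Field Z) (poset_prod Y Z)"
    using assms by (auto simp: poset_prod_def order_on_defs refl_on_def)
  moreover have "trans (poset_prod Y Z)"
    using assms unfolding order_on_defs trans_def poset_prod_def by blast
  moreover have "antisym (poset_prod Y Z)"
    using assms unfolding order_on_defs antisym_def poset_prod_def by blast
  moreover have "poset_prod Y Z \<subseteq> (Field Y \<times> Field Z) \<times> (Field Y \<times> Field Z)"
    by (auto simp: poset_prod_def Field_def)
  ultimately show ?thesis
    unfolding Field_poset_prod[OF assms] by (simp add: order_on_defs)
qed

text \<open>
  HOL cannot quantify existentially over types. Posets known to be finite may be
  sought on \<open>nat\<close> without loss of generality, by the following fact. It applies to any
  \<open>E\<close>, \<open>X\<close>, \<open>Y\<close>, \<open>Z\<close> with \<open>A \<cong> E\<^sup>X\<close>, \<open>C \<cong> Y \<times> Z\<close> and \<open>D \<cong> X \<times> Z\<close> when \<open>C\<close> and \<open>D\<close> are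
  finite and non-empty and \<open>A\<^sup>C\<close> is finite: then \<open>X\<close>, \<open>Y\<close>, \<open>Z\<close> are finite and non-empty,
  and constant maps embed \<open>A\<close> in \<open>A\<^sup>C\<close> and \<open>E\<close> in \<open>A\<close>.
\<close>

lemma finite_poset_on_nat:
  assumes "Partial_order r" "finite (Field r)"
  shows "\<exists>s :: nat rel. Partial_order s \<and> poset_iso r s"
proof -
  obtain h :: "'a \<Rightarrow> nat" where h: "inj_on h (Field r)"
    using finite_imp_inj_to_nat_seg[OF assms(2)] by blast
  define s where "s = map_prod h h ` r"
  have F: "Field s = h ` Field r"
    by (force simp: s_def Field_def)
  have iff: "(h x, h y) \<in> s \<longleftrightarrow> (x, y) \<in> r" if "x \<in> Field r" "y \<in> Field r" for x y
    using that h by (auto simp: s_def dest: inj_onD intro: FieldI1 FieldI2)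
  have sub: "s \<subseteq> Field s \<times> Field s" by (auto intro: FieldI1 FieldI2)
  have "refl_on (Field s) s"
    unfolding F using assms(1) by (auto simp: refl_on_def iff order_on_defs)
  moreover have "trans s"
  proof (rule transI)
    fix a b c assume *: "(a, b) \<in> s" "(b, c) \<in> s"
    then obtain x y z where xyz: "x \<in> Field r" "y \<in> Field r" "z \<in> Field r"
      "a = h x" "b = h y" "c = h z" using sub unfolding F by blast
    with * have "(x, y) \<in> r" "(y, z) \<in> r" by (simp_all add: iff)
    hence "(x, z) \<in> r" using assms(1) by (auto simp: order_on_defs dest: transD)
    thus "(a, c) \<in> s" using xyz by (simp add: iff)
  qed
  moreover have "antisym s"
  proof (rule antisymI)
    fix a b assume *: "(a, b) \<in> s" "(b, a) \<in> s"
    then obtain x y where xy: "x \<in> Field r" "y \<in> Field r" "a = h x" "b = h y"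
      using sub unfolding F by blast
    with * have "(x, y) \<in> r" "(y, x) \<in> r" by (simp_all add: iff)
    hence "x = y" using assms(1) by (auto simp: order_on_defs dest: antisymD)
    thus "a = b" using xy by simp
  qed
  ultimately have "Partial_order s" using sub by (simp add: order_on_defs)
  moreover have "poset_iso r s"
    unfolding poset_iso_def using h by (intro exI[of _ h]) (auto simp: bij_betw_def F iff)
  ultimately show ?thesis by blast
qed

end

theory Submission
  imports Defs "HOL-Library.Product_Order" "HOL-Library.Dual_Ordered_Lattice"
begin

text \<open>
  Let \<open>\<phi>\<close> be an isomorphism from \<open>A\<^sup>C\<close> to \<open>B\<^sup>D\<close>. The statement composes along products of exponents:
  a solution for \<open>C\<^sub>1\<close> and \<open>D\<close>, followed by one for \<open>C\<^sub>2\<close> and the factor \<open>X\<close> of \<open>D\<close> that it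
  produces, gives a solution for \<open>C\<^sub>1 \<times> C\<^sub>2\<close> and \<open>D\<close> (\<open>solves_times\<close>). Hence \<open>C\<close> and \<open>D\<close> may be
  assumed prime, that is, not a product of two smaller posets. What has to be shown then is: if
  \<open>C \<cong> D\<close> then \<open>A \<cong> B\<close> (\<open>cancel_iso\<close>), and otherwise there is one poset \<open>S\<close> with \<open>A \<cong> S\<^sup>D\<close> and
  \<open>B \<cong> S\<^sup>C\<close> (\<open>power_cases\<close> and \<open>other_base\<close>).

  The poset \<open>S\<close> is visible inside \<open>A\<close>: it is the set \<open>E\<close> of all \<open>e\<close> whose constant map is sent by
  \<open>\<phi>\<close> to a constant map. For \<open>a \<in> A\<close> let \<open>F d a\<close> be the \<open>d\<close>-th coordinate of the image of the
  constant map \<open>a\<close>, and let \<open>G c b\<close> be defined in the same way from the inverse of \<open>\<phi>\<close>. If all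
  \<open>F d a\<close> are fixed elements of \<open>B\<close>, then \<open>a\<close> is described by the monotone map \<open>d \<mapsto> F d a\<close> into
  a copy of \<open>E\<close>, which is the wanted description \<open>A \<cong> E\<^sup>D\<close>. Lengths of longest chains are
  additive over coordinates, so they can be compared on the two sides, and the composites
  \<open>G c \<circ> F d\<close> preserve them on average; this provides fixed elements, and words in these
  composites that retract \<open>A\<close> onto \<open>E\<close> and still separate comparable elements.

  Suppose first that \<open>A\<close> has a greatest element. Filling a set of coordinates of \<open>B\<^sup>D\<close> with the top
  is a closure operator that, seen from \<open>A\<^sup>C\<close>, acts coordinatewise. So a cover \<open>a' < a\<close> of \<open>A\<close>
  used in coordinate \<open>c\<close> changes a coordinate \<open>d\<close> of the image that depends on \<open>a'\<close>, \<open>a\<close> and \<open>c\<close> only, its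
  label. In an interval between neighbouring elements of \<open>E\<close> primality leaves two possibilities:
  each \<open>F d\<close> reads off the coordinate \<open>d\<close>, or the interval is trivial and \<open>\<phi>\<close> renames the coordinates along
  an isomorphism \<open>C \<cong> D\<close> (\<open>base_types\<close>). Retracting a cover to such an interval bounds its labels
  (\<open>label_bound\<close>), and it follows that the labels of a cover are constant or form an isomorphism
  \<open>C \<cong> D\<close> (\<open>classify\<close>). Descending from the top along covers, this yields that all \<open>F d a\<close> are fixed (\<open>key\<close>),
  that every monotone map into the fixed elements arises when \<open>C\<close> and \<open>D\<close> are not isomorphic (\<open>surj\<close>),
  and the matching of \<open>A\<close> with \<open>B\<close> when they are isomorphic (\<open>star\<close>).

  In general this applies to the elements above or below a fixed element. If \<open>D\<close> has a least or a
  greatest element these are all elements. If neither exponent has one, a basis with a top is forced to consist of fixed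
  elements as soon as the neighbourhood of one fixed element does (\<open>bounded_by_fixed\<close>); applied to
  auxiliary isomorphisms this carries the description from an element to all elements comparable to
  it, hence to all of the connected poset \<open>A\<close> (\<open>far_step\<close>, \<open>extend_partner\<close>).
\<close>

section \<open>Finite posets as sets in ordered types\<close>

text \<open>
  The power \<open>A\<^sup>C\<close>. The value outside \<open>C\<close> is fixed to be \<open>undefined\<close>, so that maps are equal as
  functions and the order of the function type restricts to the pointwise order on \<open>C\<close>.
\<close>

definition pw :: "'c::order set \<Rightarrow> 'a::order set \<Rightarrow> ('c \<Rightarrow> 'a) set" where
  "pw C A = {f \<in> C \<rightarrow>\<^sub>E A. \<forall>x\<in>C. \<forall>y\<in>C. x \<le> y \<longrightarrow> f x \<le> f y}"

definition cst :: "'c set \<Rightarrow> 'a \<Rightarrow> 'c \<Rightarrow> 'a" where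
  "cst C a = (\<lambda>x\<in>C. a)"

definition oisoon :: "('a::order \<Rightarrow> 'b::order) \<Rightarrow> 'a set \<Rightarrow> 'b set \<Rightarrow> bool" where
  "oisoon h S T \<longleftrightarrow> bij_betw h S T \<and> (\<forall>x\<in>S. \<forall>y\<in>S. x \<le> y \<longleftrightarrow> h x \<le> h y)"

definition oiso :: "'a::order set \<Rightarrow> 'b::order set \<Rightarrow> bool" where
  "oiso S T \<longleftrightarrow> (\<exists>h. oisoon h S T)"

text \<open>
  Connectedness as an induction principle: a property that is invariant under comparability and
  holds somewhere holds everywhere. In this form it is inherited by images and used directly.
\<close>

definition conn :: "'a::order set \<Rightarrow> bool" where
  "conn S \<longleftrightarrow> (\<forall>P. \<forall>x\<in>S. P x \<longrightarrow> (\<forall>y\<in>S. \<forall>z\<in>S. y \<le> z \<longrightarrow> P y = P z) \<longrightarrow> (\<forall>y\<in>S. P y))"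

definition upset :: "'a::order set \<Rightarrow> 'a set \<Rightarrow> bool" where
  "upset D V \<longleftrightarrow> V \<subseteq> D \<and> (\<forall>x\<in>V. \<forall>y\<in>D. x \<le> y \<longrightarrow> y \<in> V)"

definition cov :: "'a::order set \<Rightarrow> 'a \<Rightarrow> 'a \<Rightarrow> bool" where
  "cov S x y \<longleftrightarrow> x \<in> S \<and> y \<in> S \<and> x < y \<and> (\<forall>z\<in>S. x \<le> z \<and> z \<le> y \<longrightarrow> z = x \<or> z = y)"

inductive chn :: "'a::order set \<Rightarrow> nat \<Rightarrow> 'a \<Rightarrow> 'a \<Rightarrow> bool" for S where
  chn0: "x \<in> S \<Longrightarrow> chn S 0 x x"
| chnS: "x \<in> S \<Longrightarrow> x < y \<Longrightarrow> chn S n y z \<Longrightarrow> chn S (Suc n) x z"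

text \<open>
  Length of a longest chain; the maximum exists when \<open>S\<close> is finite and \<open>x \<le> y\<close> in \<open>S\<close>.
\<close>

definition len :: "'a::order set \<Rightarrow> 'a \<Rightarrow> 'a \<Rightarrow> nat" where
  "len S x y = Max {n. chn S n x y}"

lemma connD:
  assumes "conn S" "x \<in> S" "P x" "\<And>y z. y \<in> S \<Longrightarrow> z \<in> S \<Longrightarrow> y \<le> z \<Longrightarrow> P y = P z" "y \<in> S"
  shows "P y"
  using assms unfolding conn_def by blast

lemma conn_const:
  assumes "conn S" "\<And>y z. y \<in> S \<Longrightarrow> z \<in> S \<Longrightarrow> y \<le> z \<Longrightarrow> g y = g z" "x \<in> S" "y \<in> S"
  shows "g x = g y"
  using connD[OF assms(1) assms(3), of "\<lambda>z. g x = g z" y] assms by metis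

lemma pwD: "f \<in> pw C A \<Longrightarrow> c \<in> C \<Longrightarrow> f c \<in> A"
  by (auto simp: pw_def)
lemma pwM: "f \<in> pw C A \<Longrightarrow> c \<in> C \<Longrightarrow> c' \<in> C \<Longrightarrow> c \<le> c' \<Longrightarrow> f c \<le> f c'"
  by (auto simp: pw_def)
lemma pw_undef: "f \<in> pw C A \<Longrightarrow> c \<notin> C \<Longrightarrow> f c = undefined"
  by (auto simp: pw_def PiE_def extensional_def)
lemma pwI: "(\<And>c. c \<in> C \<Longrightarrow> f c \<in> A) \<Longrightarrow> (\<And>c. c \<notin> C \<Longrightarrow> f c = undefined) \<Longrightarrow>
  (\<And>x y. x \<in> C \<Longrightarrow> y \<in> C \<Longrightarrow> x \<le> y \<Longrightarrow> f x \<le> f y) \<Longrightarrow> f \<in> pw C A"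
  by (auto simp: pw_def PiE_def extensional_def)
lemma pw_le: "f \<in> pw C A \<Longrightarrow> g \<in> pw C A' \<Longrightarrow> f \<le> g \<longleftrightarrow> (\<forall>c\<in>C. f c \<le> g c)"
  unfolding le_fun_def by (metis order_refl pw_undef)
lemma pw_eqI: "f \<in> pw C A \<Longrightarrow> g \<in> pw C A' \<Longrightarrow> (\<And>c. c \<in> C \<Longrightarrow> f c = g c) \<Longrightarrow> f = g"
  by (metis ext pw_undef)
lemma pw_finite: "finite C \<Longrightarrow> finite A \<Longrightarrow> finite (pw C A)"
  unfolding pw_def by (rule finite_subset[OF _ finite_PiE[of C "\<lambda>_. A"]]) auto
lemma pw_mono: "A \<subseteq> A' \<Longrightarrow> pw C A \<subseteq> pw C A'"
  by (auto simp: pw_def)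
lemma pw_sub: "f \<in> pw C A \<Longrightarrow> (\<And>c. c \<in> C \<Longrightarrow> f c \<in> A') \<Longrightarrow> f \<in> pw C A'"
  by (auto simp: pw_def PiE_def)

lemma cst_pw[simp]: "a \<in> A \<Longrightarrow> cst C a \<in> pw C A"
  by (auto simp: pw_def cst_def)
lemma cst_ap[simp]: "c \<in> C \<Longrightarrow> cst C a c = a"
  by (simp add: cst_def)
lemma cst_le: "C \<noteq> {} \<Longrightarrow> cst C a \<le> cst C b \<longleftrightarrow> a \<le> (b::'a::order)"
  by (auto simp: cst_def le_fun_def)
lemma cst_inj: "C \<noteq> {} \<Longrightarrow> cst C a = cst C b \<longleftrightarrow> a = b"
  by (metis cst_ap ex_in_conv)

lemma pw_upd:
  assumes "f \<in> pw C A" "c \<in> C" "a \<in> A"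
    "\<And>x. x \<in> C \<Longrightarrow> x < c \<Longrightarrow> f x \<le> a" "\<And>x. x \<in> C \<Longrightarrow> c < x \<Longrightarrow> a \<le> f x"
  shows "f(c := a) \<in> pw C A"
proof (rule pwI)
  fix x y assume "x \<in> C" "y \<in> C" "x \<le> y"
  then show "(f(c := a)) x \<le> (f(c := a)) y"
    using assms pwM[OF assms(1)] by (cases "x = c"; cases "y = c") auto
qed (use assms pwD pw_undef in \<open>auto\<close>)

subsection \<open>Finite induction along the order\<close>

lemma down_induct[consumes 2, case_names step]:
  assumes "finite (S :: 'a::order set)" "x \<in> S"
    "\<And>x. x \<in> S \<Longrightarrow> (\<And>y. y \<in> S \<Longrightarrow> x < y \<Longrightarrow> P y) \<Longrightarrow> P x"
  shows "P x"
  using assms(2)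
proof (induction "card {y \<in> S. x < y}" arbitrary: x rule: less_induct)
  case less
  show ?case
  proof (rule assms(3)[OF less.prems])
    fix y assume y: "y \<in> S" "x < y"
    have "{z \<in> S. y < z} \<subset> {z \<in> S. x < z}" using y by (auto intro: less_trans)
    then show "P y" using less.hyps[of y] y psubset_card_mono assms(1) by (simp add: psubset_card_mono)
  qed
qed

lemma up_induct[consumes 2, case_names step]:
  assumes "finite (S :: 'a::order set)" "x \<in> S"
    "\<And>x. x \<in> S \<Longrightarrow> (\<And>y. y \<in> S \<Longrightarrow> y < x \<Longrightarrow> P y) \<Longrightarrow> P x"
  shows "P x"
  using assms(2)
proof (induction "card {y \<in> S. y < x}" arbitrary: x rule: less_induct)
  case less
  show ?case
  proof (rule assms(3)[OF less.prems])
    fix y assume y: "y \<in> S" "y < x"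
    have "{z \<in> S. z < y} \<subset> {z \<in> S. z < x}" using y by (auto intro: less_trans)
    then show "P y" using less.hyps[of y] y psubset_card_mono assms(1) by (simp add: psubset_card_mono)
  qed
qed

lemma ex_maximal:
  assumes "finite (S :: 'a::order set)" "x \<in> S"
  shows "\<exists>m\<in>S. x \<le> m \<and> (\<forall>y\<in>S. \<not> m < y)"
  using assms
proof (induction rule: down_induct)
  case (step x)
  show ?case
  proof (cases "\<exists>y\<in>S. x < y")
    case True then show ?thesis using step by (meson less_imp_le order_trans)
  next
    case False then show ?thesis using step by blast
  qed
qed

lemma ex_minimal:
  assumes "finite (S :: 'a::order set)" "x \<in> S"
  shows "\<exists>m\<in>S. m \<le> x \<and> (\<forall>y\<in>S. \<not> y < m)"
  using assms
proof (induction rule: up_induct)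
  case (step x)
  show ?case
  proof (cases "\<exists>y\<in>S. y < x")
    case True then show ?thesis using step by (meson less_imp_le order_trans)
  next
    case False then show ?thesis using step by blast
  qed
qed

lemma cov_above:
  assumes "finite S" "x \<in> S" "y \<in> S" "x < y"
  shows "\<exists>z. cov S x z \<and> z \<le> y"
proof -
  have "finite {z \<in> S. x < z \<and> z \<le> y}" "y \<in> {z \<in> S. x < z \<and> z \<le> y}" using assms by auto
  from ex_minimal[OF this] obtain m where m: "m \<in> S" "x < m" "m \<le> y"
    "\<forall>z\<in>{z \<in> S. x < z \<and> z \<le> y}. \<not> z < m" by auto
  have "cov S x m" unfolding cov_def
  proof (intro conjI ballI impI)
    fix z assume z: "z \<in> S" "x \<le> z \<and> z \<le> m"
    show "z = x \<or> z = m"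
    proof (rule ccontr)
      assume "\<not> ?thesis" then have "x < z" "z < m" using z by auto
      then show False using m z by auto
    qed
  qed (use m assms in auto)
  then show ?thesis using m by blast
qed

lemma cov_below:
  assumes "finite S" "x \<in> S" "y \<in> S" "x < y"
  shows "\<exists>z. cov S z y \<and> x \<le> z"
proof -
  have "finite {z \<in> S. x \<le> z \<and> z < y}" "x \<in> {z \<in> S. x \<le> z \<and> z < y}" using assms by auto
  from ex_maximal[OF this] obtain m where m: "m \<in> S" "x \<le> m" "m < y"
    "\<forall>z\<in>{z \<in> S. x \<le> z \<and> z < y}. \<not> m < z" by auto
  have "cov S m y" unfolding cov_def
  proof (intro conjI ballI impI)
    fix z assume z: "z \<in> S" "m \<le> z \<and> z \<le> y"
    show "z = m \<or> z = y"
    proof (rule ccontr)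
      assume "\<not> ?thesis" then have "m < z" "z < y" using z by auto
      then show False using m z by auto
    qed
  qed (use m assms in auto)
  then show ?thesis using m by blast
qed

lemma covD: "cov S x y \<Longrightarrow> x \<in> S \<and> y \<in> S \<and> x < y" by (simp add: cov_def)
lemma cov_mid: "cov S x y \<Longrightarrow> z \<in> S \<Longrightarrow> x \<le> z \<Longrightarrow> z \<le> y \<Longrightarrow> z = x \<or> z = y" by (simp add: cov_def)

subsection \<open>Length of a longest chain\<close>

lemma chn_in: "chn S n x y \<Longrightarrow> x \<in> S \<and> y \<in> S \<and> x \<le> y"
  by (induction rule: chn.induct) auto

lemma chn_app: "chn S n x y \<Longrightarrow> chn S m y z \<Longrightarrow> chn S (n + m) x z"
  by (induction rule: chn.induct) (auto intro: chn.intros)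

lemma chn_bound: "chn S n x y \<Longrightarrow> finite S \<Longrightarrow> n \<le> card {z \<in> S. x < z}"
proof (induction rule: chn.induct)
  case (chnS x y n z)
  have "{z \<in> S. y < z} \<subset> {z \<in> S. x < z}"
    using chnS chn_in[OF chnS(3)] by (auto intro: less_trans)
  then have "card {z \<in> S. y < z} < card {z \<in> S. x < z}"
    using chnS.prems by (intro psubset_card_mono) auto
  then show ?case using chnS by auto
qed auto

lemma len_fin: "finite S \<Longrightarrow> finite {n. chn S n x y}"
  by (rule finite_subset[of _ "{..card {z \<in> S. x < z}}"]) (auto dest: chn_bound)

lemma len_ge: "finite S \<Longrightarrow> chn S n x y \<Longrightarrow> n \<le> len S x y"
  unfolding len_def by (rule Max_ge) (auto simp: len_fin)

lemma len_att:
  assumes "finite S" "x \<in> S" "y \<in> S" "x \<le> y"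
  shows "chn S (len S x y) x y"
proof -
  have "\<exists>n. chn S n x y"
  proof (cases "x = y")
    case True then show ?thesis using assms chn0 by blast
  next
    case False then have "x < y" using assms by auto
    then have "chn S (Suc 0) x y" using assms by (meson chnS chn0)
    then show ?thesis by blast
  qed
  then have "len S x y \<in> {n. chn S n x y}" unfolding len_def
    by (intro Max_in len_fin assms) auto
  then show ?thesis by simp
qed

lemma len_add:
  assumes "finite S" "x \<in> S" "y \<in> S" "z \<in> S" "x \<le> y" "y \<le> z"
  shows "len S x y + len S y z \<le> len S x z"
  using len_ge[OF assms(1) chn_app[OF len_att len_att]] assms by auto

lemma len_pos:
  assumes "finite S" "x \<in> S" "y \<in> S" "x < y"
  shows "1 \<le> len S x y"
  using len_ge[OF assms(1), of "Suc 0" x y] assms by (auto intro: chnS chn0)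

lemma chn_self: "chn S n x x \<Longrightarrow> n = 0"
  by (cases rule: chn.cases) (auto dest: chn_in)

lemma len_self[simp]: "finite S \<Longrightarrow> x \<in> S \<Longrightarrow> len S x x = 0"
  using chn_self len_att by blast

lemma len_eq_imp_eq:
  assumes "finite S" "x \<in> S" "y \<in> S" "z \<in> S" "x \<le> y" "y \<le> z" "len S x z \<le> len S y z"
  shows "x = y"
  using len_add[of S x y z] len_pos[of S x y] assms by (cases "x = y") (auto simp: order.strict_iff_order)

lemma len_mono:
  assumes "finite S" "x \<in> S" "x' \<in> S" "y \<in> S" "y' \<in> S" "x \<le> x'" "x' \<le> y'" "y' \<le> y"
  shows "len S x' y' \<le> len S x y"
  using len_add[OF assms(1,2,3,4,6)] len_add[OF assms(1,3,5,4,7,8)] order_trans[OF assms(7,8)] by linarith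

lemma len_cov: "finite S \<Longrightarrow> cov S x y \<Longrightarrow> len S x y = 1"
proof -
  assume S: "finite S" and c: "cov S x y"
  have "chn S (len S x y) x y" using len_att[OF S] covD[OF c] by auto
  moreover have "1 \<le> len S x y" using len_pos[OF S] covD[OF c] by auto
  moreover have "n \<le> 1" if "chn S n x y" for n
    using that
  proof (cases rule: chn.cases)
    case (chnS y' n)
    have "y' = y" using cov_mid[OF c, of y'] chnS chn_in[OF chnS(4)] by (auto simp: less_le)
    then show ?thesis using chnS chn_self by auto
  qed auto
  ultimately show ?thesis by force
qed

lemma len_step:
  assumes "finite S" "x \<in> S" "y \<in> S" "x < y"
  shows "\<exists>z\<in>S. x < z \<and> z \<le> y \<and> len S x y = Suc (len S z y)"
proof -
  have "chn S (len S x y) x y" using len_att[OF assms(1-3)] assms(4) by auto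
  moreover have "1 \<le> len S x y" using len_pos assms by auto
  ultimately obtain z n where z: "x < z" "chn S n z y" "len S x y = Suc n"
    by (cases rule: chn.cases) auto
  have zi: "z \<in> S" "z \<le> y" using chn_in[OF z(2)] by auto
  have "n \<le> len S z y" using len_ge[OF assms(1) z(2)] .
  moreover have "1 + len S z y \<le> len S x y"
    using len_add[of S x z y] len_pos[of S x z] zi z assms by (auto simp: less_imp_le)
  ultimately show ?thesis using z zi by (intro bexI[of _ z]) auto
qed

lemma len_one_cov:
  assumes "finite S" "x \<in> S" "y \<in> S" "x < y" "len S x y \<le> 1"
  shows "cov S x y"
  unfolding cov_def
proof (intro conjI ballI impI)
  fix z assume z: "z \<in> S" "x \<le> z \<and> z \<le> y"
  show "z = x \<or> z = y"
  proof (rule ccontr)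
    assume "\<not> ?thesis"
    then have "x < z" "z < y" using z by auto
    then have "1 \<le> len S x z" "1 \<le> len S z y" using len_pos assms z by auto
    then show False using len_add[of S x z y] assms z by auto
  qed
qed (use assms in auto)

lemma chn_iso:
  assumes "chn S n x y" "\<And>x. x \<in> S \<Longrightarrow> h x \<in> T" "\<And>x y. x \<in> S \<Longrightarrow> y \<in> S \<Longrightarrow> x < y \<Longrightarrow> h x < h y"
  shows "chn T n (h x) (h y)"
  using assms(1)
proof (induction rule: chn.induct)
  case (chnS x y n z)
  then show ?case using assms chn_in[OF chnS(3)] by (intro chn.chnS[of _ _ "h y"]) auto
qed (auto intro: chn0 assms)

lemma pw_len_le:
  assumes "finite C" "finite A" "chn (pw C A) n f g"
  shows "n \<le> (\<Sum>c\<in>C. len A (f c) (g c))"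
  using assms(3)
proof (induction rule: chn.induct)
  case (chnS f h n g)
  have h: "h \<in> pw C A" "g \<in> pw C A" "h \<le> g" using chn_in[OF chnS(3)] by auto
  have le: "f c \<le> h c" "h c \<le> g c" for c using h chnS(2) by (auto simp: le_fun_def less_fun_def)
  have add: "len A (f c) (h c) + len A (h c) (g c) \<le> len A (f c) (g c)" if "c \<in> C" for c
    using len_add[OF assms(2)] pwD that h chnS(1) le by metis
  obtain c where c: "c \<in> C" "f c < h c"
  proof -
    have "\<exists>c\<in>C. f c \<noteq> h c" using pw_eqI[OF chnS(1) h(1)] chnS(2) by auto
    then show ?thesis using le that by (metis order.not_eq_order_implies_strict)
  qed
  have "1 \<le> len A (f c) (h c)" using len_pos[OF assms(2)] c pwD h chnS(1) by metis
  also have "\<dots> \<le> (\<Sum>c\<in>C. len A (f c) (h c))" using c assms(1) by (intro member_le_sum) auto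
  finally have "Suc n \<le> (\<Sum>c\<in>C. len A (f c) (h c)) + (\<Sum>c\<in>C. len A (h c) (g c))" using chnS by auto
  also have "\<dots> = (\<Sum>c\<in>C. len A (f c) (h c) + len A (h c) (g c))" by (simp add: sum.distrib)
  also have "\<dots> \<le> (\<Sum>c\<in>C. len A (f c) (g c))" by (intro sum_mono add)
  finally show ?case .
qed auto

text \<open>
  Below \<open>g\<close> one can raise \<open>f\<close> in a single coordinate: choose a maximal one among those where \<open>f\<close> and
  \<open>g\<close> differ, since above it the values of \<open>f\<close> are those of \<open>g\<close> and leave room.
\<close>

lemma pw_step:
  assumes "finite C" "f \<in> pw C A" "g \<in> pw C A" "f < g"
  shows "\<exists>c\<in>C. f c < g c \<and> (\<forall>a\<in>A. f c \<le> a \<longrightarrow> a \<le> g c \<longrightarrow> f(c := a) \<in> pw C A)"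
proof -
  have le: "f c \<le> g c" for c using assms(4) by (auto simp: le_fun_def less_fun_def)
  obtain c where c: "c \<in> {c\<in>C. f c < g c}"
  proof -
    have "\<exists>c\<in>C. f c \<noteq> g c" using pw_eqI[OF assms(2,3)] assms(4) by auto
    then show ?thesis using le that by (metis (mono_tags, lifting) mem_Collect_eq order.not_eq_order_implies_strict)
  qed
  from ex_maximal[OF _ c] obtain m where m: "m \<in> C" "f m < g m" "\<And>x. x \<in> C \<Longrightarrow> m < x \<Longrightarrow> \<not> f x < g x"
    using assms(1) by auto
  show ?thesis
  proof (intro bexI[of _ m] conjI ballI impI)
    fix a assume a: "a \<in> A" "f m \<le> a" "a \<le> g m"
    show "f(m := a) \<in> pw C A"
    proof (rule pw_upd[OF assms(2) m(1) a(1)])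
      fix x assume "x \<in> C" "x < m" then show "f x \<le> a" using pwM[OF assms(2), of x m] m a by (meson less_imp_le order_trans)
    next
      fix x assume x: "x \<in> C" "m < x"
      then have "f x = g x" using m(3) le by (metis order.not_eq_order_implies_strict)
      moreover have "g m \<le> g x" using pwM[OF assms(3)] x m by auto
      ultimately show "a \<le> f x" using a by auto
    qed
  qed (use m in auto)
qed

lemma pw_len_ge:
  assumes "finite C" "finite A" "f \<in> pw C A" "g \<in> pw C A" "f \<le> g"
  shows "chn (pw C A) (\<Sum>c\<in>C. len A (f c) (g c)) f g"
  using assms(3,5)
proof (induction "\<Sum>c\<in>C. len A (f c) (g c)" arbitrary: f)
  case 0
  have "f = g"
  proof (rule ccontr)
    assume "f \<noteq> g" then have "f < g" using 0 by auto
    from pw_step[OF assms(1) 0(2) assms(4) this] obtain c where "c \<in> C" "f c < g c" by auto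
    then have "1 \<le> len A (f c) (g c)" using len_pos[OF assms(2)] pwD 0 assms by metis
    then show False using 0(1) \<open>c \<in> C\<close> assms(1) by (auto simp: sum_eq_0_iff)
  qed
  then show ?case using 0 assms chn0 by metis
next
  case (Suc n)
  have "f \<noteq> g"
  proof
    assume "f = g" then have "(\<Sum>c\<in>C. len A (f c) (g c)) = 0" using pwD[OF assms(4)] assms(2) by auto
    then show False using Suc(2) by auto
  qed
  then have "f < g" using Suc by auto
  from pw_step[OF assms(1) Suc(3) assms(4) this] obtain c where c: "c \<in> C" "f c < g c"
    "\<And>a. a \<in> A \<Longrightarrow> f c \<le> a \<Longrightarrow> a \<le> g c \<Longrightarrow> f(c := a) \<in> pw C A" by auto
  from len_step[OF assms(2) pwD[OF Suc(3) c(1)] pwD[OF assms(4) c(1)] c(2)]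
  obtain a where a: "a \<in> A" "f c < a" "a \<le> g c" "len A (f c) (g c) = Suc (len A a (g c))" by auto
  let ?f = "f(c := a)"
  have f: "?f \<in> pw C A" using c a by auto
  have "f < ?f" using a by (auto simp: less_fun_def le_fun_def)
  have "?f \<le> g" using a Suc(4) by (auto simp: le_fun_def)
  have "(\<Sum>x\<in>C. len A (f x) (g x)) = len A (f c) (g c) + (\<Sum>x\<in>C-{c}. len A (f x) (g x))"
    using c assms(1) by (simp add: sum.remove)
  moreover have "(\<Sum>x\<in>C. len A (?f x) (g x)) = len A (?f c) (g c) + (\<Sum>x\<in>C-{c}. len A (?f x) (g x))"
    using c assms(1) by (simp add: sum.remove)
  moreover have "(\<Sum>x\<in>C-{c}. len A (?f x) (g x)) = (\<Sum>x\<in>C-{c}. len A (f x) (g x))"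
    by (intro sum.cong) auto
  ultimately have s: "(\<Sum>x\<in>C. len A (?f x) (g x)) = n" using a(4) Suc(2) by simp
  have "chn (pw C A) n ?f g" using Suc(1)[OF s[symmetric] f \<open>?f \<le> g\<close>] s by simp
  then show ?case using Suc(2) \<open>f < ?f\<close> chnS[OF Suc(3)] by metis
qed

text \<open>
  Every step of a chain in \<open>A\<^sup>C\<close> moves some coordinate, and the coordinates can be moved one step at
  a time. Since the left side does not mention the representation, two power representations of
  the same poset have equal sums; this is the source of all counting arguments below.
\<close>

lemma pw_len:
  assumes "finite C" "finite A" "f \<in> pw C A" "g \<in> pw C A" "f \<le> g"
  shows "len (pw C A) f g = (\<Sum>c\<in>C. len A (f c) (g c))"
  using pw_len_le[OF assms(1,2) len_att[OF pw_finite[OF assms(1,2)] assms(3,4,5)]]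
    len_ge[OF pw_finite[OF assms(1,2)] pw_len_ge[OF assms]] by auto

section \<open>Two power representations of one poset\<close>

text \<open>
  A cover in \<open>A\<^sup>C\<close> changes one coordinate only, and by a cover of \<open>A\<close>.
\<close>

lemma pw_cov:
  assumes "finite C" "cov (pw C A) f g"
  shows "\<exists>c\<in>C. g = f(c := g c) \<and> cov A (f c) (g c)"
proof -
  have fg: "f \<in> pw C A" "g \<in> pw C A" "f < g" using covD[OF assms(2)] by auto
  have le: "f x \<le> g x" for x using fg(3) by (auto simp: le_fun_def less_fun_def)
  from pw_step[OF assms(1) fg] obtain c where c: "c \<in> C" "f c < g c"
    "\<And>a. a \<in> A \<Longrightarrow> f c \<le> a \<Longrightarrow> a \<le> g c \<Longrightarrow> f(c := a) \<in> pw C A" by auto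
  have in1: "f(c := a) = f \<or> f(c := a) = g" if "a \<in> A" "f c \<le> a" "a \<le> g c" for a
    by (rule cov_mid[OF assms(2)]) (use that c le in \<open>auto simp: le_fun_def\<close>)
  have g: "f(c := g c) = g" using in1[of "g c"] pwD[OF fg(2) c(1)] c(2)
    by (metis fun_upd_same less_le order_refl)
  have "cov A (f c) (g c)" unfolding cov_def
    using in1 c pwD[OF fg(1) c(1)] pwD[OF fg(2) c(1)] by (metis fun_upd_same)
  then show ?thesis using c(1) g by metis
qed

lemma pw_cov_upd:
  assumes "f \<in> pw C A" "f(c := a) \<in> pw C A" "cov A (f c) a"
  shows "cov (pw C A) f (f(c := a))"
  unfolding cov_def
proof (intro conjI ballI impI)
  have "f c < a" using covD[OF assms(3)] by auto
  then show "f < f(c := a)" by (auto simp: less_fun_def le_fun_def)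
  fix h assume h: "h \<in> pw C A" "f \<le> h \<and> h \<le> f(c := a)"
  then have b: "f x \<le> h x" "h x \<le> (f(c := a)) x" for x by (auto simp: le_fun_def)
  have "c \<in> C" using assms(1,2) \<open>f c < a\<close> pw_undef by (metis fun_upd_same less_irrefl)
  have "h c = f c \<or> h c = a" using cov_mid[OF assms(3) pwD[OF h(1) \<open>c \<in> C\<close>]] b[of c] by auto
  moreover have "h x = f x" if "x \<noteq> c" for x using b[of x] that by auto
  ultimately show "h = f \<or> h = f(c := a)" by (metis ext fun_upd_apply)
qed (use assms in auto)

text \<open>
  The roles of \<open>(A, C)\<close> and \<open>(B, D)\<close> are symmetric. The instance with exchanged roles carries the
  prefix \<open>sw\<close>, so that every fact about \<open>A\<close> is at once available for \<open>B\<close>.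
\<close>

locale biexp =
  fixes A :: "'a::order set" and B :: "'b::order set" and C :: "'c::order set" and D :: "'d::order set"
    and phi :: "('c \<Rightarrow> 'a) \<Rightarrow> ('d \<Rightarrow> 'b)" and psi :: "('d \<Rightarrow> 'b) \<Rightarrow> ('c \<Rightarrow> 'a)"
  assumes finA: "finite A" and finB: "finite B" and finC: "finite C" and finD: "finite D"
    and neC: "C \<noteq> {}" and neD: "D \<noteq> {}" and conC: "conn C" and conD: "conn D"
    and phi_in: "f \<in> pw C A \<Longrightarrow> phi f \<in> pw D B" and psi_in: "g \<in> pw D B \<Longrightarrow> psi g \<in> pw C A"
    and psi_phi: "f \<in> pw C A \<Longrightarrow> psi (phi f) = f" and phi_psi: "g \<in> pw D B \<Longrightarrow> phi (psi g) = g"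
    and phi_mono: "f \<in> pw C A \<Longrightarrow> f' \<in> pw C A \<Longrightarrow> f \<le> f' \<Longrightarrow> phi f \<le> phi f'"
    and psi_mono: "g \<in> pw D B \<Longrightarrow> g' \<in> pw D B \<Longrightarrow> g \<le> g' \<Longrightarrow> psi g \<le> psi g'"
begin

lemma swap: "biexp B A D C psi phi"
  by unfold_locales (use finA finB finC finD neC neD conC conD phi_in psi_in psi_phi phi_psi phi_mono psi_mono in auto)

end

sublocale biexp \<subseteq> sw: biexp B A D C psi phi by (rule swap)

context biexp
begin

text \<open>
  The coordinates of the image of a constant map. As \<open>a \<le> a'\<close> iff \<open>F d a \<le> F d a'\<close> for all \<open>d\<close>, the
  maps \<open>F d\<close> together embed \<open>A\<close> into \<open>B\<^sup>D\<close>.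
\<close>

definition F :: "'d \<Rightarrow> 'a \<Rightarrow> 'b" where "F d a = phi (cst C a) d"

end

context biexp
begin

abbreviation G :: "'c \<Rightarrow> 'b \<Rightarrow> 'a" where "G \<equiv> sw.F"

text \<open>
  The fixed elements: those whose constant map is sent to a constant map. The map \<open>j\<close> below identifies the
  fixed elements of \<open>A\<close> with those of \<open>B\<close>, and every \<open>F d\<close> agrees with \<open>j\<close> on them.
\<close>

definition E :: "'a set" where "E = {a \<in> A. \<forall>d\<in>D. \<forall>d'\<in>D. F d a = F d' a}"

definition j :: "'a \<Rightarrow> 'b" where "j a = F (SOME d. d \<in> D) a"

lemma phi_le: "f \<in> pw C A \<Longrightarrow> g \<in> pw C A \<Longrightarrow> phi f \<le> phi g \<longleftrightarrow> f \<le> g"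
  using phi_mono psi_mono phi_in psi_phi by metis

lemma phi_inj: "f \<in> pw C A \<Longrightarrow> g \<in> pw C A \<Longrightarrow> phi f = phi g \<longleftrightarrow> f = g"
  using psi_phi by metis

lemma phi_less: "f \<in> pw C A \<Longrightarrow> g \<in> pw C A \<Longrightarrow> phi f < phi g \<longleftrightarrow> f < g"
  using phi_le phi_inj by (auto simp: order.strict_iff_order)

lemma phi_le_psi: "f \<in> pw C A \<Longrightarrow> g \<in> pw D B \<Longrightarrow> phi f \<le> g \<longleftrightarrow> f \<le> psi g"
  using phi_le psi_in phi_psi by metis

lemma psi_le_phi: "f \<in> pw C A \<Longrightarrow> g \<in> pw D B \<Longrightarrow> g \<le> phi f \<longleftrightarrow> psi g \<le> f"
  using phi_le psi_in phi_psi by metis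

lemma phi_cov: "cov (pw C A) f g \<Longrightarrow> cov (pw D B) (phi f) (phi g)"
proof -
  assume c: "cov (pw C A) f g"
  have fg: "f \<in> pw C A" "g \<in> pw C A" "f < g" using covD[OF c] by auto
  show ?thesis unfolding cov_def
  proof (intro conjI ballI impI)
    fix h assume h: "h \<in> pw D B" "phi f \<le> h \<and> h \<le> phi g"
    have "psi h = f \<or> psi h = g" using cov_mid[OF c psi_in[OF h(1)]] h fg phi_le_psi psi_le_phi by auto
    then show "h = phi f \<or> h = phi g" using phi_psi h(1) by metis
  qed (use fg phi_less phi_in in auto)
qed

lemma phi_len1: "f \<in> pw C A \<Longrightarrow> g \<in> pw C A \<Longrightarrow> f \<le> g \<Longrightarrow> len (pw C A) f g \<le> len (pw D B) (phi f) (phi g)"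
proof -
  assume fg: "f \<in> pw C A" "g \<in> pw C A" "f \<le> g"
  have "chn (pw D B) (len (pw C A) f g) (phi f) (phi g)"
    by (rule chn_iso[OF len_att]) (use fg pw_finite finC finA phi_in phi_less in auto)
  then show ?thesis using len_ge pw_finite finD finB by blast
qed

end

context biexp
begin

lemma phi_len: "f \<in> pw C A \<Longrightarrow> g \<in> pw C A \<Longrightarrow> f \<le> g \<Longrightarrow> len (pw D B) (phi f) (phi g) = len (pw C A) f g"
  using phi_len1[of f g] sw.phi_len1[of "phi f" "phi g"] phi_mono[of f g] phi_in psi_phi by auto

lemma phi_sum:
  assumes "f \<in> pw C A" "g \<in> pw C A" "f \<le> g"
  shows "(\<Sum>d\<in>D. len B (phi f d) (phi g d)) = (\<Sum>c\<in>C. len A (f c) (g c))"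
  using phi_len[OF assms] pw_len[OF finC finA assms] 
    pw_len[OF finD finB phi_in[OF assms(1)] phi_in[OF assms(2)] phi_mono[OF assms]] by simp

text \<open>
  Both sides are the length between the constant maps of \<open>a\<close> and \<open>a'\<close>, computed in \<open>B\<^sup>D\<close> and in \<open>A\<^sup>C\<close>.
\<close>

lemma F_sum:
  assumes "a \<in> A" "a' \<in> A" "a \<le> a'"
  shows "(\<Sum>d\<in>D. len B (F d a) (F d a')) = card C * len A a a'"
  using phi_sum[of "cst C a" "cst C a'"] assms by (simp add: F_def cst_le neC)

lemma F_in[simp]: "d \<in> D \<Longrightarrow> a \<in> A \<Longrightarrow> F d a \<in> B"
  unfolding F_def by (rule pwD[OF phi_in]) auto

lemma F_mono: "a \<in> A \<Longrightarrow> a' \<in> A \<Longrightarrow> a \<le> a' \<Longrightarrow> F d a \<le> F d a'"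
  unfolding F_def using phi_mono[of "cst C a" "cst C a'"] by (simp add: cst_le neC le_funD)

lemma F_mono2: "a \<in> A \<Longrightarrow> d \<in> D \<Longrightarrow> d' \<in> D \<Longrightarrow> d \<le> d' \<Longrightarrow> F d a \<le> F d' a"
  unfolding F_def using pwM[OF phi_in] by auto

lemma F_all:
  assumes "a \<in> A" "a' \<in> A" "\<And>d. d \<in> D \<Longrightarrow> F d a \<le> F d a'"
  shows "a \<le> a'"
  using phi_le[of "cst C a" "cst C a'"] pw_le[OF phi_in[of "cst C a"] phi_in[of "cst C a'"]] assms
  by (auto simp: cst_le neC F_def)

lemma E_A: "e \<in> E \<Longrightarrow> e \<in> A" by (simp add: E_def)

lemma F_j: "e \<in> E \<Longrightarrow> d \<in> D \<Longrightarrow> F d e = j e"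
  unfolding j_def E_def using neD some_in_eq[of D] by blast

lemma phi_E: "e \<in> E \<Longrightarrow> phi (cst C e) = cst D (j e)"
proof -
  assume e: "e \<in> E"
  have "j e \<in> B" using F_j[OF e] F_in E_A[OF e] neD by (metis ex_in_conv)
  show ?thesis
    by (rule pw_eqI[OF phi_in cst_pw[OF \<open>j e \<in> B\<close>]]) (use F_j[OF e] E_A[OF e] in \<open>auto simp: F_def\<close>)
qed

lemma E_iff: "e \<in> E \<longleftrightarrow> e \<in> A \<and> (\<exists>b. phi (cst C e) = cst D b)"
  using phi_E by (auto simp: E_def F_def)

lemma E_I: "a \<in> A \<Longrightarrow> (\<And>d. d \<in> D \<Longrightarrow> F d a = b) \<Longrightarrow> a \<in> E"
  by (auto simp: E_def)

end

context biexp
begin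

lemma jE_in: "e \<in> E \<Longrightarrow> j e \<in> sw.E"
  unfolding sw.E_iff using phi_E psi_phi E_A F_j F_in by (metis cst_pw ex_in_conv neD)

lemma j_B: "e \<in> E \<Longrightarrow> j e \<in> B"
  using jE_in sw.E_A by auto

lemma G_j: "e \<in> E \<Longrightarrow> c \<in> C \<Longrightarrow> G c (j e) = e"
  unfolding sw.F_def using phi_E psi_phi E_A by (metis cst_ap cst_pw)

end

context biexp
begin

lemma swj_j: "e \<in> E \<Longrightarrow> sw.j (j e) = e"
  using G_j neC by (simp add: sw.j_def some_in_eq)

end

context biexp
begin

lemma psi_const:
  assumes "b \<in> B" "\<And>c. c \<in> C \<Longrightarrow> G c b = q"
  shows "q \<in> E" "j q = b"
proof -
  have q: "q \<in> A" using sw.F_in assms neC by (metis ex_in_conv)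
  have "psi (cst D b) = cst C q"
    by (rule pw_eqI[OF psi_in cst_pw[OF q]]) (use assms in \<open>auto simp: sw.F_def\<close>)
  then have "phi (cst C q) = cst D b" using phi_psi assms(1) by (metis cst_pw)
  then show "q \<in> E" using q E_iff by auto
  then show "j q = b" using \<open>phi (cst C q) = cst D b\<close> phi_E cst_inj[OF neD] by metis
qed

lemma j_le: "e \<in> E \<Longrightarrow> e' \<in> E \<Longrightarrow> j e \<le> j e' \<longleftrightarrow> e \<le> e'"
  using F_j F_mono F_all E_A neD by (metis ex_in_conv)

lemma j_inj: "e \<in> E \<Longrightarrow> e' \<in> E \<Longrightarrow> j e = j e' \<longleftrightarrow> e = e'"
  using swj_j by metis

text \<open>
  If \<open>G c (F d a)\<close> does not depend on \<open>c\<close>, its value \<open>q\<close> is fixed with \<open>j q = F d a\<close>; if it does not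
  depend on \<open>d\<close> either, then \<open>F d a = j q\<close> for all \<open>d\<close>.
\<close>

lemma T_const_E:
  assumes "a \<in> A" "\<And>c d. c \<in> C \<Longrightarrow> d \<in> D \<Longrightarrow> G c (F d a) = q"
  shows "a \<in> E"
  by (rule E_I[OF assms(1)], rule psi_const(2)[symmetric]) (use assms in auto)

subsection \<open>Words in the maps between the two bases\<close>

end

context biexp
begin

definition T :: "'c \<Rightarrow> 'd \<Rightarrow> 'a \<Rightarrow> 'a" where "T c d a = G c (F d a)"

lemma T_in[simp]: "c \<in> C \<Longrightarrow> d \<in> D \<Longrightarrow> a \<in> A \<Longrightarrow> T c d a \<in> A"
  by (simp add: T_def)

lemma T_mono: "d \<in> D \<Longrightarrow> a \<in> A \<Longrightarrow> a' \<in> A \<Longrightarrow> a \<le> a' \<Longrightarrow> T c d a \<le> T c d a'"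
  unfolding T_def by (intro sw.F_mono F_mono) auto

lemma T_E: "c \<in> C \<Longrightarrow> d \<in> D \<Longrightarrow> e \<in> E \<Longrightarrow> T c d e = e"
  by (simp add: T_def F_j G_j)

text \<open>
  On average over \<open>C \<times> D\<close> going to \<open>B\<close> and back preserves lengths.
\<close>

lemma T_sum:
  assumes "a \<in> A" "a' \<in> A" "a \<le> a'"
  shows "(\<Sum>(c,d)\<in>C\<times>D. len A (T c d a) (T c d a')) = card (C \<times> D) * len A a a'"
proof -
  have "(\<Sum>(c,d)\<in>C\<times>D. len A (T c d a) (T c d a')) = (\<Sum>c\<in>C. \<Sum>d\<in>D. len A (T c d a) (T c d a'))"
    by (simp add: sum.cartesian_product)
  also have "\<dots> = (\<Sum>d\<in>D. \<Sum>c\<in>C. len A (T c d a) (T c d a'))" by (rule sum.swap)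
  also have "\<dots> = (\<Sum>d\<in>D. card D * len B (F d a) (F d a'))"
    unfolding T_def by (intro sum.cong refl sw.F_sum) (use assms F_mono in auto)
  also have "\<dots> = card D * (card C * len A a a')"
    using F_sum[OF assms] by (simp add: sum_distrib_left[symmetric])
  finally show ?thesis by (simp add: card_cartesian_product)
qed

text \<open>
  Words in the maps \<open>T c d\<close>, with their length. They are monotone and fix \<open>E\<close>. The length is recorded
  because later words are compared letter by letter.
\<close>

inductive W :: "nat \<Rightarrow> ('a \<Rightarrow> 'a) \<Rightarrow> bool" where
  W0: "W 0 (\<lambda>a. a)"
| WS: "W n w \<Longrightarrow> c \<in> C \<Longrightarrow> d \<in> D \<Longrightarrow> W (Suc n) (\<lambda>a. w (T c d a))"

lemma W_in: "W n w \<Longrightarrow> a \<in> A \<Longrightarrow> w a \<in> A"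
  by (induction arbitrary: a rule: W.induct) auto

lemma W_mono: "W n w \<Longrightarrow> a \<in> A \<Longrightarrow> a' \<in> A \<Longrightarrow> a \<le> a' \<Longrightarrow> w a \<le> w a'"
proof (induction arbitrary: a a' rule: W.induct)
  case (WS n w c d)
  show ?case by (rule WS.IH) (use WS T_mono in auto)
qed

lemma W_E: "W n w \<Longrightarrow> e \<in> E \<Longrightarrow> w e = e"
  by (induction rule: W.induct) (auto simp: T_E)

lemma W_comp: "W m v \<Longrightarrow> W n w \<Longrightarrow> W (m + n) (\<lambda>a. w (v a))"
  by (induction rule: W.induct) (auto intro: WS)

lemma W_T: "c \<in> C \<Longrightarrow> d \<in> D \<Longrightarrow> W (Suc 0) (T c d)"
  using WS[OF W0] by simp

text \<open>
  Words with all values in \<open>E\<close>; as words fix \<open>E\<close>, these are retractions of \<open>A\<close> onto \<open>E\<close>.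
\<close>

definition XE :: "nat \<Rightarrow> ('a \<Rightarrow> 'a) \<Rightarrow> bool" where
  "XE n x \<longleftrightarrow> W n x \<and> (\<forall>a\<in>A. x a \<in> E)"

text \<open>
  If no word increases the length between \<open>a\<close> and \<open>a'\<close>, then by the averaging identity no letter can
  decrease it, and the situation is inherited by the images.
\<close>

lemma W_keep:
  assumes "W n w" "a \<in> A" "a' \<in> A" "a \<le> a'"
    "\<And>n v. W n v \<Longrightarrow> len A (v a) (v a') \<le> len A a a'"
  shows "len A (w a) (w a') = len A a a'"
  using assms
proof (induction arbitrary: a a' rule: W.induct)
  case (WS n w c d)
  have b: "len A (T c d a) (T c d a') \<le> len A a a'" if "c \<in> C" "d \<in> D" for c d
    using WS.prems(4)[OF W_T[OF that]] .
  have eq: "len A (T c d a) (T c d a') = len A a a'"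
  proof (rule ccontr)
    assume "\<not> ?thesis"
    then have lt: "len A (T c d a) (T c d a') < len A a a'" using b[OF WS(2,3)] by auto
    have "(\<Sum>(c,d)\<in>C\<times>D. len A (T c d a) (T c d a')) < (\<Sum>(c,d)\<in>C\<times>D. len A a a')"
      using finC finD WS lt b by (intro sum_strict_mono_strong[of _ "(c,d)"]) auto
    then show False using T_sum[OF WS.prems(1,2,3)] by simp
  qed
  have "len A (w (T c d a)) (w (T c d a')) = len A (T c d a) (T c d a')"
  proof (rule WS.IH)
    fix n v assume "W n v"
    then show "len A (v (T c d a)) (v (T c d a')) \<le> len A (T c d a) (T c d a')"
      using WS.prems(4)[OF W.WS[OF _ WS(2,3)]] eq by auto
  qed (use WS T_mono in auto)
  then show ?case using eq by simp
qed auto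

lemma len_card: "a \<in> A \<Longrightarrow> a' \<in> A \<Longrightarrow> a \<le> a' \<Longrightarrow> len A a a' \<le> card A"
  using chn_bound[OF len_att[OF finA] finA, of a a'] card_mono[OF finA, of "{z \<in> A. a < z}"] by auto

lemma W_max:
  assumes "a \<in> A" "a' \<in> A" "a \<le> a'"
  shows "\<exists>n w. W n w \<and> len A a a' \<le> len A (w a) (w a') \<and>
     (\<forall>m v. W m v \<longrightarrow> len A (v (w a)) (v (w a')) = len A (w a) (w a'))"
proof -
  let ?P = "\<lambda>k. \<exists>n w. W n w \<and> k = len A (w a) (w a')"
  have bd: "\<forall>k. ?P k \<longrightarrow> k \<le> card A" using len_card W_in W_mono assms by blast
  have p0: "?P (len A a a')" using W0 by (intro exI[of _ 0] exI[of _ "\<lambda>a. a"]) auto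
  from GreatestI_nat[of ?P, OF p0] bd have "?P (Greatest ?P)" by blast
  then obtain n w where w: "W n w" "len A (w a) (w a') = Greatest ?P" by auto
  have mx: "len A (v a) (v a') \<le> Greatest ?P" if "W m v" for m v
    by (rule Greatest_le_nat[where b = "card A"]) (use that bd in blast)+
  have "len A (v (w a)) (v (w a')) = len A (w a) (w a')" if "W m v" for m v
  proof (rule W_keep[OF that])
    fix n' v' assume "W n' v'"
    from mx[OF W_comp[OF w(1) this]] show "len A (v' (w a)) (v' (w a')) \<le> len A (w a) (w a')"
      using w(2) by simp
  qed (use W_in[OF w(1)] W_mono[OF w(1)] assms in auto)
  moreover have "len A a a' \<le> len A (w a) (w a')" using mx[OF W0] w(2) by simp
  ultimately show ?thesis using w(1) by blast
qed

lemma ex_longest: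
  assumes "A \<noteq> {}"
  shows "\<exists>a\<in>A. \<exists>a'\<in>A. a \<le> a' \<and> (\<forall>x\<in>A. \<forall>y\<in>A. x \<le> y \<longrightarrow> len A x y \<le> len A a a')"
proof -
  obtain a0 where "a0 \<in> A" using assms by auto
  have "\<exists>p. (\<lambda>(x, y). x \<in> A \<and> y \<in> A \<and> x \<le> y) p \<and>
     (\<forall>q. (\<lambda>(x, y). x \<in> A \<and> y \<in> A \<and> x \<le> y) q \<longrightarrow> (\<lambda>(x, y). len A x y) q \<le> (\<lambda>(x, y). len A x y) p)"
    by (rule ex_has_greatest_nat[of _ "(a0, a0)" _ "Suc (card A)"]) (use \<open>a0 \<in> A\<close> len_card in \<open>auto simp: less_Suc_eq_le\<close>)
  then show ?thesis by force
qed

end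

context biexp
begin

text \<open>
  Let \<open>a \<le> a'\<close> be the ends of a longest chain of \<open>A\<close>. By averaging in both directions, the pairs
  \<open>F d a \<le> F d a'\<close> all span longest chains of \<open>B\<close>. For \<open>d \<le> d'\<close> the pair \<open>F d a \<le> F d' a'\<close> cannot span a longer one, so
  \<open>F d a = F d' a\<close>, and connectedness makes \<open>F d a\<close> independent of \<open>d\<close>.
\<close>

lemma E_nonempty:
  assumes "A \<noteq> {}"
  shows "E \<noteq> {}"
proof -
  from ex_longest[OF assms] obtain a a' where a: "a \<in> A" "a' \<in> A" "a \<le> a'"
    "\<And>x y. x \<in> A \<Longrightarrow> y \<in> A \<Longrightarrow> x \<le> y \<Longrightarrow> len A x y \<le> len A a a'" by metis
  have "B \<noteq> {}" using F_in a(1) neD by fastforce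
  from sw.ex_longest[OF this] obtain b b' where b: "b \<in> B" "b' \<in> B" "b \<le> b'"
    "\<And>x y. x \<in> B \<Longrightarrow> y \<in> B \<Longrightarrow> x \<le> y \<Longrightarrow> len B x y \<le> len B b b'" by metis
  have "card D * len B b b' = (\<Sum>c\<in>C. len A (G c b) (G c b'))" using sw.F_sum[OF b(1-3)] by simp
  also have "\<dots> \<le> (\<Sum>c\<in>C. len A a a')" by (intro sum_mono a(4)) (use b sw.F_mono in auto)
  finally have le: "card D * len B b b' \<le> (\<Sum>d\<in>D. len B (F d a) (F d a'))" using F_sum[OF a(1-3)] by simp
  have le1: "len B (F d a) (F d a') \<le> len B b b'" if "d \<in> D" for d using that a F_mono b(4) by auto
  have eq: "len B (F d a) (F d a') = len B b b'" if d: "d \<in> D" for d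
  proof (rule ccontr)
    assume "\<not> ?thesis" then have "len B (F d a) (F d a') < len B b b'" using le1[OF d] by auto
    then have "(\<Sum>d\<in>D. len B (F d a) (F d a')) < (\<Sum>d\<in>D. len B b b')"
      using finD d le1 by (intro sum_strict_mono_strong[of _ d]) auto
    then show False using le by simp
  qed
  have "F d a = F d' a" if "d \<in> D" "d' \<in> D" "d \<le> d'" for d d'
  proof (rule len_eq_imp_eq[OF finB, of _ _ "F d' a'"])
    have "len B (F d a) (F d' a') \<le> len B b b'"
      using that a F_mono[of a a' d] F_mono2[of a' d d'] by (intro b(4)) (auto intro: order_trans)
    then show "len B (F d a) (F d' a') \<le> len B (F d' a) (F d' a')" using eq[OF that(2)] by simp
  qed (use that a F_mono F_mono2 in auto)
  then have "a \<in> E" using conn_const[OF conD, of "\<lambda>d. F d a"] a unfolding E_def by blast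
  then show ?thesis by auto
qed

end

section \<open>Bases with a greatest element\<close>

text \<open>
  Closure operators that act like joining with a fixed element: for \<open>a \<le> a'\<close> the value at \<open>a'\<close> is the
  least upper bound of \<open>a'\<close> and the value at \<open>a\<close>. Being a property of the order alone, it is transported
  by \<open>\<phi>\<close>; the point is that on a power such an operator acts in each coordinate separately.
\<close>

definition jclos :: "'a::order set \<Rightarrow> ('a \<Rightarrow> 'a) \<Rightarrow> bool" where
  "jclos S n \<longleftrightarrow> (\<forall>a\<in>S. n a \<in> S \<and> a \<le> n a) \<and>
     (\<forall>a\<in>S. \<forall>a'\<in>S. a \<le> a' \<longrightarrow> n a \<le> n a' \<and> (\<forall>u\<in>S. a' \<le> u \<longrightarrow> n a \<le> u \<longrightarrow> n a' \<le> u))"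

lemma jclosD:
  assumes "jclos S n"
  shows "a \<in> S \<Longrightarrow> n a \<in> S" "a \<in> S \<Longrightarrow> a \<le> n a"
    "a \<in> S \<Longrightarrow> a' \<in> S \<Longrightarrow> a \<le> a' \<Longrightarrow> n a \<le> n a'"
    "a \<in> S \<Longrightarrow> a' \<in> S \<Longrightarrow> u \<in> S \<Longrightarrow> a \<le> a' \<Longrightarrow> a' \<le> u \<Longrightarrow> n a \<le> u \<Longrightarrow> n a' \<le> u"
  using assms unfolding jclos_def by blast+

lemma jclosI:
  assumes "\<And>a. a \<in> S \<Longrightarrow> n a \<in> S" "\<And>a. a \<in> S \<Longrightarrow> a \<le> n a"
    "\<And>a a'. a \<in> S \<Longrightarrow> a' \<in> S \<Longrightarrow> a \<le> a' \<Longrightarrow> n a \<le> n a'"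
    "\<And>a a' u. a \<in> S \<Longrightarrow> a' \<in> S \<Longrightarrow> u \<in> S \<Longrightarrow> a \<le> a' \<Longrightarrow> a' \<le> u \<Longrightarrow> n a \<le> u \<Longrightarrow> n a' \<le> u"
  shows "jclos S n"
  using assms unfolding jclos_def by blast

locale top_biexp = biexp A B C D phi psi
  for A :: "'a::order set" and B :: "'b::order set" and C :: "'c::order set" and D :: "'d::order set"
    and phi psi +
  fixes tA :: 'a and tB :: 'b
  assumes tA: "tA \<in> A" and leA: "a \<in> A \<Longrightarrow> a \<le> tA" and tB: "tB \<in> B" and leB: "b \<in> B \<Longrightarrow> b \<le> tB"
begin

lemma tswap: "top_biexp B A D C psi phi tB tA"
  by (intro top_biexp.intro swap top_biexp_axioms.intro tA leA tB leB)

end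

sublocale top_biexp \<subseteq> sw: top_biexp B A D C psi phi tB tA by (rule tswap)

context top_biexp
begin

lemma phi_top: "phi (cst C tA) = cst D tB"
proof (rule antisym)
  show "phi (cst C tA) \<le> cst D tB"
    by (subst pw_le[OF phi_in cst_pw[OF tB]]) (use tA pwD[OF phi_in] leB in auto)
  have "psi (cst D tB) \<le> cst C tA"
    by (subst pw_le[OF psi_in cst_pw[OF tA]]) (use tB pwD[OF psi_in] leA in auto)
  then show "cst D tB \<le> phi (cst C tA)" using psi_le_phi tA tB by simp
qed

lemma F_top[simp]: "d \<in> D \<Longrightarrow> F d tA = tB"
  by (simp add: F_def phi_top)

lemma tA_E[simp]: "tA \<in> E" using tA by (simp add: E_I)

lemma j_top: "j tA = tB" using F_j[OF tA_E] F_top neD by (metis ex_in_conv)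

text \<open>
  The greatest map with value \<open>a\<close> at \<open>c\<close>.
\<close>

definition cone :: "'c \<Rightarrow> 'a \<Rightarrow> 'c \<Rightarrow> 'a" where
  "cone c a = (\<lambda>x\<in>C. if x \<le> c then a else tA)"

lemma cone_pw[simp]: "a \<in> A \<Longrightarrow> cone c a \<in> pw C A"
  by (rule pwI) (auto simp: cone_def tA leA)

lemma cone_self: "c \<in> C \<Longrightarrow> cone c a c = a" by (simp add: cone_def)

lemma le_cone: "f \<in> pw C A \<Longrightarrow> a \<in> A \<Longrightarrow> c \<in> C \<Longrightarrow> f c \<le> a \<Longrightarrow> f \<le> cone c a"
  by (subst pw_le[OF _ cone_pw]) (auto simp: cone_def intro: leA pwD order_trans[OF pwM])

lemma cone_mono: "a \<in> A \<Longrightarrow> a' \<in> A \<Longrightarrow> a \<le> a' \<Longrightarrow> c \<in> C \<Longrightarrow> cone c a \<le> cone c a'"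
  by (rule le_cone) (auto simp: cone_self)

text \<open>
  The operator on \<open>A\<close> that \<open>m\<close> induces at the coordinate \<open>c\<close>, read off from cones.
\<close>

definition nu :: "(('c \<Rightarrow> 'a) \<Rightarrow> 'c \<Rightarrow> 'a) \<Rightarrow> 'c \<Rightarrow> 'a \<Rightarrow> 'a" where
  "nu m c a = m (cone c a) c"

text \<open>
  As \<open>f\<close> lies below the cone of \<open>f c\<close> at \<open>c\<close>, the value of \<open>m\<close> at that cone is the join of the cone with
  \<open>m f\<close>. The cone of \<open>m f c\<close> is an upper bound of both, so nothing is added at the coordinate \<open>c\<close>.
\<close>

lemma jclos_coord:
  assumes m: "jclos (pw C A) m" and f: "f \<in> pw C A" and c: "c \<in> C"
  shows "m f c = nu m c (f c)"
proof (rule antisym)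
  have fc: "f c \<in> A" "m f \<in> pw C A" "m f c \<in> A" using f c jclosD(1)[OF m f] pwD[OF f] pwD[OF jclosD(1)[OF m f]] by auto
  have le: "f \<le> cone c (f c)" using le_cone f fc c by auto
  show "m f c \<le> nu m c (f c)"
    unfolding nu_def using jclosD(3)[OF m f _ le] fc by (auto simp: le_fun_def)
  have "m (cone c (f c)) \<le> cone c (m f c)"
  proof (rule jclosD(4)[OF m f _ _ le])
    show "cone c (f c) \<le> cone c (m f c)"
      using jclosD(2)[OF m f] fc c by (intro cone_mono) (auto simp: le_fun_def)
    show "m f \<le> cone c (m f c)" using fc c by (intro le_cone) auto
  qed (use fc in auto)
  then show "nu m c (f c) \<le> m f c" unfolding nu_def using c by (metis cone_self le_funD)
qed

lemma jclos_nu: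
  assumes m: "jclos (pw C A) m" and c: "c \<in> C"
  shows "jclos A (nu m c)"
proof (rule jclosI)
  fix a assume a: "a \<in> A"
  show "nu m c a \<in> A" unfolding nu_def using pwD[OF jclosD(1)[OF m] c] a by simp
  show "a \<le> nu m c a" unfolding nu_def using jclosD(2)[OF m, of "cone c a"] a c cone_self by (metis cone_pw le_funD)
next
  fix a a' assume a: "a \<in> A" "a' \<in> A" "a \<le> a'"
  show "nu m c a \<le> nu m c a'" unfolding nu_def
    using jclosD(3)[OF m _ _ cone_mono[OF a c]] a by (simp add: le_funD)
next
  fix a a' u assume a: "a \<in> A" "a' \<in> A" "u \<in> A" "a \<le> a'" "a' \<le> u" "nu m c a \<le> u"
  have "m (cone c a') \<le> cone c u"
  proof (rule jclosD(4)[OF m, of "cone c a"])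
    show "m (cone c a) \<le> cone c u"
      using a c jclosD(1)[OF m] by (intro le_cone) (auto simp: nu_def)
  qed (use a c cone_mono in auto)
  then show "nu m c a' \<le> u" unfolding nu_def using c by (metis cone_self le_funD)
qed

definition lift :: "('a \<Rightarrow> 'a) \<Rightarrow> ('c \<Rightarrow> 'a) \<Rightarrow> 'c \<Rightarrow> 'a" where
  "lift n f = (\<lambda>c\<in>C. n (f c))"

lemma jclos_lift:
  assumes n: "jclos A n"
  shows "jclos (pw C A) (lift n)"
proof -
  have L: "lift n f \<in> pw C A" if "f \<in> pw C A" for f
    by (rule pwI) (use jclosD(1,3)[OF n] pwD[OF that] pwM[OF that] in \<open>auto simp: lift_def\<close>)
  show ?thesis
  proof (rule jclosI)
    fix f assume f: "f \<in> pw C A"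
    show "f \<le> lift n f" using pw_le[OF f L[OF f]] jclosD(2)[OF n] pwD[OF f] by (simp add: lift_def)
  next
    fix f g assume f: "f \<in> pw C A" "g \<in> pw C A" "f \<le> g"
    then show "lift n f \<le> lift n g"
      using pw_le[OF L[OF f(1)] L[OF f(2)]] jclosD(3)[OF n pwD[OF f(1)] pwD[OF f(2)]]
      by (simp add: lift_def le_funD)
  next
    fix f g u assume f: "f \<in> pw C A" "g \<in> pw C A" "u \<in> pw C A" "f \<le> g" "g \<le> u" "lift n f \<le> u"
    have "n (g c) \<le> u c" if "c \<in> C" for c
    proof (rule jclosD(4)[OF n, of "f c"])
      show "n (f c) \<le> u c" using f(6) that by (auto simp: le_fun_def lift_def dest: spec[of _ c])
    qed (use f that pwD in \<open>auto simp: le_funD\<close>)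
    then show "lift n g \<le> u" using pw_le[OF L[OF f(2)] f(3)] by (simp add: lift_def)
  qed (use L in auto)
qed

lemma jclos_phi:
  assumes m: "jclos (pw C A) m"
  shows "jclos (pw D B) (\<lambda>k. phi (m (psi k)))"
proof (rule jclosI)
  fix k u k' assume k: "k \<in> pw D B" "k' \<in> pw D B" "u \<in> pw D B" "k \<le> k'" "k' \<le> u" "phi (m (psi k)) \<le> u"
  have "m (psi k') \<le> psi u"
    by (rule jclosD(4)[OF m, of "psi k"]) (use k psi_in psi_mono jclosD(1)[OF m] phi_le_psi in auto)
  then show "phi (m (psi k')) \<le> u" using k psi_in jclosD(1)[OF m] phi_le_psi by auto
qed (use psi_in phi_in psi_mono phi_mono psi_le_phi jclosD[OF m] in auto)

end

context top_biexp
begin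

text \<open>
  Apply an operator of \<open>A\<close> in all coordinates of \<open>A\<^sup>C\<close>, transport it to \<open>B\<^sup>D\<close>, and look at the coordinate
  \<open>d\<close>: the result is an operator of \<open>B\<close> that corresponds to the given one under \<open>F d\<close>.
\<close>

lemma F_nu:
  assumes n: "jclos A n" and d: "d \<in> D"
  shows "jclos B (sw.nu (\<lambda>k. phi (lift n (psi k))) d)"
    "\<And>a. a \<in> A \<Longrightarrow> F d (n a) = sw.nu (\<lambda>k. phi (lift n (psi k))) d (F d a)"
proof -
  let ?m = "\<lambda>k. phi (lift n (psi k))"
  have m: "jclos (pw D B) ?m" by (intro jclos_phi jclos_lift n)
  show "jclos B (sw.nu ?m d)" by (rule sw.jclos_nu[OF m d])
  fix a assume a: "a \<in> A"
  have "lift n (cst C a) = cst C (n a)" by (auto simp: lift_def cst_def fun_eq_iff)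
  then have "F d (n a) = ?m (phi (cst C a)) d" using psi_phi a by (simp add: F_def)
  also have "\<dots> = sw.nu ?m d (F d a)"
    unfolding F_def by (rule sw.jclos_coord[OF m phi_in d]) (use a in auto)
  finally show "F d (n a) = sw.nu ?m d (F d a)" .
qed

end

context top_biexp
begin

lemma jclos_W:
  assumes "W k w" "jclos A n"
  shows "\<exists>n'. jclos A n' \<and> (\<forall>a\<in>A. w (n a) = n' (w a))"
  using assms
proof (induction arbitrary: n rule: W.induct)
  case (WS k w c d)
  from F_nu[OF WS.prems WS(3)] obtain n1 where 1: "jclos B n1" "\<forall>a\<in>A. F d (n a) = n1 (F d a)" by blast
  from sw.F_nu[OF 1(1) WS(2)] obtain n2 where 2: "jclos A n2" "\<forall>b\<in>B. G c (n1 b) = n2 (G c b)" by blast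
  have T: "T c d (n a) = n2 (T c d a)" if "a \<in> A" for a using that 1 2 WS by (simp add: T_def)
  from WS.IH[OF 2(1)] obtain n3 where "jclos A n3" "\<forall>a\<in>A. w (n2 a) = n3 (w a)" by auto
  then show ?case using T WS by (intro exI[of _ n3]) auto
qed auto

text \<open>
  Along a word \<open>x\<close> the operator \<open>n\<close> turns into some \<open>n'\<close>, and both sides equal \<open>n' (x a)\<close> because \<open>x\<close> fixes \<open>x a\<close>.
\<close>

lemma XE_nat:
  assumes "XE k x" "jclos A n" "a \<in> A"
  shows "x (n a) = x (n (x a))"
proof -
  have W: "W k x" "\<And>a. a \<in> A \<Longrightarrow> x a \<in> E" using assms by (auto simp: XE_def)
  from jclos_W[OF W(1) assms(2)] obtain n' where n': "\<forall>a\<in>A. x (n a) = n' (x a)" by auto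
  then show ?thesis using assms(3) W W_E[OF W(1)] E_A by simp
qed

text \<open>
  For \<open>c \<le> c'\<close> the elements \<open>G c b \<le> G c' b\<close> have the same length to the top only if they are equal; so
  connectedness makes \<open>G c (F d a)\<close> independent of \<open>c\<close>, and likewise of \<open>d\<close>.
\<close>

lemma const_len_E:
  assumes "a \<in> A" "\<And>c d. c \<in> C \<Longrightarrow> d \<in> D \<Longrightarrow> len A (T c d a) tA = len A a tA"
  shows "a \<in> E"
proof -
  have c: "G c (F d a) = G c' (F d a)" if "d \<in> D" "c \<in> C" "c' \<in> C" for c c' d
  proof (rule conn_const[OF conC _ that(2,3)])
    fix y z assume yz: "y \<in> C" "z \<in> C" "y \<le> z"
    show "G y (F d a) = G z (F d a)"
    proof (rule len_eq_imp_eq[OF finA _ _ tA])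
      show "len A (G y (F d a)) tA \<le> len A (G z (F d a)) tA"
        using assms(2)[OF yz(1) that(1)] assms(2)[OF yz(2) that(1)] by (simp add: T_def)
    qed (use yz that assms leA sw.F_mono2 in auto)
  qed
  obtain c0 d0 where cd: "c0 \<in> C" "d0 \<in> D" using neC neD by auto
  have d: "G c0 (F d a) = G c0 (F d' a)" if "d \<in> D" "d' \<in> D" for d d'
  proof (rule conn_const[OF conD _ that])
    fix y z assume yz: "y \<in> D" "z \<in> D" "y \<le> z"
    show "G c0 (F y a) = G c0 (F z a)"
    proof (rule len_eq_imp_eq[OF finA _ _ tA])
      show "len A (G c0 (F y a)) tA \<le> len A (G c0 (F z a)) tA"
        using assms(2)[OF cd(1) yz(1)] assms(2)[OF cd(1) yz(2)] by (simp add: T_def)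
    qed (use yz cd assms leA sw.F_mono F_mono2 in auto)
  qed
  show ?thesis by (rule T_const_E[OF assms(1), of "G c0 (F d0 a)"]) (use c d cd in metis)
qed

lemma ex_W_E:
  assumes "a \<in> A"
  shows "\<exists>n w. W n w \<and> w a \<in> E"
proof -
  from W_max[OF assms tA leA[OF assms]] obtain n w where w: "W n w"
    "\<And>m v. W m v \<Longrightarrow> len A (v (w a)) (v (w tA)) = len A (w a) (w tA)" by blast
  have "w a \<in> E"
  proof (rule const_len_E)
    fix c d assume cd: "c \<in> C" "d \<in> D"
    then show "len A (T c d (w a)) tA = len A (w a) tA"
      using w(2)[OF W_T[OF cd]] W_E[OF w(1) tA_E] T_E[OF cd tA_E] by simp
  qed (use W_in w assms in auto)
  then show ?thesis using w by blast
qed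

lemma ex_XE: "\<exists>n x. XE n x"
proof -
  have "\<exists>n w. W n w \<and> (\<forall>a\<in>S. w a \<in> E)" if "finite S" "S \<subseteq> A" for S
    using that
  proof (induction S rule: finite_induct)
    case (insert a S)
    then obtain n w where w: "W n w" "\<forall>a\<in>S. w a \<in> E" by auto
    from ex_W_E[OF W_in[OF w(1), of a]] insert obtain m v where v: "W m v" "v (w a) \<in> E" by auto
    have "v (w x) \<in> E" if "x \<in> S" for x using w(2) that W_E[OF v(1)] by simp
    then show ?case using W_comp[OF w(1) v(1)] v(2) by (intro exI[of _ "n+m"] exI[of _ "\<lambda>a. v (w a)"]) auto
  qed (use W0 in auto)
  from this[OF finA] show ?thesis by (auto simp: XE_def)
qed

lemma XE_comp: "W n w \<Longrightarrow> XE m x \<Longrightarrow> XE (n + m) (\<lambda>a. x (w a))"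
  by (auto simp: XE_def W_in intro: W_comp)

text \<open>
  A word that makes the length between \<open>a'\<close> and \<open>a\<close> as large as possible can be followed by any word
  without collapsing the pair, in particular by a retraction onto \<open>E\<close>.
\<close>

lemma separate:
  assumes "a' \<in> A" "a \<in> A" "a' < a"
  shows "\<exists>n x. XE n x \<and> x a' < x a"
proof -
  from W_max[OF assms(1,2)] assms(3) obtain n w where w: "W n w" "len A a' a \<le> len A (w a') (w a)"
    "\<And>m v. W m v \<Longrightarrow> len A (v (w a')) (v (w a)) = len A (w a') (w a)" by (metis less_imp_le)
  obtain m x where x: "XE m x" using ex_XE by auto
  have Wx: "W m x" using x by (simp add: XE_def)
  have "1 \<le> len A (x (w a')) (x (w a))" using w(2) w(3)[OF Wx] len_pos[OF finA assms] by simp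
  moreover have "x (w a') \<le> x (w a)" using W_mono[OF W_comp[OF w(1) Wx] assms(1,2)] assms(3) by simp
  ultimately have "x (w a') < x (w a)"
    using W_in[OF Wx W_in[OF w(1) assms(1)]] finA by (auto simp: order.strict_iff_order)
  then show ?thesis using XE_comp[OF w(1) x] by blast
qed

subsection \<open>Labels of covers\<close>

text \<open>
  Filling the coordinates in \<open>V\<close> with the top of \<open>B\<close>.
\<close>

definition nV :: "'d set \<Rightarrow> ('c \<Rightarrow> 'a) \<Rightarrow> 'c \<Rightarrow> 'a" where
  "nV V f = psi (\<lambda>d\<in>D. if d \<in> V then tB else phi f d)"

lemma nVk_pw: "upset D V \<Longrightarrow> k \<in> pw D B \<Longrightarrow> (\<lambda>d\<in>D. if d \<in> V then tB else k d) \<in> pw D B"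
  by (rule pwI) (auto simp: upset_def tB leB pwD pwM)

lemma phi_nV:
  "upset D V \<Longrightarrow> f \<in> pw C A \<Longrightarrow> phi (nV V f) = (\<lambda>d\<in>D. if d \<in> V then tB else phi f d)"
  unfolding nV_def by (intro phi_psi nVk_pw phi_in)

lemma jclos_nV: assumes V: "upset D V" shows "jclos (pw C A) (nV V)"
proof (rule jclosI)
  fix f assume f: "f \<in> pw C A"
  show n: "nV V f \<in> pw C A" unfolding nV_def by (intro psi_in nVk_pw V phi_in f)
  show "f \<le> nV V f"
    by (subst phi_le[OF f n, symmetric], subst phi_nV[OF V f], subst pw_le[OF phi_in[OF f] nVk_pw[OF V phi_in[OF f]]])
      (use pwD[OF phi_in[OF f]] leB in auto)
next
  fix f g assume f: "f \<in> pw C A" "g \<in> pw C A" "f \<le> g"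
  show "nV V f \<le> nV V g" unfolding nV_def
  proof (intro psi_mono nVk_pw V phi_in f)
    show "(\<lambda>d\<in>D. if d \<in> V then tB else phi f d) \<le> (\<lambda>d\<in>D. if d \<in> V then tB else phi g d)"
      using phi_mono[OF f] by (auto simp: le_fun_def)
  qed
next
  fix f g u assume f: "f \<in> pw C A" "g \<in> pw C A" "u \<in> pw C A" "f \<le> g" "g \<le> u" "nV V f \<le> u"
  have "(\<lambda>d\<in>D. if d \<in> V then tB else phi f d) \<le> phi u"
    using f(6) sw.phi_le_psi[OF nVk_pw[OF V phi_in[OF f(1)]] f(3)] unfolding nV_def by simp
  then have "(\<lambda>d\<in>D. if d \<in> V then tB else phi g d) \<le> phi u"
    using phi_mono[OF f(2,3,5)] unfolding le_fun_def restrict_def by (smt (verit))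
  then show "nV V g \<le> u"
    using sw.phi_le_psi[OF nVk_pw[OF V phi_in[OF f(2)]] f(3)] unfolding nV_def by simp
qed

abbreviation nuV :: "'d set \<Rightarrow> 'c \<Rightarrow> 'a \<Rightarrow> 'a" where "nuV V \<equiv> nu (nV V)"

lemma nV_coord: "upset D V \<Longrightarrow> f \<in> pw C A \<Longrightarrow> c \<in> C \<Longrightarrow> nV V f c = nuV V c (f c)"
  by (intro jclos_coord jclos_nV)

text \<open>
  The label of a cover \<open>a' < a\<close> at \<open>c\<close>: the coordinate of \<open>B\<^sup>D\<close> that changes when \<open>a'\<close> is replaced by \<open>a\<close>
  in coordinate \<open>c\<close>. The definition uses the cone of \<open>a'\<close>; by \<open>lab_cov\<close> any other context gives the same coordinate.
\<close>

definition lab :: "'a \<Rightarrow> 'a \<Rightarrow> 'c \<Rightarrow> 'd" where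
  "lab a a' c = (SOME d. d \<in> D \<and> phi (cone c a) d \<noteq> phi ((cone c a)(c := a')) d)"

lemma upset_up: "d \<in> D \<Longrightarrow> upset D {x \<in> D. d \<le> x}"
  by (auto simp: upset_def)

text \<open>
  The changed coordinate \<open>d\<close> lies in \<open>V\<close> iff filling \<open>V\<close> absorbs the change. Since filling acts
  coordinatewise on \<open>A\<^sup>C\<close>, this is decided by the values at \<open>c\<close> alone, so \<open>d\<close> does not depend on the context \<open>f\<close>.
\<close>

lemma cov_coord:
  assumes f: "f \<in> pw C A" "f(c := a') \<in> pw C A" "cov A (f c) a'"
  shows "\<exists>d\<in>D. phi (f(c := a')) = (phi f)(d := phi (f(c := a')) d) \<and>
    cov B (phi f d) (phi (f(c := a')) d) \<and>
    (\<forall>V. upset D V \<longrightarrow> (a' \<le> nuV V c (f c) \<longleftrightarrow> d \<in> V))"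
proof -
  let ?g = "f(c := a')"
  have c: "c \<in> C" using f pw_undef covD[OF f(3)] by (metis fun_upd_same less_irrefl)
  from pw_cov[OF finD phi_cov[OF pw_cov_upd[OF f]]] obtain d where
    d: "d \<in> D" "phi ?g = (phi f)(d := phi ?g d)" "cov B (phi f d) (phi ?g d)" by auto
  have "a' \<le> nuV V c (f c) \<longleftrightarrow> d \<in> V" if V: "upset D V" for V
  proof -
    note n = jclosD[OF jclos_nV[OF V]]
    have "a' \<le> nuV V c (f c) \<longleftrightarrow> ?g \<le> nV V f"
    proof
      assume "a' \<le> nuV V c (f c)"
      then show "?g \<le> nV V f" using n(2)[OF f(1)] nV_coord[OF V f(1) c] by (auto simp: le_fun_def)
    next
      assume "?g \<le> nV V f" from le_funD[OF this, of c]
      show "a' \<le> nuV V c (f c)" using nV_coord[OF V f(1) c] by simp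
    qed
    also have "\<dots> \<longleftrightarrow> phi ?g \<le> phi (nV V f)" using phi_le[OF f(2) n(1)[OF f(1)]] by simp
    also have "\<dots> \<longleftrightarrow> d \<in> V"
    proof
      assume "phi ?g \<le> phi (nV V f)" from le_funD[OF this, of d]
      show "d \<in> V" using d covD[OF d(3)] unfolding phi_nV[OF V f(1)] by (auto split: if_splits)
    next
      assume "d \<in> V"
      moreover have "phi ?g x = phi f x" if "x \<notin> V" for x using d(2) that \<open>d \<in> V\<close> by (metis fun_upd_other)
      ultimately show "phi ?g \<le> phi (nV V f)"
        by (subst pw_le[OF phi_in[OF f(2)] phi_in[OF n(1)[OF f(1)]]])
          (use leB pwD[OF phi_in[OF f(2)]] in \<open>auto simp: phi_nV[OF V f(1)]\<close>)
    qed
    finally show ?thesis .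
  qed
  then show ?thesis using d by blast
qed

lemma cone_upd:
  assumes "c \<in> C" "a \<in> A" "a' \<in> A" "a \<le> a'"
  shows "(cone c a)(c := a') \<in> pw C A"
  by (rule pw_upd[OF cone_pw]) (use assms leA tA in \<open>auto simp: cone_def\<close>)

lemma lab_nuV:
  assumes "cov A a a'" "c \<in> C"
  shows "lab a a' c \<in> D" "\<And>V. upset D V \<Longrightarrow> a' \<le> nuV V c a \<longleftrightarrow> lab a a' c \<in> V"
proof -
  have a: "a \<in> A" "a' \<in> A" "a < a'" using covD[OF assms(1)] by auto
  have "cov A (cone c a c) a'" using assms cone_self by metis
  from cov_coord[OF cone_pw[OF a(1)] cone_upd[OF assms(2) a(1,2)] this] a(3) obtain d where
    d: "d \<in> D" "phi ((cone c a)(c := a')) = (phi (cone c a))(d := phi ((cone c a)(c := a')) d)"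
    "cov B (phi (cone c a) d) (phi ((cone c a)(c := a')) d)"
    "\<And>V. upset D V \<Longrightarrow> (a' \<le> nuV V c a \<longleftrightarrow> d \<in> V)"
    unfolding cone_self[OF assms(2)] by (auto simp: less_imp_le)
  have "lab a a' c = d" unfolding lab_def
  proof (rule some_equality)
    fix x assume "x \<in> D \<and> phi (cone c a) x \<noteq> phi ((cone c a)(c := a')) x"
    then show "x = d" using d(2) by (metis fun_upd_other)
  qed (use d covD[OF d(3)] in auto)
  then show "lab a a' c \<in> D" "\<And>V. upset D V \<Longrightarrow> a' \<le> nuV V c a \<longleftrightarrow> lab a a' c \<in> V" using d by auto
qed

lemma lab_cov:
  assumes f: "f \<in> pw C A" "f(c := a') \<in> pw C A" "cov A (f c) a'"
  shows "phi (f(c := a')) = (phi f)(lab (f c) a' c := phi (f(c := a')) (lab (f c) a' c))"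
    "cov B (phi f (lab (f c) a' c)) (phi (f(c := a')) (lab (f c) a' c))" "c \<in> C"
proof -
  show c: "c \<in> C" using f pw_undef covD[OF f(3)] by (metis fun_upd_same less_irrefl)
  from cov_coord[OF f] obtain d where d: "d \<in> D"
    "phi (f(c := a')) = (phi f)(d := phi (f(c := a')) d)"
    "cov B (phi f d) (phi (f(c := a')) d)"
    "\<And>V. upset D V \<Longrightarrow> (a' \<le> nuV V c (f c) \<longleftrightarrow> d \<in> V)" by blast
  note l = lab_nuV[OF f(3) c]
  have "d = lab (f c) a' c"
    using d(4)[OF upset_up[OF d(1)]] d(4)[OF upset_up[OF l(1)]] l(2)[OF upset_up[OF d(1)]]
      l(2)[OF upset_up[OF l(1)]] d(1) l(1) by (auto intro: antisym)
  then show "phi (f(c := a')) = (phi f)(lab (f c) a' c := phi (f(c := a')) (lab (f c) a' c))"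
    "cov B (phi f (lab (f c) a' c)) (phi (f(c := a')) (lab (f c) a' c))" using d by auto
qed

end

context top_biexp
begin

lemma lab_back:
  assumes f: "f \<in> pw C A" "f(c := a') \<in> pw C A" "cov A (f c) a'"
  shows "sw.lab (phi f (lab (f c) a' c)) (phi (f(c := a')) (lab (f c) a' c)) (lab (f c) a' c) = c"
proof -
  let ?d = "lab (f c) a' c" and ?g = "f(c := a')"
  note l = lab_cov[OF f]
  have k: "phi f \<in> pw D B" "(phi f)(?d := phi ?g ?d) \<in> pw D B" using phi_in f l(1) by metis+
  have ps: "psi ((phi f)(?d := phi ?g ?d)) = ?g" using l(1) psi_phi[OF f(2)] by simp
  from sw.lab_cov(1)[OF k l(2)] ps psi_phi[OF f(1)]
  have eq: "?g = f(sw.lab (phi f ?d) (phi ?g ?d) ?d := ?g (sw.lab (phi f ?d) (phi ?g ?d) ?d))" by simp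
  show ?thesis
  proof (rule ccontr)
    assume "\<not> ?thesis"
    then have "?g c = f c" using fun_cong[OF eq, of c] by auto
    then show False using covD[OF f(3)] by auto
  qed
qed

end

section \<open>Isomorphisms, prime posets and duality\<close>

lemma oisoI:
  assumes "\<And>x. x \<in> S \<Longrightarrow> h x \<in> T" "\<And>x y. x \<in> S \<Longrightarrow> y \<in> S \<Longrightarrow> x \<le> y \<longleftrightarrow> h x \<le> h y"
    "\<And>t. t \<in> T \<Longrightarrow> \<exists>x\<in>S. h x = t"
  shows "oisoon h S T"
proof -
  have "h ` S = T" using assms(1,3) by force
  moreover have "inj_on h S" unfolding inj_on_def using assms(2) by (metis order_antisym order_refl)
  ultimately show ?thesis unfolding oisoon_def bij_betw_def using assms(2) by blast
qed

lemma oisoonD: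
  assumes "oisoon h S T"
  shows "x \<in> S \<Longrightarrow> h x \<in> T" "x \<in> S \<Longrightarrow> y \<in> S \<Longrightarrow> x \<le> y \<longleftrightarrow> h x \<le> h y"
    "t \<in> T \<Longrightarrow> \<exists>x\<in>S. h x = t" "bij_betw h S T"
    "x \<in> S \<Longrightarrow> y \<in> S \<Longrightarrow> h x = h y \<longleftrightarrow> x = y"
  using assms unfolding oisoon_def bij_betw_def inj_on_def by auto

lemma oisoon_comp: "oisoon h S T \<Longrightarrow> oisoon k T U \<Longrightarrow> oisoon (\<lambda>x. k (h x)) S U"
  unfolding oisoon_def using bij_betw_trans[of h S T k U] by (auto simp: comp_def dest: bij_betwE)

lemma oisoon_inv: "oisoon h S T \<Longrightarrow> oisoon (the_inv_into S h) T S"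
proof -
  assume h: "oisoon h S T"
  have b: "bij_betw h S T" by (rule oisoonD(4)[OF h])
  have *: "the_inv_into S h t \<in> S" "h (the_inv_into S h t) = t" if "t \<in> T" for t
    using that b by (auto simp: bij_betw_def the_inv_into_into f_the_inv_into_f)
  show ?thesis unfolding oisoon_def
    using bij_betw_the_inv_into[OF b] * oisoonD(2)[OF h] by auto
qed

lemma oiso_refl: "oiso S S"
  unfolding oiso_def by (rule exI[of _ "\<lambda>x. x"]) (rule oisoI; auto)
lemma oiso_sym: "oiso S T \<Longrightarrow> oiso T S"
  unfolding oiso_def using oisoon_inv by blast
lemma oiso_trans: "oiso S T \<Longrightarrow> oiso T U \<Longrightarrow> oiso S U"
  unfolding oiso_def using oisoon_comp by blast
lemma oiso_card: "oiso S T \<Longrightarrow> card S = card T"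
  unfolding oiso_def oisoon_def using bij_betw_same_card by blast

lemma conn_oiso: assumes "conn S" "oiso S T" shows "conn T"
  unfolding conn_def
proof (intro allI impI ballI)
  obtain h where h: "oisoon h T S" using oiso_sym[OF assms(2)] by (auto simp: oiso_def)
  obtain g where g: "oisoon g S T" "\<And>t. t \<in> T \<Longrightarrow> g (h t) = t"
  proof (rule that[OF oisoon_inv[OF h]])
    show "the_inv_into T h (h t) = t" if "t \<in> T" for t
      using oisoonD(4)[OF h] that by (simp add: bij_betw_def the_inv_into_f_f)
  qed
  fix P x y assume a: "x \<in> T" "P x" "\<forall>y\<in>T. \<forall>z\<in>T. y \<le> z \<longrightarrow> P y = P z" "y \<in> T"
  have "P (g (h y))"
  proof (rule connD[OF assms(1) oisoonD(1)[OF h a(1)], of "\<lambda>s. P (g s)"])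
    show "P (g (h x))" using a(1,2) g(2) by simp
    show "P (g s) = P (g t)" if "s \<in> S" "t \<in> S" "s \<le> t" for s t
      using a(3) oisoonD(1)[OF g(1) that(1)] oisoonD(1)[OF g(1) that(2)] oisoonD(2)[OF g(1) that(1,2)] that(3) by blast
  qed (rule oisoonD(1)[OF h a(4)])
  then show "P y" using a(4) g(2) by simp
qed

text \<open>
  Evaluation at a point of \<open>C\<close> maps \<open>A\<^sup>C\<close> onto \<open>A\<close>.
\<close>

lemma conn_base: assumes "conn (pw C A)" "C \<noteq> {}" shows "conn A"
  unfolding conn_def
proof (intro allI impI ballI)
  fix P x y assume a: "x \<in> A" "P x" "\<forall>y\<in>A. \<forall>z\<in>A. y \<le> z \<longrightarrow> P y = P z" "y \<in> A"
  obtain c where c: "c \<in> C" using assms(2) by auto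
  have "P (cst C y c)"
  proof (rule connD[OF assms(1) cst_pw[OF a(1)], of "\<lambda>f. P (f c)"])
    show "P (cst C x c)" using a(2) c by simp
    show "P (f c) = P (g c)" if "f \<in> pw C A" "g \<in> pw C A" "f \<le> g" for f g
      using a(3) pwD[OF that(1) c] pwD[OF that(2) c] le_funD[OF that(3)] by blast
  qed (rule cst_pw[OF a(4)])
  then show "P y" using c by simp
qed

text \<open>
  Irreducibility with respect to products. Only factors inside \<open>S\<close> are mentioned; this is general
  because every factor of \<open>S\<close> is isomorphic to a slice of \<open>S\<close>.
\<close>

definition prime :: "'s::order set \<Rightarrow> bool" where
  "prime S \<longleftrightarrow> finite S \<and> conn S \<and> 2 \<le> card S \<and>
     (\<forall>U V. U \<subseteq> S \<longrightarrow> V \<subseteq> S \<longrightarrow> oiso S (U \<times> V) \<longrightarrow> card U = 1 \<or> card V = 1)"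

lemma prime_prod:
  fixes U :: "'u::order set" and V :: "'v::order set"
  assumes "prime S" "oiso S (U \<times> V)"
  shows "card U = 1 \<or> card V = 1"
proof -
  obtain h where h: "oisoon h S (U \<times> V)" using assms(2) by (auto simp: oiso_def)
  note h' = oisoonD[OF h]
  have "S \<noteq> {}" using assms(1) by (auto simp: prime_def)
  then obtain s0 where s0: "s0 \<in> S" by auto
  obtain u0 v0 where h0: "h s0 = (u0, v0)" by (cases "h s0")
  have u0: "u0 \<in> U" "v0 \<in> V" using h'(1)[OF s0] h0 by auto
  let ?U = "{s \<in> S. snd (h s) = v0}" and ?V = "{s \<in> S. fst (h s) = u0}"
  have U: "oisoon (\<lambda>s. fst (h s)) ?U U"
  proof (rule oisoI)
    fix t assume "t \<in> U" then show "\<exists>x\<in>?U. fst (h x) = t" using h'(3)[of "(t, v0)"] u0 by force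
  qed (use h'(1,2) in \<open>force simp: less_eq_prod_def\<close>)+
  have V: "oisoon (\<lambda>s. snd (h s)) ?V V"
  proof (rule oisoI)
    fix t assume "t \<in> V" then show "\<exists>x\<in>?V. snd (h x) = t" using h'(3)[of "(u0, t)"] u0 by force
  qed (use h'(1,2) in \<open>force simp: less_eq_prod_def\<close>)+
  have "oisoon (\<lambda>(s,t). (fst (h s), snd (h t))) (?U \<times> ?V) (U \<times> V)"
  proof (rule oisoI)
    fix t assume "t \<in> U \<times> V"
    then show "\<exists>x\<in>?U \<times> ?V. (\<lambda>(s,t). (fst (h s), snd (h t))) x = t"
      using oisoonD(3)[OF U, of "fst t"] oisoonD(3)[OF V, of "snd t"] by force
  qed (use oisoonD(1,2)[OF U] oisoonD(1,2)[OF V] in auto)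
  then have "oiso S (?U \<times> ?V)" using assms(2) oiso_sym oiso_trans unfolding oiso_def by blast
  then have "card ?U = 1 \<or> card ?V = 1"
    using assms(1)[unfolded prime_def, THEN conjunct2, THEN conjunct2, THEN conjunct2, rule_format, of ?U ?V] by auto
  moreover have "card ?U = card U" "card ?V = card V"
    by (rule oiso_card, unfold oiso_def, rule exI, rule U, rule oiso_card, unfold oiso_def, rule exI, rule V)
  ultimately show ?thesis by simp
qed

subsection \<open>Restriction and duality\<close>

lemma (in biexp) restrict:
  assumes "A' \<subseteq> A" "B' \<subseteq> B" "\<And>f. f \<in> pw C A' \<Longrightarrow> phi f \<in> pw D B'" "\<And>k. k \<in> pw D B' \<Longrightarrow> psi k \<in> pw C A'"
  shows "biexp A' B' C D phi psi"
proof -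
  have "f \<in> pw C A" if "f \<in> pw C A'" for f using that pw_mono[OF assms(1)] by auto
  moreover have "k \<in> pw D B" if "k \<in> pw D B'" for k using that pw_mono[OF assms(2)] by auto
  ultimately show ?thesis
    by unfold_locales (use assms finA finB finC finD neC neD conC conD psi_phi phi_psi phi_mono psi_mono
        finite_subset[of A' A] finite_subset[of B' B] in auto)
qed

text \<open>
  Reversing the orders of \<open>A\<close> and \<open>C\<close> reverses the order of \<open>A\<^sup>C\<close>. Through \<open>biexp_dual\<close>, statements about
  bases with a top also hold for bases with a bottom.
\<close>

definition dfun :: "'c set \<Rightarrow> ('c \<Rightarrow> 'a) \<Rightarrow> 'c dual \<Rightarrow> 'a dual" where
  "dfun C f = (\<lambda>x\<in>dual ` C. dual (f (undual x)))"
definition ufun :: "'c set \<Rightarrow> ('c dual \<Rightarrow> 'a dual) \<Rightarrow> 'c \<Rightarrow> 'a" where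
  "ufun C g = (\<lambda>x\<in>C. undual (g (dual x)))"

lemma dual_img: "x \<in> dual ` S \<longleftrightarrow> undual x \<in> S"
  by (metis dual_undual image_eqI image_iff undual_dual)

lemma dfun_pw: "f \<in> pw C A \<Longrightarrow> dfun C f \<in> pw (dual ` C) (dual ` A)"
  by (rule pwI) (auto simp: dfun_def dual_less_eq_iff pwD pwM)
lemma ufun_pw: "g \<in> pw (dual ` C) (dual ` A) \<Longrightarrow> ufun C g \<in> pw C A"
proof (rule pwI)
  fix c assume g: "g \<in> pw (dual ` C) (dual ` A)" "c \<in> C"
  then show "ufun C g c \<in> A" using pwD[OF g(1), of "dual c"] by (auto simp: ufun_def dual_img)
next
  fix x y assume g: "g \<in> pw (dual ` C) (dual ` A)" "x \<in> C" "y \<in> C" "x \<le> y"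
  then show "ufun C g x \<le> ufun C g y" using pwM[OF g(1), of "dual y" "dual x"]
    by (auto simp: ufun_def dual_less_eq_iff)
qed (auto simp: ufun_def)
lemma ufun_dfun: "f \<in> pw C A \<Longrightarrow> ufun C (dfun C f) = f"
  by (rule pw_eqI[OF ufun_pw[OF dfun_pw]]) (auto simp: ufun_def dfun_def)
lemma dfun_ufun: "g \<in> pw (dual ` C) (dual ` A) \<Longrightarrow> dfun C (ufun C g) = g"
  by (rule pw_eqI[OF dfun_pw[OF ufun_pw]]) (auto simp: ufun_def dfun_def)
lemma dfun_mono: "(\<And>c. c \<in> C \<Longrightarrow> f c \<le> g c) \<Longrightarrow> dfun C g \<le> dfun C (f::_ \<Rightarrow> _::order)"
  by (auto simp: dfun_def le_fun_def)
lemma ufun_mono: "g \<le> g' \<Longrightarrow> ufun C g' \<le> ufun C (g::_ \<Rightarrow> _::order dual)"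
  by (auto simp: ufun_def le_fun_def dual_less_eq_iff)
lemma dfun_ap: "c \<in> C \<Longrightarrow> dfun C f (dual c) = dual (f c)" by (simp add: dfun_def)
lemma ufun_cst: "ufun C (cst (dual ` C) x) = cst C (undual x)"
  by (auto simp: ufun_def cst_def)
lemma conn_dual: "conn C \<Longrightarrow> conn (dual ` C)"
  unfolding conn_def[of "dual ` C"]
proof (intro allI impI ballI)
  fix P x y
  assume c: "conn C"
    and P: "x \<in> dual ` C" "P x" "\<forall>y\<in>dual ` C. \<forall>z\<in>dual ` C. y \<le> z \<longrightarrow> P y = P z" and y: "y \<in> dual ` C"
  have "P (dual (undual y))"
  proof (rule connD[OF c, of "undual x" "\<lambda>z. P (dual z)"])
    fix u v assume "u \<in> C" "v \<in> C" "u \<le> v"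
    then show "P (dual u) = P (dual v)" using P(3)[rule_format, of "dual v" "dual u"] by simp
  qed (use P(1,2) y dual_img[of x C] dual_img[of y C] in simp_all)
  then show "P y" by simp
qed

lemma biexp_dual:
  assumes "biexp A B C D phi psi"
  shows "biexp (dual ` A) (dual ` B) (dual ` C) (dual ` D)
    (\<lambda>f. dfun D (phi (ufun C f))) (\<lambda>k. dfun C (psi (ufun D k)))"
proof -
  interpret biexp A B C D phi psi by (rule assms)
  show ?thesis
  proof unfold_locales
    fix f assume f: "f \<in> pw (dual ` C) (dual ` A)"
    show "dfun D (phi (ufun C f)) \<in> pw (dual ` D) (dual ` B)" using f by (intro dfun_pw phi_in ufun_pw)
    show "dfun C (psi (ufun D (dfun D (phi (ufun C f))))) = f"
      using f by (simp add: ufun_dfun[OF phi_in[OF ufun_pw]] psi_phi ufun_pw dfun_ufun)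
    fix f' assume f': "f' \<in> pw (dual ` C) (dual ` A)" "f \<le> f'"
    show "dfun D (phi (ufun C f)) \<le> dfun D (phi (ufun C f'))"
      using phi_mono[OF ufun_pw[OF f'(1)] ufun_pw[OF f] ufun_mono[OF f'(2)]] by (intro dfun_mono) (simp add: le_funD)
  next
    fix f assume f: "f \<in> pw (dual ` D) (dual ` B)"
    show "dfun C (psi (ufun D f)) \<in> pw (dual ` C) (dual ` A)" using f by (intro dfun_pw psi_in ufun_pw)
    show "dfun D (phi (ufun C (dfun C (psi (ufun D f))))) = f"
      using f by (simp add: ufun_dfun[OF psi_in[OF ufun_pw]] phi_psi ufun_pw dfun_ufun)
    fix f' assume f': "f' \<in> pw (dual ` D) (dual ` B)" "f \<le> f'"
    show "dfun C (psi (ufun D f)) \<le> dfun C (psi (ufun D f'))"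
      using psi_mono[OF ufun_pw[OF f'(1)] ufun_pw[OF f] ufun_mono[OF f'(2)]] by (intro dfun_mono) (simp add: le_funD)
  qed (use finA finB finC finD neC neD conC conD conn_dual in auto)
qed

context biexp
begin

abbreviation "dphi \<equiv> (\<lambda>f. dfun D (phi (ufun C f)))"

end

context biexp
begin

abbreviation "dpsi \<equiv> sw.dphi"

lemma dual_F: "d \<in> D \<Longrightarrow> biexp.F (dual ` C) dphi (dual d) x = dual (F d (undual x))"
  by (simp add: biexp.F_def[OF biexp_dual[OF biexp_axioms]] ufun_cst dfun_ap F_def)

end

context biexp
begin

lemma dual_E: "biexp.E (dual ` A) (dual ` C) (dual ` D) dphi = dual ` E"
proof -
  have "x \<in> biexp.E (dual ` A) (dual ` C) (dual ` D) dphi \<longleftrightarrow> undual x \<in> E" for x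
    unfolding biexp.E_def[OF biexp_dual[OF biexp_axioms]] E_def
    by (simp add: dual_img dual_F)
  then show ?thesis using dual_img by blast
qed

lemma dual_T: "c \<in> C \<Longrightarrow> d \<in> D \<Longrightarrow>
   biexp.T (dual ` C) (dual ` D) dphi dpsi (dual c) (dual d) x = dual (T c d (undual x))"
  by (simp add: biexp.T_def[OF biexp_dual[OF biexp_axioms]] T_def dual_F sw.dual_F)

lemma dual_W: "W n w \<Longrightarrow> biexp.W (dual ` C) (dual ` D) dphi dpsi n (\<lambda>x. dual (w (undual x)))"
proof (induction rule: W.induct)
  case W0
  show ?case using biexp.W0[OF biexp_dual[OF biexp_axioms]] by simp
next
  case (WS n w c d)
  have "biexp.W (dual ` C) (dual ` D) dphi dpsi (Suc n)
    (\<lambda>a. dual (w (undual (biexp.T (dual ` C) (dual ` D) dphi dpsi (dual c) (dual d) a))))"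
    by (rule biexp.WS[OF biexp_dual[OF biexp_axioms] WS.IH]) (use WS in auto)
  then show ?case using WS by (simp add: dual_T)
qed

lemma dual_XE: "XE n x \<Longrightarrow>
   biexp.XE (dual ` A) (dual ` C) (dual ` D) dphi dpsi n (\<lambda>y. dual (x (undual y)))"
  unfolding biexp.XE_def[OF biexp_dual[OF biexp_axioms]] XE_def dual_E using dual_W by auto

lemma W_flip: "W n w \<Longrightarrow> c \<in> C \<Longrightarrow> d \<in> D \<Longrightarrow> sw.W (Suc n) (\<lambda>b. F d (w (G c b)))"
proof (induction arbitrary: c rule: W.induct)
  case W0
  then show ?case using sw.W_T[of d c] by (simp add: sw.T_def[abs_def])
next
  case (WS n w c' d')
  from sw.WS[OF WS.IH[OF WS(2) WS.prems(2)] WS(3) WS.prems(1)]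
  show ?case by (simp add: sw.T_def T_def)
qed

end

context top_biexp
begin

text \<open>
  Filling commutes with retractions, so only the retracted value of the coordinate matters.
\<close>

lemma XE_nV:
  assumes "upset D V" "f \<in> pw C A" "c \<in> C" "XE k x"
  shows "x (nV V f c) = x (nV V (cst C (x (f c))) c)"
proof -
  have "f c \<in> A" "x (f c) \<in> A" using pwD[OF assms(2,3)] assms(4) E_A by (auto simp: XE_def)
  then show ?thesis
    using nV_coord[OF assms(1,2,3)] nV_coord[OF assms(1) cst_pw assms(3)] 
      XE_nat[OF assms(4) jclos_nu[OF jclos_nV[OF assms(1)] assms(3)]] assms(3) by simp
qed

end

section \<open>Bounded bases with only two fixed elements\<close>

text \<open>
  The case in which only the bounds are fixed. It will be applied to the interval between two elements
  of \<open>E\<close> that are neighbours in \<open>E\<close>.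
\<close>

locale bounded_biexp = top_biexp A B C D phi psi tA tB
  for A :: "'a::order set" and B :: "'b::order set" and C :: "'c::order set" and D :: "'d::order set"
    and phi psi tA tB +
  fixes bA :: 'a and bB :: 'b
  assumes bA: "bA \<in> A" and geA: "a \<in> A \<Longrightarrow> bA \<le> a" and bB: "bB \<in> B" and geB: "b \<in> B \<Longrightarrow> bB \<le> b"
    and nontriv: "bA \<noteq> tA" and E2: "E \<subseteq> {bA, tA}"
begin

lemma phi_bot: "phi (cst C bA) = cst D bB"
proof (rule antisym)
  have "cst C bA \<le> psi (cst D bB)"
    by (subst pw_le[OF cst_pw[OF bA] psi_in]) (use bB pwD[OF psi_in] geA in auto)
  then show "phi (cst C bA) \<le> cst D bB" using phi_le_psi bA bB by simp
  show "cst D bB \<le> phi (cst C bA)"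
    by (subst pw_le[OF cst_pw[OF bB] phi_in]) (use bA pwD[OF phi_in] geB in auto)
qed

lemma F_bot[simp]: "d \<in> D \<Longrightarrow> F d bA = bB"
  by (simp add: F_def phi_bot)

lemma bA_E[simp]: "bA \<in> E" using bA by (simp add: E_I)

lemma j_bot: "j bA = bB" using F_j[OF bA_E] F_bot neD by (metis ex_in_conv)

lemma bswap: "bounded_biexp B A D C psi phi tB tA bB bA"
proof (intro bounded_biexp.intro tswap bounded_biexp_axioms.intro bB geB bA geA)
  show "bB \<noteq> tB" using nontriv j_inj[OF bA_E tA_E] by (simp add: j_top j_bot)
  have "sw.E \<subseteq> j ` E" using sw.jE_in sw.swj_j by (metis image_eqI subsetI)
  then have "sw.E \<subseteq> j ` {bA, tA}" using E2 by blast
  then show "sw.E \<subseteq> {bB, tB}" by (simp add: j_top j_bot)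
qed

end

sublocale bounded_biexp \<subseteq> sw: bounded_biexp B A D C psi phi tB tA bB bA by (rule bswap)

context bounded_biexp
begin

lemma dual_top_biexp: "top_biexp (dual ` A) (dual ` B) (dual ` C) (dual ` D) dphi dpsi (dual bA) (dual bB)"
  by (intro top_biexp.intro top_biexp_axioms.intro biexp_dual[OF biexp_axioms])
    (use bA bB geA geB in \<open>auto simp: dual_img dual_less_eq_iff\<close>)

text \<open>
  The dual of filling: the coordinates outside \<open>V\<close> are reset to the bottom of \<open>B\<close>.
\<close>

definition iV :: "'d set \<Rightarrow> ('c \<Rightarrow> 'a) \<Rightarrow> 'c \<Rightarrow> 'a" where
  "iV V f = psi (\<lambda>d\<in>D. if d \<in> V then phi f d else bB)"

lemma iVk_pw: "upset D V \<Longrightarrow> k \<in> pw D B \<Longrightarrow> (\<lambda>d\<in>D. if d \<in> V then k d else bB) \<in> pw D B"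
  by (rule pwI) (auto simp: upset_def bB geB pwD pwM)

lemma phi_iV:
  "upset D V \<Longrightarrow> f \<in> pw C A \<Longrightarrow> phi (iV V f) = (\<lambda>d\<in>D. if d \<in> V then phi f d else bB)"
  unfolding iV_def by (intro phi_psi iVk_pw phi_in)

lemma iV_pw: "upset D V \<Longrightarrow> f \<in> pw C A \<Longrightarrow> iV V f \<in> pw C A"
  unfolding iV_def by (intro psi_in iVk_pw phi_in)

lemma XE_iV:
  assumes V: "upset D V" and f: "f \<in> pw C A" and c: "c \<in> C" and x: "XE k x"
  shows "x (iV V f c) = x (iV V (cst C (x (f c))) c)"
proof -
  interpret du: top_biexp "dual ` A" "dual ` B" "dual ` C" "dual ` D" dphi dpsi "dual bA" "dual bB"
    by (rule dual_top_biexp)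
  let ?V = "dual ` (D - V)"
  have uV: "upset (dual ` D) ?V" using V by (auto simp: upset_def)
  have n: "du.nV ?V (dfun C f) = dfun C (iV V f)" if f: "f \<in> pw C A" for f
  proof -
    have "(\<lambda>d\<in>dual ` D. if d \<in> ?V then dual bB else dphi (dfun C f) d) =
      dfun D (\<lambda>d\<in>D. if d \<in> V then phi f d else bB)"
      unfolding ufun_dfun[OF f] by (auto simp: dfun_def fun_eq_iff)
    then show ?thesis unfolding du.nV_def iV_def using ufun_dfun[OF iVk_pw[OF V phi_in[OF f]]] by simp
  qed
  have xf: "x (f c) \<in> A" using x E_A pwD[OF f c] by (auto simp: XE_def)
  have dc: "dfun C (cst C a) = cst (dual ` C) (dual a)" for a :: 'a
    by (rule ext) (auto simp: dfun_def cst_def restrict_def dual_img)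
  have "dual (x (undual (du.nV ?V (dfun C f) (dual c)))) =
     dual (x (undual (du.nV ?V (cst (dual ` C) (dual (x (undual (dfun C f (dual c)))))) (dual c))))"
    using du.XE_nV[OF uV dfun_pw[OF f] _ dual_XE[OF x]] c by simp
  then show ?thesis using n[OF f] n[OF cst_pw[OF xf]] c by (simp add: dfun_ap dc)
qed

subsection \<open>Two-valued words\<close>

text \<open>
  A retraction onto \<open>E\<close> takes only the two bounds as values here, so it is a predicate.
\<close>

definition twoval :: "('a \<Rightarrow> bool) \<Rightarrow> bool" where
  "twoval p \<longleftrightarrow> (\<exists>n x. XE n x \<and> p = (\<lambda>a. a \<in> A \<and> x a = tA))"

definition pull :: "('a \<Rightarrow> bool) \<Rightarrow> 'c \<Rightarrow> 'b \<Rightarrow> bool" where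
  "pull p c = (\<lambda>b. b \<in> B \<and> p (G c b))"

text \<open>
  The coordinate of \<open>B\<^sup>D\<close> that determines \<open>p (f c)\<close>.
\<close>

definition source :: "('a \<Rightarrow> bool) \<Rightarrow> 'c \<Rightarrow> 'd" where
  "source p c = (SOME d. d \<in> D \<and> (\<forall>f\<in>pw C A. p (f c) \<longleftrightarrow> pull p c (phi f d)))"

lemma twovalD: "twoval p \<Longrightarrow> p tA" "twoval p \<Longrightarrow> \<not> p bA" "twoval p \<Longrightarrow> p a \<Longrightarrow> a \<in> A"
    "twoval p \<Longrightarrow> p a \<Longrightarrow> a \<le> a' \<Longrightarrow> a' \<in> A \<Longrightarrow> p a'"
proof -
  assume "twoval p"
  then obtain n x where x: "XE n x" "p = (\<lambda>a. a \<in> A \<and> x a = tA)" by (auto simp: twoval_def)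
  have W: "W n x" using x by (simp add: XE_def)
  show "p tA" "\<not> p bA" using W_E[OF W] x tA nontriv by auto
  show "p a \<Longrightarrow> a \<in> A" using x by auto
  show "p a \<Longrightarrow> a \<le> a' \<Longrightarrow> a' \<in> A \<Longrightarrow> p a'" using x W_mono[OF W, of a a'] W_in[OF W, of a'] leA by (auto intro: antisym)
qed

end

context bounded_biexp
begin

lemma twoval_pull: assumes "twoval p" "c \<in> C" shows "sw.twoval (pull p c)"
proof -
  obtain n x where x: "XE n x" "p = (\<lambda>a. a \<in> A \<and> x a = tA)" using assms(1) by (auto simp: twoval_def)
  have W: "W n x" "\<And>a. a \<in> A \<Longrightarrow> x a \<in> E" using x by (auto simp: XE_def)
  obtain d where d: "d \<in> D" using neD by auto
  have xe: "sw.XE (Suc n) (\<lambda>b. F d (x (G c b)))"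
    unfolding sw.XE_def using W_flip[OF W(1) assms(2) d] F_j[OF W(2) d] jE_in[OF W(2)] assms(2) by simp
  have "pull p c = (\<lambda>b. b \<in> B \<and> F d (x (G c b)) = tB)"
  proof (rule ext)
    fix b show "pull p c b = (b \<in> B \<and> F d (x (G c b)) = tB)"
    proof (cases "b \<in> B")
      case True
      then have "x (G c b) \<in> E" using W(2) assms(2) by simp
      then have "F d (x (G c b)) = tB \<longleftrightarrow> x (G c b) = tA" using F_j[OF _ d] j_inj[OF _ tA_E] j_top by metis
      then show ?thesis using True x(2) assms(2) by (simp add: pull_def)
    qed (auto simp: pull_def)
  qed
  then show ?thesis unfolding sw.twoval_def using xe by blast
qed

text \<open>
  The predicate \<open>x \<cdot> = tA\<close> turns filling into a disjunction and, in \<open>word_meet\<close>, resetting into a conjunction.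
\<close>

lemma word_join:
  assumes "XE k x" "upset D V" "f \<in> pw C A" "c \<in> C"
  shows "x (nV V f c) = tA \<longleftrightarrow> x (f c) = tA \<or> x (nV V (cst C bA) c) = tA"
proof -
  have fc: "f c \<in> A" using pwD assms by metis
  then have "x (f c) \<in> {bA, tA}" using assms(1) E2 by (auto simp: XE_def)
  moreover have "nV V (cst C tA) c = tA"
    using jclosD(2)[OF jclos_nV[OF assms(2)] cst_pw[OF tA]] jclosD(1)[OF jclos_nV[OF assms(2)] cst_pw[OF tA]]
      pwD[of _ C A c] assms(4) leA by (metis antisym cst_ap le_funD)
  moreover have "x tA = tA" using assms(1) W_E[OF _ tA_E] by (auto simp: XE_def)
  moreover have "x bA = bA" using assms(1) W_E[OF _ bA_E] by (auto simp: XE_def)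
  ultimately show ?thesis using XE_nV[OF assms(2,3,4,1)] nontriv by auto
qed

lemma word_meet:
  assumes "XE k x" "upset D V" "f \<in> pw C A" "c \<in> C"
  shows "x (iV V f c) = tA \<longleftrightarrow> x (f c) = tA \<and> x (iV V (cst C tA) c) = tA"
proof -
  have fc: "f c \<in> A" using pwD assms by metis
  then have "x (f c) \<in> {bA, tA}" using assms(1) E2 by (auto simp: XE_def)
  moreover have "iV V (cst C bA) c = bA"
  proof -
    have "(\<lambda>d\<in>D. if d \<in> V then cst D bB d else bB) = cst D bB" by (auto simp: cst_def)
    then have "iV V (cst C bA) = cst C bA" unfolding iV_def phi_bot using sw.phi_bot by simp
    then show ?thesis using assms by simp
  qed
  moreover have "x bA = bA" using assms(1) W_E[OF _ bA_E] by (auto simp: XE_def)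
  ultimately show ?thesis using XE_iV[OF assms(2,3,4,1)] nontriv by auto
qed

lemma chi_eq: "upset D V \<Longrightarrow> iV V (cst C tA) = nV V (cst C bA)"
  unfolding iV_def nV_def phi_bot phi_top by (rule arg_cong[of _ _ psi]) auto

text \<open>
  The upsets \<open>V\<close> for which \<open>p\<close> accepts the \<open>c\<close>-th coordinate of the indicator map of \<open>V\<close> form a prime filter, hence consist of the
  upsets that contain one element \<open>d\<close>. Resetting outside the upset of \<open>d\<close> and filling all coordinates not
  below \<open>d\<close> does not change \<open>p (f c)\<close> but leaves only the coordinate \<open>d\<close> of \<open>\<phi> f\<close>.
\<close>

lemma ex_source:
  assumes p: "twoval p" and c: "c \<in> C"
  shows "\<exists>d\<in>D. \<forall>f\<in>pw C A. p (f c) \<longleftrightarrow> pull p c (phi f d)"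
proof -
  obtain n x where x: "XE n x" "p = (\<lambda>a. a \<in> A \<and> x a = tA)" using p by (auto simp: twoval_def)
  have W: "W n x" using x by (simp add: XE_def)
  let ?P = "\<lambda>V. x (nV V (cst C bA) c) = tA"
  have un: "?P (V \<union> U) \<longleftrightarrow> ?P V \<or> ?P U" if V: "upset D V" and U: "upset D U" for V U
  proof -
    have "nV (V \<union> U) (cst C bA) = nV V (nV U (cst C bA))"
      using phi_nV[OF U cst_pw[OF bA]] unfolding nV_def[of V] nV_def[of "V \<union> U"]
      by (intro arg_cong[of _ _ psi]) auto
    then show ?thesis using word_join[OF x(1) V jclosD(1)[OF jclos_nV[OF U] cst_pw[OF bA]] c] by auto
  qed
  have int: "?P (V \<inter> U) \<longleftrightarrow> ?P V \<and> ?P U" if V: "upset D V" and U: "upset D U" for V U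
  proof -
    have VU: "upset D (V \<inter> U)" using V U by (auto simp: upset_def)
    have "iV (V \<inter> U) (cst C tA) = iV V (iV U (cst C tA))"
      using phi_iV[OF U cst_pw[OF tA]] unfolding iV_def[of V] iV_def[of "V \<inter> U"]
      by (intro arg_cong[of _ _ psi]) auto
    then show ?thesis
      using word_meet[OF x(1) V iV_pw[OF U cst_pw[OF tA]] c] chi_eq[OF V] chi_eq[OF U] chi_eq[OF VU] by auto
  qed
  have PD: "?P D"
  proof -
    have "nV D (cst C bA) = cst C tA" unfolding nV_def
      using psi_phi[OF cst_pw[OF tA]] phi_top by (simp add: cst_def cong: restrict_cong)
    then show ?thesis using c W_E[OF W tA_E] by simp
  qed
  have Pe: "\<not> ?P {}"
  proof -
    have "nV {} (cst C bA) = cst C bA" unfolding nV_def phi_bot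
      using psi_phi[OF cst_pw[OF bA]] phi_bot by (simp add: cst_def cong: restrict_cong)
    then show ?thesis using c W_E[OF W bA_E] nontriv by simp
  qed
  have uD: "upset D D" by (auto simp: upset_def)
  let ?M = "\<lambda>V. upset D V \<and> ?P V"
  \<comment> \<open>the least accepted upset; it is principal because acceptance is prime\<close>
  obtain V where V: "?M V" "\<And>U. ?M U \<Longrightarrow> card V \<le> card U"
    using ex_has_least_nat[of ?M D card] PD uD by auto
  have finV: "finite V" using V(1) finD finite_subset by (auto simp: upset_def)
  have least: "V \<subseteq> U" if "?M U" for U
  proof -
    have "?M (V \<inter> U)" using int that V(1) by (auto simp: upset_def)
    then have "card V \<le> card (V \<inter> U)" using V(2) by auto
    then have "V \<inter> U = V" using finV by (metis card_seteq inf_le1)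
    then show ?thesis by auto
  qed
  have "\<exists>d\<in>V. ?P {y \<in> D. d \<le> y}"
  proof (rule ccontr)
    assume no: "\<not> ?thesis"
    have "upset D (\<Union>d\<in>S. {y \<in> D. d \<le> y}) \<and> \<not> ?P (\<Union>d\<in>S. {y \<in> D. d \<le> y})" if "finite S" "S \<subseteq> V" for S
      using that
    proof (induction S rule: finite_induct)
      case empty then show ?case using Pe by (auto simp: upset_def)
    next
      case (insert d S)
      have u: "upset D {y \<in> D. d \<le> y}" by (auto simp: upset_def)
      have "upset D ({y \<in> D. d \<le> y} \<union> (\<Union>d\<in>S. {y \<in> D. d \<le> y}))" using insert u by (auto simp: upset_def)
      then show ?case using un[OF u] insert no by simp
    qed
    moreover have "(\<Union>d\<in>V. {y \<in> D. d \<le> y}) = V" using V(1) by (auto simp: upset_def)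
    ultimately show False using V(1) finV by (metis order_refl)
  qed
  then obtain d where d: "d \<in> V" "?P {y \<in> D. d \<le> y}" by auto
  have dD: "d \<in> D" using d(1) V(1) by (auto simp: upset_def)
  \<comment> \<open>the two upsets leave exactly the coordinate \<open>d\<close> unchanged\<close>
  let ?U = "{y \<in> D. d \<le> y}" and ?W = "{y \<in> D. \<not> y \<le> d}"
  have uU: "upset D ?U" and uW: "upset D ?W" by (auto simp: upset_def intro: order_trans)
  have PW: "\<not> ?P ?W" using least[of ?W] uW d(1) by auto
  have key: "x (f c) = tA \<longleftrightarrow> x (nV ?W (iV ?U f) c) = tA" if f: "f \<in> pw C A" for f
    using word_join[OF x(1) uW iV_pw[OF uU f] c] word_meet[OF x(1) uU f c] chi_eq[OF uU] d(2) PW by auto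
  have same: "nV ?W (iV ?U f) = nV ?W (iV ?U g)" if f: "f \<in> pw C A" "g \<in> pw C A" "phi f d = phi g d" for f g
    unfolding nV_def phi_iV[OF uU f(1)] phi_iV[OF uU f(2)]
    by (rule arg_cong[of _ _ psi]) (use f(3) in \<open>auto simp: fun_eq_iff restrict_def\<close>)
  show ?thesis
  proof (intro bexI[of _ d] ballI)
    fix f assume f: "f \<in> pw C A"
    have b: "phi f d \<in> B" using pwD[OF phi_in[OF f] dD] .
    let ?g = "psi (cst D (phi f d))"
    have g: "?g \<in> pw C A" "phi ?g d = phi f d" using b psi_in phi_psi dD by auto
    have "x (f c) = tA \<longleftrightarrow> x (?g c) = tA" using key[OF f] key[OF g(1)] same[OF f g(1)] g(2) by simp
    then show "p (f c) = pull p c (phi f d)"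
      using x(2) pwD[OF f c] pwD[OF g(1) c] b by (simp add: pull_def sw.F_def)
  qed (rule dD)
qed

lemma source:
  assumes "twoval p" "c \<in> C"
  shows "source p c \<in> D" "\<And>f. f \<in> pw C A \<Longrightarrow> p (f c) \<longleftrightarrow> pull p c (phi f (source p c))"
proof -
  have "source p c \<in> D \<and> (\<forall>f\<in>pw C A. p (f c) \<longleftrightarrow> pull p c (phi f (source p c)))"
    unfolding source_def by (rule someI_ex) (use ex_source[OF assms] in blast)
  then show "source p c \<in> D" "\<And>f. f \<in> pw C A \<Longrightarrow> p (f c) \<longleftrightarrow> pull p c (phi f (source p c))" by auto
qed

text \<open>
  The predicates \<open>f \<mapsto> p (f c)\<close> on \<open>A\<^sup>C\<close> are ordered like the pairs \<open>(p, c)\<close>: constant maps test \<open>p\<close>,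
  indicator maps test \<open>c\<close>.
\<close>

lemma ev_le:
  assumes "twoval p" "twoval p'" "c \<in> C" "c' \<in> C"
  shows "(\<forall>f\<in>pw C A. p (f c) \<longrightarrow> p' (f c')) \<longleftrightarrow> p \<le> p' \<and> c \<le> c'"
proof
  assume L: "\<forall>f\<in>pw C A. p (f c) \<longrightarrow> p' (f c')"
  have "p \<le> p'"
  proof (intro le_funI le_boolI)
    fix a assume a: "p a"
    then show "p' a" using L[rule_format, of "cst C a"] twovalD(3)[OF assms(1) a] assms by simp
  qed
  moreover have "c \<le> c'"
  proof (rule ccontr)
    assume n: "\<not> c \<le> c'"
    let ?f = "\<lambda>x\<in>C. if c \<le> x then tA else bA"
    have "?f \<in> pw C A" by (rule pwI) (auto simp: tA bA leA)
    then show False using L[rule_format, of ?f] n assms twovalD(1)[OF assms(1)] twovalD(2)[OF assms(2)] by simp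
  qed
  ultimately show "p \<le> p' \<and> c \<le> c'" by auto
next
  assume R: "p \<le> p' \<and> c \<le> c'"
  show "\<forall>f\<in>pw C A. p (f c) \<longrightarrow> p' (f c')"
  proof (intro ballI impI)
    fix f assume f: "f \<in> pw C A" "p (f c)"
    then have "p' (f c)" using R by (auto simp: le_fun_def)
    then show "p' (f c')" using twovalD(4)[OF assms(2)] pwM[OF f(1) assms(3,4)] pwD[OF f(1) assms(4)] R by auto
  qed
qed

end

context bounded_biexp
begin

text \<open>
  By \<open>source\<close> the same predicate on \<open>A\<^sup>C\<close> is given by \<open>(p, c)\<close> and, on the other side, by
  \<open>(pull p c, source p c)\<close>. So this passage is an order embedding of pairs, and \<open>source_inv\<close> says that the
  passage back is its inverse.
\<close>

lemma source_le:
  assumes "twoval p" "twoval p'" "c \<in> C" "c' \<in> C"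
  shows "pull p c \<le> pull p' c' \<and> source p c \<le> source p' c' \<longleftrightarrow> p \<le> p' \<and> c \<le> c'"
proof -
  have "(\<forall>f\<in>pw C A. p (f c) \<longrightarrow> p' (f c')) \<longleftrightarrow>
    (\<forall>k\<in>pw D B. pull p c (k (source p c)) \<longrightarrow> pull p' c' (k (source p' c')))"
    using source(2)[OF assms(1,3)] source(2)[OF assms(2,4)] phi_in psi_in phi_psi by metis
  then show ?thesis
    using ev_le[OF assms] sw.ev_le[OF twoval_pull[OF assms(1,3)] twoval_pull[OF assms(2,4)] source(1)[OF assms(1,3)] source(1)[OF assms(2,4)]]
    by blast
qed

lemma source_inv:
  assumes "twoval p" "c \<in> C"
  shows "sw.pull (pull p c) (source p c) = p" "sw.source (pull p c) (source p c) = c"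
proof -
  let ?q = "pull p c" and ?d = "source p c"
  let ?p = "sw.pull ?q ?d" and ?c = "sw.source ?q ?d"
  have q: "sw.twoval ?q" "?d \<in> D" using twoval_pull[OF assms] source[OF assms] by auto
  note d' = sw.source[OF q]
  have p': "twoval ?p" by (rule sw.twoval_pull[OF q])
  have e: "p (f c) = ?p (f ?c)" if "f \<in> pw C A" for f
    using source(2)[OF assms that] d'(2)[OF phi_in[OF that]] psi_phi[OF that] by simp
  have "p \<le> ?p \<and> c \<le> ?c" using ev_le[OF assms(1) p' assms(2) d'(1)] e by blast
  moreover have "?p \<le> p \<and> ?c \<le> c" using ev_le[OF p' assms(1) d'(1) assms(2)] e by blast
  ultimately show "?p = p" "?c = c" by auto
qed

end

context bounded_biexp
begin

text \<open>
  A strict inequality that is not seen by the source of some coordinate. It will be shown that a gap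
  persists along all words, which is impossible since a retraction makes all predicates equal.
\<close>

definition gap :: "('a \<Rightarrow> bool) \<Rightarrow> ('a \<Rightarrow> bool) \<Rightarrow> bool" where
  "gap p p' \<longleftrightarrow> twoval p \<and> twoval p' \<and> p < p' \<and> (\<exists>c\<in>C. source p c = source p' c)"

text \<open>
  Moving from \<open>c0\<close> to a comparable \<open>c\<close>, the pair formed by the pullback at \<open>c\<close> of one predicate and the source of the
  other is squeezed between known pairs. So the sources agree at \<open>c\<close> as well.
\<close>

lemma gap_source:
  assumes "gap p p'" "c \<in> C"
  shows "source p c = source p' c"
proof -
  have p: "twoval p" "twoval p'" "p \<le> p'" using assms(1) by (simp_all add: gap_def less_imp_le)
  obtain c0 where c0: "c0 \<in> C" "source p c0 = source p' c0" using assms(1) by (auto simp: gap_def)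
  note d1 = source(1)[OF p(1)] and d2 = source(1)[OF p(2)] and q1 = twoval_pull[OF p(1)] and q2 = twoval_pull[OF p(2)]
  have up: "source p c = source p' c" if c: "c0 \<in> C" "c \<in> C" "c0 \<le> c" "source p c0 = source p' c0" for c0 c
  proof -
    let ?q = "pull p' c" and ?d = "source p c"
    have le: "pull p c \<le> pull p' c" "source p c \<le> source p' c" using source_le[OF p(1,2) c(2) c(2)] p by auto
    have le0: "source p c0 \<le> source p c" using source_le[OF p(1,1) c(1) c(2)] c(3) by auto
    have le0': "pull p' c0 \<le> pull p' c" using source_le[OF p(2,2) c(1) c(2)] c(3) by auto
    have A: "sw.pull ?q ?d \<le> p' \<and> sw.source ?q ?d \<le> c"
      using sw.source_le[OF q2 q2 d1 d2, OF c(2) c(2) c(2) c(2)] source_inv[OF p(2) c(2)] le by auto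
    have B: "c \<le> sw.source ?q ?d"
      using sw.source_le[OF q1 q2 d1 d1, OF c(2) c(2) c(2) c(2)] source_inv[OF p(1) c(2)] le by auto
    have C: "p' \<le> sw.pull ?q ?d"
      using sw.source_le[OF q2 q2 d2 d1, OF c(1) c(2) c(1) c(2)] source_inv[OF p(2) c(1)] le0 le0' c(4) by auto
    have "sw.pull ?q ?d = p'" "sw.source ?q ?d = c" using A B C by auto
    then show ?thesis using sw.source_inv(2)[OF q2 d1, OF c(2) c(2)] by simp
  qed
  have down: "source p c = source p' c" if c: "c0 \<in> C" "c \<in> C" "c \<le> c0" "source p c0 = source p' c0" for c0 c
  proof -
    let ?q = "pull p c" and ?d = "source p' c"
    have le: "pull p c \<le> pull p' c" "source p c \<le> source p' c" using source_le[OF p(1,2) c(2) c(2)] p by auto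
    have le0: "source p' c \<le> source p' c0" using source_le[OF p(2,2) c(2) c(1)] c(3) by auto
    have le0': "pull p c \<le> pull p c0" using source_le[OF p(1,1) c(2) c(1)] c(3) by auto
    have A: "p \<le> sw.pull ?q ?d \<and> c \<le> sw.source ?q ?d"
      using sw.source_le[OF q1 q1 d1 d2, OF c(2) c(2) c(2) c(2)] source_inv[OF p(1) c(2)] le by auto
    have B: "sw.source ?q ?d \<le> c"
      using sw.source_le[OF q1 q2 d2 d2, OF c(2) c(2) c(2) c(2)] source_inv[OF p(2) c(2)] le by auto
    have C: "sw.pull ?q ?d \<le> p"
      using sw.source_le[OF q1 q1 d2 d1, OF c(2) c(1) c(2) c(1)] source_inv[OF p(1) c(1)] le0 le0' c(4) by auto
    have "sw.pull ?q ?d = p" "sw.source ?q ?d = c" using A B C by auto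
    then show ?thesis using sw.source_inv(2)[OF q1 d2, OF c(2) c(2)] by simp
  qed
  show ?thesis
    by (rule connD[OF conC c0(1), of "\<lambda>c. source p c = source p' c"]) (use c0 up down assms(2) in blast)+
qed

end

context bounded_biexp
begin

lemma gap_pull:
  assumes "gap p p'" "c \<in> C"
  shows "sw.gap (pull p c) (pull p' c)"
proof -
  have p: "twoval p" "twoval p'" "p < p'" using assms(1) by (auto simp: gap_def)
  note e = gap_source[OF assms]
  have "pull p c \<le> pull p' c" using source_le[OF p(1,2) assms(2) assms(2)] less_imp_le[OF p(3)] by blast
  moreover have "pull p c \<noteq> pull p' c"
    using source_inv(1)[OF p(1) assms(2)] source_inv(1)[OF p(2) assms(2)] e p(3) by (metis less_irrefl)
  moreover have "sw.source (pull p c) (source p c) = sw.source (pull p' c) (source p c)"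
    using source_inv(2)[OF p(1) assms(2)] source_inv(2)[OF p(2) assms(2)] e by metis
  ultimately show ?thesis
    unfolding sw.gap_def using twoval_pull[OF p(1) assms(2)] twoval_pull[OF p(2) assms(2)] source(1)[OF p(1) assms(2)]
    by (metis order.not_eq_order_implies_strict)
qed

definition along :: "('a \<Rightarrow> bool) \<Rightarrow> ('a \<Rightarrow> 'a) \<Rightarrow> 'a \<Rightarrow> bool" where
  "along p w = (\<lambda>a. a \<in> A \<and> p (w a))"

end

context bounded_biexp
begin

lemma along_T: "c \<in> C \<Longrightarrow> d \<in> D \<Longrightarrow> along p (\<lambda>a. w (T c d a)) = sw.pull (pull (along p w) c) d"
  by (auto simp: along_def sw.pull_def pull_def T_def fun_eq_iff)

lemma gap_W: "W n w \<Longrightarrow> gap p p' \<Longrightarrow> gap (along p w) (along p' w)"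
proof (induction rule: W.induct)
  case W0
  have "along p (\<lambda>a. a) = p" "along p' (\<lambda>a. a) = p'"
    using W0 twovalD(3)[of p] twovalD(3)[of p'] by (auto simp: along_def gap_def fun_eq_iff)
  then show ?case using W0 by simp
next
  case (WS n w c d)
  then show ?case by (simp add: along_T gap_pull sw.gap_pull)
qed

lemma along_XE: "twoval p \<Longrightarrow> XE n x \<Longrightarrow> along p x = (\<lambda>a. a \<in> A \<and> x a = tA)"
proof -
  assume p: "twoval p" "XE n x"
  obtain m y where y: "XE m y" "p = (\<lambda>a. a \<in> A \<and> y a = tA)" using p by (auto simp: twoval_def)
  have "y (x a) = x a" if "a \<in> A" for a using W_E y(1) p(2) that by (auto simp: XE_def)
  then show ?thesis using p(2) E_A by (auto simp: along_def y(2) XE_def fun_eq_iff)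
qed

lemma no_gap: "\<not> gap p p'"
proof
  assume gap: "gap p p'"
  obtain n x where x: "XE n x" using ex_XE by auto
  have "gap (along p x) (along p' x)" using gap_W[OF _ gap] x by (auto simp: XE_def)
  moreover have "along p x = along p' x" using along_XE[OF _ x] gap by (auto simp: gap_def)
  ultimately show False by (auto simp: gap_def)
qed

text \<open>
  If the pullbacks differ, pulling the larger one back at the source of the smaller predicate produces a
  predicate that forms a gap with the smaller one.
\<close>

lemma le_pull_eq:
  assumes "twoval p" "twoval p'" "p \<le> p'" "c \<in> C"
  shows "pull p c = pull p' c"
proof (rule ccontr)
  assume ne: "pull p c \<noteq> pull p' c"
  let ?q = "pull p c" and ?q' = "pull p' c" and ?d = "source p c"
  have le: "?q \<le> ?q'" "?d \<le> source p' c" using source_le[OF assms(1,2,4,4)] assms(3) by auto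
  have q: "sw.twoval ?q" "sw.twoval ?q'" "?d \<in> D" "source p' c \<in> D" using assms twoval_pull source(1) by auto
  let ?p = "sw.pull ?q' ?d"
  have p1: "p \<le> ?p \<and> c \<le> sw.source ?q' ?d"
    using sw.source_le[OF q(1,2,3,3)] source_inv[OF assms(1,4)] le by auto
  have "sw.source ?q' ?d \<le> c"
    using sw.source_le[OF q(2,2,3,4)] source_inv[OF assms(2,4)] le by auto
  then have c: "sw.source ?q' ?d = c" using p1 by auto
  have i: "pull ?p c = ?q'" "source ?p c = ?d" using sw.source_inv[OF q(2,3)] c by auto
  have "twoval ?p" by (rule sw.twoval_pull[OF q(2,3)])
  moreover have "p \<noteq> ?p" using i ne by metis
  then have "p < ?p" using p1 by (simp add: order.strict_iff_order)
  moreover have "\<exists>ca\<in>C. source p ca = source ?p ca" using i(2) assms(4) by metis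
  ultimately have "gap p ?p" unfolding gap_def using assms(1) by blast
  then show False using no_gap by auto
qed

text \<open>
  All pullbacks of \<open>p\<close> at once, so that connectedness applies to an equation of functions.
\<close>

definition pulls :: "('a \<Rightarrow> bool) \<Rightarrow> 'c \<Rightarrow> 'b \<Rightarrow> bool" where "pulls p = (\<lambda>c\<in>C. pull p c)"

lemma pulls_pull: "pulls p = pulls p' \<Longrightarrow> c \<in> C \<Longrightarrow> pull p c = pull p' c"
  unfolding pulls_def by (metis restrict_apply')

lemma pulls_le: "twoval p \<Longrightarrow> twoval p' \<Longrightarrow> p \<le> p' \<Longrightarrow> pulls p = pulls p'"
  unfolding pulls_def by (rule restrict_ext) (rule le_pull_eq)

end

context bounded_biexp
begin

lemma pulls_T:
  assumes p: "twoval p" and c: "c \<in> C" "c' \<in> C" and d: "d \<in> D" "d' \<in> D"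
  shows "pulls (sw.pull (pull p c) d) = pulls (sw.pull (pull p c') d')"
proof -
  have P: "twoval (sw.pull (pull p c) d)" if "c \<in> C" "d \<in> D" for c d using sw.twoval_pull[OF twoval_pull[OF p]] that by auto
  have up: "sw.pull (pull p c) d \<le> sw.pull (pull p c') d'" if "c \<in> C" "c' \<in> C" "d \<in> D" "d' \<in> D" "c \<le> c'" "d \<le> d'" for c c' d d'
  proof (intro le_funI le_boolI)
    fix a assume a: "sw.pull (pull p c) d a"
    then have A: "a \<in> A" "p (G c (F d a))" by (auto simp: sw.pull_def pull_def)
    have "G c (F d a) \<le> G c' (F d' a)"
      using order_trans[OF sw.F_mono[of "F d a" "F d' a" c] sw.F_mono2[of "F d' a" c c']] A(1) F_mono2[of a d d'] that by simp
    then show "sw.pull (pull p c') d' a" using twovalD(4)[OF p A(2)] A(1) that by (simp add: sw.pull_def pull_def)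
  qed
  have "pulls (sw.pull (pull p c) d) = pulls (sw.pull (pull p c') d)"
    by (rule conn_const[OF conC, of "\<lambda>c. pulls (sw.pull (pull p c) d)"]) (use c d up P pulls_le in auto)
  also have "\<dots> = pulls (sw.pull (pull p c') d')"
    by (rule conn_const[OF conD, of "\<lambda>d. pulls (sw.pull (pull p c') d)"]) (use c d up P pulls_le in auto)
  finally show ?thesis .
qed

lemma twoval_along: "twoval p \<Longrightarrow> W n w \<Longrightarrow> twoval (along p w)"
proof -
  assume a: "twoval p" "W n w"
  obtain m y where y: "XE m y" "p = (\<lambda>a. a \<in> A \<and> y a = tA)" using a by (auto simp: twoval_def)
  show ?thesis unfolding twoval_def
    by (intro exI[of _ "n + m"] exI[of _ "\<lambda>a. y (w a)"] conjI XE_comp a y)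
      (use W_in[OF a(2)] y(2) in \<open>auto simp: along_def fun_eq_iff\<close>)
qed

text \<open>
  Changing one letter of a word to a comparable one gives comparable predicates, whose pullbacks agree by
  \<open>le_pull_eq\<close>; connectedness of \<open>C\<close> and \<open>D\<close> extends this to arbitrary letters.
\<close>

lemma pulls_W: "W n w \<Longrightarrow> W n w' \<Longrightarrow> twoval p \<Longrightarrow> pulls (along p w) = pulls (along p w')"
proof (induction arbitrary: w' rule: W.induct)
  case W0
  have "w' = (\<lambda>a. a)" using W0(1) by cases auto
  then show ?case by simp
next
  case (WS n w c d)
  from WS.prems(1) obtain v c' d' where v: "w' = (\<lambda>a. v (T c' d' a))" "W n v" "c' \<in> C" "d' \<in> D" by cases auto
  have "pull (along p w) c = pull (along p v) c" by (rule pulls_pull[OF WS.IH[OF v(2) WS.prems(2)] WS(2)])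
  then show ?case
    using pulls_T[OF twoval_along[OF WS.prems(2) v(2)] WS(2) v(3) WS(3) v(4)] WS v by (simp add: along_T)
qed

text \<open>
  If \<open>x\<close> and \<open>y\<close> are retractions onto \<open>E\<close>, then \<open>x \<circ> y = y\<close> and \<open>y \<circ> x = x\<close>, and these two words have the same length.
\<close>

lemma pulls_eq:
  assumes "twoval p" "twoval p'" shows "pulls p = pulls p'"
proof -
  obtain n x where x: "XE n x" "p = (\<lambda>a. a \<in> A \<and> x a = tA)" using assms by (auto simp: twoval_def)
  obtain m y where y: "XE m y" "p' = (\<lambda>a. a \<in> A \<and> y a = tA)" using assms by (auto simp: twoval_def)
  have W: "W n x" "W m y" using x y by (auto simp: XE_def)
  have E: "x a \<in> E" "y a \<in> E" if "a \<in> A" for a using x y that by (auto simp: XE_def)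
  have "along p (\<lambda>a. x (y a)) = p'"
    using W_E[OF W(1)] E E_A by (auto simp: along_def x(2) y(2) fun_eq_iff)
  moreover have "along p (\<lambda>a. y (x a)) = p"
    using W_E[OF W(1)] W_E[OF W(2)] E E_A by (auto simp: along_def x(2) fun_eq_iff)
  moreover have "pulls (along p (\<lambda>a. x (y a))) = pulls (along p (\<lambda>a. y (x a)))"
    by (rule pulls_W[of "n + m", OF _ _ assms(1)]) (use W_comp[OF W(2,1)] W_comp[OF W(1,2)] in \<open>auto simp: add.commute\<close>)
  ultimately show ?thesis by simp
qed

text \<open>
  Otherwise one retraction sends \<open>G c b\<close> to the top and another one to the bottom, so that their
  pullbacks at \<open>c\<close> differ.
\<close>

lemma G_two:
  assumes "c \<in> C" "b \<in> B"
  shows "G c b \<in> {bA, tA}"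
proof (rule ccontr)
  assume "\<not> ?thesis"
  then have lt: "bA < G c b" "G c b < tA" using geA[of "G c b"] leA[of "G c b"] assms by (auto simp: order.strict_iff_order)
  have gA: "G c b \<in> A" using assms by simp
  from separate[OF bA gA lt(1)] obtain n x where x: "XE n x" "x bA < x (G c b)" by auto
  from separate[OF gA tA lt(2)] obtain m y where y: "XE m y" "y (G c b) < y tA" by auto
  let ?p = "\<lambda>a. a \<in> A \<and> x a = tA" and ?p' = "\<lambda>a. a \<in> A \<and> y a = tA"
  have P: "twoval ?p" "twoval ?p'" using x y by (auto simp: twoval_def)
  have "x (G c b) \<in> {bA, tA}" using x(1) gA by (intro subsetD[OF E2]) (simp add: XE_def)
  moreover have "x bA = bA" using x(1) W_E[OF _ bA_E] unfolding XE_def by blast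
  ultimately have "x (G c b) = tA" using x(2) by (metis insertE less_irrefl singletonD)
  moreover have "y (G c b) \<noteq> tA" using y W_E[OF _ tA_E] unfolding XE_def by (metis less_irrefl)
  moreover have "pull ?p c = pull ?p' c" by (rule pulls_pull[OF pulls_eq[OF P] assms(1)])
  then have "pull ?p c b = pull ?p' c b" by (rule fun_cong)
  ultimately show False using gA assms(2) by (simp add: pull_def)
qed

text \<open>
  As \<open>F d\<close> has only two values, it is a predicate, and it is two-valued in the sense above. Its sources
  are the coordinates \<open>Fsource d c\<close>.
\<close>

definition Fp :: "'d \<Rightarrow> 'a \<Rightarrow> bool" where "Fp d = (\<lambda>a. a \<in> A \<and> F d a = tB)"

definition Fsource :: "'d \<Rightarrow> 'c \<Rightarrow> 'd" where "Fsource d c = source (Fp d) c"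

end

context bounded_biexp
begin

lemma twoval_Fp:
  assumes "d \<in> D"
  shows "twoval (Fp d)"
proof -
  obtain c where c: "c \<in> C" using neC by auto
  have "T c d a \<in> E" if "a \<in> A" for a using G_two[OF c F_in[OF assms that]] bA_E tA_E
    by (metis T_def insertE singletonD)
  then have "XE 1 (T c d)" using W_T[OF c assms] by (simp add: XE_def)
  moreover have "Fp d = (\<lambda>a. a \<in> A \<and> T c d a = tA)"
  proof (rule ext)
    fix a show "Fp d a = (a \<in> A \<and> T c d a = tA)"
    proof (cases "a \<in> A \<and> F d a \<noteq> tB")
      case True
      then have g: "F d a = bB" using sw.G_two[OF assms, of a] by blast
      show ?thesis unfolding Fp_def T_def g using sw.F_bot[OF c] nontriv sw.nontriv by simp
    next
      case False
      then show ?thesis using c by (cases "a \<in> A") (simp_all add: Fp_def T_def)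
    qed
  qed
  ultimately show ?thesis unfolding twoval_def by blast
qed

lemma pull_Fp: "c \<in> C \<Longrightarrow> d \<in> D \<Longrightarrow> pull (Fp d) c = sw.Fp c"
proof (rule ext)
  fix b assume c: "c \<in> C" "d \<in> D"
  show "pull (Fp d) c b = sw.Fp c b"
  proof (cases "b \<in> B")
    case True
    show ?thesis
    proof (cases "G c b = tA")
      case False
      then have g: "G c b = bA" using G_two[OF c(1) True] by blast
      show ?thesis unfolding pull_def Fp_def sw.Fp_def g using c nontriv sw.nontriv by simp
    qed (use True c tA in \<open>simp add: pull_def Fp_def sw.Fp_def\<close>)
  qed (simp add: pull_def sw.Fp_def)
qed

lemma Fsource_in: "c \<in> C \<Longrightarrow> d \<in> D \<Longrightarrow> Fsource d c \<in> D"
  unfolding Fsource_def by (intro source twoval_Fp)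

lemma Fsource_le:
  assumes "c \<in> C" "d \<in> D" "c' \<in> C" "d' \<in> D"
  shows "sw.Fp c \<le> sw.Fp c' \<and> Fsource d c \<le> Fsource d' c' \<longleftrightarrow> Fp d \<le> Fp d' \<and> c \<le> c'"
  using source_le[OF twoval_Fp[OF assms(2)] twoval_Fp[OF assms(4)] assms(1,3)] assms by (simp add: pull_Fp Fsource_def)

end

context bounded_biexp
begin

lemma Fsource_Fp:
  assumes "c \<in> C" "d \<in> D"
  shows "Fp (Fsource d c) = Fp d"
proof -
  have "Fp d = sw.pull (pull (Fp d) c) (source (Fp d) c)"
    using source_inv(1)[OF twoval_Fp[OF assms(2)] assms(1)] by simp
  also have "\<dots> = Fp (Fsource d c)" using sw.pull_Fp[OF Fsource_in[OF assms] assms(1)] assms by (simp add: pull_Fp Fsource_def)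
  finally show ?thesis by simp
qed

end

context bounded_biexp
begin

lemma Fsource_inv: "c \<in> C \<Longrightarrow> d \<in> D \<Longrightarrow> sw.Fsource c (Fsource d c) = c"
  using source_inv(2)[OF twoval_Fp] by (simp add: Fsource_def sw.Fsource_def pull_Fp)

lemma Fsource_cong: "Fp d = Fp d' \<Longrightarrow> Fsource d c = Fsource d' c"
  by (simp add: Fsource_def)

lemma F_Fsource:
  assumes "c \<in> C" "d \<in> D" "f \<in> pw C A"
  shows "F d (f c) = tB \<longleftrightarrow> G c (phi f (Fsource d c)) = tA"
proof -
  have "f c \<in> A" "phi f (Fsource d c) \<in> B" using pwD assms Fsource_in phi_in by metis+
  then show ?thesis
    using source(2)[OF twoval_Fp[OF assms(2)] assms(1,3)] assms(1,2) unfolding Fsource_def[symmetric]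
    by (simp add: pull_Fp) (simp add: Fp_def sw.Fp_def)
qed

end

context bounded_biexp
begin

text \<open>
  The passage of pairs \<open>(Fp d, c) \<mapsto> (sw.Fp c, Fsource d c)\<close> and its inverse keep the predicate parts of \<open>D\<close>
  resp. \<open>C\<close> fixed. For a fixed \<open>c0\<close> this displays \<open>D\<close> as a product, which primality makes trivial.
\<close>

lemma product_D:
  assumes c0: "c0 \<in> C"
  shows "oisoon (\<lambda>d. (Fp d, sw.Fsource c0 d)) D (Fp ` D \<times> {c \<in> C. sw.Fp c = sw.Fp c0})"
proof (rule oisoI)
  fix d assume d: "d \<in> D"
  then show "(Fp d, sw.Fsource c0 d) \<in> Fp ` D \<times> {c \<in> C. sw.Fp c = sw.Fp c0}"
    using sw.Fsource_in[OF d c0] sw.Fsource_Fp[OF d c0] by auto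
  fix d' assume d': "d' \<in> D"
  show "d \<le> d' \<longleftrightarrow> (Fp d, sw.Fsource c0 d) \<le> (Fp d', sw.Fsource c0 d')"
    using sw.Fsource_le[OF d c0 d' c0] by auto
next
  fix t assume "t \<in> Fp ` D \<times> {c \<in> C. sw.Fp c = sw.Fp c0}"
  then obtain d c where t: "t = (Fp d, c)" "d \<in> D" "c \<in> C" "sw.Fp c = sw.Fp c0" by auto
  show "\<exists>x\<in>D. (Fp x, sw.Fsource c0 x) = t"
    using Fsource_Fp[OF t(3,2)] Fsource_inv[OF t(3,2)] sw.Fsource_cong[OF t(4)] Fsource_in[OF t(3,2)] t(1)
    by (intro bexI[of _ "Fsource d c"]) auto
qed

end

context bounded_biexp
begin

lemma Fp_same:
  assumes "\<And>d d'. d \<in> D \<Longrightarrow> d' \<in> D \<Longrightarrow> Fp d = Fp d'"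
  shows "A = {bA, tA}"
proof -
  have "A \<subseteq> E"
  proof
    fix a assume a: "a \<in> A"
    have "F d a = F d' a" if "d \<in> D" "d' \<in> D" for d d'
    proof -
      have "F d a = tB \<longleftrightarrow> F d' a = tB" using fun_cong[OF assms[OF that], of a] a by (simp add: Fp_def)
      then show ?thesis using sw.G_two[OF that(1) a] sw.G_two[OF that(2) a] by (metis insertE singletonD)
    qed
    then show "a \<in> E" using a unfolding E_def by blast
  qed
  then have "A \<subseteq> {bA, tA}" using E2 by (rule order_trans)
  then show ?thesis using bA tA by (intro equalityI) simp_all
qed

end

context bounded_biexp
begin

text \<open>
  In the product decomposition of \<open>D\<close> one factor is a point. If it is the set of predicates \<open>Fp d\<close>, all \<open>F d\<close>
  agree, everything is fixed, and the same decomposition of \<open>C\<close> turns \<open>Fsource\<close> into an isomorphism. If it is the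
  other factor, the source of \<open>Fp d\<close> at any \<open>c\<close> can only be \<open>d\<close> itself.
\<close>

lemma base_types:
  assumes pC: "prime C" and pD: "prime D"
  shows "(\<forall>d\<in>D. \<forall>c\<in>C. \<forall>f\<in>pw C A. F d (f c) = tB \<longleftrightarrow> G c (phi f d) = tA) \<or>
    (A = {bA, tA} \<and> B = {bB, tB} \<and>
      (\<exists>al. oisoon al C D \<and> (\<forall>f\<in>pw C A. \<forall>c\<in>C. phi f (al c) = tB \<longleftrightarrow> f c = tA)))"
proof (cases "card (Fp ` D) = 1")
  case True
  then have same: "Fp d = Fp d'" if "d \<in> D" "d' \<in> D" for d d'
    using that by (metis card_1_singletonE image_eqI singletonD)
  have A: "A = {bA, tA}" by (rule Fp_same[OF same])
  obtain d0 where d0: "d0 \<in> D" using neD by auto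
  have "{d \<in> D. Fp d = Fp d0} = D" using same[OF _ d0] by blast
  then have o: "oisoon (\<lambda>c. (sw.Fp c, Fsource d0 c)) C (sw.Fp ` C \<times> D)" using sw.product_D[OF d0] by simp
  have "card (sw.Fp ` C) = 1"
    using prime_prod[OF pC, of "sw.Fp ` C" D] o pD by (auto simp: oiso_def prime_def)
  then have sameC: "sw.Fp c = sw.Fp c'" if "c \<in> C" "c' \<in> C" for c c'
    using that by (metis card_1_singletonE image_eqI singletonD)
  have B: "B = {bB, tB}" by (rule sw.Fp_same[OF sameC])
  have "oisoon (Fsource d0) C D"
  proof (rule oisoI)
    fix t assume "t \<in> D"
    then show "\<exists>x\<in>C. Fsource d0 x = t" using oisoonD(3)[OF o, of "(sw.Fp (SOME c. c \<in> C), t)"] neC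
      by (auto simp: some_in_eq)
  next
    fix x y assume "x \<in> C" "y \<in> C"
    then show "x \<le> y \<longleftrightarrow> Fsource d0 x \<le> Fsource d0 y" using oisoonD(2)[OF o, of x y] sameC[of x y] by auto
  qed (use Fsource_in d0 in auto)
  moreover have "phi f (Fsource d0 c) = tB \<longleftrightarrow> f c = tA" if f: "f \<in> pw C A" and c: "c \<in> C" for f c
  proof -
    have 1: "f c = bA \<or> f c = tA" using pwD[OF f c] A by blast
    have 2: "phi f (Fsource d0 c) = bB \<or> phi f (Fsource d0 c) = tB" using pwD[OF phi_in[OF f] Fsource_in[OF c d0]] B by blast
    have "F d0 (f c) = tB \<longleftrightarrow> f c = tA" using 1 F_top[OF d0] F_bot[OF d0] nontriv sw.nontriv by metis
    moreover have "G c (phi f (Fsource d0 c)) = tA \<longleftrightarrow> phi f (Fsource d0 c) = tB"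
      using 2 sw.F_top[OF c] sw.F_bot[OF c] nontriv sw.nontriv by metis
    ultimately show ?thesis using F_Fsource[OF c d0 f] by blast
  qed
  ultimately show ?thesis using A B by blast
next
  case False
  obtain c0 where c0: "c0 \<in> C" using neC by auto
  have "card {c \<in> C. sw.Fp c = sw.Fp c0} = 1"
    using prime_prod[OF pD, of "Fp ` D" "{c \<in> C. sw.Fp c = sw.Fp c0}"] product_D[OF c0] False by (auto simp: oiso_def)
  then obtain z where z: "{c \<in> C. sw.Fp c = sw.Fp c0} = {z}" by (rule card_1_singletonE)
  have o: "oisoon (\<lambda>d. (Fp d, sw.Fsource c0 d)) D (Fp ` D \<times> {z})" using product_D[OF c0] z by simp
  have "Fsource d c = d" if "d \<in> D" "c \<in> C" for d c
  proof -
    have "sw.Fsource c0 d = z" "sw.Fsource c0 (Fsource d c) = z"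
      using oisoonD(1)[OF o that(1)] oisoonD(1)[OF o Fsource_in[OF that(2,1)]] by auto
    then show ?thesis using oisoonD(5)[OF o Fsource_in[OF that(2,1)] that(1)] Fsource_Fp[OF that(2,1)] by simp
  qed
  then show ?thesis using F_Fsource by metis
qed

end

section \<open>Covers of fixed elements\<close>

lemma covL: "cov S x y \<Longrightarrow> x \<in> S" "cov S x y \<Longrightarrow> y \<in> S" "cov S x y \<Longrightarrow> x < y" "cov S x y \<Longrightarrow> x \<le> y"
  by (simp_all add: cov_def less_imp_le)

lemma le_upd: "f c \<le> a \<Longrightarrow> f \<le> f(c := (a::_::order))"
  by (simp add: le_fun_def)
lemma upd_le: "f \<le> g \<Longrightarrow> a \<le> g c \<Longrightarrow> f(c := (a::_::order)) \<le> g"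
  by (simp add: le_fun_def)

lemma sum_le_eq:
  fixes f g :: "'x \<Rightarrow> nat"
  assumes "finite S" "\<And>x. x \<in> S \<Longrightarrow> f x \<le> g x" "sum g S \<le> sum f S" "x \<in> S"
  shows "f x = g x"
proof (rule ccontr)
  assume "f x \<noteq> g x"
  then have "f x < g x" using assms(2,4) by (simp add: le_neq_implies_less)
  then have "sum f S < sum g S" using assms by (intro sum_strict_mono_strong[of S x]) auto
  then show False using assms(3) by simp
qed

context biexp
begin

lemma ge_E: "s \<in> E \<Longrightarrow> f \<in> pw C A \<Longrightarrow> (\<forall>c\<in>C. s \<le> f c) \<longleftrightarrow> (\<forall>d\<in>D. j s \<le> phi f d)"
  using phi_le[of "cst C s" f] pw_le[of "cst C s" C A f A] pw_le[of "cst D (j s)" D B "phi f" B]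
  by (simp add: phi_E E_A j_B phi_in)

lemma le_E: "s \<in> E \<Longrightarrow> f \<in> pw C A \<Longrightarrow> (\<forall>c\<in>C. f c \<le> s) \<longleftrightarrow> (\<forall>d\<in>D. phi f d \<le> j s)"
  using phi_le[of f "cst C s"] pw_le[of f C A "cst C s" A] pw_le[of "phi f" D B "cst D (j s)" B]
  by (simp add: phi_E E_A j_B phi_in)

lemma pw_Collect: "f \<in> pw C {a \<in> A. P a} \<longleftrightarrow> f \<in> pw C A \<and> (\<forall>c\<in>C. P (f c))"
  by (auto simp: pw_def)

end

context biexp
begin

lemma top_biexp_below:
  assumes e: "e \<in> E"
  shows "top_biexp {a \<in> A. a \<le> e} {b \<in> B. b \<le> j e} C D phi psi e (j e)"
proof (intro top_biexp.intro top_biexp_axioms.intro restrict)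
  fix f assume "f \<in> pw C {a \<in> A. a \<le> e}"
  then have f: "f \<in> pw C A" "\<forall>c\<in>C. f c \<le> e" by (auto simp: pw_Collect)
  then show "phi f \<in> pw D {b \<in> B. b \<le> j e}" using le_E[OF e f(1)] phi_in[OF f(1)] by (simp add: sw.pw_Collect)
next
  fix k assume "k \<in> pw D {b \<in> B. b \<le> j e}"
  then have k: "k \<in> pw D B" "\<forall>d\<in>D. k d \<le> j e" by (auto simp: sw.pw_Collect)
  then show "psi k \<in> pw C {a \<in> A. a \<le> e}"
    using sw.le_E[OF jE_in[OF e] k(1)] psi_in[OF k(1)] by (simp add: pw_Collect swj_j[OF e])
qed (use e E_A j_B in auto)

lemma bounded_biexp_interval:
  assumes "cov E s s'"
  shows "bounded_biexp {a \<in> A. s \<le> a \<and> a \<le> s'} {b \<in> B. j s \<le> b \<and> b \<le> j s'} C D phi psi s' (j s') s (j s)"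
proof -
  have e: "s \<in> E" "s' \<in> E" "s < s'" using covD[OF assms] by auto
  have r: "biexp {a \<in> A. s \<le> a \<and> a \<le> s'} {b \<in> B. j s \<le> b \<and> b \<le> j s'} C D phi psi"
  proof (rule restrict)
    fix f assume "f \<in> pw C {a \<in> A. s \<le> a \<and> a \<le> s'}"
    then have f: "f \<in> pw C A" "\<forall>c\<in>C. s \<le> f c" "\<forall>c\<in>C. f c \<le> s'" by (auto simp: pw_Collect)
    then show "phi f \<in> pw D {b \<in> B. j s \<le> b \<and> b \<le> j s'}"
      using le_E[OF e(2) f(1)] ge_E[OF e(1) f(1)] phi_in[OF f(1)] by (simp add: sw.pw_Collect)
  next
    fix k assume "k \<in> pw D {b \<in> B. j s \<le> b \<and> b \<le> j s'}"
    then have k: "k \<in> pw D B" "\<forall>d\<in>D. j s \<le> k d" "\<forall>d\<in>D. k d \<le> j s'" by (auto simp: sw.pw_Collect)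
    then show "psi k \<in> pw C {a \<in> A. s \<le> a \<and> a \<le> s'}"
      using sw.le_E[OF jE_in[OF e(2)] k(1)] sw.ge_E[OF jE_in[OF e(1)] k(1)] psi_in[OF k(1)]
      by (simp add: pw_Collect swj_j[OF e(1)] swj_j[OF e(2)])
  qed auto
  have jle: "j s \<le> j s'" using j_le e by (simp add: less_imp_le)
  show ?thesis
  proof (intro bounded_biexp.intro top_biexp.intro r top_biexp_axioms.intro bounded_biexp_axioms.intro)
    show "biexp.E {a \<in> A. s \<le> a \<and> a \<le> s'} C D phi \<subseteq> {s, s'}"
    proof
      fix x assume "x \<in> biexp.E {a \<in> A. s \<le> a \<and> a \<le> s'} C D phi"
      then have "x \<in> E" "s \<le> x" "x \<le> s'" unfolding biexp.E_def[OF r] E_def mem_Collect_eq by blast+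
      then show "x \<in> {s, s'}" using cov_mid[OF assms] by blast
    qed
  qed (use e E_A j_B jle in \<open>auto simp: less_imp_le\<close>)
qed

text \<open>
  The first outcome of \<open>base_types\<close> for the interval between neighbours \<open>s\<close>, \<open>s'\<close> in \<open>E\<close>, in a form symmetric in the
  two sides: \<open>F d\<close> reads the coordinate \<open>d\<close>.
\<close>

definition full_edge :: "'a \<Rightarrow> 'a \<Rightarrow> bool" where
  "full_edge s s' \<longleftrightarrow> (\<forall>a\<in>A. s \<le> a \<longrightarrow> a \<le> s' \<longrightarrow> (\<forall>d\<in>D. F d a = j s \<or> F d a = j s')) \<and>
     (\<forall>b\<in>B. j s \<le> b \<longrightarrow> b \<le> j s' \<longrightarrow> (\<forall>c\<in>C. G c b = s \<or> G c b = s')) \<and>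
     (\<forall>f\<in>pw C A. (\<forall>c\<in>C. s \<le> f c \<and> f c \<le> s') \<longrightarrow>
       (\<forall>d\<in>D. \<forall>c\<in>C. F d (f c) = j s' \<longleftrightarrow> G c (phi f d) = s'))"

text \<open>
  The second outcome: nothing lies strictly between, and \<open>\<phi>\<close> renames coordinates along \<open>al\<close>.
\<close>

definition bare_edge :: "'a \<Rightarrow> 'a \<Rightarrow> ('c \<Rightarrow> 'd) \<Rightarrow> bool" where
  "bare_edge s s' al \<longleftrightarrow> (\<forall>a\<in>A. s \<le> a \<longrightarrow> a \<le> s' \<longrightarrow> a = s \<or> a = s') \<and>
     (\<forall>b\<in>B. j s \<le> b \<longrightarrow> b \<le> j s' \<longrightarrow> b = j s \<or> b = j s') \<and> oisoon al C D \<and>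
     (\<forall>f\<in>pw C A. (\<forall>c\<in>C. s \<le> f c \<and> f c \<le> s') \<longrightarrow> (\<forall>c\<in>C. phi f (al c) = j s' \<longleftrightarrow> f c = s'))"

lemma edge_types:
  assumes pC: "prime C" and pD: "prime D" and cv: "cov E s s'"
  shows "full_edge s s' \<or> (\<exists>al. bare_edge s s' al)"
proof -
  interpret r: bounded_biexp "{a \<in> A. s \<le> a \<and> a \<le> s'}" "{b \<in> B. j s \<le> b \<and> b \<le> j s'}" C D phi psi s' "j s'" s "j s"
    by (rule bounded_biexp_interval[OF cv])
  have F2: "F d a = j s \<or> F d a = j s'" if "a \<in> A" "s \<le> a" "a \<le> s'" "d \<in> D" for a d
    using r.sw.G_two[of d a] that by blast
  have G2: "G c b = s \<or> G c b = s'" if "b \<in> B" "j s \<le> b" "b \<le> j s'" "c \<in> C" for b c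
    using r.G_two[of c b] that by blast
  from r.base_types[OF pC pD] show ?thesis
  proof (elim disjE conjE exE)
    assume *: "\<forall>d\<in>D. \<forall>c\<in>C. \<forall>f\<in>pw C {a \<in> A. s \<le> a \<and> a \<le> s'}. F d (f c) = j s' \<longleftrightarrow> G c (phi f d) = s'"
    have "full_edge s s'" unfolding full_edge_def
    proof (intro conjI ballI impI)
      fix f d c assume f: "f \<in> pw C A" "\<forall>c\<in>C. s \<le> f c \<and> f c \<le> s'" "d \<in> D" "c \<in> C"
      then have "f \<in> pw C {a \<in> A. s \<le> a \<and> a \<le> s'}" unfolding pw_Collect by blast
      then show "F d (f c) = j s' \<longleftrightarrow> G c (phi f d) = s'" using * f(3,4) by blast
    qed (use F2 G2 in blast)+
    then show ?thesis ..
  next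
    fix al assume al: "{a \<in> A. s \<le> a \<and> a \<le> s'} = {s, s'}" "{b \<in> B. j s \<le> b \<and> b \<le> j s'} = {j s, j s'}"
      "oisoon al C D" "\<forall>f\<in>pw C {a \<in> A. s \<le> a \<and> a \<le> s'}. \<forall>c\<in>C. phi f (al c) = j s' \<longleftrightarrow> f c = s'"
    have "bare_edge s s' al" unfolding bare_edge_def
    proof (intro conjI ballI impI)
      fix f c assume f: "f \<in> pw C A" "\<forall>c\<in>C. s \<le> f c \<and> f c \<le> s'" "c \<in> C"
      then have "f \<in> pw C {a \<in> A. s \<le> a \<and> a \<le> s'}" unfolding pw_Collect by blast
      then show "phi f (al c) = j s' \<longleftrightarrow> f c = s'" using al(4) f(3) by blast
    qed (use al(1-3) in blast)+
    then show ?thesis by blast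
  qed
qed

end

context biexp
begin

lemma psi_between:
  assumes "s \<in> E" "s' \<in> E" "k \<in> pw D B" "\<forall>d\<in>D. j s \<le> k d \<and> k d \<le> j s'"
  shows "\<forall>c\<in>C. s \<le> psi k c \<and> psi k c \<le> s'"
  using sw.ge_E[OF jE_in[OF assms(1)] assms(3)] sw.le_E[OF jE_in[OF assms(2)] assms(3)] assms(4)
  by (simp add: swj_j[OF assms(1)] swj_j[OF assms(2)])

lemma bare_edge_swap:
  assumes "s \<in> E" "s' \<in> E" "bare_edge s s' al"
  shows "sw.bare_edge (j s) (j s') (the_inv_into C al)"
  unfolding sw.bare_edge_def swj_j[OF assms(1)] swj_j[OF assms(2)]
proof (intro conjI ballI impI)
  have o: "oisoon al C D" using assms(3) by (simp add: bare_edge_def)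
  show "oisoon (the_inv_into C al) D C" by (rule oisoon_inv[OF o])
  fix k d assume k: "k \<in> pw D B" "\<forall>d\<in>D. j s \<le> k d \<and> k d \<le> j s'" and d: "d \<in> D"
  have c: "the_inv_into C al d \<in> C" "al (the_inv_into C al d) = d"
    using oisoonD(4)[OF o] d by (auto simp: bij_betw_def the_inv_into_into f_the_inv_into_f)
  have "phi (psi k) (al (the_inv_into C al d)) = j s' \<longleftrightarrow> psi k (the_inv_into C al d) = s'"
    using assms(3) psi_in[OF k(1)] psi_between[OF assms(1,2) k] c(1) unfolding bare_edge_def by blast
  then show "psi k (the_inv_into C al d) = s' \<longleftrightarrow> k d = j s'" using phi_psi[OF k(1)] c(2) by simp
qed (use assms(3) in \<open>auto simp: bare_edge_def\<close>)

end

subsection \<open>Truncated closures\<close>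

text \<open>
  A relation between an operator of \<open>A\<close> and one of the elements below \<open>e\<close>. It is needed because filling with the
  top of \<open>B\<close> and filling with \<open>j e\<close> are different operations, and only the latter stays inside an interval.
\<close>

definition compat :: "'a::order set \<Rightarrow> 'a \<Rightarrow> ('a \<Rightarrow> 'a) \<Rightarrow> ('a \<Rightarrow> 'a) \<Rightarrow> bool" where
  "compat S e n n' \<longleftrightarrow> (\<forall>t\<in>S. \<forall>u\<in>S. t \<le> u \<longrightarrow> u \<le> e \<longrightarrow> u \<le> n t \<longrightarrow> u \<le> n' t)"

context top_biexp
begin

text \<open>
  Test the transported operators on the map that is \<open>t\<close> below \<open>d\<close> and \<open>j e\<close> elsewhere, and on the same map
  raised to \<open>u\<close> at \<open>d\<close>: both are bounded by \<open>e\<close>, so compatibility applies in each coordinate of \<open>A\<^sup>C\<close>.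
\<close>

lemma compat_F:
  assumes e: "e \<in> E" and n: "jclos A n" and n': "jclos {a \<in> A. a \<le> e} n'" and cp: "compat A e n n'" and d: "d \<in> D"
  shows "\<exists>m m'. jclos B m \<and> jclos {b \<in> B. b \<le> j e} m' \<and> compat B (j e) m m' \<and>
    (\<forall>a\<in>A. F d (n a) = m (F d a)) \<and> (\<forall>a\<in>A. a \<le> e \<longrightarrow> F d (n' a) = m' (F d a))"
proof -
  interpret r: top_biexp "{a \<in> A. a \<le> e}" "{b \<in> B. b \<le> j e}" C D phi psi e "j e" by (rule top_biexp_below[OF e])
  let ?M = "\<lambda>k. phi (lift n (psi k))" and ?M' = "\<lambda>k. phi (lift n' (psi k))"
  have jM: "jclos (pw D B) ?M" by (intro jclos_phi jclos_lift n)
  have jM': "jclos (pw D {b \<in> B. b \<le> j e}) ?M'" by (intro r.jclos_phi r.jclos_lift n')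
  have "compat B (j e) (sw.nu ?M d) (r.sw.nu ?M' d)"
    unfolding compat_def
  proof (intro ballI impI)
    fix t u assume tu: "t \<in> B" "u \<in> B" "t \<le> u" "u \<le> j e" "u \<le> sw.nu ?M d t"
    have t': "t \<le> j e" using tu order_trans by blast
    let ?k = "r.sw.cone d t"
    let ?g = "?k(d := u)"
    have kr: "?k \<in> pw D {b \<in> B. b \<le> j e}" "?g \<in> pw D {b \<in> B. b \<le> j e}"
      by (rule r.sw.cone_pw, use tu t' in blast, rule r.sw.cone_upd[OF d]) (use tu t' in blast)+
    have k: "?k \<in> pw D B" "?g \<in> pw D B" using kr(1)[unfolded sw.pw_Collect] kr(2)[unfolded sw.pw_Collect] by blast+
    have kd: "?k d = t" using r.sw.cone_self[OF d] .
    have kg: "?k \<le> ?g" by (rule le_upd) (simp only: kd tu(3))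
    have ud: "u \<le> ?M ?k d" using tu(5) by (simp only: sw.jclos_coord[OF jM k(1) d] kd)
    have "?g \<le> ?M ?k"
      by (rule upd_le[OF jclosD(2)[OF jM k(1)] ud])
    then have pg: "psi ?g \<le> lift n (psi ?k)"
      using psi_le_phi[OF _ k(2)] jclosD(1)[OF jclos_lift[OF n] psi_in[OF k(1)]] by simp
    have "psi ?g c \<le> lift n' (psi ?k) c" if c: "c \<in> C" for c
    proof -
      have "psi ?g c \<le> n (psi ?k c)" using le_funD[OF pg, of c] c by (simp add: lift_def)
      moreover have "psi ?k c \<le> psi ?g c" using psi_mono[OF k kg] by (simp add: le_funD)
      moreover have "psi ?g c \<le> e" "psi ?g c \<in> A" "psi ?k c \<in> A"
        using pwD[OF r.psi_in[OF kr(2)] c] pwD[OF r.psi_in[OF kr(1)] c] by auto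
      ultimately show ?thesis using cp c unfolding compat_def by (simp add: lift_def)
    qed
    then have "psi ?g \<le> lift n' (psi ?k)"
      using pw_le[OF r.psi_in[OF kr(2)] jclosD(1)[OF r.jclos_lift[OF n'] r.psi_in[OF kr(1)]]] by simp
    then have "?g \<le> ?M' ?k"
      using r.psi_le_phi[OF jclosD(1)[OF r.jclos_lift[OF n'] r.psi_in[OF kr(1)]] kr(2)] by simp
    from le_funD[OF this, of d] show "u \<le> r.sw.nu ?M' d t" by (simp add: r.sw.nu_def)
  qed
  moreover have "F d (n' a) = r.sw.nu ?M' d (F d a)" if "a \<in> A" "a \<le> e" for a
    using r.F_nu(2)[OF n' d] that by simp
  ultimately show ?thesis using F_nu[OF n d] r.F_nu(1)[OF n' d] by blast
qed

end

context top_biexp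
begin

lemma compat_W:
  assumes "W k w" "e \<in> E" "jclos A n" "jclos {a \<in> A. a \<le> e} n'" "compat A e n n'"
  shows "\<exists>m m'. compat A e m m' \<and>
    (\<forall>a\<in>A. w (n a) = m (w a)) \<and> (\<forall>a\<in>A. a \<le> e \<longrightarrow> w (n' a) = m' (w a))"
  using assms
proof (induction arbitrary: n n' rule: W.induct)
  case (WS k w c d)
  from compat_F[OF WS.prems WS(3)] obtain m m' where m: "jclos B m" "jclos {b \<in> B. b \<le> j e} m'"
    "compat B (j e) m m'" "\<And>a. a \<in> A \<Longrightarrow> F d (n a) = m (F d a)" "\<And>a. a \<in> A \<Longrightarrow> a \<le> e \<Longrightarrow> F d (n' a) = m' (F d a)"
    by blast
  note e = WS.prems(1)
  from sw.compat_F[OF jE_in[OF e] m(1-3) WS(2)] obtain p p' where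
    p: "jclos A p" "jclos {a \<in> A. a \<le> e} p'" "compat A e p p'"
    "\<And>b. b \<in> B \<Longrightarrow> G c (m b) = p (G c b)" "\<And>b. b \<in> B \<Longrightarrow> b \<le> j e \<Longrightarrow> G c (m' b) = p' (G c b)"
    unfolding swj_j[OF e] by blast
  have T: "T c d (n a) = p (T c d a)" if "a \<in> A" for a using that m(4) p(4) WS(3) by (simp add: T_def)
  have T': "T c d (n' a) = p' (T c d a)" "T c d a \<le> e" if "a \<in> A" "a \<le> e" for a
  proof -
    have "F d a \<le> j e" using F_mono[OF that(1) E_A[OF e] that(2), of d] F_j[OF e WS(3)] by simp
    then show "T c d (n' a) = p' (T c d a)" using that m(5) p(5) WS(3) by (simp add: T_def)
    show "T c d a \<le> e" using T_mono[OF WS(3) that(1) E_A[OF e] that(2), of c] T_E[OF WS(2,3) e] by simp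
  qed
  from WS.IH[OF e p(1-3)] obtain q q' where q: "compat A e q q'"
    "\<forall>a\<in>A. w (p a) = q (w a)" "\<forall>a\<in>A. a \<le> e \<longrightarrow> w (p' a) = q' (w a)" by blast
  show ?case
    by (intro exI[of _ q] exI[of _ q'] conjI) (use q T T' WS in auto)
qed auto

text \<open>
  Transported along \<open>z\<close>, the two filling operators remain compatible, so filling up to \<open>e\<close> already reaches \<open>e\<close>.
\<close>

lemma trunc_chi:
  assumes s: "s \<in> E" and e: "e \<in> E" and se: "s \<le> e" and z: "XE k z" and V: "upset D V" and c: "c \<in> C"
    and le: "e \<le> z (nuV V c s)"
  shows "e \<le> z (psi (\<lambda>d\<in>D. if d \<in> V then j e else j s) c)"
proof -
  interpret r: top_biexp "{a \<in> A. a \<le> e}" "{b \<in> B. b \<le> j e}" C D phi psi e "j e" by (rule top_biexp_below[OF e])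
  have "compat A e (nuV V c) (r.nuV V c)"
    unfolding compat_def
  proof (intro ballI impI)
    fix t u assume tu: "t \<in> A" "u \<in> A" "t \<le> u" "u \<le> e" "u \<le> nuV V c t"
    have t': "t \<le> e" using tu order_trans by blast
    let ?k = "r.cone c t"
    let ?g = "?k(c := u)"
    have kr: "?k \<in> pw C {a \<in> A. a \<le> e}" "?g \<in> pw C {a \<in> A. a \<le> e}"
      by (rule r.cone_pw, use tu t' in blast, rule r.cone_upd[OF c]) (use tu t' in blast)+
    have k: "?k \<in> pw C A" "?g \<in> pw C A" using kr(1)[unfolded pw_Collect] kr(2)[unfolded pw_Collect] by blast+
    have kc: "?k c = t" using r.cone_self[OF c] .
    have "?g \<le> nV V ?k"
      by (rule upd_le[OF jclosD(2)[OF jclos_nV[OF V] k(1)]]) (simp only: nV_coord[OF V k(1) c] kc tu(5))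
    then have "phi ?g \<le> phi (nV V ?k)" using phi_le[OF k(2) jclosD(1)[OF jclos_nV[OF V] k(1)]] by simp
    then have "phi ?g x \<le> phi ?k x" if "x \<in> D" "x \<notin> V" for x
      using that by (auto simp: phi_nV[OF V k(1)] le_fun_def dest: spec[of _ x])
    moreover have "phi ?g x \<le> j e" if "x \<in> D" for x using pwD[OF r.phi_in[OF kr(2)] that] by simp
    ultimately have "phi ?g \<le> phi (r.nV V ?k)"
      by (subst pw_le[OF r.phi_in[OF kr(2)] r.phi_in[OF jclosD(1)[OF r.jclos_nV[OF V] kr(1)]]])
        (simp add: r.phi_nV[OF V kr(1)])
    then have "?g \<le> r.nV V ?k" using r.phi_le[OF kr(2) jclosD(1)[OF r.jclos_nV[OF V] kr(1)]] by simp
    from le_funD[OF this, of c] show "u \<le> r.nuV V c t" by (simp add: r.nu_def)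
  qed
  moreover have W: "W k z" using z by (simp add: XE_def)
  ultimately obtain m m' where m: "compat A e m m'" "\<forall>a\<in>A. z (nuV V c a) = m (z a)"
    "\<forall>a\<in>A. a \<le> e \<longrightarrow> z (r.nuV V c a) = m' (z a)"
    using compat_W[OF W e jclos_nu[OF jclos_nV[OF V] c] r.jclos_nu[OF r.jclos_nV[OF V] c]] by blast
  have zs: "z s = s" using W_E[OF W s] .
  have "e \<le> m s" using le m(2) E_A[OF s] zs by simp
  then have "e \<le> m' s" using m(1) E_A s e se unfolding compat_def by blast
  also have "m' s = z (r.nuV V c s)" using m(3) E_A[OF s] se zs by simp
  also have "r.nuV V c s = r.nV V (cst C s) c"
    using r.nV_coord[OF V cst_pw c, of s] E_A[OF s] se c by simp
  also have "r.nV V (cst C s) = psi (\<lambda>d\<in>D. if d \<in> V then j e else j s)"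
    unfolding r.nV_def phi_E[OF s] by (rule arg_cong[of _ _ psi]) auto
  finally show ?thesis .
qed

lemma edge_chi:
  assumes s: "s \<in> E" and e: "e \<in> E" and se: "s < e" and V: "upset D V" and c: "c \<in> C" and d: "d \<in> D" and c1: "c1 \<in> C"
    and le: "e \<le> x (T c1 d (psi (\<lambda>d\<in>D. if d \<in> V then j e else j s) c))" and x: "XE k x"
  shows "full_edge s e \<Longrightarrow> d \<in> V" "bare_edge s e al \<Longrightarrow> al c \<in> V"
proof -
  let ?k = "\<lambda>d\<in>D. if d \<in> V then j e else j s"
  have jle: "j s \<le> j e" using j_le[OF s e] se by simp
  have k: "?k \<in> pw D B" by (rule pwI) (use V jle s e j_B in \<open>auto simp: upset_def\<close>)
  have b: "\<forall>c\<in>C. s \<le> psi ?k c \<and> psi ?k c \<le> e" by (rule psi_between[OF s e k]) (use jle in auto)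
  have a: "psi ?k c \<in> A" "s \<le> psi ?k c" "psi ?k c \<le> e" using b c pwD[OF psi_in[OF k] c] by auto
  have W: "W k x" using x by (simp add: XE_def)
  have no: "\<not> e \<le> x s" using W_E[OF W s] se by simp
  have jne: "j s \<noteq> j e" using j_inj[OF s e] se by simp
  show "d \<in> V" if t: "full_edge s e"
  proof (rule ccontr)
    assume nV: "d \<notin> V"
    have "F d (psi ?k c) = j e \<longleftrightarrow> G c (phi (psi ?k) d) = e"
      using t psi_in[OF k] b c d unfolding full_edge_def by blast
    also have "phi (psi ?k) d = j s" using phi_psi[OF k] nV d by simp
    finally have "F d (psi ?k c) \<noteq> j e" using G_j[OF s c] less_imp_neq[OF se] by metis
    then have "F d (psi ?k c) = j s" using t a d unfolding full_edge_def by blast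
    then have "T c1 d (psi ?k c) = s" using G_j[OF s c1] by (simp add: T_def)
    then show False using le no by simp
  qed
  show "al c \<in> V" if t: "bare_edge s e al"
  proof (rule ccontr)
    assume nV: "al c \<notin> V"
    have o: "al c \<in> D" using t c by (auto simp: bare_edge_def dest: oisoonD(1))
    have "phi (psi ?k) (al c) = j e \<longleftrightarrow> psi ?k c = e"
      using t psi_in[OF k] b c unfolding bare_edge_def by blast
    then have "psi ?k c \<noteq> e" using phi_psi[OF k] nV o jne by simp
    then have "psi ?k c = s" using t a unfolding bare_edge_def by blast
    then show False using le no T_E[OF c1 d s] by simp
  qed
qed

text \<open>
  Filling the upset of the label absorbs the cover. A retraction that separates the cover at the pair
  \<open>s < e\<close> therefore sends the filled element to something above \<open>e\<close>, and by \<open>trunc_chi\<close> the indicator map of this upset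
  is sent to \<open>e\<close> at \<open>c\<close>. The type of the interval tells for which upsets this happens.
\<close>

lemma label_bound:
  assumes cv: "cov A a' a" and x: "XE k x" and c1: "c1 \<in> C" and d: "d \<in> D"
    and s: "s \<in> E" and e: "e \<in> E" and se: "s < e"
    and lo: "x (T c1 d a') \<le> s" and hi: "e \<le> x (T c1 d a)" and c: "c \<in> C"
  shows "full_edge s e \<Longrightarrow> lab a' a c \<le> d" "bare_edge s e al \<Longrightarrow> lab a' a c \<le> al c"
proof -
  let ?V = "{y \<in> D. lab a' a c \<le> y}" and ?z = "\<lambda>a. x (T c1 d a)"
  note l = lab_nuV[OF cv c]
  have V: "upset D ?V" using upset_up[OF l(1)] .
  have a: "a' \<in> A" "a \<in> A" using covD[OF cv] by auto
  have z: "XE (Suc 0 + k) ?z" by (rule XE_comp[OF W_T[OF c1 d] x])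
  have W: "W (Suc 0 + k) ?z" using z by (simp add: XE_def)
  have jc: "jclos A (nuV ?V c)" by (rule jclos_nu[OF jclos_nV[OF V] c])
  have "a \<le> nuV ?V c a'" using l(2)[OF V] l(1) by auto
  then have "?z a \<le> ?z (nuV ?V c a')" using W_mono[OF W a(2) jclosD(1)[OF jc a(1)]] by simp
  also have "\<dots> = ?z (nuV ?V c (?z a'))" by (rule XE_nat[OF z jc a(1)])
  also have "\<dots> \<le> ?z (nuV ?V c s)"
    using lo a s c1 d W_in[OF W] E_A jclosD[OF jc] by (intro W_mono[OF W]) auto
  finally have "e \<le> ?z (nuV ?V c s)" using hi by simp
  from trunc_chi[OF s e _ z V c this] se
  have chi: "e \<le> x (T c1 d (psi (\<lambda>d\<in>D. if d \<in> ?V then j e else j s) c))" by simp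
  show "lab a' a c \<le> d" if "full_edge s e" using edge_chi(1)[OF s e se V c d c1 chi x that] by simp
  show "lab a' a c \<le> al c" if "bare_edge s e al" using edge_chi(2)[OF s e se V c d c1 chi x that] by simp
qed

subsection \<open>Counting labels\<close>

text \<open>
  The maps between two constant ones; adding elements to \<open>U\<close> one at a time walks from the constant map \<open>a'\<close> to \<open>a\<close>.
\<close>

definition step :: "'a \<Rightarrow> 'a \<Rightarrow> 'c set \<Rightarrow> 'c \<Rightarrow> 'a" where
  "step a' a U = (\<lambda>x\<in>C. if x \<in> U then a else a')"

lemma step_pw: "a' \<in> A \<Longrightarrow> a \<in> A \<Longrightarrow> a' \<le> a \<Longrightarrow> upset C U \<Longrightarrow> step a' a U \<in> pw C A"
  by (rule pwI) (auto simp: step_def upset_def)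

lemma step_ins: "c \<in> C \<Longrightarrow> c \<notin> U \<Longrightarrow> (step a' a U)(c := a) = step a' a (insert c U)"
  by (auto simp: step_def fun_eq_iff)

lemma step_mono: "a' \<le> a \<Longrightarrow> U \<subseteq> U' \<Longrightarrow> step a' a U \<le> step a' a U'"
  by (auto simp: step_def le_fun_def)

lemma step_empty: "step a' a {} = cst C a'" by (simp add: step_def cst_def)
lemma step_full: "step a' a C = cst C a" by (auto simp: step_def cst_def)

lemma step_cov:
  assumes cv: "cov A a' a" and c: "c \<in> C" "c \<notin> U" "upset C U" "upset C (insert c U)"
  defines "k \<equiv> phi (step a' a U)" and "k' \<equiv> phi (step a' a (insert c U))"
  shows "k' = k(lab a' a c := k' (lab a' a c))" "cov B (k (lab a' a c)) (k' (lab a' a c))"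
    "sw.lab (k (lab a' a c)) (k' (lab a' a c)) (lab a' a c) = c"
proof -
  have a: "a' \<in> A" "a \<in> A" "a' \<le> a" using covD[OF cv] by auto
  let ?f = "step a' a U"
  have f: "?f \<in> pw C A" "?f(c := a) \<in> pw C A" "?f c = a'"
    using step_pw[OF a c(3)] step_pw[OF a c(4)] step_ins[OF c(1,2)] c by (simp, simp, simp add: step_def)
  have cv': "cov A (?f c) a" using cv f(3) by simp
  show "k' = k(lab a' a c := k' (lab a' a c))" "cov B (k (lab a' a c)) (k' (lab a' a c))"
    "sw.lab (k (lab a' a c)) (k' (lab a' a c)) (lab a' a c) = c"
    using lab_cov[OF f(1,2) cv'] lab_back[OF f(1,2) cv'] f(3) step_ins[OF c(1,2)]
    by (simp_all add: k_def k'_def)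
qed

lemma step_between:
  assumes cv: "cov A a' a" and U: "upset C U"
  shows "F d a' \<le> phi (step a' a U) d" "phi (step a' a U) d \<le> F d a"
proof -
  have a: "a' \<in> A" "a \<in> A" "a' \<le> a" using covD[OF cv] by auto
  have e: "upset C {}" "upset C C" "U \<subseteq> C" using U by (auto simp: upset_def)
  show "F d a' \<le> phi (step a' a U) d" 
    using phi_mono[OF step_pw[OF a e(1)] step_pw[OF a U] step_mono[OF a(3)]] by (simp add: F_def step_empty le_funD)
  show "phi (step a' a U) d \<le> F d a" 
    using phi_mono[OF step_pw[OF a U] step_pw[OF a e(2)] step_mono[OF a(3) e(3)]] by (simp add: F_def step_full le_funD)
qed

lemma count_le:
  assumes cv: "cov A a' a" and d: "d \<in> D" and U: "upset C U"
  shows "card {c \<in> U. lab a' a c = d} \<le> len B (F d a') (phi (step a' a U) d)"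
  using U
proof (induction "card U" arbitrary: U)
  case 0
  then have "U = {}" using finC finite_subset[of U C] by (simp add: upset_def)
  then show ?case by simp
next
  case (Suc n)
  have a: "a' \<in> A" "a \<in> A" "a' \<le> a" using covD[OF cv] by auto
  have fU: "finite U" "U \<noteq> {}" using Suc(2) card_eq_0_iff[of U] by auto
  then obtain c where c: "c \<in> U" "\<And>y. y \<in> U \<Longrightarrow> \<not> y < c" using ex_minimal[of U] by blast
  let ?U = "U - {c}"
  have cC: "c \<in> C" using Suc(3) c by (auto simp: upset_def)
  have U': "upset C ?U" using Suc(3) c by (auto simp: upset_def order.strict_iff_order)
  have ins: "insert c ?U = U" using c(1) by auto
  have IH: "card {x \<in> ?U. lab a' a x = d} \<le> len B (F d a') (phi (step a' a ?U) d)"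
    using Suc(1)[OF _ U'] Suc(2) c(1) fU by simp
  note st = step_cov[OF cv cC _ U', unfolded ins, OF _ Suc(3)]
  show ?case
  proof (cases "lab a' a c = d")
    case True
    have "{x \<in> U. lab a' a x = d} = insert c {x \<in> ?U. lab a' a x = d}" using True c by auto
    then have "card {x \<in> U. lab a' a x = d} = Suc (card {x \<in> ?U. lab a' a x = d})"
      using fU(1) by simp
    also have "\<dots> \<le> len B (F d a') (phi (step a' a ?U) d) + len B (phi (step a' a ?U) d) (phi (step a' a U) d)"
      using IH len_cov[OF finB st(2)] True by simp
    also have "\<dots> \<le> len B (F d a') (phi (step a' a U) d)"
      by (rule len_add[OF finB]) (use a d step_between[OF cv U'] st(2) covD[OF st(2)] True in \<open>auto simp: less_imp_le\<close>)
    finally show ?thesis .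
  next
    case False
    then have "phi (step a' a U) d = phi (step a' a ?U) d" using fun_cong[OF st(1), of d] by simp
    moreover have "{x \<in> U. lab a' a x = d} = {x \<in> ?U. lab a' a x = d}" using False by auto
    ultimately show ?thesis using IH by simp
  qed
qed

text \<open>
  Walking from the constant map \<open>a'\<close> to \<open>a\<close>, each \<open>c\<close> contributes one step to the coordinate given by its label. This bounds each
  length from below, and the lengths add up to \<open>card C\<close>.
\<close>

lemma label_count:
  assumes cv: "cov A a' a" and d: "d \<in> D"
  shows "len B (F d a') (F d a) = card {c \<in> C. lab a' a c = d}"
proof -
  have a: "a' \<in> A" "a \<in> A" "a' \<le> a" using covD[OF cv] by auto
  have "upset C C" by (simp add: upset_def)
  then have le: "card {c \<in> C. lab a' a c = d} \<le> len B (F d a') (F d a)" if "d \<in> D" for d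
    using count_le[OF cv that, of C] a by (simp add: step_full F_def)
  have "(\<Sum>d\<in>D. len B (F d a') (F d a)) = card C" using F_sum[OF a] len_cov[OF finA cv] by simp
  also have "\<dots> = (\<Sum>d\<in>D. card {c \<in> C. lab a' a c = d})"
    using sum_fun_comp[OF finC finD, of "lab a' a" "\<lambda>_. 1::nat"] lab_nuV(1)[OF cv] by auto
  finally show ?thesis using sum_le_eq[of D "\<lambda>d. card {c \<in> C. lab a' a c = d}" "\<lambda>d. len B (F d a') (F d a)" d, OF finD le _ d] by simp
qed

lemma F_eq_iff_label:
  assumes cv: "cov A a' a" and d: "d \<in> D"
  shows "F d a' < F d a \<longleftrightarrow> (\<exists>c\<in>C. lab a' a c = d)"
proof -
  have a: "a' \<in> A" "a \<in> A" "a' \<le> a" using covD[OF cv] by auto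
  have "F d a' < F d a \<longleftrightarrow> 1 \<le> len B (F d a') (F d a)"
  proof
    assume "F d a' < F d a" then show "1 \<le> len B (F d a') (F d a)" using len_pos[OF finB] a d by simp
  next
    assume "1 \<le> len B (F d a') (F d a)"
    then have "F d a' \<noteq> F d a" using finB a d by auto
    then show "F d a' < F d a" using F_mono[OF a] by (simp add: order.strict_iff_order)
  qed
  also have "\<dots> \<longleftrightarrow> {c \<in> C. lab a' a c = d} \<noteq> {}"
    unfolding label_count[OF cv d] using finC by (simp add: Suc_le_eq card_gt_0_iff)
  finally show ?thesis by auto
qed

subsection \<open>Squares\<close>

text \<open>
  Opposite sides of a square have the same labels.
\<close>

lemma square_lab:
  assumes "cov A a s" "cov A a s'" "cov A s r" "cov A s' r" "s \<noteq> s'" "c \<in> C"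
  shows "lab s' r c = lab a s c"
proof (rule ccontr)
  assume ne: "lab s' r c \<noteq> lab a s c"
  have i: "a \<in> A" "s \<in> A" "s' \<in> A" "r \<in> A" "a \<le> s" "a \<le> s'" "s < r" "s' < r" "a \<le> r"
    using covL[OF assms(1)] covL[OF assms(2)] covL[OF assms(3)] covL[OF assms(4)] by (auto intro: order_trans)
  let ?f = "cone c a"
  have fp: "?f \<in> pw C A" "?f(c := s) \<in> pw C A" "?f(c := s') \<in> pw C A" "?f(c := r) \<in> pw C A" "?f c = a"
    using cone_pw cone_upd[OF assms(6)] cone_self[OF assms(6)] i by (auto intro: order_trans less_imp_le)
  note l1 = lab_cov[of ?f c s, unfolded fp(5), OF fp(1,2) assms(1)]
  note l2 = lab_cov[of ?f c s', unfolded fp(5), OF fp(1,3) assms(2)]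
  note l4 = lab_cov[of "?f(c := s')" c r, simplified, OF fp(3,4) assms(4)]
  have m: "phi (?f(c := s)) \<le> phi (?f(c := r))" using i by (intro phi_mono fp) (auto simp: le_fun_def less_imp_le)
  let ?l = "lab a s c"
  have "phi ?f ?l < phi (?f(c := s)) ?l" using covD[OF l1(2)] by simp
  also have le: "\<dots> \<le> phi (?f(c := r)) ?l" using m by (simp add: le_funD)
  also have e: "phi (?f(c := r)) ?l = phi (?f(c := s')) ?l" using fun_cong[OF l4(1), of ?l] ne by simp
  finally have lt: "phi ?f ?l < phi (?f(c := s')) ?l" .
  then have l2e: "lab a s' c = ?l" using fun_cong[OF l2(1), of ?l] by (metis fun_upd_other less_irrefl)
  have "phi (?f(c := s)) ?l = phi (?f(c := s')) ?l"
    using cov_mid[OF l2(2)[unfolded l2e], of "phi (?f(c := s)) ?l"] covL[OF l1(2)] le e by (metis less_irrefl)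
  then have "phi (?f(c := s)) = phi (?f(c := s'))" using l1(1) l2(1)[unfolded l2e] by metis
  then have "?f(c := s) = ?f(c := s')" using phi_inj[OF fp(2,3)] by simp
  then have "s = s'" by (metis fun_upd_same)
  then show False using assms(5) by simp
qed

text \<open>
  Two covers of \<open>a\<close> that change different coordinates of \<open>B\<^sup>D\<close> can be performed together there, and the result, seen in \<open>A\<^sup>C\<close>, can only
  differ in the coordinate \<open>c\<close>.
\<close>

lemma upper_square:
  assumes "cov A a s" "cov A a s'" "c \<in> C" "lab a s c \<noteq> lab a s' c"
  shows "\<exists>r. cov A s r \<and> cov A s' r"
proof -
  have i: "a \<in> A" "s \<in> A" "s' \<in> A" "a \<le> s" "a \<le> s'" using covL[OF assms(1)] covL[OF assms(2)] by auto
  let ?f = "cone c a"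
  have fp: "?f \<in> pw C A" "?f(c := s) \<in> pw C A" "?f(c := s') \<in> pw C A" "?f c = a"
    using cone_pw cone_upd[OF assms(3)] cone_self[OF assms(3)] i by auto
  let ?l = "lab a s c" and ?l' = "lab a s' c"
  note l1 = lab_cov[of ?f c s, unfolded fp(4), OF fp(1,2) assms(1)]
  note l2 = lab_cov[of ?f c s', unfolded fp(4), OF fp(1,3) assms(2)]
  let ?k = "phi (?f(c := s))" and ?k' = "phi (?f(c := s'))"
  have k: "?k \<in> pw D B" "?k' \<in> pw D B" using phi_in fp by auto
  have o: "?k x = phi ?f x" if "x \<noteq> ?l" for x using fun_cong[OF l1(1), of x] that by simp
  have o': "?k' x = phi ?f x" if "x \<noteq> ?l'" for x using fun_cong[OF l2(1), of x] that by simp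
  let ?h = "?k(?l' := ?k' ?l')"
  have h': "?h = ?k'(?l := ?k ?l)" using o o' assms(4) by (auto simp: fun_eq_iff)
  have up: "?k \<le> ?h" "?k' \<le> ?h"
  proof -
    have "?k ?l' \<le> ?k' ?l'" using o[of ?l'] covD[OF l2(2)] assms(4) by (simp add: less_imp_le)
    then show "?k \<le> ?h" by (auto simp: le_fun_def)
    have "?k' ?l \<le> ?k ?l" using o'[of ?l] covD[OF l1(2)] assms(4) by (simp add: less_imp_le)
    then show "?k' \<le> ?h" unfolding h' by (auto simp: le_fun_def)
  qed
  have D: "?l \<in> D" "?l' \<in> D" using lab_nuV(1) assms by auto
  have h: "?h \<in> pw D B"
  proof (rule pwI)
    fix x y assume xy: "x \<in> D" "y \<in> D" "x \<le> y"
    have "?h x = ?k x \<or> ?h x = ?k' x" by auto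
    moreover have "?k x \<le> ?h y" "?k' x \<le> ?h y"
      using order_trans[OF pwM[OF k(1) xy] le_funD[OF up(1)]] order_trans[OF pwM[OF k(2) xy] le_funD[OF up(2)]] by auto
    ultimately show "?h x \<le> ?h y" by metis
  qed (use pwD[OF k(1)] pwD[OF k(2)] pw_undef[OF k(1)] D in auto)
  have c1: "cov (pw C A) (?f(c := s)) (psi ?h)"
    using sw.phi_cov[OF pw_cov_upd[OF k(1) h]] o[of ?l'] l2(2) assms(4) psi_phi[OF fp(2)] by simp
  have c2: "cov (pw C A) (?f(c := s')) (psi ?h)"
    using sw.phi_cov[OF pw_cov_upd[OF k(2), of ?l "?k ?l"]] o'[of ?l] l1(2) assms(4) psi_phi[OF fp(3)] h h' by simp
  have ns: "\<not> s' \<le> s" "\<not> s \<le> s'"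
    using cov_mid[OF assms(1) i(3) i(5)] cov_mid[OF assms(2) i(2) i(4)] assms covD[OF assms(1)] covD[OF assms(2)]
    by (auto simp: less_le)
  have "cov A s (psi ?h c)"
  proof -
    from pw_cov[OF finC c1] obtain x where x: "psi ?h = (?f(c := s))(x := psi ?h x)" "cov A ((?f(c := s)) x) (psi ?h x)" by auto
    have "s' \<le> psi ?h c" using covD[OF c2] by (metis fun_upd_same le_funD less_imp_le)
    then have "x = c" using fun_cong[OF x(1), of c] ns by (metis fun_upd_other fun_upd_same)
    then show ?thesis using x(2) by simp
  qed
  moreover have "cov A s' (psi ?h c)"
  proof -
    from pw_cov[OF finC c2] obtain x where x: "psi ?h = (?f(c := s'))(x := psi ?h x)" "cov A ((?f(c := s')) x) (psi ?h x)" by auto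
    have "s \<le> psi ?h c" using covD[OF c1] by (metis fun_upd_same le_funD less_imp_le)
    then have "x = c" using fun_cong[OF x(1), of c] ns by (metis fun_upd_other fun_upd_same)
    then show ?thesis using x(2) by simp
  qed
  ultimately show ?thesis by blast
qed

text \<open>
  Two successive changes of \<open>B\<^sup>D\<close> can be performed in the other order when the second coordinate is not
  below the first.
\<close>

lemma chain_square:
  assumes "cov A a s" "cov A s r" "c \<in> C" "\<not> lab s r c \<le> lab a s c"
  shows "\<exists>s'. s' \<noteq> s \<and> cov A a s' \<and> cov A s' r \<and> lab a s' c = lab s r c"
proof -
  have i: "a \<in> A" "s \<in> A" "r \<in> A" "a \<le> s" "s \<le> r" "a \<le> r"
    using covL[OF assms(1)] covL[OF assms(2)] by (auto intro: order_trans)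
  let ?f = "cone c a"
  have fp: "?f \<in> pw C A" "?f(c := s) \<in> pw C A" "?f(c := r) \<in> pw C A" "?f c = a"
    using cone_pw cone_upd[OF assms(3)] cone_self[OF assms(3)] i by auto
  let ?l = "lab a s c" and ?l' = "lab s r c"
  note l1 = lab_cov[of ?f c s, unfolded fp(4), OF fp(1,2) assms(1)]
  note l2 = lab_cov[of "?f(c := s)" c r, simplified, OF fp(2,3) assms(2)]
  have ne: "?l \<noteq> ?l'" using assms(4) by auto
  let ?k = "phi ?f" and ?g = "phi (?f(c := s))" and ?r = "phi (?f(c := r))"
  have k: "?k \<in> pw D B" "?r \<in> pw D B" using phi_in fp by auto
  have D: "?l \<in> D" "?l' \<in> D" using lab_nuV(1) assms by auto
  have o: "?g x = ?k x" if "x \<noteq> ?l" for x using fun_cong[OF l1(1), of x] that by simp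
  have o': "?r x = ?g x" if "x \<noteq> ?l'" for x using fun_cong[OF l2(1), of x] that by simp
  have cv': "cov B (?k ?l') (?r ?l')" using l2(2) o[of ?l'] ne by simp
  let ?h = "?k(?l' := ?r ?l')"
  have h: "?h \<in> pw D B"
  proof (rule pw_upd[OF k(1) D(2)])
    fix x assume x: "x \<in> D" "x < ?l'"
    have "?k x \<le> ?k ?l'" using pwM[OF k(1) x(1) D(2)] x by simp
    then show "?k x \<le> ?r ?l'" using covD[OF cv'] by (metis less_imp_le order_trans)
  next
    fix x assume x: "x \<in> D" "?l' < x"
    then have "x \<noteq> ?l" "x \<noteq> ?l'" using assms(4) by auto
    then show "?r ?l' \<le> ?k x" using pwM[OF k(2) D(2) x(1)] x o o' by simp
  qed (use pwD[OF k(2) D(2)] in auto)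
  have hr: "?r = ?h(?l := ?g ?l)"
    using o o' ne by (auto simp: fun_eq_iff)
  have c1: "cov (pw D B) ?k ?h" using pw_cov_upd[OF k(1) h] cv' by simp
  have c2: "cov (pw D B) ?h ?r"
    using pw_cov_upd[OF h, of ?l "?g ?l"] hr k(2) l1(2) ne by simp
  have p1: "cov (pw C A) ?f (psi ?h)" using sw.phi_cov[OF c1] psi_phi[OF fp(1)] by simp
  have p2: "cov (pw C A) (psi ?h) (?f(c := r))" using sw.phi_cov[OF c2] psi_phi[OF fp(3)] by simp
  let ?s = "psi ?h c"
  have bt: "?f x \<le> psi ?h x" "psi ?h x \<le> (?f(c := r)) x" for x
    by (fact le_funD[OF covL(4)[OF p1]], fact le_funD[OF covL(4)[OF p2]])
  have pe: "psi ?h = ?f(c := ?s)" 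
  proof (rule ext)
    fix x show "psi ?h x = (?f(c := ?s)) x" using bt[of x] by (cases "x = c") auto
  qed
  have a1: "cov A a ?s"
  proof -
    from pw_cov[OF finC p1] obtain x where x: "cov A (?f x) (psi ?h x)" by auto
    then have "x = c" using fun_cong[OF pe, of x] covD[OF x] by (cases "x = c") auto
    then show ?thesis using x fp(4) by simp
  qed
  have a2: "cov A ?s r"
  proof -
    from pw_cov[OF finC p2] obtain x where x: "cov A (psi ?h x) ((?f(c := r)) x)" by auto
    then have "x = c" using fun_cong[OF pe, of x] covD[OF x] by (cases "x = c") auto
    then show ?thesis using x by simp
  qed
  have ps: "?f(c := ?s) \<in> pw C A" using pe psi_in[OF h] by simp
  note l3 = lab_cov[of ?f c ?s, unfolded fp(4), OF fp(1) ps a1]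
  have "phi (?f(c := ?s)) = ?h" using pe phi_psi[OF h] by simp
  then have le: "lab a ?s c = ?l'" using l3(2) l3(1) cv' covD by (metis fun_upd_other less_irrefl)
  then have "?s \<noteq> s" using ne by auto
  then show ?thesis using a1 a2 le by blast
qed

text \<open>
  The dual of \<open>upper_square\<close>. For minimal \<open>c\<close> the greatest map with value \<open>w\<close> at \<open>c\<close> differs from the one with value \<open>p\<close>
  in that coordinate only, which replaces the missing bottom of \<open>A\<close>.
\<close>

lemma lower_square:
  assumes "cov A w p" "cov A v p" "c \<in> C" "\<And>x. x \<in> C \<Longrightarrow> \<not> x < c" "lab w p c \<noteq> lab v p c"
  shows "\<exists>u. cov A u w \<and> cov A u v"
proof -
  have i: "p \<in> A" "w \<in> A" "v \<in> A" "w \<le> p" "v \<le> p" using covL[OF assms(1)] covL[OF assms(2)] by auto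
  let ?f = "cone c p"
  have cu: "?f(c := y) = cone c y" for y using assms(3,4) by (auto simp: cone_def fun_eq_iff order.strict_iff_order)
  have fp: "cone c y \<in> pw C A" "cone c y c = y" "(cone c y)(c := p) = cone c p" if "y \<in> A" for y
    using cone_pw[OF that] cone_self[OF assms(3)] cu[of p] assms(3,4) by (auto simp: cone_def fun_eq_iff order.strict_iff_order)
  let ?l = "lab w p c" and ?l' = "lab v p c"
  note l1 = lab_cov[of "cone c w" c p, unfolded fp(2)[OF i(2)] fp(3)[OF i(2)], OF fp(1)[OF i(2)] fp(1)[OF i(1)] assms(1)]
  note l2 = lab_cov[of "cone c v" c p, unfolded fp(2)[OF i(3)] fp(3)[OF i(3)], OF fp(1)[OF i(3)] fp(1)[OF i(1)] assms(2)]
  let ?k = "phi (cone c w)" and ?k' = "phi (cone c v)" and ?p = "phi (cone c p)"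
  have k: "?k \<in> pw D B" "?k' \<in> pw D B" using phi_in fp i by auto
  have o: "?p x = ?k x" if "x \<noteq> ?l" for x using fun_cong[OF l1(1), of x] that by simp
  have o': "?p x = ?k' x" if "x \<noteq> ?l'" for x using fun_cong[OF l2(1), of x] that by simp
  let ?h = "?k(?l' := ?k' ?l')"
  have h': "?h = ?k'(?l := ?k ?l)" 
  proof (rule ext)
    fix x show "?h x = (?k'(?l := ?k ?l)) x"
      using o[of x] o'[of x] assms(5) by (cases "x = ?l"; cases "x = ?l'") simp_all
  qed
  have e1: "?k ?l' = ?p ?l'" "?k' ?l = ?p ?l" using o[of ?l'] o'[of ?l] assms(5) by auto
  have up: "?h \<le> ?k" "?h \<le> ?k'"
  proof -
    have "?k' ?l' \<le> ?k ?l'" using e1 covD[OF l2(2)] by (simp add: less_imp_le)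
    then show "?h \<le> ?k" by (auto simp: le_fun_def)
    have "?k ?l \<le> ?k' ?l" using e1 covD[OF l1(2)] by (simp add: less_imp_le)
    then show "?h \<le> ?k'" unfolding h' by (auto simp: le_fun_def)
  qed
  have D: "?l \<in> D" "?l' \<in> D" using lab_nuV(1) assms by auto
  have h: "?h \<in> pw D B"
  proof (rule pwI)
    fix x y assume xy: "x \<in> D" "y \<in> D" "x \<le> y"
    have "?h y = ?k y \<or> ?h y = ?k' y" by auto
    moreover have "?h x \<le> ?k y" "?h x \<le> ?k' y"
      using order_trans[OF le_funD[OF up(1)] pwM[OF k(1) xy]] order_trans[OF le_funD[OF up(2)] pwM[OF k(2) xy]] by auto
    ultimately show "?h x \<le> ?h y" by metis
  qed (use pwD[OF k(1)] pwD[OF k(2)] pw_undef[OF k(1)] D in auto)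
  have hk1: "?k = ?h(?l' := ?k ?l')" by simp
  have hk2: "?k' = ?h(?l := ?k' ?l)" unfolding h' by simp
  note hk = hk1 hk2
  have "cov (pw D B) ?h ?k"
    using pw_cov_upd[OF h, of ?l' "?k ?l'"] hk(1) k(1) e1 l2(2) by simp
  then have c1: "cov (pw C A) (psi ?h) (cone c w)" using sw.phi_cov psi_phi[OF fp(1)[OF i(2)]] by metis
  have hl: "?h ?l = ?k ?l" using assms(5) by simp
  have "cov (pw D B) ?h ?k'"
    using pw_cov_upd[OF h, of ?l "?k' ?l"] hk(2)[symmetric] k(2) e1 l1(2) hl by simp
  then have c2: "cov (pw C A) (psi ?h) (cone c v)" using sw.phi_cov psi_phi[OF fp(1)[OF i(3)]] by metis
  have ns: "\<not> v \<le> w" "\<not> w \<le> v"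
    using cov_mid[OF assms(1) i(3) _ i(5)] cov_mid[OF assms(2) i(2) _ i(4)] assms covD[OF assms(1)] covD[OF assms(2)]
    by (auto simp: less_le)
  have "cov A (psi ?h c) w"
  proof -
    from pw_cov[OF finC c1] obtain x where x: "cone c w = (psi ?h)(x := cone c w x)" "cov A (psi ?h x) (cone c w x)" by auto
    have "psi ?h c \<le> v" using covD[OF c2] fp(2)[OF i(3)] by (metis le_funD less_imp_le)
    then have "x = c" using fun_cong[OF x(1), of c] ns fp(2)[OF i(2)] by (metis fun_upd_other fun_upd_same)
    then show ?thesis using x(2) fp(2)[OF i(2)] by simp
  qed
  moreover have "cov A (psi ?h c) v"
  proof -
    from pw_cov[OF finC c2] obtain x where x: "cone c v = (psi ?h)(x := cone c v x)" "cov A (psi ?h x) (cone c v x)" by auto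
    have "psi ?h c \<le> w" using covD[OF c1] fp(2)[OF i(2)] by (metis le_funD less_imp_le)
    then have "x = c" using fun_cong[OF x(1), of c] ns fp(2)[OF i(3)] by (metis fun_upd_other fun_upd_same)
    then show ?thesis using x(2) fp(2)[OF i(3)] by simp
  qed
  ultimately show ?thesis by blast
qed

end

lemma oisoon_cong: "(\<And>x. x \<in> S \<Longrightarrow> h x = h' x) \<Longrightarrow> oisoon h S T \<Longrightarrow> oisoon h' S T"
  by (rule oisoI) (use oisoonD in \<open>metis\<close>)+

text \<open>
  A finite poset has no isomorphism onto itself that is pointwise smaller than another one.
\<close>

lemma oisoon_le_eq:
  assumes fin: "finite S" and p: "oisoon p S T" and q: "oisoon q S T"
    and le: "\<And>x. x \<in> S \<Longrightarrow> p x \<le> q x" and x: "x \<in> S"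
  shows "p x = q x"
  using fin x
proof (induction rule: up_induct)
  case (step c)
  obtain c' where c': "c' \<in> S" "q c' = p c" using oisoonD(3)[OF q oisoonD(1)[OF p step(1)]] by blast
  have "c' \<le> c" using oisoonD(2)[OF q c'(1) step(1)] c'(2) le[OF step(1)] by simp
  moreover have "\<not> c' < c"
  proof
    assume "c' < c"
    then have "p c' = p c" using step(2)[OF c'(1)] c'(2) by simp
    then show False using oisoonD(5)[OF p c'(1) step(1)] \<open>c' < c\<close> by simp
  qed
  ultimately have "c' = c" by simp
  then show ?case using c'(2) by simp
qed

lemma prime_two: "prime S \<Longrightarrow> \<exists>x\<in>S. \<exists>y\<in>S. \<not> x \<le> y"
proof -
  assume p: "prime S"
  then have "2 \<le> card S" by (simp add: prime_def)
  then obtain x where x: "x \<in> S" by fastforce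
  have "S \<noteq> {x}" using \<open>2 \<le> card S\<close> by auto
  then obtain y where "y \<in> S" "y \<noteq> x" using x by blast
  then show ?thesis using x by (metis antisym)
qed

section \<open>Classification of covers\<close>

locale prime_top_biexp = top_biexp A B C D phi psi tA tB
  for A :: "'a::order set" and B :: "'b::order set" and C :: "'c::order set" and D :: "'d::order set"
    and phi psi tA tB +
  assumes pC: "prime C" and pD: "prime D"
begin

lemma pswap: "prime_top_biexp B A D C psi phi tB tA"
  by (intro prime_top_biexp.intro tswap prime_top_biexp_axioms.intro pC pD)

end

sublocale prime_top_biexp \<subseteq> sw: prime_top_biexp B A D C psi phi tB tA by (rule pswap)

context prime_top_biexp
begin

lemma F_less: 
  assumes "a' \<in> A" "a \<in> A" "a' < a"
  shows "\<exists>d\<in>D. F d a' < F d a"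
proof (rule ccontr)
  assume "\<not> ?thesis"
  then have "F d a \<le> F d a'" if "d \<in> D" for d
    using that F_mono[OF assms(1,2), of d] assms(3) by (auto simp: order.strict_iff_order)
  then have "a \<le> a'" using F_all assms by blast
  then show False using assms(3) by simp
qed

lemma finE: "finite E" using finA by (simp add: E_def)

end

context prime_top_biexp
begin

text \<open>
  A cover is separated by some retraction, and between its two values there are neighbours in \<open>E\<close>.
\<close>

lemma ex_edge:
  assumes "a' \<in> A" "a \<in> A" "a' \<le> a" "d \<in> D" "F d a' < F d a"
  shows "\<exists>c1 k x s e. c1 \<in> C \<and> XE k x \<and> s = x (T c1 d a') \<and> cov E s e \<and> e \<le> x (T c1 d a)"
proof -
  from sw.F_less[of "F d a'" "F d a"] obtain c1 where c1: "c1 \<in> C" "T c1 d a' < T c1 d a"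
    using assms by (auto simp: T_def)
  from separate[OF _ _ c1(2)] obtain k x where x: "XE k x" "x (T c1 d a') < x (T c1 d a)"
    using c1 assms by auto
  have "x (T c1 d a') \<in> E" "x (T c1 d a) \<in> E" using x(1) c1(1) assms by (auto simp: XE_def)
  from cov_above[OF finE this x(2)] show ?thesis using c1 x by blast
qed

lemma cover_jump:
  assumes "a' \<in> A" "a \<in> A" "a' \<le> a" "d \<in> D" "F d a' < F d a"
  shows "\<exists>u v. cov A u v \<and> a' \<le> u \<and> v \<le> a \<and> F d u < F d v"
proof -
  let ?S = "{u \<in> A. a' \<le> u \<and> u \<le> a \<and> F d u = F d a'}"
  have "finite ?S" "a' \<in> ?S" using finA assms by auto
  from ex_maximal[OF this] obtain u where u: "u \<in> ?S" "\<And>y. y \<in> ?S \<Longrightarrow> \<not> u < y" by blast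
  have "u < a" using u(1) assms(5) by (auto simp: order.strict_iff_order)
  from cov_above[OF finA _ assms(2) this] u(1) obtain v where v: "cov A u v" "v \<le> a" by auto
  have "v \<notin> ?S" using u(2) covL(3)[OF v(1)] by blast
  moreover have "a' \<le> v" using u(1) covL(4)[OF v(1)] by (auto intro: order_trans)
  ultimately have "F d v \<noteq> F d a'" using v covL[OF v(1)] by blast
  then have "F d u \<noteq> F d v" using u(1) by auto
  moreover have "F d u \<le> F d v" using F_mono covL[OF v(1)] by blast
  ultimately have "F d u < F d v" by (rule order.not_eq_order_implies_strict)
  then show ?thesis using u v by blast
qed

lemma edge_chi_conv:
  assumes s: "s \<in> E" and e: "e \<in> E" and se: "s < e" and V: "upset D V" and c: "c \<in> C" and d: "d \<in> D" and c1: "c1 \<in> C"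
    and x: "XE k x"
  shows "full_edge s e \<Longrightarrow> d \<in> V \<Longrightarrow> x (T c1 d (psi (\<lambda>d\<in>D. if d \<in> V then j e else j s) c)) = e"
    "bare_edge s e al \<Longrightarrow> al c \<in> V \<Longrightarrow> x (T c1 d (psi (\<lambda>d\<in>D. if d \<in> V then j e else j s) c)) = e"
proof -
  let ?k = "\<lambda>d\<in>D. if d \<in> V then j e else j s"
  have jle: "j s \<le> j e" using j_le[OF s e] se by simp
  have k: "?k \<in> pw D B" by (rule pwI) (use V jle s e j_B in \<open>auto simp: upset_def\<close>)
  have b: "\<forall>c\<in>C. s \<le> psi ?k c \<and> psi ?k c \<le> e" by (rule psi_between[OF s e k]) (use jle in auto)
  have W: "W k x" using x by (simp add: XE_def)
  show "x (T c1 d (psi ?k c)) = e" if t: "full_edge s e" and dV: "d \<in> V"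
  proof -
    have "F d (psi ?k c) = j e \<longleftrightarrow> G c (phi (psi ?k) d) = e"
      using t psi_in[OF k] b c d unfolding full_edge_def by blast
    also have "phi (psi ?k) d = j e" using phi_psi[OF k] dV d by simp
    finally have "F d (psi ?k c) = j e" using G_j[OF e c] by metis
    then have "T c1 d (psi ?k c) = e" using G_j[OF e c1] by (simp add: T_def)
    then show ?thesis using W_E[OF W e] by simp
  qed
  show "x (T c1 d (psi ?k c)) = e" if t: "bare_edge s e al" and dV: "al c \<in> V"
  proof -
    have o: "al c \<in> D" using t c by (auto simp: bare_edge_def dest: oisoonD(1))
    have "phi (psi ?k) (al c) = j e \<longleftrightarrow> psi ?k c = e"
      using t psi_in[OF k] b c unfolding bare_edge_def by blast
    moreover have "phi (psi ?k) (al c) = j e" using phi_psi[OF k] dV o by simp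
    ultimately have "psi ?k c = e" by blast
    then show ?thesis using T_E[OF c1 d e] W_E[OF W e] by simp
  qed
qed

lemma chi_le_nuV:
  assumes s: "s \<in> E" and e: "e \<in> E" and se: "s < e" and V: "upset D V" and c: "c \<in> C"
  shows "psi (\<lambda>d\<in>D. if d \<in> V then j e else j s) c \<le> nuV V c s" "psi (\<lambda>d\<in>D. if d \<in> V then j e else j s) c \<in> A"
proof -
  let ?k = "\<lambda>d\<in>D. if d \<in> V then j e else j s"
  have jle: "j s \<le> j e" using j_le[OF s e] se by simp
  have k: "?k \<in> pw D B" by (rule pwI) (use V jle s e j_B in \<open>auto simp: upset_def\<close>)
  have "?k \<le> (\<lambda>d\<in>D. if d \<in> V then tB else phi (cst C s) d)"
    using leB[OF j_B[OF e]] by (auto simp: le_fun_def phi_E[OF s])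
  then have "psi ?k \<le> nV V (cst C s)"
    unfolding nV_def by (rule psi_mono[OF k nVk_pw[OF V phi_in[OF cst_pw[OF E_A[OF s]]]]])
  then show "psi ?k c \<le> nuV V c s"
    using nV_coord[OF V cst_pw[OF E_A[OF s]] c] c by (metis cst_ap le_funD)
  show "psi ?k c \<in> A" using pwD[OF psi_in[OF k] c] .
qed

text \<open>
  Induction from the top. If \<open>a'\<close> has two upper covers with different labels, a square moves the cover upwards without
  changing its labels. Otherwise filling \<open>V\<close> fixes \<open>a'\<close> in coordinate \<open>c\<close> whenever the label is not in \<open>V\<close>; retracted to an edge of \<open>E\<close>, this
  turns the bound of \<open>label_bound\<close> into an equality, and the two types of edges give the two cases.
\<close>

lemma classify:
  assumes "cov A a' a"
  shows "(\<exists>d\<in>D. \<forall>c\<in>C. lab a' a c = d) \<or> oisoon (lab a' a) C D"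
proof -
  have "a' \<in> A" using covD[OF assms] by auto
  with finA have "\<forall>a. cov A a' a \<longrightarrow> (\<exists>d\<in>D. \<forall>c\<in>C. lab a' a c = d) \<or> oisoon (lab a' a) C D"
  proof (induction rule: down_induct)
    case (step a')
    show ?case
    proof (intro allI impI)
      fix a assume cv: "cov A a' a"
      have aA: "a \<in> A" "a' < a" using covD[OF cv] by auto
      show "(\<exists>d\<in>D. \<forall>c\<in>C. lab a' a c = d) \<or> oisoon (lab a' a) C D"
      proof (cases "\<exists>a2 c. cov A a' a2 \<and> c \<in> C \<and> lab a' a c \<noteq> lab a' a2 c")
        case True
        then obtain a2 c where a2: "cov A a' a2" "c \<in> C" "lab a' a c \<noteq> lab a' a2 c" by blast
        from upper_square[OF cv a2] obtain r where r: "cov A a r" "cov A a2 r" by blast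
        have "a \<noteq> a2" using a2(3) by auto
        have eq: "lab a2 r c = lab a' a c" if "c \<in> C" for c
          by (rule square_lab[OF cv a2(1) r \<open>a \<noteq> a2\<close> that])
        have "(\<exists>d\<in>D. \<forall>c\<in>C. lab a2 r c = d) \<or> oisoon (lab a2 r) C D"
          using step(2)[OF covL(2)[OF a2(1)] covL(3)[OF a2(1)]] r(2) by blast
        then show ?thesis using eq oisoon_cong[of C "lab a2 r" "lab a' a" D] by auto
      next
        case False
        then have same: "lab a' a2 c = lab a' a c" if "cov A a' a2" "c \<in> C" for a2 c
          using that by metis
        \<comment> \<open>otherwise the filled element would lie above some upper cover, whose label is the common one\<close>
        have fix0: "nuV V c a' = a'" if V: "upset D V" and c: "c \<in> C" and l: "lab a' a c \<notin> V" for V c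
        proof (rule ccontr)
          assume ne: "nuV V c a' \<noteq> a'"
          note jn = jclosD[OF jclos_nu[OF jclos_nV[OF V] c]]
          have "a' < nuV V c a'" using jn(2)[OF step(1)] ne by (simp add: order.strict_iff_order)
          from cov_above[OF finA step(1) jn(1)[OF step(1)] this] obtain a2 where
            a2: "cov A a' a2" "a2 \<le> nuV V c a'" by blast
          then show False using lab_nuV(2)[OF a2(1) c V] same[OF a2(1) c] l by simp
        qed
        from F_less[OF step(1) aA] obtain d where d: "d \<in> D" "F d a' < F d a" by blast
        from ex_edge[OF step(1) aA(1) less_imp_le[OF aA(2)] d] obtain c1 k x s e where
          x: "c1 \<in> C" "XE k x" "s = x (T c1 d a')" "cov E s e" "e \<le> x (T c1 d a)" by blast
        have se: "s \<in> E" "e \<in> E" "s < e" using covD[OF x(4)] by auto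
        let ?z = "\<lambda>a. x (T c1 d a)"
        have z: "XE (Suc 0 + k) ?z" by (rule XE_comp[OF W_T[OF x(1) d(1)] x(2)])
        have Wz: "W (Suc 0 + k) ?z" using z by (simp add: XE_def)
        have closed: "lab a' a c \<in> V" if V: "upset D V" and c: "c \<in> C"
            and zc: "?z (psi (\<lambda>d\<in>D. if d \<in> V then j e else j s) c) = e" for V c
        proof (rule ccontr)
          assume l: "lab a' a c \<notin> V"
          have jn: "jclos A (nuV V c)" by (rule jclos_nu[OF jclos_nV[OF V] c])
          have "e \<le> ?z (nuV V c s)"
            using W_mono[OF Wz chi_le_nuV(2)[OF se V c] jclosD(1)[OF jn E_A[OF se(1)]] chi_le_nuV(1)[OF se V c]] zc by simp
          also have "\<dots> = ?z (nuV V c a')" using XE_nat[OF z jn step(1)] x(3) by simp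
          also have "\<dots> = s" using fix0[OF V c l] x(3) by simp
          finally show False using se(3) by simp
        qed
        from edge_types[OF pC pD x(4)] show ?thesis
        proof (elim disjE exE)
          assume t: "full_edge s e"
          have "lab a' a c = d" if c: "c \<in> C" for c
          proof (rule antisym)
            show "lab a' a c \<le> d" by (rule label_bound(1)[OF cv x(2,1) d(1) se _ x(5) c t]) (simp add: x(3))
            have V: "upset D {y \<in> D. d \<le> y}" by (rule upset_up[OF d(1)])
            show "d \<le> lab a' a c"
              using closed[OF V c edge_chi_conv(1)[OF se V c d(1) x(1,2) t]] d(1) by simp
          qed
          then show ?thesis using d(1) by blast
        next
          fix al assume t: "bare_edge s e al"
          have o: "oisoon al C D" using t by (simp add: bare_edge_def)
          have "al c = lab a' a c" if c: "c \<in> C" for c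
          proof (rule antisym)
            show "lab a' a c \<le> al c" by (rule label_bound(2)[OF cv x(2,1) d(1) se _ x(5) c t]) (simp add: x(3))
            have V: "upset D {y \<in> D. al c \<le> y}" by (rule upset_up[OF oisoonD(1)[OF o c]])
            show "al c \<le> lab a' a c"
              using closed[OF V c edge_chi_conv(2)[OF se V c d(1) x(1,2) t]] oisoonD(1)[OF o c] by simp
          qed
          then have "oisoon (lab a' a) C D" using oisoon_cong[OF _ o] by blast
          then show ?thesis ..
        qed
      qed
    qed
  qed
  then show ?thesis using assms by blast
qed

lemma cover_EE_iso:
  assumes cv: "cov A s e" and s: "s \<in> E" and e: "e \<in> E"
  shows "oisoon (lab s e) C D"
proof (rule ccontr)
  assume "\<not> ?thesis"
  then obtain d where d: "\<And>c. c \<in> C \<Longrightarrow> lab s e c = d" using classify[OF cv] by blast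
  have "j s < j e" using j_le[OF s e] j_inj[OF s e] covD[OF cv] by (simp add: order.strict_iff_order)
  then have "y = d" if "y \<in> D" for y
    using F_eq_iff_label[OF cv that] F_j[OF s that] F_j[OF e that] d by auto
  then show False using prime_two[OF pD] by blast
qed

lemma cov_E: "cov A s e \<Longrightarrow> s \<in> E \<Longrightarrow> e \<in> E \<Longrightarrow> cov E s e"
  unfolding cov_def using E_A by blast

lemma F_const_label:
  assumes cv: "cov A a' a" and l: "\<And>c. c \<in> C \<Longrightarrow> lab a' a c = d0" and d: "d \<in> D" "d \<noteq> d0"
  shows "F d a' = F d a"
proof -
  have "\<not> F d a' < F d a" using F_eq_iff_label[OF cv d(1)] l d(2) by auto
  then show ?thesis using F_mono[OF covL(1)[OF cv] covL(2)[OF cv] covL(4)[OF cv], of d] by (simp add: order.strict_iff_order)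
qed

lemma flip_XE:
  assumes "sw.XE k y" "d \<in> D" "c \<in> C"
  shows "XE (Suc k) (\<lambda>a. G c (y (F d a)))"
  using assms sw.W_flip[of k y d c] sw.F_j sw.jE_in unfolding XE_def sw.XE_def by auto

end

section \<open>All values are fixed elements\<close>

context prime_top_biexp
begin

text \<open>
  The change from \<open>a'\<close> to \<open>a\<close> happens in the coordinate \<open>d\<close> only, in \<open>card C\<close> steps, one for each \<open>c\<close>. If all these steps have
  constant labels as well, then \<open>G c\<close> moves by \<open>card D\<close> in the step of \<open>c\<close>, and by counting in no other step; so
  \<open>G c (F d a')\<close> has the same distance from the fixed \<open>G c (F d a)\<close> for all \<open>c\<close> and is constant. A step whose labels form
  an isomorphism would force its \<open>c\<close> to be least, and then the distances would add up to too much.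
\<close>

lemma key_const:
  assumes cv: "cov A a' a" and good: "\<And>d. d \<in> D \<Longrightarrow> F d a \<in> sw.E" and d: "d \<in> D"
    and l: "\<And>c. c \<in> C \<Longrightarrow> lab a' a c = d"
  shows "F d a' \<in> sw.E" "\<And>c U. upset C U \<Longrightarrow> c \<in> U \<Longrightarrow> G c (phi (step a' a U) d) = G c (F d a)"
proof -
  have a: "a' \<in> A" "a \<in> A" "a' \<le> a" using covL[OF cv] by auto
  let ?b' = "F d a'" and ?b = "F d a"
  let ?e = "sw.j ?b"
  have Gb: "G c ?b = ?e" if "c \<in> C" for c by (rule sw.F_j[OF good[OF d] that])
  \<comment> \<open>the walk passes from \<open>lo c\<close> to \<open>hi c\<close> when \<open>c\<close> is added to its strict upset\<close>
  define lo where "lo c = phi (step a' a {x \<in> C. c < x}) d" for c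
  define hi where "hi c = phi (step a' a {x \<in> C. c \<le> x}) d" for c
  have up: "upset C {x \<in> C. c < x}" "upset C {x \<in> C. c \<le> x}" for c by (auto simp: upset_def intro: less_le_trans order_trans)
  have ins: "insert c {x \<in> C. c < x} = {x \<in> C. c \<le> x}" if "c \<in> C" for c using that by auto
  have st: "cov B (lo c) (hi c)" "sw.lab (lo c) (hi c) d = c" if c: "c \<in> C" for c
    using step_cov(2,3)[OF cv c _ up(1), of c] up(2)[of c] l[OF c] unfolding ins[OF c] lo_def hi_def by auto
  have bd: "?b' \<le> lo c" "hi c \<le> ?b" for c using step_between[OF cv up(1)] step_between[OF cv up(2)] unfolding lo_def hi_def by auto
  have mono: "phi (step a' a U) d \<le> phi (step a' a U') d" if "upset C U" "upset C U'" "U \<subseteq> U'" for U U'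
    using phi_mono[OF step_pw[OF a that(1)] step_pw[OF a that(2)] step_mono[OF a(3) that(3)]] by (rule le_funD)
  have B: "?b' \<in> B" "?b \<in> B" "?b' \<le> ?b" "lo c \<in> B" "hi c \<in> B" "lo c \<le> hi c" if "c \<in> C" for c
    using d a F_mono[OF a] covL[OF st(1)[OF that]] by auto
  have tot: "(\<Sum>c\<in>C. len A (G c ?b') (G c ?b)) = card D * card C"
  proof -
    have "len B ?b' ?b = card C" using label_count[OF cv d] l by (auto intro: arg_cong[of _ _ card])
    then show ?thesis using sw.F_sum[of ?b' ?b] d a F_mono[OF a] by simp
  qed
  have lenc: "len A (G c (lo c)) (G c (hi c)) = card D" if c: "c \<in> C" and cc: "\<And>y. y \<in> D \<Longrightarrow> sw.lab (lo c) (hi c) y = c" for c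
    using sw.label_count[OF st(1)[OF c] c] cc by (auto intro: arg_cong[of _ _ card])
  have const: "sw.lab (lo c) (hi c) y = c" if c: "c \<in> C" and y: "y \<in> D" for c y
  proof (rule ccontr)
    assume no: "sw.lab (lo c) (hi c) y \<noteq> c"
    \<comment> \<open>a non-constant label forces c and d to be least\<close>
    have iso: "oisoon (sw.lab (lo c) (hi c)) D C" if "c \<in> C" "y \<in> D" "sw.lab (lo c) (hi c) y \<noteq> c" for c y
    proof -
      have "\<not> (\<exists>x\<in>C. \<forall>y\<in>D. sw.lab (lo c) (hi c) y = x)" using that st(2)[OF that(1)] d by metis
      then show ?thesis using sw.classify[OF st(1)[OF that(1)]] by blast
    qed
    have least: "c \<le> x" if c: "c \<in> C" and y: "y \<in> D" "sw.lab (lo c) (hi c) y \<noteq> c" and xC: "x \<in> C" for c y x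
    proof -
      let ?s = "sw.lab (lo c) (hi c)"
      note o = iso[OF c y]
      obtain u v where uv: "u \<in> C" "v \<in> C" "\<not> u \<le> v" using prime_two[OF pC] by blast
      have "G v (lo c) < G v (hi c)" using sw.F_eq_iff_label[OF st(1)[OF c] uv(2)] oisoonD(3)[OF o uv(2)] by blast
      from sw.ex_edge[OF B(4,5,6)[OF c] uv(2) this] c obtain d1 k z s e where
        z: "d1 \<in> D" "sw.XE k z" "s = z (sw.T d1 v (lo c))" "cov sw.E s e" "e \<le> z (sw.T d1 v (hi c))" by blast
      have se: "s \<in> sw.E" "e \<in> sw.E" "s < e" using covD[OF z(4)] by auto
      from sw.edge_types[OF pD pC z(4)] obtain al where t: "sw.bare_edge s e al"
      proof (elim disjE exE)
        assume t: "sw.full_edge s e"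
        obtain y' where y': "y' \<in> D" "?s y' = u" using oisoonD(3)[OF o uv(1)] by blast
        have "?s y' \<le> v" by (rule sw.label_bound(1)[OF st(1)[OF c] z(2,1) uv(2) se _ z(5) y'(1) t]) (simp add: z(3))
        then show ?thesis using y'(2) uv(3) by simp
      qed
      have t': "bare_edge (sw.j s) (sw.j e) (the_inv_into D al)" by (rule sw.bare_edge_swap[OF se(1,2) t])
      have jse: "sw.j s < sw.j e" using sw.j_le[OF se(1,2)] sw.j_inj[OF se(1,2)] se(3) by (simp add: order.strict_iff_order)
      have Wz: "sw.W k z" "\<And>b. b \<in> B \<Longrightarrow> z b \<in> sw.E" using z(2) by (auto simp: sw.XE_def)
      let ?x = "\<lambda>a. G v (z (F d1 a))"
      have x: "XE (Suc k) ?x" by (rule flip_XE[OF z(2,1) uv(2)])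
      have val: "?x (T v d a'') = sw.j (z (sw.T d1 v (F d a'')))" if "a'' \<in> A" for a''
        using sw.F_j[OF Wz(2) uv(2), of "sw.T d1 v (F d a'')"] that d uv z(1) by (simp add: T_def sw.T_def)
      have m: "sw.j (z (sw.T d1 v p)) \<le> sw.j (z (sw.T d1 v q))" if "p \<in> B" "q \<in> B" "p \<le> q" for p q
        using sw.W_mono[OF Wz(1) _ _ sw.T_mono[OF uv(2) that]] sw.j_le[OF Wz(2) Wz(2)] z(1) uv that by simp
      have lo': "?x (T v d a') \<le> sw.j s" using val[OF a(1)] m[OF B(1,4)[OF c] bd(1)] z(3) c by simp
      have "sw.j e \<le> sw.j (z (sw.T d1 v (hi c)))" using sw.j_le[OF se(2) Wz(2)] z(5,1) B(5)[OF c] uv by simp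
      also have "\<dots> \<le> ?x (T v d a)" using val[OF a(2)] m[OF B(5,2)[OF c] bd(2)] c by simp
      finally have hi': "sw.j e \<le> ?x (T v d a)" .
      have oi: "oisoon (the_inv_into D al) C D" using t' by (simp add: bare_edge_def)
      have dmin: "d \<le> y" if yD: "y \<in> D" for y
      proof -
        obtain w where w: "w \<in> C" "the_inv_into D al w = y" using oisoonD(3)[OF oi yD] by blast
        have "lab a' a w \<le> the_inv_into D al w"
          by (rule label_bound(2)[OF cv x uv(2) d sw.jE_in[OF se(1)] sw.jE_in[OF se(2)] jse lo' hi' w(1) t'])
        then show ?thesis using w l by simp
      qed
      obtain y where yx: "y \<in> D" "?s y = x" using oisoonD(3)[OF o xC] by blast
      then show ?thesis using oisoonD(2)[OF o d yx(1)] dmin[OF yx(1)] st(2)[OF c] by simp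
    qed
    have min: "c \<le> x" if "x \<in> C" for x by (rule least[OF c y no that])
    have cc: "sw.lab (lo c') (hi c') y' = c'" if "c' \<in> C" "c' \<noteq> c" "y' \<in> D" for c' y'
      using least[OF that(1,3) _ c] min[OF that(1)] that(2) by (metis antisym)
    have hic: "hi c = ?b"
    proof -
      have "{x \<in> C. c \<le> x} = C" using min by blast
      then show ?thesis unfolding hi_def by (simp add: step_full F_def)
    qed
    \<comment> \<open>the step of the least element moves every \<open>G c'\<close> once more\<close>
    have big: "card D + 1 \<le> len A (G c' ?b') ?e" if c': "c' \<in> C" "c' \<noteq> c" for c'
    proof -
      have hl: "hi c' \<le> lo c"
        unfolding hi_def lo_def
      proof (rule mono[OF up(2) up(1)], rule subsetI)
        fix x assume x: "x \<in> {x \<in> C. c' \<le> x}"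
        then have "c < c'" "c' \<le> x" using min[OF c'(1)] c'(2) by (auto simp: order.strict_iff_order)
        then show "x \<in> {x \<in> C. c < x}" using x by (auto intro: less_le_trans)
      qed
      have lt: "G c' (lo c) < G c' (hi c)"
        using sw.F_eq_iff_label[OF st(1)[OF c] c'(1)] oisoonD(3)[OF iso[OF c y no] c'(1)] by blast
      have "card D + 1 \<le> len A (G c' (lo c')) (G c' (hi c')) + len A (G c' (lo c)) (G c' (hi c))"
        using lenc[OF c'(1)] cc[OF c'] len_pos[OF finA _ _ lt] c'(1) B(4,5)[OF c] by simp
      also have "\<dots> \<le> len A (G c' ?b') (G c' (hi c')) + len A (G c' (hi c')) (G c' ?b)"
        by (intro add_mono len_mono[OF finA])
          (use c' c B B(6)[OF c, unfolded hic] hl bd hic sw.F_mono in auto)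
      also have "\<dots> \<le> len A (G c' ?b') (G c' ?b)"
        by (rule len_add[OF finA]) (use c' B[OF c'(1)] bd(2) order_trans[OF bd(1) B(6)[OF c'(1)]] sw.F_mono in auto)
      finally show ?thesis using Gb[OF c'(1)] by simp
    qed
    have all: "card D + 1 \<le> len A (G c' ?b') (G c' ?b)" if c': "c' \<in> C" for c'
    proof (cases "c' = c")
      case False then show ?thesis using big[OF c'] Gb[OF c'] by simp
    next
      case True
      obtain c2 where c2: "c2 \<in> C" "c2 \<noteq> c" using prime_two[OF pC] c by (metis order_refl)
      have le: "G c2 ?b' \<le> ?e" using sw.F_mono[OF B(1,2,3)[OF c], of c2] Gb[OF c2(1)] by simp
      have "len A (G c2 ?b') ?e \<le> len A (G c ?b') ?e"
        by (rule len_mono[OF finA])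
          (use c c2 B(1)[OF c] min[OF c2(1)] sw.F_mono2 le sw.jE_in[OF good[OF d]] E_A in auto)
      then show ?thesis using big[OF c2] Gb[OF c'] True by simp
    qed
    have "card C * (card D + 1) \<le> (\<Sum>c\<in>C. len A (G c ?b') (G c ?b))"
      using sum_mono[of C "\<lambda>_. card D + 1", OF all] by simp
    then have "card C * (card D + 1) \<le> card C * card D" using tot by (simp add: mult.commute)
    then show False using finC neC by (simp add: card_gt_0_iff)
  qed
  have parts: "len A (G c ?b') (G c (lo c)) + card D + len A (G c (hi c)) (G c ?b) \<le> len A (G c ?b') (G c ?b)" if c: "c \<in> C" for c
  proof -
    have g: "G c ?b' \<le> G c (lo c)" "G c (lo c) \<le> G c (hi c)" "G c (hi c) \<le> G c ?b"
      "G c ?b' \<in> A" "G c (lo c) \<in> A" "G c (hi c) \<in> A" "G c ?b \<in> A"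
      using sw.F_mono B[OF c] bd c by auto
    have "len A (G c ?b') (G c (lo c)) + card D \<le> len A (G c ?b') (G c (hi c))"
      using len_add[OF finA g(4,5,6,1,2)] lenc[OF c const[OF c]] by simp
    also have "\<dots> + len A (G c (hi c)) (G c ?b) \<le> len A (G c ?b') (G c ?b)"
      by (rule len_add[OF finA g(4,6,7) order_trans[OF g(1,2)] g(3)])
    finally show ?thesis by simp
  qed
  have eq: "len A (G c ?b') (G c ?b) = card D" if c: "c \<in> C" for c
    by (rule sum_le_eq[of C "\<lambda>_. card D", symmetric, OF finC _ _ c]) (use parts tot in \<open>fastforce simp: mult.commute\<close>)+
  have hie: "G c (hi c) = G c ?b" if c: "c \<in> C" for c
  proof (rule ccontr)
    assume "G c (hi c) \<noteq> G c ?b"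
    then have "G c (hi c) < G c ?b" using sw.F_mono[OF B(5,2)[OF c] bd(2)] c by (simp add: order.strict_iff_order)
    from len_pos[OF finA _ _ this] show False using parts[OF c] eq[OF c] c B[OF c] by simp
  qed
  show "G c (phi (step a' a U) d) = G c (F d a)" if U: "upset C U" and cU: "c \<in> U" for c U
  proof (rule antisym)
    have c: "c \<in> C" using U cU by (auto simp: upset_def)
    have sb: "phi (step a' a U) d \<in> B" using pwD[OF phi_in[OF step_pw[OF a U]] d] .
    show "G c (phi (step a' a U) d) \<le> G c ?b" using sw.F_mono[OF sb B(2)[OF c]] step_between[OF cv U] c by simp
    have "hi c \<le> phi (step a' a U) d" unfolding hi_def
      by (rule mono[OF up(2) U]) (use U cU in \<open>auto simp: upset_def\<close>)
    then show "G c ?b \<le> G c (phi (step a' a U) d)" using sw.F_mono[OF B(5)[OF c] sb] hie[OF c] by metis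
  qed
  have "G y ?b' = G z ?b'" if "y \<in> C" "z \<in> C" "y \<le> z" for y z
  proof (rule len_eq_imp_eq[OF finA, of _ _ ?e])
    show "len A (G y ?b') ?e \<le> len A (G z ?b') ?e" using eq that Gb by simp
    show "G z ?b' \<le> ?e" using sw.F_mono[OF B(1,2,3)[OF that(2)], of z] Gb[OF that(2)] by simp
  qed (use that B sw.F_mono2 sw.jE_in[OF good[OF d]] E_A in auto)
  then have "G y ?b' = G z ?b'" if "y \<in> C" "z \<in> C" for y z
    using conn_const[OF conC, of "\<lambda>c. G c ?b'"] that by blast
  then show "F d a' \<in> sw.E" unfolding sw.E_def using F_in[OF d a(1)] by blast
qed

text \<open>
  Here each \<open>F d a'\<close> is covered by \<open>F d a\<close>. If the labels of this cover form an isomorphism, \<open>G c\<close> moves by one step for all \<open>c\<close>,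
  and \<open>F d a'\<close> is fixed. If they are constantly \<open>c\<close>, then \<open>c\<close> is minimal and \<open>G c\<close> moves through
  several covers; comparing the bounds that one edge of \<open>E\<close> imposes on all the covers involved makes \<open>c\<close> and \<open>d\<close> least and gives
  two different covers the same label \<open>d\<close>.
\<close>

lemma key_iso:
  assumes cv: "cov A a' a" and good: "\<And>d. d \<in> D \<Longrightarrow> F d a \<in> sw.E" and o: "oisoon (lab a' a) C D" and d: "d \<in> D"
  shows "F d a' \<in> sw.E" "cov B (F d a') (F d a)"
proof -
  have a: "a' \<in> A" "a \<in> A" "a' \<le> a" using covL[OF cv] by auto
  let ?b' = "F d a'" and ?b = "F d a"
  let ?e = "sw.j ?b"
  have Gb: "G c ?b = ?e" if "c \<in> C" for c by (rule sw.F_j[OF good[OF d] that])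
  obtain c where c: "c \<in> C" "lab a' a c = d" using oisoonD(3)[OF o d] by blast
  have B: "?b' \<in> B" "?b \<in> B" "?b' \<le> ?b" using d a F_mono[OF a] by auto
  have "{x \<in> C. lab a' a x = d} = {c}" using c oisoonD(5)[OF o] by blast
  then have len1: "len B ?b' ?b = 1" using label_count[OF cv d] by simp
  then have "?b' \<noteq> ?b" using finB B by auto
  then have "?b' < ?b" using B(3) by (simp add: order.strict_iff_order)
  then show cb: "cov B ?b' ?b" using len_one_cov[OF finB B(1,2)] len1 by simp
  have eA: "?e \<in> A" using sw.jE_in[OF good[OF d]] E_A by simp
  have Gle: "G x ?b' \<le> ?e" if "x \<in> C" for x using sw.F_mono[OF B, of x] Gb[OF that] by simp
  have up: "upset C {x \<in> C. c < x}" "upset C (insert c {x \<in> C. c < x})"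
    using c(1) by (auto simp: upset_def intro: less_le_trans order.strict_trans1 simp: order.order_iff_strict)
  have labd: "sw.lab ?b' ?b d = c"
  proof -
    let ?k = "phi (step a' a {x \<in> C. c < x}) d" and ?k' = "phi (step a' a (insert c {x \<in> C. c < x})) d"
    note st = step_cov[OF cv c(1) _ up, unfolded c(2)]
    have kc: "cov B ?k ?k'" using st(2) by simp
    have kb: "?b' \<le> ?k" "?k < ?k'" "?k' \<le> ?b"
      using step_between[OF cv up(1), of d] step_between[OF cv up(2), of d] covL(3)[OF kc] by auto
    have "?k \<noteq> ?b" "?k' \<noteq> ?b'" using kb by auto
    moreover have "?k = ?b' \<or> ?k = ?b" "?k' = ?b' \<or> ?k' = ?b"
      using cov_mid[OF cb covL(1)[OF kc]] cov_mid[OF cb covL(2)[OF kc]] kb by (auto intro: order_trans less_imp_le)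
    ultimately have "?k = ?b'" "?k' = ?b" by blast+
    then show ?thesis using st(3) by simp
  qed
  show "?b' \<in> sw.E"
  proof (cases "oisoon (sw.lab ?b' ?b) D C")
    case True
    have one: "len A (G x ?b') ?e = 1" if x: "x \<in> C" for x
    proof -
      obtain y where y: "y \<in> D" "sw.lab ?b' ?b y = x" using oisoonD(3)[OF True x] by blast
      have "{z \<in> D. sw.lab ?b' ?b z = x} = {y}" using y oisoonD(5)[OF True] by blast
      then show ?thesis using sw.label_count[OF cb x] Gb[OF x] by simp
    qed
    have "G y ?b' = G z ?b'" if "y \<in> C" "z \<in> C" "y \<le> z" for y z
      by (rule len_eq_imp_eq[OF finA, of _ _ ?e]) (use that B sw.F_mono2 Gle eA one in auto)
    then have "G y ?b' = G z ?b'" if "y \<in> C" "z \<in> C" for y z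
      using conn_const[OF conC, of "\<lambda>c. G c ?b'"] that by blast
    then show ?thesis unfolding sw.E_def using B by blast
  next
    case False
    then obtain x where x: "\<And>y. y \<in> D \<Longrightarrow> sw.lab ?b' ?b y = x" using sw.classify[OF cb] by blast
    then have lc: "sw.lab ?b' ?b y = c" if "y \<in> D" for y using that d labd by metis
    have other: "G x ?b' = ?e" if "x \<in> C" "x \<noteq> c" for x
      using sw.F_const_label[OF cb lc that] Gb[OF that(1)] by simp
    have lt: "G c ?b' < G c ?b" using sw.F_eq_iff_label[OF cb c(1)] lc d by blast
    have cmin: "\<not> x < c" if "x \<in> C" for x
    proof
      assume "x < c"
      then have "G x ?b' \<le> G c ?b'" using sw.F_mono2[OF B(1) that c(1)] by simp
      then show False using other[OF that] \<open>x < c\<close> lt Gb[OF c(1)] by (metis less_irrefl less_le_not_le)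
    qed
    obtain y0 where y0: "y0 \<in> C" "\<not> y0 \<le> c"
      using prime_two[OF pC] cmin c(1) by (metis order.not_eq_order_implies_strict order_refl)
    \<comment> \<open>a cover between \<open>G c (F d a')\<close> and \<open>G c (F d a)\<close> whose label at \<open>c\<close> differs from \<open>d\<close>\<close>
    obtain d' where d': "d' \<in> D" "d' \<noteq> d" using prime_two[OF pD] d by (metis order_refl)
    let ?V = "{y \<in> D. d' < y}"
    have upV: "upset D ?V" "upset D (insert d' ?V)"
      using d'(1) by (auto simp: upset_def intro: less_le_trans order.strict_trans1 simp: order.order_iff_strict)
    define u where "u = psi (sw.step ?b' ?b ?V) c"
    define v where "v = psi (sw.step ?b' ?b (insert d' ?V)) c"
    note st = sw.step_cov[OF cb d'(1) _ upV, unfolded lc[OF d'(1)]]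
    have uv: "cov A u v" "lab u v c = d'" using st(2,3) unfolding u_def v_def by simp_all
    have ub: "G c ?b' \<le> u" "v \<le> G c ?b" using sw.step_between[OF cb upV(1)] sw.step_between[OF cb upV(2)] unfolding u_def v_def by auto
    have uvA: "u \<in> A" "v \<in> A" "u \<le> v" using covL[OF uv(1)] by auto
    have "F d' u < F d' v" using F_eq_iff_label[OF uv(1) d'(1)] uv(2) c(1) by blast
    from ex_edge[OF uvA d'(1) this] obtain c1 k x s e where
      z: "c1 \<in> C" "XE k x" "s = x (T c1 d' u)" "cov E s e" "e \<le> x (T c1 d' v)" by blast
    have se: "s \<in> E" "e \<in> E" "s < e" using covD[OF z(4)] by auto
    let ?z = "\<lambda>a. x (T c1 d' a)"
    have zX: "XE (Suc 0 + k) ?z" by (rule XE_comp[OF W_T[OF z(1) d'(1)] z(2)])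
    have Wz: "W (Suc 0 + k) ?z" "\<And>a. a \<in> A \<Longrightarrow> ?z a \<in> E" using zX by (auto simp: XE_def)
    have GA: "G c ?b' \<in> A" "G c ?b \<in> A" using B c by auto
    have zlo: "?z (G c ?b') \<le> s" using W_mono[OF Wz(1) GA(1) uvA(1) ub(1)] z(3) by simp
    have zhi: "e \<le> ?z (G c ?b)" using W_mono[OF Wz(1) uvA(2) GA(2) ub(2)] z(5) by simp
    from edge_types[OF pC pD z(4)] obtain al where t: "bare_edge s e al"
    proof (elim disjE exE)
      assume t: "full_edge s e"
      have "lab a' a y0 \<le> d" by (rule label_bound(1)[OF cv zX c(1) d se _ _ y0(1) t]) (use zlo zhi in \<open>simp_all add: T_def\<close>)
      then show ?thesis using oisoonD(2)[OF o y0(1) c(1)] c(2) y0(2) by simp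
    qed
    have al: "oisoon al C D" using t by (simp add: bare_edge_def)
    have t': "sw.bare_edge (j s) (j e) (the_inv_into C al)" by (rule bare_edge_swap[OF se(1,2) t])
    have jse: "j s < j e" using j_le[OF se(1,2)] j_inj[OF se(1,2)] se(3) by (simp add: order.strict_iff_order)
    have al': "oisoon (the_inv_into C al) D C" using t' by (simp add: sw.bare_edge_def)
    let ?y = "\<lambda>b. F d' (x (G c1 b))"
    have y: "sw.XE (Suc k) ?y" by (rule sw.flip_XE[OF z(2,1) d'(1)])
    have val: "?y (sw.T d' c b) = j (?z (G c b))" if "b \<in> B" for b
      using F_j[OF Wz(2) d'(1), of "G c b"] that c(1) by (simp add: T_def sw.T_def)
    have ylo: "?y (sw.T d' c ?b') \<le> j s" using val[OF B(1)] zlo j_le[OF Wz(2)[OF GA(1)] se(1)] by simp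
    have yhi: "j e \<le> ?y (sw.T d' c ?b)" using val[OF B(2)] zhi j_le[OF se(2) Wz(2)[OF GA(2)]] by simp
    have cleast: "c \<le> w" if w: "w \<in> C" for w
    proof -
      obtain y' where y': "y' \<in> D" "the_inv_into C al y' = w" using oisoonD(3)[OF al' w] by blast
      have "sw.lab ?b' ?b y' \<le> the_inv_into C al y'"
        by (rule sw.label_bound(2)[OF cb y d'(1) c(1) jE_in[OF se(1)] jE_in[OF se(2)] jse ylo yhi y'(1) t'])
      then show ?thesis using lc[OF y'(1)] y'(2) by simp
    qed
    have "lab u v c \<le> al c" by (rule label_bound(2)[OF uv(1) z(2,1) d'(1) se _ z(5) c(1) t]) (simp add: z(3))
    moreover have "al c \<le> d"
    proof -
      obtain w where "w \<in> C" "al w = d" using oisoonD(3)[OF al d] by blast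
      then show ?thesis using oisoonD(2)[OF al c(1), of w] cleast by auto
    qed
    moreover have "d \<le> d'"
    proof -
      obtain w where "w \<in> C" "lab a' a w = d'" using oisoonD(3)[OF o d'(1)] by blast
      then show ?thesis using oisoonD(2)[OF o c(1), of w] cleast c(2) by auto
    qed
    ultimately show ?thesis using uv(2) d'(2) by (metis order.antisym order_trans)
  qed
qed

lemma key:
  assumes "a \<in> A" "d \<in> D"
  shows "F d a \<in> sw.E"
proof -
  from finA assms(1) have "\<forall>d\<in>D. F d a \<in> sw.E"
  proof (induction rule: down_induct)
    case (step a')
    show ?case
    proof (cases "a' = tA")
      case True then show ?thesis by simp
    next
      case False
      then have "a' < tA" using leA[OF step(1)] by (simp add: order.strict_iff_order)
      from cov_above[OF finA step(1) tA this] obtain a where cv: "cov A a' a" by blast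
      have good: "F d a \<in> sw.E" if "d \<in> D" for d using step(2)[OF covL(2)[OF cv] covL(3)[OF cv]] that by blast
      show ?thesis
      proof (cases "oisoon (lab a' a) C D")
        case True then show ?thesis using key_iso(1)[OF cv good] by blast
      next
        case False
        then obtain d0 where d0: "d0 \<in> D" "\<And>c. c \<in> C \<Longrightarrow> lab a' a c = d0" using classify[OF cv] by blast
        show ?thesis
        proof
          fix d assume d: "d \<in> D"
          show "F d a' \<in> sw.E"
          proof (cases "d = d0")
            case True then show ?thesis using key_const(1)[OF cv good d0] by blast
          next
            case False then show ?thesis using F_const_label[OF cv d0(2) d False] good[OF d] by simp
          qed
        qed
      qed
    qed
  qed
  then show ?thesis using assms(2) by blast
qed

end

section \<open>Bases with a top: the exponents\<close>

context prime_top_biexp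
begin

lemma pw_B: "k \<in> pw D sw.E \<Longrightarrow> k \<in> pw D B"
  using pw_mono[of sw.E B D] sw.E_A by auto

text \<open>
  For \<open>c \<le> c'\<close> equal lengths up to \<open>a\<close> force \<open>f c = f c'\<close>.
\<close>

lemma len_const:
  assumes f: "f \<in> pw C A" and a: "a \<in> A" and le: "\<And>c. c \<in> C \<Longrightarrow> f c \<le> a"
    and len: "\<And>c. c \<in> C \<Longrightarrow> len A (f c) a = n"
  shows "\<exists>a'\<in>A. f = cst C a'"
proof -
  have "f y = f z" if "y \<in> C" "z \<in> C" "y \<le> z" for y z
    by (rule len_eq_imp_eq[OF finA, of _ _ a]) (use that pwD[OF f] pwM[OF f] a le len in auto)
  then have *: "f y = f z" if "y \<in> C" "z \<in> C" for y z
    using conn_const[OF conC, of f] that by blast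
  obtain c where c: "c \<in> C" using neC by auto
  have "f = cst C (f c)"
    by (rule pw_eqI[OF f cst_pw[OF pwD[OF f c]]]) (use *[OF _ c] in \<open>simp add: cst_def\<close>)
  then show ?thesis using pwD[OF f c] by blast
qed

text \<open>
  Each step in the interval makes some two-valued \<open>F d\<close> jump, and each \<open>F d\<close> can jump only once.
\<close>

lemma E_interval_len:
  assumes s: "s \<in> E" and e: "e \<in> E" and se: "s < e"
    and two: "\<And>a d. a \<in> A \<Longrightarrow> s \<le> a \<Longrightarrow> a \<le> e \<Longrightarrow> d \<in> D \<Longrightarrow> F d a = j s \<or> F d a = j e"
  shows "len A s e \<le> card D"
proof -
  have "n \<le> card {d \<in> D. F d v \<noteq> j e}" if "chn A n v w" "w = e" "s \<le> v" for n v w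
    using that
  proof (induction rule: chn.induct)
    case (chnS x y n z)
    have y: "y \<in> A" "y \<le> e" using chn_in[OF chnS(3)] chnS.prems by auto
    have xy: "s \<le> y" "x \<le> e" using chnS.prems chnS(2) y by auto
    obtain d where d: "d \<in> D" "F d x < F d y" using F_less[OF chnS(1) y(1) chnS(2)] by blast
    have le: "F d x \<le> F d y" for d using F_mono[OF chnS(1) y(1)] chnS(2) by simp
    have jse: "j s < j e" using j_le[OF s e] j_inj[OF s e] se by (simp add: order.strict_iff_order)
    have dy: "F d y = j e \<and> F d x \<noteq> j e"
      using two[OF chnS(1) chnS.prems(2) xy(2) d(1)] two[OF y(1) xy(1) y(2) d(1)] d(2) jse
      by (metis less_asym less_irrefl)
    have "{d \<in> D. F d y \<noteq> j e} \<subset> {d \<in> D. F d x \<noteq> j e}"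
    proof
      show "{d \<in> D. F d y \<noteq> j e} \<subseteq> {d \<in> D. F d x \<noteq> j e}"
      proof clarify
        fix d assume "d \<in> D" "F d y \<noteq> j e" "F d x = j e"
        then show False using le[of d] two[OF y(1) xy(1) y(2), of d] jse by auto
      qed
      show "{d \<in> D. F d y \<noteq> j e} \<noteq> {d \<in> D. F d x \<noteq> j e}" using d(1) dy by blast
    qed
    then have "card {d \<in> D. F d y \<noteq> j e} < card {d \<in> D. F d x \<noteq> j e}"
      using finD by (intro psubset_card_mono) auto
    then show ?case using chnS.IH[OF chnS.prems(1) xy(1)] by simp
  qed auto
  from this[OF len_att[OF finA E_A[OF s] E_A[OF e] less_imp_le[OF se]] refl order_refl]
  show ?thesis using card_mono[OF finD, of "{d \<in> D. F d s \<noteq> j e}"] by (rule order_trans) auto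
qed

end

context prime_top_biexp
begin

text \<open>
  Downward induction along covers of maps into the fixed elements. Going down replaces one value \<open>e\<close> by a
  neighbour \<open>e'\<close>, so on the side of \<open>A\<close> the total distance from the constant map \<open>a\<close> is the length between \<open>e'\<close> and \<open>e\<close>,
  at most \<open>card C\<close>. Between \<open>e'\<close> and \<open>e\<close> there is a cover with constant label \<open>c\<close> for every \<open>c\<close>, so every coordinate is at
  distance exactly one, and the map is constant.
\<close>

lemma surj:
  assumes no: "\<not> oiso C D" and k: "k \<in> pw D sw.E"
  shows "\<exists>a\<in>A. k = phi (cst C a)"
proof -
  have fin: "finite (pw D sw.E)" using pw_finite finD sw.finE by blast
  show ?thesis using fin k
  proof (induction rule: down_induct)
    case (step k)
    note kB = pw_B[OF step(1)]
    have top: "cst D tB \<in> pw D sw.E" by simp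
    show ?case
    proof (cases "k = cst D tB")
      case True then show ?thesis using phi_top tA by metis
    next
      case False
      have "k \<le> cst D tB" by (subst pw_le[OF step(1) top]) (use pwD[OF kB] leB in auto)
      then have "k < cst D tB" using False by (simp add: order.strict_iff_order)
      from cov_above[OF fin step(1) top this] obtain k1 where k1: "cov (pw D sw.E) k k1" by blast
      note k1B = pw_B[OF covL(2)[OF k1]]
      from pw_cov[OF finD k1] obtain d where d: "d \<in> D" "k1 = k(d := k1 d)" "cov sw.E (k d) (k1 d)" by blast
      have ko: "k1 x = k x" if "x \<noteq> d" for x using fun_cong[OF d(2), of x] that by simp
      define e' e where "e' = k d" and "e = k1 d"
      have ee: "cov sw.E e' e" using d(3) by (simp add: e'_def e_def)
      have eE: "e' \<in> sw.E" "e \<in> sw.E" "e' < e" using covD[OF ee] by auto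
      have eB: "e' \<in> B" "e \<in> B" using eE sw.E_A by auto
      obtain a where a: "a \<in> A" "k1 = phi (cst C a)" using step(2)[OF covL(2)[OF k1] covL(3)[OF k1]] by blast
      have t: "sw.full_edge e' e"
      proof (rule ccontr)
        assume "\<not> ?thesis"
        then obtain al where "sw.bare_edge e' e al" using sw.edge_types[OF pD pC ee] by blast
        then have "oiso D C" unfolding sw.bare_edge_def oiso_def by blast
        then show False using no oiso_sym by blast
      qed
      have two: "G c b = sw.j e' \<or> G c b = sw.j e" if "b \<in> B" "e' \<le> b" "b \<le> e" "c \<in> C" for c b
        using t that unfolding sw.full_edge_def by blast
      have psk: "psi k \<in> pw C A" by (rule psi_in[OF kB])
      have psi_k1: "psi k1 = cst C a" using a psi_phi by simp
      have le: "psi k \<le> cst C a" using psi_mono[OF kB k1B covL(4)[OF k1]] psi_k1 by simp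
      have le': "psi k c \<le> a" if "c \<in> C" for c using le_funD[OF le, of c] that by simp
      have "(\<Sum>c\<in>C. len A (psi k c) a) = (\<Sum>c\<in>C. len A (psi k c) (cst C a c))" by (intro sum.cong) auto
      also have "\<dots> = (\<Sum>x\<in>D. len B (k x) (k1 x))"
        using phi_sum[OF psk cst_pw[OF a(1)] le] phi_psi[OF kB] a(2) by simp
      also have "\<dots> = (\<Sum>x\<in>D. if x = d then len B e' e else 0)"
        using ko pwD[OF kB] finB by (intro sum.cong) (auto simp: e'_def e_def)
      also have "\<dots> = len B e' e" using d(1) finD by simp
      also have "\<dots> \<le> card C" by (rule sw.E_interval_len[OF eE two])
      finally have sum: "(\<Sum>c\<in>C. len A (psi k c) a) \<le> card C" .
      have ge1: "1 \<le> len A (psi k c) a" if c: "c \<in> C" for c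
      proof -
        have "sw.j e' < sw.j e" using sw.j_le[OF eE(1,2)] sw.j_inj[OF eE(1,2)] eE(3) by (simp add: order.strict_iff_order)
        then have "G c e' < G c e" using sw.F_j[OF eE(1) c] sw.F_j[OF eE(2) c] by simp
        from sw.cover_jump[OF eB less_imp_le[OF eE(3)] c this] obtain u v where
          uv: "cov B u v" "e' \<le> u" "v \<le> e" "G c u < G c v" by blast
        obtain y where y: "y \<in> D" "sw.lab u v y = c" using sw.F_eq_iff_label[OF uv(1) c] uv(4) by blast
        have "\<not> oisoon (sw.lab u v) D C" using no oiso_sym unfolding oiso_def by blast
        then have lab: "sw.lab u v d = c" using sw.classify[OF uv(1)] y d(1) by metis
        have up: "k(d := w) \<in> pw D B" if "w \<in> B" "e' \<le> w" "w \<le> e" for w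
        proof (rule pw_upd[OF kB d(1) that(1)])
          fix x assume "x \<in> D" "x < d"
          then show "k x \<le> w" using pwM[OF kB, of x d] d(1) that(2) unfolding e'_def by (metis less_imp_le order_trans)
        next
          fix x assume "x \<in> D" "d < x"
          then show "w \<le> k x" using pwM[OF k1B, of d x] ko[of x] d(1) that(3) unfolding e_def by (metis less_imp_le less_irrefl order_trans)
        qed
        have wu: "k(d := u) \<in> pw D B" "k(d := v) \<in> pw D B"
          using up covL[OF uv(1)] uv by (auto intro: order_trans)
        have "cov A (psi (k(d := u)) c) (psi (k(d := v)) c)"
          using sw.lab_cov(2)[of "k(d := u)" d v] wu uv(1) lab by simp
        then have "psi (k(d := u)) c < psi (k(d := v)) c" by (rule covL(3))
        moreover have "psi k \<le> psi (k(d := u))" 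
          by (rule psi_mono[OF kB wu(1)], rule le_upd) (use uv(2) in \<open>simp add: e'_def\<close>)
        moreover have "psi (k(d := v)) \<le> psi k1"
          by (rule psi_mono[OF wu(2) k1B], rule upd_le[OF covL(4)[OF k1]]) (use uv(3) in \<open>simp add: e_def\<close>)
        ultimately have "psi k c < a" using psi_k1 c by (metis cst_ap le_funD order.strict_trans1 order.strict_trans2)
        then show ?thesis using len_pos[OF finA pwD[OF psk c] a(1)] by simp
      qed
      have "len A (psi k c) a = 1" if "c \<in> C" for c
        by (rule sum_le_eq[of C "\<lambda>_. 1", symmetric, OF finC ge1 _ that]) (use sum in auto)
      from len_const[OF psk a(1) le' this] obtain a' where "a' \<in> A" "psi k = cst C a'" by blast
      then show ?thesis using phi_psi[OF kB] by metis
    qed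
  qed
qed

lemma card_len_E:
  assumes "card C = card D" "s \<in> E" "e \<in> E" "s \<le> e"
  shows "len B (j s) (j e) = len A s e"
proof -
  have "card D * len B (j s) (j e) = card C * len A s e"
    using F_sum[OF E_A[OF assms(2)] E_A[OF assms(3)] assms(4)] F_j[OF assms(2)] F_j[OF assms(3)] by simp
  then show ?thesis using assms(1) finD neD by (simp add: card_gt_0_iff)
qed

end

context prime_top_biexp
begin

lemma iso_label_bare_edge:
  assumes cv: "cov A u v" and o: "oisoon (lab u v) C D"
  shows "\<exists>c1 d1 k x s e al. c1 \<in> C \<and> d1 \<in> D \<and> XE k x \<and> s = x (T c1 d1 u) \<and> cov E s e \<and> e \<le> x (T c1 d1 v) \<and> bare_edge s e al"
proof -
  obtain y d1 where d1: "y \<in> D" "d1 \<in> D" "\<not> y \<le> d1" using prime_two[OF pD] by blast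
  have "F d1 u < F d1 v" using F_eq_iff_label[OF cv d1(2)] oisoonD(3)[OF o d1(2)] by blast
  from ex_edge[OF covL(1,2,4)[OF cv] d1(2) this] obtain c1 k x s e where
    z: "c1 \<in> C" "XE k x" "s = x (T c1 d1 u)" "cov E s e" "e \<le> x (T c1 d1 v)" by blast
  have se: "s \<in> E" "e \<in> E" "s < e" using covD[OF z(4)] by auto
  have "\<not> full_edge s e"
  proof
    assume t: "full_edge s e"
    obtain w where w: "w \<in> C" "lab u v w = y" using oisoonD(3)[OF o d1(1)] by blast
    have "lab u v w \<le> d1" by (rule label_bound(1)[OF cv z(2,1) d1(2) se _ z(5) w(1) t]) (simp add: z(3))
    then show False using w(2) d1(3) by simp
  qed
  then show ?thesis using edge_types[OF pC pD z(4)] z d1(2) by blast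
qed

text \<open>
  The map \<open>c \<mapsto> F (th c) a\<close> is moved to \<open>A\<^sup>C\<close> through \<open>th\<close> and \<open>j\<close>, and the claim is that its image in \<open>B\<^sup>D\<close> is
  constant. Downward induction over \<open>a\<close>: the total distance from the known constant map is \<open>card D\<close>, and every coordinate \<open>d\<close>
  contributes at least one because some cover in the gap has label \<open>d\<close>.
\<close>

lemma star:
  assumes th: "oisoon th C D" and a: "a \<in> A"
  shows "\<exists>b\<in>B. \<forall>c\<in>C. G c b = sw.j (F (th c) a)"
proof -
  have cCD: "card C = card D" using oiso_card[of C D] th by (auto simp: oiso_def)
  have cC2: "2 \<le> card C" using pC by (simp add: prime_def)
  define f where "f a = (\<lambda>c\<in>C. sw.j (F (th c) a))" for a
  have thD: "th c \<in> D" if "c \<in> C" for c using oisoonD(1)[OF th that] .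
  have fE: "f a c \<in> E" if "a \<in> A" "c \<in> C" for a c
    using sw.jE_in[OF key[OF that(1) thD[OF that(2)]]] that by (simp add: f_def)
  have jf: "j (f a c) = F (th c) a" if "a \<in> A" "c \<in> C" for a c
    using sw.swj_j[OF key[OF that(1) thD[OF that(2)]]] that by (simp add: f_def)
  have fpw: "f a \<in> pw C A" if "a \<in> A" for a
  proof (rule pwI)
    fix x y assume xy: "x \<in> C" "y \<in> C" "x \<le> y"
    then show "f a x \<le> f a y"
      using sw.j_le[OF key[OF that thD[OF xy(1)]] key[OF that thD[OF xy(2)]]] F_mono2[OF that thD[OF xy(1)] thD[OF xy(2)]]
        oisoonD(2)[OF th xy(1,2)] by (simp add: f_def)
  qed (use fE[OF that] E_A in \<open>auto simp: f_def\<close>)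
  have fle: "f a' c \<le> f a c" if "a' \<in> A" "a \<in> A" "a' \<le> a" "c \<in> C" for a' a c
    using j_le[OF fE[OF that(1,4)] fE[OF that(2,4)]] jf that F_mono[OF that(1-3)] by simp
  have "\<exists>b\<in>B. phi (f a) = cst D b"
    using finA a
  proof (induction rule: down_induct)
    case (step a')
    show ?case
    proof (cases "a' = tA")
      case True
      have "f tA = cst C tA" unfolding f_def cst_def by (rule restrict_ext) (simp add: thD sw.j_top)
      then show ?thesis using True phi_top tB by metis
    next
      case False
      then have "a' < tA" using leA[OF step(1)] by (simp add: order.strict_iff_order)
      from cov_above[OF finA step(1) tA this] obtain a where cv: "cov A a' a" by blast
      have aA: "a \<in> A" "a' \<le> a" using covL[OF cv] by auto
      obtain b where b: "b \<in> B" "phi (f a) = cst D b" using step(2)[OF aA(1) covL(3)[OF cv]] by blast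
      let ?k = "phi (f a')"
      have k: "?k \<in> pw D B" by (rule phi_in[OF fpw[OF step(1)]])
      have ff: "f a' \<le> f a" using pw_le[OF fpw[OF step(1)] fpw[OF aA(1)]] fle[OF step(1) aA] by blast
      have kb: "?k d \<le> b" if "d \<in> D" for d
        using le_funD[OF phi_mono[OF fpw[OF step(1)] fpw[OF aA(1)] ff], of d] b(2) that by simp
      \<comment> \<open>inserting a cover into the gap at c raises the value at its label\<close>
      have ins: "1 \<le> len B (?k d) b"
        if c: "c \<in> C" and uv: "cov A u v" "f a' c \<le> u" "v \<le> f a c" and l: "lab u v c = d"
          and g: "g \<in> pw C A" "f a' \<le> g" "g(c := v) \<le> f a" "g(c := u) \<in> pw C A" "g(c := v) \<in> pw C A" "f a' \<le> g(c := u)"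
          and d: "d \<in> D" for c u v d g
      proof -
        have "cov B (phi (g(c := u)) d) (phi (g(c := v)) d)"
          using lab_cov(2)[of "g(c := u)" c v] g uv(1) l by simp
        then have "phi (g(c := u)) d < phi (g(c := v)) d" by (rule covL(3))
        moreover have "?k d \<le> phi (g(c := u)) d" by (rule le_funD[OF phi_mono[OF fpw[OF step(1)] g(4,6)]])
        moreover have "phi (g(c := v)) d \<le> phi (f a) d" by (rule le_funD[OF phi_mono[OF g(5) fpw[OF aA(1)] g(3)]])
        ultimately have "?k d < phi (f a) d" by (meson order.strict_trans1 order.strict_trans2)
        then have "?k d < b" using b(2) d by simp
        then show ?thesis using len_pos[OF finB pwD[OF k d] b(1)] by simp
      qed
      have sum: "(\<Sum>d\<in>D. len B (?k d) b) = (\<Sum>c\<in>C. len A (f a' c) (f a c))"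
      proof -
        have "(\<Sum>d\<in>D. len B (?k d) b) = (\<Sum>d\<in>D. len B (?k d) (phi (f a) d))"
          using b(2) by (intro sum.cong) auto
        then show ?thesis using phi_sum[OF fpw[OF step(1)] fpw[OF aA(1)] ff] by simp
      qed
      have "(\<Sum>d\<in>D. len B (?k d) b) = card D \<and> (\<forall>d\<in>D. 1 \<le> len B (?k d) b)"
      proof (cases "oisoon (lab a' a) C D")
        case True
        note o = True
        have one: "cov A (f a' c) (f a c)" if c: "c \<in> C" for c
        proof -
          have cb: "cov B (F (th c) a') (F (th c) a)" by (rule key_iso(2)[OF cv key[OF aA(1)] o thD[OF c]])
          have "len A (f a' c) (f a c) = 1"
            using card_len_E[OF cCD fE[OF step(1) c] fE[OF aA(1) c] fle[OF step(1) aA c]] jf[OF step(1) c] jf[OF aA(1) c]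
              len_cov[OF finB cb] by simp
          moreover have "f a' c \<noteq> f a c" using jf[OF step(1) c] jf[OF aA(1) c] covL(3)[OF cb] by (metis less_irrefl)
          then have "f a' c < f a c" using fle[OF step(1) aA c] by (simp add: order.strict_iff_order)
          ultimately show ?thesis
            using len_one_cov[OF finA pwD[OF fpw[OF step(1)] c] pwD[OF fpw[OF aA(1)] c]] by simp
        qed
        have "(\<Sum>c\<in>C. len A (f a' c) (f a c)) = card C" using len_cov[OF finA one] by simp
        moreover have "1 \<le> len B (?k d) b" if d: "d \<in> D" for d
        proof -
          obtain c where c: "c \<in> C" "lab a' a c = d" using oisoonD(3)[OF o d] by blast
          let ?s = "f a' c" and ?e = "f a c"
          note cv1 = one[OF c(1)]
          have se: "?s \<in> E" "?e \<in> E" "?s < ?e" using fE c step(1) aA covL(3)[OF cv1] by auto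
          have o1: "oisoon (lab ?s ?e) C D" by (rule cover_EE_iso[OF cv1 se(1,2)])
          from iso_label_bare_edge[OF cv1 o1] obtain c1 d1 k x s e al where
            z: "c1 \<in> C" "d1 \<in> D" "XE k x" "s = x (T c1 d1 ?s)" "cov E s e" "e \<le> x (T c1 d1 ?e)" "bare_edge s e al" by blast
          have W: "W k x" using z(3) by (simp add: XE_def)
          have xs: "x (T c1 d1 ?s) = ?s" "x (T c1 d1 ?e) = ?e" using T_E[OF z(1,2)] W_E[OF W] se by auto
          have "e = ?e" using cov_mid[OF cov_E[OF cv1 se(1,2)], of e] z(4,5,6) xs covD[OF z(5)] by (auto simp: less_imp_le)
          then have t: "bare_edge ?s ?e al" using z(4,7) xs by simp
          have al: "oisoon al C D" using t by (simp add: bare_edge_def)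
          have l1: "lab ?s ?e w \<le> al w" if "w \<in> C" for w
            by (rule label_bound(2)[OF cv1 z(3,1,2) se _ _ that t]) (simp_all add: xs)
          have G1: "T c1 (th c) a' = ?s" "T c1 (th c) a = ?e"
            using sw.F_j[OF key[OF step(1) thD[OF c(1)]] z(1)] sw.F_j[OF key[OF aA(1) thD[OF c(1)]] z(1)] c(1)
            by (simp_all add: T_def f_def)
          have l2: "lab a' a w \<le> al w" if "w \<in> C" for w
            by (rule label_bound(2)[OF cv z(3,1) thD[OF c(1)] se _ _ that t]) (simp_all add: G1 W_E[OF W se(1)] W_E[OF W se(2)])
          have "lab ?s ?e c = d"
            using oisoon_le_eq[OF finC o1 al l1 c(1)] oisoon_le_eq[OF finC o al l2 c(1)] c(2) by simp
          moreover define g where "g = (\<lambda>x\<in>C. if c < x then f a x else f a' x)"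
          have gpw: "g \<in> pw C A"
          proof (rule pwI)
            fix x y assume xy: "x \<in> C" "y \<in> C" "x \<le> y"
            have "f a' x \<le> f a y" using order_trans[OF fle[OF step(1) aA xy(1)] pwM[OF fpw[OF aA(1)] xy]] .
            then show "g x \<le> g y"
              using xy pwM[OF fpw[OF aA(1)] xy] pwM[OF fpw[OF step(1)] xy] by (auto simp: g_def intro: less_le_trans)
          qed (use pwD[OF fpw[OF aA(1)]] pwD[OF fpw[OF step(1)]] in \<open>auto simp: g_def\<close>)
          have gc: "g c = ?s" using c(1) by (simp add: g_def)
          have gs: "g(c := ?s) = g" using gc by auto
          have ge: "g(c := ?e) \<in> pw C A"
          proof (rule pw_upd[OF gpw c(1) pwD[OF fpw[OF aA(1)] c(1)]])
            fix x assume x: "x \<in> C" "x < c"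
            then have "g x = f a' x" by (auto simp: g_def)
            then show "g x \<le> ?e"
              using order_trans[OF fle[OF step(1) aA x(1)] pwM[OF fpw[OF aA(1)] x(1) c(1)]] x(2) by simp
          next
            fix x assume x: "x \<in> C" "c < x"
            then show "?e \<le> g x" using pwM[OF fpw[OF aA(1)] c(1) x(1)] by (simp add: g_def)
          qed
          have fg: "f a' \<le> g" by (subst pw_le[OF fpw[OF step(1)] gpw]) (use fle[OF step(1) aA] in \<open>auto simp: g_def\<close>)
          have gf: "g(c := ?e) \<le> f a"
            by (subst pw_le[OF ge fpw[OF aA(1)]]) (use fle[OF step(1) aA] in \<open>auto simp: g_def\<close>)
          show ?thesis
            by (rule ins[OF c(1) cv1 order_refl order_refl _ gpw fg gf _ ge _ d]) (use calculation gs gpw fg in simp_all)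
        qed
        ultimately show ?thesis using sum cCD by simp
      next
        case False
        then obtain d0 where d0: "d0 \<in> D" "\<And>c. c \<in> C \<Longrightarrow> lab a' a c = d0" using classify[OF cv] by blast
        obtain c0 where c0: "c0 \<in> C" "th c0 = d0" using oisoonD(3)[OF th d0(1)] by blast
        have same: "f a' c = f a c" if "c \<in> C" "c \<noteq> c0" for c
        proof -
          have "th c \<noteq> d0" using oisoonD(5)[OF th that(1) c0(1)] that(2) c0(2) by simp
          then show ?thesis using F_const_label[OF cv d0(2) thD[OF that(1)]] that(1) by (simp add: f_def)
        qed
        let ?s = "f a' c0" and ?e = "f a c0"
        have lE: "len A ?s ?e = card C"
        proof -
          have "len B (F d0 a') (F d0 a) = card C"
            using label_count[OF cv d0(1)] d0(2) by (auto intro: arg_cong[of _ _ card])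
          then show ?thesis
            using card_len_E[OF cCD fE[OF step(1) c0(1)] fE[OF aA(1) c0(1)] fle[OF step(1) aA c0(1)]]
              jf[OF step(1) c0(1)] jf[OF aA(1) c0(1)] c0(2) by simp
        qed
        have sE: "?s \<in> E" "?e \<in> E" using fE c0 step(1) aA by auto
        have "?s \<noteq> ?e" using lE cC2 E_A[OF sE(1)] finA by auto
        then have lt: "?s < ?e" using fle[OF step(1) aA c0(1)] by (simp add: order.strict_iff_order)
        have Fd0: "F d0 a' = j ?s" "F d0 a = j ?e" using jf[OF step(1) c0(1)] jf[OF aA(1) c0(1)] c0(2) by auto
        \<comment> \<open>an intermediate fixed element would be the value of some step map\<close>
        have cE: "cov E ?s ?e"
          unfolding cov_def
        proof (intro conjI ballI impI sE lt)
          fix m assume m: "m \<in> E" "?s \<le> m \<and> m \<le> ?e"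
          show "m = ?s \<or> m = ?e"
          proof (rule ccontr)
            assume no: "\<not> ?thesis"
            let ?h = "(phi (cst C a'))(d0 := j m)"
            have pa: "phi (cst C a') \<in> pw D B" "phi (cst C a) \<in> pw D B" using phi_in step(1) aA by auto
            have jm: "j ?s \<le> j m" "j m \<le> j ?e" using j_le sE m by auto
            have eqo: "phi (cst C a') x = phi (cst C a) x" if "x \<in> D" "x \<noteq> d0" for x
              using F_const_label[OF cv d0(2) that] by (simp add: F_def)
            have at: "phi (cst C a') d0 = j ?s" "phi (cst C a) d0 = j ?e" using Fd0 by (simp_all add: F_def)
            have h: "?h \<in> pw D B"
            proof (rule pw_upd[OF pa(1) d0(1) j_B[OF m(1)]])
              fix x assume "x \<in> D" "x < d0"
              then show "phi (cst C a') x \<le> j m" using pwM[OF pa(1), of x d0] d0(1) at jm(1) by (metis less_imp_le order_trans)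
            next
              fix x assume "x \<in> D" "d0 < x"
              then show "j m \<le> phi (cst C a') x" using pwM[OF pa(2), of d0 x] d0(1) at jm(2) eqo[of x] by (metis less_imp_le less_irrefl order_trans)
            qed
            have h1: "phi (cst C a') \<le> ?h" by (rule le_upd) (simp add: at jm)
            have h2: "?h \<le> phi (cst C a)"
              by (rule upd_le[OF phi_mono]) (use step(1) aA at jm cst_le[OF neC] in auto)
            let ?p = "psi ?h"
            have p: "?p \<in> pw C A" by (rule psi_in[OF h])
            have "cst C a' \<le> ?p" "?p \<le> cst C a"
              using sw.psi_le_phi[OF h cst_pw[OF step(1)]] h1 sw.phi_le_psi[OF h cst_pw[OF aA(1)]] h2
                phi_le_psi[OF cst_pw[OF step(1)] h] psi_le_phi[OF cst_pw[OF aA(1)] h] by auto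
            then have bt: "a' \<le> ?p c" "?p c \<le> a" if "c \<in> C" for c
              using le_funD[of "cst C a'" ?p c] le_funD[of ?p "cst C a" c] that by auto
            have pv: "?p c = a' \<or> ?p c = a" if "c \<in> C" for c
              using cov_mid[OF cv pwD[OF p that] bt[OF that]] .
            let ?U = "{c \<in> C. ?p c = a}"
            have U: "upset C ?U"
              unfolding upset_def
            proof (intro conjI ballI impI)
              fix x y assume "x \<in> ?U" "y \<in> C" "x \<le> y"
              then show "y \<in> ?U" using pwM[OF p, of x y] bt[of y] by (auto intro: antisym)
            qed auto
            have pst: "?p = step a' a ?U"
              by (rule pw_eqI[OF p step_pw[OF step(1) aA U]]) (use pv in \<open>auto simp: step_def\<close>)
            have hst: "phi (step a' a ?U) d0 = j m" using phi_psi[OF h] pst by (metis fun_upd_same)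
            have "?U \<noteq> {}"
            proof
              assume e: "?U = {}"
              have "j m = j ?s" using hst unfolding e step_empty at by simp
              then show False using no j_inj[OF m(1) sE(1)] by simp
            qed
            then obtain c where c: "c \<in> ?U" by blast
            have "G c (j m) = G c (F d0 a)" using key_const(2)[OF cv key[OF aA(1)] d0 U c] hst by simp
            then have "m = ?e" using G_j[OF m(1)] G_j[OF sE(2)] Fd0 c by auto
            then show False using no by simp
          qed
        qed
        have notriv: "\<not> bare_edge ?s ?e al" for al
        proof
          assume t: "bare_edge ?s ?e al"
          have "cov A ?s ?e" unfolding cov_def using t E_A sE lt unfolding bare_edge_def by blast
          then show False using len_cov[OF finA] lE cC2 by fastforce
        qed
        have "(\<Sum>c\<in>C. len A (f a' c) (f a c)) = (\<Sum>c\<in>C. if c = c0 then card C else 0)"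
          using same lE pwD[OF fpw[OF aA(1)]] finA by (intro sum.cong) auto
        also have "\<dots> = card C" using c0(1) finC by simp
        finally have "(\<Sum>c\<in>C. len A (f a' c) (f a c)) = card C" .
        moreover have "1 \<le> len B (?k d) b" if d: "d \<in> D" for d
        proof -
          have "F d ?s < F d ?e" using F_j[OF sE(1) d] F_j[OF sE(2) d] j_le[OF sE] j_inj[OF sE] lt
            by (simp add: order.strict_iff_order)
          from cover_jump[OF E_A[OF sE(1)] E_A[OF sE(2)] less_imp_le[OF lt] d this] obtain u v where
            uv: "cov A u v" "?s \<le> u" "v \<le> ?e" "F d u < F d v" by blast
          have uvA: "u \<in> A" "v \<in> A" "u \<le> v" using covL[OF uv(1)] by auto
          have "\<not> oisoon (lab u v) C D"
          proof
            assume "oisoon (lab u v) C D"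
            from iso_label_bare_edge[OF uv(1) this] obtain c1 d1 k x s e al where
              z: "c1 \<in> C" "d1 \<in> D" "XE k x" "s = x (T c1 d1 u)" "cov E s e" "e \<le> x (T c1 d1 v)" "bare_edge s e al" by blast
            have W: "W (Suc 0 + k) (\<lambda>a. x (T c1 d1 a))" using XE_comp[OF W_T[OF z(1,2)] z(3)] by (simp add: XE_def)
            have "?s \<le> s" using W_mono[OF W E_A[OF sE(1)] uvA(1) uv(2)] W_E[OF W sE(1)] z(4) by simp
            moreover have "e \<le> ?e" using W_mono[OF W uvA(2) E_A[OF sE(2)] uv(3)] W_E[OF W sE(2)] z(6) by simp
            ultimately have "s = ?s" "e = ?e"
              using cov_mid[OF cE covL(1)[OF z(5)]] cov_mid[OF cE covL(2)[OF z(5)]] covL(3,4)[OF z(5)]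
              by (metis leD order_trans)+
            then show False using z(7) notriv by blast
          qed
          then obtain d2 where "\<And>c. c \<in> C \<Longrightarrow> lab u v c = d2" using classify[OF uv(1)] by blast
          then have l: "lab u v c0 = d" using F_eq_iff_label[OF uv(1) d] uv(4) c0(1) by metis
          have up: "(f a')(c0 := w) \<in> pw C A" if "w \<in> A" "?s \<le> w" "w \<le> ?e" for w
          proof (rule pw_upd[OF fpw[OF step(1)] c0(1) that(1)])
            fix x assume "x \<in> C" "x < c0"
            then show "f a' x \<le> w" using pwM[OF fpw[OF step(1)], of x c0] c0(1) that(2) by (metis less_imp_le order_trans)
          next
            fix x assume "x \<in> C" "c0 < x"
            then show "w \<le> f a' x" using pwM[OF fpw[OF aA(1)], of c0 x] c0(1) that(3) same[of x] by (metis less_imp_le less_irrefl order_trans)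
          qed
          show ?thesis
            by (rule ins[OF c0(1) uv(1-3) l fpw[OF step(1)] order_refl upd_le[OF ff uv(3)] up up le_upd[of "f a'" c0 u, OF uv(2)] d])
              (use uvA uv in \<open>auto intro: order_trans\<close>)
        qed
        ultimately show ?thesis using sum cCD by simp
      qed
      then have "len B (?k d) b = 1" if "d \<in> D" for d
        using sum_le_eq[of D "\<lambda>_. 1" "\<lambda>d. len B (?k d) b" d] finD that by simp
      from sw.len_const[OF k b(1) kb this] show ?thesis by blast
    qed
  qed
  then obtain b where b: "b \<in> B" "phi (f a) = cst D b" by blast
  have "psi (cst D b) = f a" using psi_phi[OF fpw[OF a]] b(2) by simp
  then have "G c b = f a c" for c by (simp add: sw.F_def)
  then show ?thesis using b(1) by (intro bexI[of _ b]) (simp_all add: f_def)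
qed

text \<open>
  A maximal non-fixed \<open>a\<close> has upper covers with constant labels only, and squares upwards show that the top is its only one. So
  the top has a lower cover with constant label. Squares downwards move such a lower cover from
  the top to \<open>q\<close>, where it would be a cover between fixed elements; but those have labels forming an isomorphism.
  A missing maximum of \<open>D\<close> and a missing minimum of \<open>C\<close> provide the different labels that the squares need.
\<close>

lemma bounded_by_fixed:
  assumes nomax: "\<And>d. d \<in> D \<Longrightarrow> \<exists>y\<in>D. \<not> y \<le> d" and nomin: "\<And>c. c \<in> C \<Longrightarrow> \<exists>x\<in>C. \<not> c \<le> x"
    and q: "q \<in> E" and near: "\<And>a. a \<in> A \<Longrightarrow> a \<le> q \<or> q \<le> a \<Longrightarrow> a \<in> E"
  shows "A = E"
proof (rule ccontr)
  assume "A \<noteq> E"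
  then obtain a0 where "a0 \<in> A - E" using E_A by blast
  from ex_maximal[OF _ this] finA obtain a where a: "a \<in> A" "a \<notin> E" "\<And>y. y \<in> A \<Longrightarrow> a < y \<Longrightarrow> y \<in> E" by auto
  have constE: False if "cov A u v" "u \<in> E" "v \<in> E" "\<And>c. c \<in> C \<Longrightarrow> lab u v c = x" for u v x
  proof -
    obtain y z where yz: "y \<in> C" "z \<in> C" "\<not> y \<le> z" using prime_two[OF pC] by blast
    then show False using oisoonD(2)[OF cover_EE_iso[OF that(1-3)] yz(1,2)] that(4) by simp
  qed
  have labc: "\<exists>x\<in>D. \<forall>c\<in>C. lab a p c = x" if cv: "cov A a p" for p
  proof (rule ccontr)
    assume no: "\<not> ?thesis"
    then have o: "oisoon (lab a p) C D" using classify[OF cv] by blast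
    have pE: "p \<in> E" using a(3) covL[OF cv] by blast
    have one: "len B (F d a) (j p) = 1" if d: "d \<in> D" for d
    proof -
      obtain y where y: "y \<in> C" "lab a p y = d" using oisoonD(3)[OF o d] by blast
      have "{z \<in> C. lab a p z = d} = {y}" using y oisoonD(5)[OF o] by blast
      then show ?thesis using label_count[OF cv d] F_j[OF pE d] by simp
    qed
    have le: "F d a \<le> j p" if "d \<in> D" for d using F_mono[OF a(1) covL(2,4)[OF cv], of d] F_j[OF pE that] by simp
    have "F y a = F z a" if "y \<in> D" "z \<in> D" "y \<le> z" for y z
      by (rule len_eq_imp_eq[OF finB, of _ _ "j p"]) (use that a(1) F_mono2 le one j_B[OF pE] in auto)
    then have "F y a = F z a" if "y \<in> D" "z \<in> D" for y z
      using conn_const[OF conD, of "\<lambda>d. F d a"] that by blast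
    then show False using a(1,2) unfolding E_def by blast
  qed
  have top: "p = tA" if cv: "cov A a p" for p
  proof (rule ccontr)
    assume "p \<noteq> tA"
    then have "p < tA" using leA covL[OF cv] by (simp add: order.strict_iff_order)
    from cov_above[OF finA covL(2)[OF cv] tA this] obtain r where r: "cov A p r" by blast
    have E: "p \<in> E" "r \<in> E" using a(3) covL[OF cv] covL[OF r] by (auto intro: less_trans)
    obtain x where x: "x \<in> D" "\<And>c. c \<in> C \<Longrightarrow> lab a p c = x" using labc[OF cv] by blast
    obtain y where y: "y \<in> D" "\<not> y \<le> x" using nomax[OF x(1)] by blast
    obtain c where c: "c \<in> C" "lab p r c = y" using oisoonD(3)[OF cover_EE_iso[OF r E] y(1)] by blast
    obtain s where s: "s \<noteq> p" "cov A a s" "cov A s r"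
      using chain_square[OF cv r c(1)] c(2) x(2)[OF c(1)] y(2) by auto
    have "lab s r w = x" if "w \<in> C" for w
      using square_lab[OF cv s(2) r s(3) s(1)[symmetric] that] x(2)[OF that] by simp
    then show False using constE[OF s(3) _ E(2)] a(3) covL[OF s(2)] by blast
  qed
  have "a < tA" using leA[OF a(1)] a(2) tA_E by (metis order.not_eq_order_implies_strict)
  from cov_above[OF finA a(1) tA this] top have ct: "cov A a tA" by metis
  let ?S = "{p \<in> A. q \<le> p \<and> (\<exists>w x. cov A w p \<and> (\<forall>c\<in>C. lab w p c = x))}"
  have "finite ?S" "tA \<in> ?S" using finA tA leA[OF E_A[OF q]] ct labc[OF ct] by auto
  from ex_minimal[OF this] obtain p where p: "p \<in> ?S" "\<And>y. y \<in> ?S \<Longrightarrow> \<not> y < p" by blast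
  then obtain w x where w: "cov A w p" "\<And>c. c \<in> C \<Longrightarrow> lab w p c = x" by blast
  have pE: "p \<in> E" using near p(1) by blast
  have "p \<noteq> q"
  proof
    assume "p = q"
    then have "w \<in> E" using near covL[OF w(1)] by blast
    then show False using constE[OF w(1) _ pE w(2)] by blast
  qed
  then have "q < p" using p(1) by (auto simp: order.strict_iff_order)
  from cov_below[OF finA E_A[OF q] _ this] p(1) obtain p1 where p1: "cov A p1 p" "q \<le> p1" by auto
  have p1E: "p1 \<in> E" using near covL[OF p1(1)] p1(2) by blast
  note o = cover_EE_iso[OF p1(1) p1E pE]
  obtain c where c: "c \<in> C" "\<And>y. y \<in> C \<Longrightarrow> \<not> y < c" "lab p1 p c \<noteq> x"
  proof -
    obtain c0 where "c0 \<in> C" using neC by auto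
    from ex_minimal[OF finC this] obtain c1 where c1: "c1 \<in> C" "\<And>y. y \<in> C \<Longrightarrow> \<not> y < c1" by blast
    obtain y where y: "y \<in> C" "\<not> c1 \<le> y" using nomin[OF c1(1)] by blast
    from ex_minimal[OF finC y(1)] obtain c2 where c2: "c2 \<in> C" "c2 \<le> y" "\<And>y. y \<in> C \<Longrightarrow> \<not> y < c2" by blast
    have "lab p1 p c1 \<noteq> lab p1 p c2" using oisoonD(5)[OF o c1(1) c2(1)] y(2) c2(2) by blast
    then show ?thesis using that c1 c2 by metis
  qed
  have ne: "w \<noteq> p1" using w(2)[OF c(1)] c(3) by blast
  obtain u where u: "cov A u w" "cov A u p1"
    using lower_square[OF w(1) p1(1) c(1,2)] w(2)[OF c(1)] c(3) by auto
  have "lab u p1 y = x" if "y \<in> C" for y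
    using square_lab[OF u(2) u(1) p1(1) w(1) ne[symmetric] that] w(2)[OF that] by simp
  then have "p1 \<in> ?S" using u(2) p1 covL[OF p1(1)] by blast
  then show False using p(2) covL(3)[OF p1(1)] by blast
qed

end

section \<open>Above or below a fixed element\<close>

text \<open>
  The order or its converse. The flag allows one argument for the elements above and those below a fixed one.
\<close>

definition cmp :: "bool \<Rightarrow> 'a::order \<Rightarrow> 'a \<Rightarrow> bool" where
  "cmp s x y \<longleftrightarrow> (if s then y \<le> x else x \<le> y)"

lemma cmp_refl [simp]: "cmp s x x" by (simp add: cmp_def)
lemma cmp_trans: "cmp s x y \<Longrightarrow> cmp s y z \<Longrightarrow> cmp s x z" by (auto simp: cmp_def split: if_splits)
lemma cmp_either: "x \<le> y \<or> y \<le> x \<longleftrightarrow> (\<exists>s. cmp s x y)"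
  unfolding cmp_def by (metis (full_types))
lemma cmp_fun: "cmp s f g \<longleftrightarrow> (\<forall>x. cmp s (f x) (g x))" by (auto simp: cmp_def le_fun_def)

lemma prime_dual:
  assumes "prime (S :: 's::order set)"
  shows "prime (dual ` S)"
proof -
  have "card U = 1 \<or> card V = 1" if o: "oiso (dual ` S) (U \<times> V)" for U V :: "'s dual set"
  proof -
    obtain h where h: "oisoon h (dual ` S) (U \<times> V)" using o by (auto simp: oiso_def)
    have "oisoon (\<lambda>s. (undual (fst (h (dual s))), undual (snd (h (dual s))))) S (undual ` U \<times> undual ` V)"
    proof (rule oisoI)
      fix x assume "x \<in> S"
      then show "(undual (fst (h (dual x))), undual (snd (h (dual x)))) \<in> undual ` U \<times> undual ` V"
        using oisoonD(1)[OF h, of "dual x"] by (auto simp: mem_Times_iff)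
    next
      fix x y assume xy: "x \<in> S" "y \<in> S"
      have "dual y \<le> dual x \<longleftrightarrow> h (dual y) \<le> h (dual x)" using oisoonD(2)[OF h, of "dual y" "dual x"] xy by blast
      then show "x \<le> y \<longleftrightarrow> (undual (fst (h (dual x))), undual (snd (h (dual x)))) \<le> (undual (fst (h (dual y))), undual (snd (h (dual y))))"
        by (simp add: less_eq_prod_def dual_less_eq_iff)
    next
      fix t assume "t \<in> undual ` U \<times> undual ` V"
      then obtain u v where t: "t = (undual u, undual v)" "u \<in> U" "v \<in> V" by auto
      then obtain x where "x \<in> S" "h (dual x) = (u, v)" using oisoonD(3)[OF h, of "(u, v)"] by auto
      then show "\<exists>x\<in>S. (undual (fst (h (dual x))), undual (snd (h (dual x)))) = t" using t(1) by (intro bexI[of _ x]) simp_all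
    qed
    then have "card (undual ` U) = 1 \<or> card (undual ` V) = 1" using prime_prod[OF assms] by (auto simp: oiso_def)
    moreover have "card (undual ` W) = card W" for W :: "'s dual set" by (rule card_image) (auto intro: inj_onI dual_eqI)
    ultimately show ?thesis by simp
  qed
  moreover have "card (dual ` S) = card S" by (rule card_image) (auto intro: inj_onI)
  ultimately show ?thesis using assms conn_dual unfolding prime_def by auto
qed

lemma oisoon_dual:
  assumes "oisoon h S T"
  shows "oisoon (\<lambda>x. dual (h (undual x))) (dual ` S) (dual ` T)"
proof (rule oisoI)
  fix t assume "t \<in> dual ` T"
  then show "\<exists>x\<in>dual ` S. dual (h (undual x)) = t" using oisoonD(3)[OF assms] by fastforce
qed (use oisoonD(1,2)[OF assms] in auto)

lemma oiso_dual: "oiso (dual ` S) (dual ` T) \<Longrightarrow> oiso S T"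
proof -
  assume "oiso (dual ` S) (dual ` T)"
  then obtain h where h: "oisoon h (dual ` S) (dual ` T)" by (auto simp: oiso_def)
  have "oisoon (\<lambda>x. undual (h (dual x))) S T"
  proof (rule oisoI)
    fix x assume "x \<in> S" then show "undual (h (dual x)) \<in> T" using oisoonD(1)[OF h, of "dual x"] by (auto simp: dual_img)
  next
    fix x y assume "x \<in> S" "y \<in> S"
    then show "x \<le> y \<longleftrightarrow> undual (h (dual x)) \<le> undual (h (dual y))"
      using oisoonD(2)[OF h, of "dual y" "dual x"] by (simp add: dual_less_eq_iff)
  next
    fix t assume "t \<in> T"
    then obtain x where "x \<in> S" "h (dual x) = dual t" using oisoonD(3)[OF h, of "dual t"] by auto
    then show "\<exists>x\<in>S. undual (h (dual x)) = t" by (intro bexI[of _ x]) simp_all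
  qed
  then show "oiso S T" by (auto simp: oiso_def)
qed

text \<open>
  Neither a least nor a greatest element.
\<close>

definition noext :: "'a::order set \<Rightarrow> bool" where
  "noext S \<longleftrightarrow> (\<forall>m\<in>S. (\<exists>x\<in>S. \<not> m \<le> x) \<and> (\<exists>x\<in>S. \<not> x \<le> m))"

context biexp
begin

lemma dual_j: "e \<in> E \<Longrightarrow> biexp.j (dual ` C) (dual ` D) dphi (dual e) = dual (j e)"
proof -
  assume e: "e \<in> E"
  obtain d where d: "d \<in> D" using neD by auto
  have "biexp.j (dual ` C) (dual ` D) dphi (dual e) = biexp.F (dual ` C) dphi (dual d) (dual e)"
    by (rule biexp.F_j[OF biexp_dual[OF biexp_axioms], symmetric]) (use e d dual_E in auto)
  then show ?thesis using dual_F[OF d] F_j[OF e d] by simp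
qed

lemma dual_below:
  assumes "prime C" "prime D" "e \<in> E"
  shows "prime_top_biexp {x \<in> dual ` A. x \<le> dual e} {y \<in> dual ` B. y \<le> dual (j e)} (dual ` C) (dual ` D) dphi dpsi (dual e) (dual (j e))"
proof -
  have "dual e \<in> biexp.E (dual ` A) (dual ` C) (dual ` D) dphi" unfolding dual_E using assms(3) by simp
  from biexp.top_biexp_below[OF biexp_dual[OF biexp_axioms] this]
  show ?thesis unfolding dual_j[OF assms(3)]
    by (intro prime_top_biexp.intro prime_top_biexp_axioms.intro prime_dual assms)
qed

lemma prime_top_biexp_below: "prime C \<Longrightarrow> prime D \<Longrightarrow> e \<in> E \<Longrightarrow> prime_top_biexp {a \<in> A. a \<le> e} {b \<in> B. b \<le> j e} C D phi psi e (j e)"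
  by (intro prime_top_biexp.intro prime_top_biexp_axioms.intro top_biexp_below)

text \<open>
  \<open>bounded_by_fixed\<close> together with its dual.
\<close>

lemma bounded_cmp:
  assumes p: "prime C" "prime D" and n: "noext C" "noext D"
    and t: "t \<in> A" "\<And>a. a \<in> A \<Longrightarrow> cmp s t a" "u \<in> B" "\<And>b. b \<in> B \<Longrightarrow> cmp s u b"
    and q: "q \<in> E" and near: "\<And>a. a \<in> A \<Longrightarrow> a \<le> q \<or> q \<le> a \<Longrightarrow> a \<in> E"
  shows "A = E"
proof (cases s)
  case True
  interpret r: prime_top_biexp A B C D phi psi t u
    by (intro prime_top_biexp.intro prime_top_biexp_axioms.intro top_biexp.intro top_biexp_axioms.intro biexp_axioms)
      (use True t p in \<open>auto simp: cmp_def\<close>)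
  show ?thesis by (rule r.bounded_by_fixed[OF _ _ q near]) (use n in \<open>auto simp: noext_def\<close>)
next
  case False
  interpret r: prime_top_biexp "dual ` A" "dual ` B" "dual ` C" "dual ` D" dphi dpsi "dual t" "dual u"
    by (intro prime_top_biexp.intro prime_top_biexp_axioms.intro top_biexp.intro top_biexp_axioms.intro biexp_dual[OF biexp_axioms] prime_dual p)
      (use False t in \<open>auto simp: cmp_def dual_img dual_less_eq_iff\<close>)
  have "dual ` A = r.E"
  proof (rule r.bounded_by_fixed)
    show "dual q \<in> r.E" unfolding dual_E using q by simp
  next
    fix a assume "a \<in> dual ` A" "a \<le> dual q \<or> dual q \<le> a"
    then show "a \<in> r.E" unfolding dual_E using near[of "undual a"] by (auto simp: dual_img dual_less_eq_iff)
  next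
    fix d assume "d \<in> dual ` D" then show "\<exists>y\<in>dual ` D. \<not> y \<le> d" using n(2) by (fastforce simp: noext_def)
  next
    fix d assume "d \<in> dual ` C" then show "\<exists>y\<in>dual ` C. \<not> d \<le> y" using n(1) by (fastforce simp: noext_def)
  qed
  then show ?thesis unfolding dual_E by (simp add: inj_image_eq_iff[OF inj_dual])
qed

end

text \<open>
  The situation of the theorem for prime exponents.
\<close>

locale prime_biexp = biexp A B C D phi psi
  for A :: "'a::order set" and B :: "'b::order set" and C :: "'c::order set" and D :: "'d::order set" and phi psi +
  assumes pC: "prime C" and pD: "prime D" and neA: "A \<noteq> {}" and conP: "conn (pw C A)"
begin

lemma gswap: "prime_biexp B A D C psi phi"
proof (intro prime_biexp.intro prime_biexp_axioms.intro pC pD swap)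
  obtain a d where "a \<in> A" "d \<in> D" using neA neD by auto
  from F_in[OF this(2,1)] show "B \<noteq> {}" by auto
  have "oisoon phi (pw C A) (pw D B)"
    by (rule oisoI) (use phi_in phi_le psi_in phi_psi in blast)+
  then show "conn (pw D B)" using conn_oiso[OF conP] unfolding oiso_def by blast
qed

lemma conA: "conn A" by (rule conn_base[OF conP neC])

end

sublocale prime_biexp \<subseteq> sw: prime_biexp B A D C psi phi by (rule gswap)

context prime_biexp
begin

lemma ex_E: "\<exists>e. e \<in> E" using E_nonempty[OF neA] by auto

lemma near_key:
  assumes e: "e \<in> E" and a: "a \<in> A" and cm: "cmp s e a" and d: "d \<in> D"
  shows "F d a \<in> sw.E"
proof (cases s)
  case True
  interpret r: prime_top_biexp "{a \<in> A. a \<le> e}" "{b \<in> B. b \<le> j e}" C D phi psi e "j e" by (rule prime_top_biexp_below[OF pC pD e])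
  have "F d a \<in> r.sw.E" by (rule r.key[OF _ d]) (use a cm True in \<open>simp add: cmp_def\<close>)
  then show ?thesis unfolding r.sw.E_def sw.E_def by blast
next
  case False
  interpret r: prime_top_biexp "{x \<in> dual ` A. x \<le> dual e}" "{y \<in> dual ` B. y \<le> dual (j e)}" "dual ` C" "dual ` D" dphi dpsi "dual e" "dual (j e)"
    by (rule dual_below[OF pC pD e])
  have "r.F (dual d) (dual a) \<in> r.sw.E" by (rule r.key) (use a cm d False in \<open>simp_all add: cmp_def\<close>)
  then have "r.F (dual d) (dual a) \<in> biexp.E (dual ` B) (dual ` D) (dual ` C) dpsi"
    unfolding r.sw.E_def biexp.E_def[OF biexp_dual[OF sw.biexp_axioms]] by blast
  then show ?thesis unfolding sw.dual_E dual_F[OF d] by auto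
qed

lemma near_surj:
  assumes no: "\<not> oiso C D" and e: "e \<in> E" and k: "k \<in> pw D sw.E" and cm: "\<And>d. d \<in> D \<Longrightarrow> cmp s (j e) (k d)"
  shows "\<exists>a\<in>A. k = phi (cst C a)"
proof (cases s)
  case True
  interpret r: prime_top_biexp "{a \<in> A. a \<le> e}" "{b \<in> B. b \<le> j e}" C D phi psi e "j e" by (rule prime_top_biexp_below[OF pC pD e])
  have "k \<in> pw D r.sw.E"
  proof (rule pw_sub[OF k])
    fix d assume d: "d \<in> D"
    have "k d \<in> sw.E" "k d \<le> j e" using pwD[OF k d] cm[OF d] True by (simp_all add: cmp_def)
    then show "k d \<in> r.sw.E" unfolding r.sw.E_def sw.E_def by blast
  qed
  from r.surj[OF no this] show ?thesis by blast
next
  case False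
  interpret r: prime_top_biexp "{x \<in> dual ` A. x \<le> dual e}" "{y \<in> dual ` B. y \<le> dual (j e)}" "dual ` C" "dual ` D" dphi dpsi "dual e" "dual (j e)"
    by (rule dual_below[OF pC pD e])
  have kB: "k \<in> pw D B" using k pw_mono[of sw.E B D] sw.E_A by auto
  have "dfun D k \<in> pw (dual ` D) r.sw.E"
  proof (rule pw_sub[OF dfun_pw[OF kB]])
    fix c assume "c \<in> dual ` D"
    then obtain d where d: "d \<in> D" "c = dual d" by auto
    have "dual (k d) \<in> biexp.E (dual ` B) (dual ` D) (dual ` C) dpsi" unfolding sw.dual_E using pwD[OF k d(1)] by simp
    moreover have "dual (k d) \<le> dual (j e)" using cm[OF d(1)] False by (simp add: cmp_def)
    ultimately have "dual (k d) \<in> r.sw.E"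
      unfolding r.sw.E_def biexp.E_def[OF biexp_dual[OF sw.biexp_axioms]] by blast
    then show "dfun D k c \<in> r.sw.E" using d by (simp add: dfun_ap)
  qed
  moreover have "\<not> oiso (dual ` C) (dual ` D)" using no oiso_dual by blast
  ultimately obtain a where a: "a \<in> dual ` A" "dfun D k = dphi (cst (dual ` C) a)" using r.surj by blast
  have aA: "undual a \<in> A" using a(1) by (simp add: dual_img)
  have "ufun D (dfun D k) = ufun D (dfun D (phi (cst C (undual a))))" using a(2) by (simp add: ufun_cst)
  then have "k = phi (cst C (undual a))" using ufun_dfun[OF kB] ufun_dfun[OF phi_in[OF cst_pw[OF aA]]] by simp
  then show ?thesis using aA by blast
qed

lemma near_star:
  assumes th: "oisoon th C D" and e: "e \<in> E" and a: "a \<in> A" and cm: "cmp s e a"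
  shows "\<exists>b\<in>B. cmp s (j e) b \<and> (\<forall>c\<in>C. G c b = sw.j (F (th c) a))"
proof (cases s)
  case True
  interpret r: prime_top_biexp "{a \<in> A. a \<le> e}" "{b \<in> B. b \<le> j e}" C D phi psi e "j e" by (rule prime_top_biexp_below[OF pC pD e])
  have "\<exists>b\<in>{b \<in> B. b \<le> j e}. \<forall>c\<in>C. G c b = sw.j (F (th c) a)" by (rule r.star[OF th]) (use a cm True in \<open>simp add: cmp_def\<close>)
  then show ?thesis using True by (auto simp: cmp_def)
next
  case False
  interpret r: prime_top_biexp "{x \<in> dual ` A. x \<le> dual e}" "{y \<in> dual ` B. y \<le> dual (j e)}" "dual ` C" "dual ` D" dphi dpsi "dual e" "dual (j e)"
    by (rule dual_below[OF pC pD e])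
  have "dual a \<in> {x \<in> dual ` A. x \<le> dual e}" using a cm False by (simp add: cmp_def)
  from r.star[OF oisoon_dual[OF th] this] obtain b where
    b: "b \<in> dual ` B" "b \<le> dual (j e)" "\<forall>c\<in>dual ` C. r.G c b = r.sw.j (r.F (dual (th (undual c))) (dual a))" by blast
  have "G c (undual b) = sw.j (F (th c) a)" if c: "c \<in> C" for c
  proof -
    have thc: "th c \<in> D" by (rule oisoonD(1)[OF th c])
    have "dual (G c (undual b)) = r.G (dual c) b" using sw.dual_F[OF c] by simp
    also have "\<dots> = r.sw.j (r.F (dual (th c)) (dual a))" using b(3) c by simp
    also have "\<dots> = dual (sw.j (F (th c) a))"
      using sw.dual_j[OF near_key[OF e a cm thc]] by (simp add: dual_F[OF thc])
    finally show ?thesis by simp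
  qed
  moreover have "undual b \<in> B" "j e \<le> undual b" using b by (auto simp: dual_img dual_less_eq_iff)
  ultimately show ?thesis using False by (auto simp: cmp_def)
qed

end

context prime_biexp
begin

text \<open>
  If \<open>m\<close> is, say, the greatest element of \<open>D\<close>, then \<open>a\<close> lies below every \<open>G c (F m a)\<close>. This element is fixed as soon as \<open>F m a\<close> is
  comparable to a fixed element, so being below a fixed element spreads along comparabilities.
\<close>

lemma near_extremal:
  assumes ext: "\<not> noext D" and a: "a \<in> A"
  shows "\<exists>e\<in>E. \<exists>s. cmp s e a"
proof -
  obtain m s where m: "m \<in> D" "\<And>x. x \<in> D \<Longrightarrow> cmp s m x"
  proof -
    obtain m where "m \<in> D" "(\<forall>x\<in>D. m \<le> x) \<or> (\<forall>x\<in>D. x \<le> m)" using ext unfolding noext_def by blast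
    then show ?thesis using that[of m True] that[of m False] unfolding cmp_def by auto
  qed
  have stp: "\<exists>e\<in>E. cmp s e a1" if a1: "a1 \<in> A" "a0 \<in> A" "e \<in> E" "cmp s e a0" "a0 \<le> a1 \<or> a1 \<le> a0" for a0 a1 e
  proof (cases "cmp s a0 a1")
    case True
    then show ?thesis using cmp_trans[OF a1(4) True] a1(3) by blast
  next
    case False
    then have cm: "cmp s a1 a0" using a1(5) by (auto simp: cmp_def)
    have y: "F m a0 \<in> sw.E" by (rule near_key[OF a1(3,2,4) m(1)])
    have Fm: "cmp s (F m a1) (F m a0)" using cm F_mono[OF a1(1,2), of m] F_mono[OF a1(2,1), of m] by (auto simp: cmp_def split: if_splits)
    have FB: "F m a1 \<in> B" using m(1) a1(1) by simp
    have "\<exists>s'. cmp s' (F m a0) (F m a1)" using Fm by (auto simp: cmp_def intro: exI[of _ "\<not> s"] split: if_splits)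
    then have GE: "G c (F m a1) \<in> E" if "c \<in> C" for c using sw.near_key[OF y FB _ that] by blast
    obtain c where c: "c \<in> C" using neC by auto
    let ?q = "G c (F m a1)"
    have "cmp s (F m a1) (F d a1)" if "d \<in> D" for d
      using F_mono2[OF a1(1) m(1) that] F_mono2[OF a1(1) that m(1)] m(2)[OF that] by (auto simp: cmp_def split: if_splits)
    then have "cmp s (phi (psi (cst D (F m a1)))) (phi (cst C a1))"
      using pw_le[OF phi_in[OF cst_pw[OF a1(1)]] cst_pw[OF FB]] pw_le[OF cst_pw[OF FB] phi_in[OF cst_pw[OF a1(1)]]]
      unfolding phi_psi[OF cst_pw[OF FB]] by (cases s) (simp_all add: cmp_def F_def)
    then have "cmp s (psi (cst D (F m a1))) (cst C a1)"
      using phi_le[OF psi_in[OF cst_pw[OF FB]] cst_pw[OF a1(1)]] phi_le[OF cst_pw[OF a1(1)] psi_in[OF cst_pw[OF FB]]]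
      by (simp add: cmp_def split: if_splits)
    then have "cmp s ?q a1" using c by (auto simp: cmp_fun sw.F_def dest: spec[of _ c])
    then show ?thesis using GE[OF c] by blast
  qed
  obtain e where e: "e \<in> E" using ex_E by blast
  have "\<exists>e\<in>E. cmp s e a"
  proof (rule connD[OF conA E_A[OF e], of "\<lambda>a. \<exists>e\<in>E. cmp s e a"])
    show "\<exists>e'\<in>E. cmp s e' e" using e by (intro bexI[of _ e]) simp_all
    show "(\<exists>e\<in>E. cmp s e y) = (\<exists>e\<in>E. cmp s e z)" if "y \<in> A" "z \<in> A" "y \<le> z" for y z
      using stp[OF that(1,2)] stp[OF that(2,1)] that(3) by blast
  qed (rule a)
  then show ?thesis by blast
qed

lemma power_of_surj:
  assumes key: "\<And>a d. a \<in> A \<Longrightarrow> d \<in> D \<Longrightarrow> F d a \<in> sw.E"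
    and surj: "\<And>k. k \<in> pw D sw.E \<Longrightarrow> \<exists>a\<in>A. k = phi (cst C a)"
  shows "oiso A (pw D sw.E)"
  unfolding oiso_def
proof (intro exI oisoI)
  fix x assume x: "x \<in> A"
  show "phi (cst C x) \<in> pw D sw.E" by (rule pw_sub[OF phi_in[OF cst_pw[OF x]]]) (use key[OF x] in \<open>simp add: F_def\<close>)
  fix y assume y: "y \<in> A"
  show "x \<le> y \<longleftrightarrow> phi (cst C x) \<le> phi (cst C y)" using phi_le x y cst_le[OF neC, of x y] by simp
next
  fix t assume "t \<in> pw D sw.E" then show "\<exists>x\<in>A. phi (cst C x) = t" using surj by metis
qed

text \<open>
  A map into the fixed elements is comparable to the constant map given by its value at the extremal element.
\<close>

lemma power_ext:
  assumes no: "\<not> oiso C D" and ext: "\<not> noext D"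
  shows "oiso A (pw D sw.E)"
proof (rule power_of_surj)
  fix a d assume "a \<in> A" "d \<in> D"
  then show "F d a \<in> sw.E" using near_extremal[OF ext] near_key by blast
next
  fix k assume k: "k \<in> pw D sw.E"
  obtain m where m: "m \<in> D" "(\<forall>x\<in>D. m \<le> x) \<or> (\<forall>x\<in>D. x \<le> m)" using ext unfolding noext_def by blast
  have "k m \<in> sw.E" using pwD[OF k m(1)] .
  then have e: "sw.j (k m) \<in> E" "j (sw.j (k m)) = k m" using sw.jE_in sw.swj_j by auto
  from m(2) show "\<exists>a\<in>A. k = phi (cst C a)"
  proof
    assume "\<forall>x\<in>D. m \<le> x"
    then show ?thesis using near_surj[OF no e(1) k, of False] pwM[OF k m(1)] by (simp add: e(2) cmp_def)
  next
    assume "\<forall>x\<in>D. x \<le> m"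
    then show ?thesis using near_surj[OF no e(1) k, of True] pwM[OF k _ m(1)] by (simp add: e(2) cmp_def)
  qed
qed

end

lemma biexp_of_iso:
  assumes "finite A" "finite B" "finite C" "finite D" "C \<noteq> {}" "D \<noteq> {}" "conn C" "conn D"
    and h: "oisoon h (pw C A) (pw D B)"
  shows "biexp A B C D h (the_inv_into (pw C A) h)"
proof -
  let ?g = "the_inv_into (pw C A) h"
  have b: "bij_betw h (pw C A) (pw D B)" by (rule oisoonD(4)[OF h])
  note g = oisoon_inv[OF h]
  show ?thesis
  proof (intro biexp.intro assms(1-8))
    show "h f \<in> pw D B" if "f \<in> pw C A" for f by (rule oisoonD(1)[OF h that])
    show "?g f \<in> pw C A" if "f \<in> pw D B" for f by (rule oisoonD(1)[OF g that])
    show "?g (h f) = f" if "f \<in> pw C A" for f using b that by (simp add: bij_betw_def the_inv_into_f_f)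
    show "h (?g f) = f" if "f \<in> pw D B" for f using b that by (simp add: bij_betw_def f_the_inv_into_f)
    show "h f \<le> h f'" if "f \<in> pw C A" "f' \<in> pw C A" "f \<le> f'" for f f' using oisoonD(2)[OF h that(1,2)] that(3) by simp
    show "?g f \<le> ?g f'" if "f \<in> pw D B" "f' \<in> pw D B" "f \<le> f'" for f f' using oisoonD(2)[OF g that(1,2)] that(3) by simp
  qed
qed

lemma cmp_ap: "cmp s f g \<Longrightarrow> cmp s (f x) (g x)" by (simp add: cmp_fun)

section \<open>Spreading away from the fixed elements\<close>

context prime_biexp
begin

text \<open>
  The description of \<open>A\<close> by maps into fixed elements holds for everything comparable to \<open>a\<close>.
\<close>

definition far :: "'a \<Rightarrow> bool" where
  "far a \<longleftrightarrow> a \<in> A \<and> (\<forall>a1\<in>A. a1 \<le> a \<or> a \<le> a1 \<longrightarrow> (\<forall>d\<in>D. F d a1 \<in> sw.E)) \<and>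
     (\<forall>k\<in>pw D sw.E. k \<le> phi (cst C a) \<or> phi (cst C a) \<le> k \<longrightarrow> (\<exists>a1\<in>A. k = phi (cst C a1)))"

lemma far_E:
  assumes no: "\<not> oiso C D" and e: "e \<in> E"
  shows "far e"
  unfolding far_def
proof (intro conjI ballI impI)
  fix a d assume "a \<in> A" "a \<le> e \<or> e \<le> a" "d \<in> D"
  then show "F d a \<in> sw.E" using near_key[OF e, of a] cmp_either by blast
next
  fix k assume k: "k \<in> pw D sw.E" "k \<le> phi (cst C e) \<or> phi (cst C e) \<le> k"
  then obtain s where "cmp s (phi (cst C e)) k" using cmp_either by blast
  then have "cmp s (j e) (k d)" if "d \<in> D" for d
    using cmp_ap[of s _ k d] that unfolding phi_E[OF e] by fastforce
  then show "\<exists>a\<in>A. k = phi (cst C a)" by (rule near_surj[OF no e k(1)])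
qed (rule E_A[OF e])

lemma cmp_phi: "f \<in> pw C A \<Longrightarrow> g \<in> pw C A \<Longrightarrow> cmp s (phi f) (phi g) \<longleftrightarrow> cmp s f g"
  using phi_le by (simp add: cmp_def)

lemma cmp_cst: "cmp s (cst C a) (cst C (a'::'x::order)) \<longleftrightarrow> cmp s a a'"
  using cst_le[OF neC, of a a'] cst_le[OF neC, of a' a] by (simp add: cmp_def)

lemma cmp_pw: "f \<in> pw C S \<Longrightarrow> g \<in> pw C S' \<Longrightarrow> cmp s f g \<longleftrightarrow> (\<forall>c\<in>C. cmp s (f c) (g c))"
  using pw_le[of f C S g S'] pw_le[of g C S' f S] by (simp add: cmp_def)

lemma cmp_F_all: "a \<in> A \<Longrightarrow> a' \<in> A \<Longrightarrow> (\<And>d. d \<in> D \<Longrightarrow> cmp s (F d a) (F d a')) \<Longrightarrow> cmp s a a'"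
  unfolding cmp_def by (cases s) (auto intro: F_all)

lemma cmp_F_mono: "a \<in> A \<Longrightarrow> a' \<in> A \<Longrightarrow> cmp s a a' \<Longrightarrow> cmp s (F d a) (F d a')"
  unfolding cmp_def by (cases s) (auto intro: F_mono)

lemma cmp_j: "e \<in> E \<Longrightarrow> e' \<in> E \<Longrightarrow> cmp s (j e) (j e') \<longleftrightarrow> cmp s e e'"
  using j_le by (simp add: cmp_def)

lemma pw_DB: "k \<in> pw D sw.E \<Longrightarrow> k \<in> pw D B"
  using pw_mono[of sw.E B D] sw.E_A by auto

end

context prime_biexp
begin

text \<open>
  Let \<open>Q\<close> be the set of elements on the side of \<open>a1\<close> where \<open>a\<close> lies, and \<open>H\<close> the set of maps from \<open>D\<close> to \<open>E\<close> on the
  corresponding side of \<open>d \<mapsto> F d a1\<close>. For a map \<open>f\<close> from \<open>C\<close> to \<open>Q\<close> all \<open>\<phi> f d\<close> are comparable to fixed elements and hence are maps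
  from \<open>C\<close> to \<open>E\<close> themselves, which yields \<open>Q\<^sup>C \<cong> H\<^sup>C\<close>. The fixed elements of this
  isomorphism are those \<open>a2 \<in> Q\<close> for which all \<open>F d a2\<close> are fixed. Everything comparable to \<open>a\<close> is of this kind, so
  \<open>bounded_cmp\<close> applies on both sides.
\<close>

lemma far_step:
  assumes no: "\<not> oiso C D" and ne: "noext C" and fa: "far a" and a1: "a1 \<in> A" and cm: "cmp s a1 a"
  shows "far a1"
proof -
  have aA: "a \<in> A" using fa by (simp add: far_def)
  have good: "F d a2 \<in> sw.E" if "a2 \<in> A" "cmp s' a a2 \<or> cmp s' a2 a" "d \<in> D" for a2 s' d
    using fa that unfolding far_def cmp_def by (meson)
  have img: "\<exists>a2\<in>A. k = phi (cst C a2)" if "k \<in> pw D sw.E" "cmp s' (phi (cst C a)) k \<or> cmp s' k (phi (cst C a))" for k s'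
    using fa that unfolding far_def cmp_def by (meson)
  have y: "F d a1 \<in> sw.E" if "d \<in> D" for d using good[OF a1 _ that] cm by blast
  define Q where "Q = {a2 \<in> A. cmp s a1 a2}"
  define h0 where "h0 = (\<lambda>d\<in>D. sw.j (F d a1))"
  define H where "H = {h \<in> pw D E. cmp s h0 h}"
  define chi where "chi f = (\<lambda>c\<in>C. \<lambda>d\<in>D. G c (phi f d))" for f
  have QA: "f \<in> pw C A" if "f \<in> pw C Q" for f using that pw_mono[of Q A C] by (auto simp: Q_def)
  have fa1: "cmp s (F d a1) (phi f d)" if "f \<in> pw C Q" for f d
  proof -
    have "cmp s (cst C a1) f" using cmp_pw[OF cst_pw[OF a1] QA[OF that]] pwD[OF that] by (simp add: Q_def)
    then have "cmp s (phi (cst C a1)) (phi f)" using cmp_phi[OF cst_pw[OF a1] QA[OF that]] by simp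
    then show ?thesis by (simp add: cmp_fun F_def)
  qed
  have pB: "phi f d \<in> B" if "f \<in> pw C Q" "d \<in> D" for f d using pwD[OF phi_in[OF QA[OF that(1)]] that(2)] .
  have GE: "G c (phi f d) \<in> E" if "f \<in> pw C Q" "d \<in> D" "c \<in> C" for f d c
    by (rule sw.near_key[OF y[OF that(2)] pB[OF that(1,2)] fa1[OF that(1)] that(3)])
  have h0E: "h0 \<in> pw D E"
  proof (rule pwI)
    fix d d' assume dd: "d \<in> D" "d' \<in> D" "d \<le> d'"
    then show "h0 d \<le> h0 d'" using sw.j_le[OF y[OF dd(1)] y[OF dd(2)]] F_mono2[OF a1 dd] by (simp add: h0_def)
  qed (use y sw.jE_in in \<open>auto simp: h0_def\<close>)
  have row: "(\<lambda>d\<in>D. G c (phi f d)) \<in> H" if f: "f \<in> pw C Q" and c: "c \<in> C" for f c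
  proof -
    have r: "(\<lambda>d\<in>D. G c (phi f d)) \<in> pw D E"
      by (rule pwI) (use GE[OF f _ c] pB[OF f] pwM[OF phi_in[OF QA[OF f]]] sw.F_mono in auto)
    have "cmp s (sw.j (F d a1)) (G c (phi f d))" if d: "d \<in> D" for d
      using sw.cmp_F_mono[OF _ pB[OF f d] fa1[OF f], of c] sw.F_j[OF y[OF d] c] sw.E_A[OF y[OF d]] by simp
    then have "cmp s h0 (\<lambda>d\<in>D. G c (phi f d))" using sw.cmp_pw[OF h0E r] by (simp add: h0_def)
    then show ?thesis using r by (simp add: H_def)
  qed
  have iso: "oisoon chi (pw C Q) (pw C H)"
  proof (rule oisoI)
    fix f assume f: "f \<in> pw C Q"
    show "chi f \<in> pw C H"
    proof (rule pwI)
      fix x z assume xz: "x \<in> C" "z \<in> C" "x \<le> z"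
      then show "chi f x \<le> chi f z" using sw.F_mono2[OF pB[OF f] xz] by (auto simp: chi_def le_fun_def)
    qed (use row[OF f] in \<open>auto simp: chi_def\<close>)
    fix g assume g: "g \<in> pw C Q"
    have "f \<le> g \<longleftrightarrow> (\<forall>d\<in>D. phi f d \<le> phi g d)"
      using phi_le[OF QA[OF f] QA[OF g]] pw_le[OF phi_in[OF QA[OF f]] phi_in[OF QA[OF g]]] by simp
    also have "\<dots> \<longleftrightarrow> (\<forall>d\<in>D. \<forall>c\<in>C. G c (phi f d) \<le> G c (phi g d))"
      using sw.F_all[OF pB[OF f] pB[OF g]] sw.F_mono[OF pB[OF f] pB[OF g]] by blast
    also have "\<dots> \<longleftrightarrow> chi f \<le> chi g"
    proof
      assume l: "chi f \<le> chi g"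
      show "\<forall>d\<in>D. \<forall>c\<in>C. G c (phi f d) \<le> G c (phi g d)"
      proof (intro ballI)
        fix d c assume "d \<in> D" "c \<in> C"
        then show "G c (phi f d) \<le> G c (phi g d)" using le_funD[OF le_funD[OF l, of c], of d] by (simp add: chi_def)
      qed
    qed (auto simp: chi_def le_fun_def)
    finally show "f \<le> g \<longleftrightarrow> chi f \<le> chi g" .
  next
    fix M assume M: "M \<in> pw C H"
    have MH: "M c \<in> pw D E" "cmp s h0 (M c)" if "c \<in> C" for c using pwD[OF M that] by (auto simp: H_def)
    have "\<exists>b\<in>B. \<forall>c\<in>C. G c b = M c d" if d: "d \<in> D" for d
    proof -
      let ?m = "\<lambda>c\<in>C. M c d"
      have m: "?m \<in> pw C E"
        by (rule pwI) (use pwD[OF MH(1) d] pwM[OF M] in \<open>auto simp: le_funD\<close>)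
      have "cmp s (sw.j (F d a1)) (?m c)" if "c \<in> C" for c
        using cmp_ap[OF MH(2)[OF that], of d] that d by (simp add: h0_def)
      from sw.near_surj[OF _ y[OF d] m this] no oiso_sym
      obtain b where b: "b \<in> B" "?m = psi (cst D b)" by blast
      have "G c b = M c d" if "c \<in> C" for c using fun_cong[OF b(2), of c] that by (simp add: sw.F_def)
      then show ?thesis using b(1) by blast
    qed
    then obtain bb where bb: "\<And>d. d \<in> D \<Longrightarrow> bb d \<in> B" "\<And>d c. d \<in> D \<Longrightarrow> c \<in> C \<Longrightarrow> G c (bb d) = M c d" by metis
    let ?k = "\<lambda>d\<in>D. bb d"
    have k: "?k \<in> pw D B"
    proof (rule pwI)
      fix d d' assume dd: "d \<in> D" "d' \<in> D" "d \<le> d'"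
      have "bb d \<le> bb d'"
        by (rule sw.F_all[OF bb(1)[OF dd(1)] bb(1)[OF dd(2)]]) (use bb(2) dd pwM[OF MH(1)] in simp)
      then show "?k d \<le> ?k d'" using dd by simp
    qed (use bb in auto)
    have "cmp s (F d a1) (bb d)" if d: "d \<in> D" for d
    proof (rule sw.cmp_F_all[OF sw.E_A[OF y[OF d]] bb(1)[OF d]])
      fix c assume c: "c \<in> C"
      then show "cmp s (G c (F d a1)) (G c (bb d))"
        using cmp_ap[OF MH(2)[OF c], of d] sw.F_j[OF y[OF d] c] bb(2)[OF d c] d by (simp add: h0_def)
    qed
    then have "cmp s (phi (cst C a1)) ?k" using sw.cmp_pw[OF phi_in[OF cst_pw[OF a1]] k] by (simp add: F_def)
    then have "cmp s (phi (cst C a1)) (phi (psi ?k))" using phi_psi[OF k] by simp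
    then have "cmp s (cst C a1) (psi ?k)" using cmp_phi[OF cst_pw[OF a1] psi_in[OF k]] by simp
    then have "\<forall>c\<in>C. cmp s a1 (psi ?k c)" using cmp_pw[OF cst_pw[OF a1] psi_in[OF k]] by simp
    then have pQ: "psi ?k \<in> pw C Q" by (intro pw_sub[OF psi_in[OF k]]) (use pwD[OF psi_in[OF k]] in \<open>simp add: Q_def\<close>)
    have "chi (psi ?k) = M"
    proof (rule ext)
      fix c show "chi (psi ?k) c = M c"
      proof (cases "c \<in> C")
        case True
        have "(\<lambda>d\<in>D. G c (phi (psi ?k) d)) = M c"
          using pw_undef[OF MH(1)[OF True]] phi_psi[OF k] bb(2) True by (auto simp: fun_eq_iff)
        then show ?thesis using True by (simp add: chi_def)
      next
        case False then show ?thesis using pw_undef[OF M False] by (simp add: chi_def)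
      qed
    qed
    then show "\<exists>f\<in>pw C Q. chi f = M" using pQ by blast
  qed
  have finQ: "finite Q" using finA by (simp add: Q_def)
  have "finite E" using finA by (simp add: E_def)
  then have finH: "finite H" unfolding H_def by (intro finite_subset[OF _ pw_finite[OF finD]]) auto
  interpret x: biexp Q H C C chi "the_inv_into (pw C Q) chi"
    by (rule biexp_of_iso[OF finQ finH finC finC neC neC conC conC iso])
  have xF: "x.F c a2 = (\<lambda>d\<in>D. G c (F d a2))" if "c \<in> C" for c a2
    using that by (simp add: x.F_def chi_def F_def)
  have xg: "a2 \<in> x.E" "x.j a2 = (\<lambda>d\<in>D. sw.j (F d a2))" if "a2 \<in> Q" "\<And>d. d \<in> D \<Longrightarrow> F d a2 \<in> sw.E" for a2
  proof -
    have e: "x.F c a2 = (\<lambda>d\<in>D. sw.j (F d a2))" if "c \<in> C" for c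
      unfolding xF[OF that] by (rule restrict_ext) (use sw.F_j[OF \<open>\<And>d. d \<in> D \<Longrightarrow> F d a2 \<in> sw.E\<close> that] in blast)
    show "a2 \<in> x.E" by (rule x.E_I[OF that(1) e])
    then show "x.j a2 = (\<lambda>d\<in>D. sw.j (F d a2))" using x.F_j e neC by (metis ex_in_conv)
  qed
  have aQ: "a \<in> Q" using aA cm by (simp add: Q_def)
  have ga: "F d a \<in> sw.E" if "d \<in> D" for d by (rule good[OF aA _ that, of s]) simp
  have xa: "a \<in> x.E" by (rule xg(1)[OF aQ ga])
  have h0H: "h0 \<in> H" using h0E by (simp add: H_def)
  have a1Q: "a1 \<in> Q" using a1 by (simp add: Q_def)
  have QE: "Q = x.E"
  proof (rule x.bounded_cmp[OF pC pC ne ne a1Q _ h0H _ xa])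
    fix a2 assume a2: "a2 \<in> Q" "a2 \<le> a \<or> a \<le> a2"
    then obtain s' where "cmp s' a a2" using cmp_either by blast
    then show "a2 \<in> x.E" using xg(1)[OF a2(1)] good[of a2 s'] a2(1) by (simp add: Q_def)
  qed (auto simp: Q_def H_def)
  have goodQ: "F d a2 \<in> sw.E" if a2: "a2 \<in> Q" and d: "d \<in> D" for a2 d
  proof -
    have "a2 \<in> x.E" using QE a2 by simp
    then have eq: "x.F c a2 = x.F c' a2" if "c \<in> C" "c' \<in> C" for c c' using that unfolding x.E_def by blast
    have "G c (F d a2) = G c' (F d a2)" if "c \<in> C" "c' \<in> C" for c c'
      using fun_cong[OF eq[OF that], of d] xF[OF that(1), of a2] xF[OF that(2), of a2] d by simp
    moreover have "F d a2 \<in> B" using a2 d by (simp add: Q_def)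
    ultimately show ?thesis unfolding sw.E_def by blast
  qed
  have HE: "H = x.sw.E"
  proof (rule x.sw.bounded_cmp[OF pC pC ne ne h0H _ a1Q _ x.jE_in[OF xa]])
    fix h assume h: "h \<in> H" "h \<le> x.j a \<or> x.j a \<le> h"
    have hE: "h \<in> pw D E" "cmp s h0 h" using h(1) by (auto simp: H_def)
    let ?k = "\<lambda>d\<in>D. j (h d)"
    have k: "?k \<in> pw D sw.E"
      by (rule pwI) (use pwD[OF hE(1)] pwM[OF hE(1)] jE_in j_le in auto)
    obtain s' where s': "cmp s' (x.j a) h" using h(2) cmp_either by blast
    have "cmp s' (F d a) (?k d)" if d: "d \<in> D" for d
    proof -
      have "cmp s' (sw.j (F d a)) (h d)" using cmp_ap[OF s', of d] fun_cong[OF xg(2)[OF aQ ga], of d] d by simp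
      then have "cmp s' (j (sw.j (F d a))) (j (h d))" using cmp_j[OF sw.jE_in[OF ga[OF d]] pwD[OF hE(1) d]] by simp
      then show ?thesis using sw.swj_j[OF ga[OF d]] d by simp
    qed
    then have "cmp s' (phi (cst C a)) ?k" using sw.cmp_pw[OF phi_in[OF cst_pw[OF aA]] k] by (simp add: F_def)
    then obtain a2 where a2: "a2 \<in> A" "?k = phi (cst C a2)" using img[OF k] by blast
    have Fa2: "F d a2 = j (h d)" if "d \<in> D" for d using fun_cong[OF a2(2), of d] that by (simp add: F_def)
    have "cmp s a1 a2"
    proof (rule cmp_F_all[OF a1 a2(1)])
      fix d assume d: "d \<in> D"
      have "cmp s (sw.j (F d a1)) (h d)" using cmp_ap[OF hE(2), of d] d by (simp add: h0_def)
      then have "cmp s (j (sw.j (F d a1))) (j (h d))" using cmp_j[OF sw.jE_in[OF y[OF d]] pwD[OF hE(1) d]] by simp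
      then show "cmp s (F d a1) (F d a2)" using sw.swj_j[OF y[OF d]] Fa2[OF d] by simp
    qed
    then have a2Q: "a2 \<in> Q" using a2 by (simp add: Q_def)
    have g2: "F d a2 \<in> sw.E" if "d \<in> D" for d by (rule goodQ[OF a2Q that])
    have "x.j a2 = h"
    proof (rule ext)
      fix z
      have "x.j a2 z = (\<lambda>d\<in>D. sw.j (F d a2)) z" by (rule fun_cong[OF xg(2)[OF a2Q g2]])
      then show "x.j a2 z = h z"
        using Fa2 swj_j[OF pwD[OF hE(1)]] pw_undef[OF hE(1)] by (cases "z \<in> D") simp_all
    qed
    then show "h \<in> x.sw.E" using x.jE_in[OF xg(1)[OF a2Q g2]] by simp
  qed (auto simp: Q_def H_def)
  show ?thesis
    unfolding far_def
  proof (intro conjI ballI impI a1)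
    fix a2 d assume a2: "a2 \<in> A" "a2 \<le> a1 \<or> a1 \<le> a2" "d \<in> D"
    show "F d a2 \<in> sw.E"
    proof (cases "cmp s a1 a2")
      case True then show ?thesis using goodQ[OF _ a2(3)] a2(1) by (simp add: Q_def)
    next
      case False
      then have "cmp s a2 a1" using a2(2) by (auto simp: cmp_def)
      then show ?thesis using good[OF a2(1) _ a2(3)] cmp_trans[OF _ cm] by blast
    qed
  next
    fix k assume k: "k \<in> pw D sw.E" "k \<le> phi (cst C a1) \<or> phi (cst C a1) \<le> k"
    show "\<exists>a2\<in>A. k = phi (cst C a2)"
    proof (cases "cmp s (phi (cst C a1)) k")
      case True
      let ?h = "\<lambda>d\<in>D. sw.j (k d)"
      have h: "?h \<in> pw D E"
        by (rule pwI) (use pwD[OF k(1)] pwM[OF k(1)] sw.jE_in sw.j_le in auto)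
      have "cmp s (h0 d) (?h d)" if d: "d \<in> D" for d
        using True d sw.cmp_j[OF y[OF d] pwD[OF k(1) d]] unfolding cmp_fun by (simp add: h0_def F_def)
      then have "?h \<in> H" using sw.cmp_pw[OF h0E h] h by (simp add: H_def)
      then have hx: "?h \<in> x.sw.E" using HE by simp
      define a2 where "a2 = x.sw.j ?h"
      have a2E: "a2 \<in> x.E" "x.j a2 = ?h" using x.sw.jE_in[OF hx] x.sw.swj_j[OF hx] by (simp_all add: a2_def)
      then have a2Q: "a2 \<in> Q" using QE by simp
      have g2: "F d a2 \<in> sw.E" if "d \<in> D" for d by (rule goodQ[OF a2Q that])
      have "k d = F d a2" if d: "d \<in> D" for d
      proof -
        have "sw.j (F d a2) = sw.j (k d)" using fun_cong[OF a2E(2), of d] xg(2)[OF a2Q g2] d by simp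
        then show ?thesis using sw.j_inj[OF g2[OF d] pwD[OF k(1) d]] by simp
      qed
      then have "k = phi (cst C a2)"
        by (intro pw_eqI[OF k(1) phi_in[OF cst_pw]]) (use a2Q in \<open>auto simp: Q_def F_def\<close>)
      then show ?thesis using a2Q by (auto simp: Q_def)
    next
      case False
      then have "cmp s k (phi (cst C a1))" using k(2) by (auto simp: cmp_def)
      moreover have "cmp s (phi (cst C a1)) (phi (cst C a))" using cmp_phi[OF cst_pw[OF a1] cst_pw[OF aA]] cmp_cst[of s a1 a] cm by simp
      ultimately show ?thesis using img[OF k(1)] cmp_trans by blast
    qed
  qed
qed

lemma far_all:
  assumes no: "\<not> oiso C D" and ne: "noext C" and a: "a \<in> A"
  shows "far a"
proof -
  obtain e where e: "e \<in> E" using ex_E by blast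
  show ?thesis
  proof (rule connD[OF conA E_A[OF e], of far])
    show "far e" by (rule far_E[OF no e])
    show "far y = far z" if "y \<in> A" "z \<in> A" "y \<le> z" for y z
      using far_step[OF no ne, of y z True] far_step[OF no ne, of z y False] that by (auto simp: cmp_def)
  qed (rule a)
qed

end

context prime_biexp
begin

text \<open>
  The map \<open>rho\<close> retracts the connected \<open>B\<^sup>D\<close> monotonically onto the maps into fixed elements. So these maps are connected, and
  being the image of a constant map spreads by \<open>far\<close>.
\<close>

lemma power_noext:
  assumes no: "\<not> oiso C D" and nC: "noext C" and nD: "noext D"
  shows "oiso A (pw D sw.E)"
proof (rule power_of_surj)
  note fA = far_all[OF no nC]
  show key: "F d a \<in> sw.E" if "a \<in> A" "d \<in> D" for a d using fA[OF that(1)] that unfolding far_def by blast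
  have "\<not> oiso D C" using no oiso_sym by blast
  note fB = sw.far_all[OF this nD]
  have GE: "G c b \<in> E" if "b \<in> B" "c \<in> C" for b c using fB[OF that(1)] that unfolding sw.far_def by blast
  fix k assume k: "k \<in> pw D sw.E"
  obtain c where c: "c \<in> C" using neC by auto
  obtain e where e: "e \<in> E" using ex_E by blast
  define rho where "rho h = (\<lambda>d\<in>D. j (G c (h d)))" for h
  have rin: "rho h \<in> pw D sw.E" if h: "h \<in> pw D B" for h
    by (rule pwI) (use GE[OF pwD[OF h] c] jE_in j_le sw.F_mono pwD[OF h] pwM[OF h] in \<open>auto simp: rho_def\<close>)
  have rle: "rho h \<le> rho h'" if h: "h \<in> pw D B" "h' \<in> pw D B" "h \<le> h'" for h h'
  proof -
    have "j (G c (h d)) \<le> j (G c (h' d))" if d: "d \<in> D" for d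
      using j_le[OF GE[OF pwD[OF h(1) d] c] GE[OF pwD[OF h(2) d] c]] sw.F_mono[OF pwD[OF h(1) d] pwD[OF h(2) d], of c] h(3)
      by (simp add: le_funD)
    then show ?thesis by (auto simp: rho_def le_fun_def)
  qed
  let ?P = "\<lambda>h. \<exists>a\<in>A. rho h = phi (cst C a)"
  have st: "?P h'" if h: "h \<in> pw D B" "h' \<in> pw D B" "rho h \<le> rho h' \<or> rho h' \<le> rho h" "?P h" for h h'
  proof -
    obtain a where a: "a \<in> A" "rho h = phi (cst C a)" using h(4) by blast
    show ?thesis using fA[OF a(1)] rin[OF h(2)] h(3) a(2) unfolding far_def by auto
  qed
  have "?P k"
  proof (rule connD[OF sw.conP phi_in[OF cst_pw[OF E_A[OF e]]], of ?P])
    have "rho (phi (cst C e)) = phi (cst C e)" unfolding rho_def phi_E[OF e]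
      using G_j[OF e c] by (auto simp: cst_def)
    then show "?P (phi (cst C e))" using E_A[OF e] by blast
    show "?P h = ?P h'" if "h \<in> pw D B" "h' \<in> pw D B" "h \<le> h'" for h h'
      using st[OF that(1,2)] st[OF that(2,1)] rle[OF that] by blast
  qed (rule pw_DB[OF k])
  moreover have "rho k = k"
  proof (rule pw_eqI[OF rin[OF pw_DB[OF k]] k])
    fix d assume d: "d \<in> D"
    then show "rho k d = k d" using sw.F_j[OF pwD[OF k d] c] sw.swj_j[OF pwD[OF k d]] by (simp add: rho_def)
  qed
  ultimately show "\<exists>a\<in>A. k = phi (cst C a)" by simp
qed

lemma power_cases:
  assumes no: "\<not> oiso C D"
  shows "oiso A (pw D sw.E) \<or> oiso B (pw C E)"
proof -
  have no': "\<not> oiso D C" using no oiso_sym by blast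
  show ?thesis using power_ext[OF no] sw.power_ext[OF no'] power_noext[OF no] by blast
qed

end

section \<open>Isomorphic exponents cancel\<close>

text \<open>
  An isomorphism of the exponents and its inverse; both are parameters to keep the situation symmetric.
\<close>

locale same_exponent = prime_biexp A B C D phi psi
  for A :: "'a::order set" and B :: "'b::order set" and C :: "'c::order set" and D :: "'d::order set" and phi psi +
  fixes th :: "'c \<Rightarrow> 'd" and th' :: "'d \<Rightarrow> 'c"
  assumes th: "oisoon th C D" and th': "oisoon th' D C"
    and th'_th: "c \<in> C \<Longrightarrow> th' (th c) = c" and th_th': "d \<in> D \<Longrightarrow> th (th' d) = d"
begin

lemma cswap: "same_exponent B A D C psi phi th' th"
  by (intro same_exponent.intro gswap same_exponent_axioms.intro th th' th'_th th_th')

end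

sublocale same_exponent \<subseteq> sw: same_exponent B A D C psi phi th' th by (rule cswap)

context same_exponent
begin

lemma thD: "c \<in> C \<Longrightarrow> th c \<in> D" by (rule oisoonD(1)[OF th])

text \<open>
  Partners: a fixed \<open>e\<close> belongs to \<open>j e\<close>, and \<open>a\<close> belongs to \<open>b\<close> if the coordinates of their constant maps,
  matched along \<open>th\<close>, are partners with exchanged roles.
\<close>

primrec Rn :: "nat \<Rightarrow> 'a \<Rightarrow> 'b \<Rightarrow> bool" where
  "Rn 0 a b \<longleftrightarrow> a \<in> E \<and> b = j a"
| "Rn (Suc n) a b \<longleftrightarrow> a \<in> A \<and> b \<in> B \<and> (\<forall>c\<in>C. Rn n (G c b) (F (th c) a))"

lemma Rn_in: "Rn n a b \<Longrightarrow> a \<in> A \<and> b \<in> B"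
  by (cases n) (auto simp: E_A j_B)

lemma Rn_Suc: "Rn n a b \<Longrightarrow> Rn (Suc n) a b"
proof (induction n arbitrary: a b)
  case 0 then show ?case by (simp add: E_A j_B G_j F_j thD)
next
  case (Suc n) then show ?case by (auto simp: thD)
qed

lemma Rn_mono: "Rn n a b \<Longrightarrow> n \<le> m \<Longrightarrow> Rn m a b"
  by (rule lift_Suc_mono_le[of "\<lambda>n. Rn n a b", unfolded le_bool_def, rule_format]) (use Rn_Suc in auto)

text \<open>
  Elements are compared through their coordinates, and matched coordinates compare alike by induction.
\<close>

lemma Rn_le: "Rn n a b \<Longrightarrow> Rn n a' b' \<Longrightarrow> a \<le> a' \<longleftrightarrow> b \<le> b'"
proof (induction n arbitrary: a b a' b')
  case 0 then show ?case by (simp add: j_le)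
next
  case (Suc n)
  have i: "a \<in> A" "b \<in> B" "a' \<in> A" "b' \<in> B" using Suc.prems by auto
  have "a \<le> a' \<longleftrightarrow> (\<forall>d\<in>D. F d a \<le> F d a')" using F_all[OF i(1,3)] F_mono[OF i(1,3)] by blast
  also have "\<dots> \<longleftrightarrow> (\<forall>c\<in>C. F (th c) a \<le> F (th c) a')" using thD th_th' oisoonD(1)[OF th'] by metis
  also have "\<dots> \<longleftrightarrow> (\<forall>c\<in>C. G c b \<le> G c b')"
    by (intro ball_cong refl Suc.IH[symmetric]) (use Suc.prems in auto)
  also have "\<dots> \<longleftrightarrow> b \<le> b'" using sw.F_all[OF i(2,4)] sw.F_mono[OF i(2,4)] by blast
  finally show ?case .
qed

definition R :: "'a \<Rightarrow> 'b \<Rightarrow> bool" where "R a b \<longleftrightarrow> (\<exists>n. Rn n a b)"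

lemma R_in: "R a b \<Longrightarrow> a \<in> A" "R a b \<Longrightarrow> b \<in> B" unfolding R_def using Rn_in by blast+

lemma R_le: "R a b \<Longrightarrow> R a' b' \<Longrightarrow> a \<le> a' \<longleftrightarrow> b \<le> b'"
proof -
  assume "R a b" "R a' b'"
  then obtain n m where "Rn n a b" "Rn m a' b'" by (auto simp: R_def)
  then have "Rn (max n m) a b" "Rn (max n m) a' b'" by (auto intro: Rn_mono)
  then show ?thesis by (rule Rn_le)
qed

lemma R_cmp: "R a b \<Longrightarrow> R a' b' \<Longrightarrow> cmp s a a' \<longleftrightarrow> cmp s b b'"
  using R_le by (simp add: cmp_def)

lemma R_fun1: "R a b \<Longrightarrow> R a b' \<Longrightarrow> b = b'"
  using R_le by (metis order_antisym order_refl)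
lemma R_fun2: "R a b \<Longrightarrow> R a' b \<Longrightarrow> a = a'"
  using R_le by (metis order_antisym order_refl)

lemma R_E: "e \<in> E \<Longrightarrow> R e (j e)" unfolding R_def by (rule exI[of _ 0]) simp

lemma R_inv: assumes "R a b" "c \<in> C" shows "R (G c b) (F (th c) a)"
proof -
  obtain n where "Rn n a b" using assms(1) by (auto simp: R_def)
  from Rn_Suc[OF this] show ?thesis using assms(2) by (auto simp: R_def)
qed

lemma R_step:
  assumes "a \<in> A" "b \<in> B" "\<And>c. c \<in> C \<Longrightarrow> R (G c b) (F (th c) a)"
  shows "R a b"
proof -
  have "\<forall>c\<in>C. \<exists>n. Rn n (G c b) (F (th c) a)" using assms(3) by (auto simp: R_def)
  then obtain n where n: "\<And>c. c \<in> C \<Longrightarrow> Rn (n c) (G c b) (F (th c) a)" by metis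
  have "Rn (Max (n ` C)) (G c b) (F (th c) a)" if "c \<in> C" for c
    by (rule Rn_mono[OF n[OF that]]) (use finC that in auto)
  then have "Rn (Suc (Max (n ` C))) a b" using assms(1,2) by simp
  then show ?thesis unfolding R_def by blast
qed

text \<open>
  Reachable from \<open>E\<close> in \<open>n\<close> comparabilities.
\<close>

primrec ra :: "nat \<Rightarrow> 'a \<Rightarrow> bool" where
  "ra 0 a \<longleftrightarrow> a \<in> E"
| "ra (Suc n) a \<longleftrightarrow> a \<in> A \<and> (\<exists>a' s. ra n a' \<and> cmp s a' a)"

lemma ra_A: "ra n a \<Longrightarrow> a \<in> A" by (cases n) (auto simp: E_A)
lemma ra_Suc: "ra n a \<Longrightarrow> ra (Suc n) a" using ra_A by (auto intro: exI[of _ a])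

end

context same_exponent
begin

lemma R_swap: "sw.Rn n b a \<longleftrightarrow> Rn n a b"
proof (induction n arbitrary: a b)
  case 0 then show ?case using jE_in swj_j sw.jE_in sw.swj_j by auto
next
  case (Suc n)
  have "(\<forall>d\<in>D. sw.Rn n (F d a) (G (th' d) b)) \<longleftrightarrow> (\<forall>c\<in>C. Rn n (G c b) (F (th c) a))"
    using Suc.IH thD sw.thD th'_th th_th' by metis
  then show ?case by auto
qed

lemma sw_R: "sw.R b a \<longleftrightarrow> R a b" by (simp add: sw.R_def R_def R_swap)

text \<open>
  The map \<open>G c\<close> decreases the radius, because elements of radius one are sent to fixed elements.
\<close>

lemma ra_G: "sw.ra (Suc n) b \<Longrightarrow> c \<in> C \<Longrightarrow> ra n (G c b)"
proof (induction n arbitrary: b)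
  case 0
  then obtain b' s where b: "b \<in> B" "b' \<in> sw.E" "cmp s b' b" by auto
  show ?case using sw.near_key[OF b(2,1,3) 0(2)] by simp
next
  case (Suc n)
  then obtain b' s where b: "b \<in> B" "sw.ra (Suc n) b'" "cmp s b' b" unfolding sw.ra.simps(2)[of "Suc n"] by blast
  have "b' \<in> B" by (rule sw.ra_A[OF b(2)])
  then have "cmp s (G c b') (G c b)" using sw.cmp_F_mono b by blast
  then show ?case using Suc.IH[OF b(2) Suc.prems(2)] b(1) Suc.prems(2) by auto
qed

definition Pn :: "nat \<Rightarrow> bool" where
  "Pn n \<longleftrightarrow> (\<forall>a. ra n a \<longrightarrow> (\<exists>b. sw.ra n b \<and> R a b))"

lemma Pn_1: "Pn (Suc 0)"
  unfolding Pn_def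
proof (intro allI impI)
  fix a assume "ra (Suc 0) a"
  then obtain e s where a: "a \<in> A" "e \<in> E" "cmp s e a" by auto
  from near_star[OF th a(2,1,3)] obtain b where b: "b \<in> B" "cmp s (j e) b" "\<forall>c\<in>C. G c b = sw.j (F (th c) a)" by blast
  have F: "F (th c) a \<in> sw.E" if "c \<in> C" for c using near_key[OF a(2,1,3) thD[OF that]] .
  have "R a b"
  proof (rule R_step[OF a(1) b(1)])
    fix c assume c: "c \<in> C"
    have "R (sw.j (F (th c) a)) (j (sw.j (F (th c) a)))" by (rule R_E[OF sw.jE_in[OF F[OF c]]])
    then show "R (G c b) (F (th c) a)" using b(3) c sw.swj_j[OF F[OF c]] by simp
  qed
  moreover have "sw.ra (Suc 0) b" using b jE_in[OF a(2)] by auto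
  ultimately show "\<exists>b. sw.ra (Suc 0) b \<and> R a b" by blast
qed

end

context same_exponent
begin

text \<open>
  Let \<open>Q\<close> and \<open>Qb\<close> be the sides of \<open>a1\<close> and of its partner \<open>b1\<close>. For a map \<open>f\<close> from \<open>C\<close> to \<open>Q\<close> the values of
  \<open>\<phi> f\<close> have radius small enough to have partners; replacing them by these and applying \<open>\<phi>\<close> again gives \<open>Q\<^sup>C \<cong> Qb\<^sup>D\<close>.
  Its fixed elements are exactly the elements with a partner in \<open>Qb\<close>. All elements comparable to \<open>a0\<close> have partners, so
  \<open>bounded_cmp\<close> gives partners to all of \<open>Q\<close>.
\<close>

lemma extend_partner:
  assumes ne: "noext C" "noext D" and P: "Pn (Suc m)" and P': "sw.Pn (Suc m)"
    and a0: "ra m a0" and a1: "ra (Suc m) a1" and s0: "cmp s a1 a0" and a2: "a2 \<in> A" and s2: "cmp s a1 a2"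
  shows "\<exists>b. sw.ra (Suc (Suc m)) b \<and> R a2 b"
proof -
  have A: "a0 \<in> A" "a1 \<in> A" using ra_A a0 a1 by auto
  obtain b1 where b1: "sw.ra (Suc m) b1" "R a1 b1" using P a1 unfolding Pn_def by blast
  obtain b0 where b0: "R a0 b0" using P ra_Suc[OF a0] unfolding Pn_def by blast
  have B: "b1 \<in> B" using sw.ra_A[OF b1(1)] .
  define Q where "Q = {a \<in> A. cmp s a1 a}"
  define Qb where "Qb = {b \<in> B. cmp s b1 b}"
  define pr where "pr y = (SOME u. R u y)" for y
  have pr: "pr y = u" if "R u y" for u y
    unfolding pr_def using that R_fun2 by (intro some_equality) blast+
  define u where "u f = (\<lambda>c\<in>C. pr (phi f (th c)))" for f
  have QA: "f \<in> pw C A" if "f \<in> pw C Q" for f using that pw_mono[of Q A C] by (auto simp: Q_def)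
  have QB: "g \<in> pw D B" if "g \<in> pw D Qb" for g using that pw_mono[of Qb B D] by (auto simp: Qb_def)
  have pB: "phi f d \<in> B" if "f \<in> pw C Q" "d \<in> D" for f d using pwD[OF phi_in[OF QA[OF that(1)]] that(2)] .
  have fa1: "cmp s (F d a1) (phi f d)" if "f \<in> pw C Q" for f d
  proof -
    have "cmp s (cst C a1) f" using cmp_pw[OF cst_pw[OF A(2)] QA[OF that]] pwD[OF that] by (simp add: Q_def)
    then have "cmp s (phi (cst C a1)) (phi f)" using cmp_phi[OF cst_pw[OF A(2)] QA[OF that]] by simp
    then show ?thesis by (simp add: cmp_fun F_def)
  qed
  have Ru: "R (u f c) (phi f (th c))" if f: "f \<in> pw C Q" and c: "c \<in> C" for f c
  proof -
    have "sw.ra m (F (th c) a1)" by (rule sw.ra_G[OF a1 thD[OF c]])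
    then have "sw.ra (Suc m) (phi f (th c))" using fa1[OF f] pB[OF f thD[OF c]] by auto
    then obtain x where "R x (phi f (th c))" using P' unfolding sw.Pn_def sw_R by blast
    then show ?thesis using pr c by (simp add: u_def)
  qed
  have upw: "u f \<in> pw C A" if f: "f \<in> pw C Q" for f
  proof (rule pwI)
    fix x z assume xz: "x \<in> C" "z \<in> C" "x \<le> z"
    have "phi f (th x) \<le> phi f (th z)"
      by (rule pwM[OF phi_in[OF QA[OF f]]]) (use xz thD oisoonD(2)[OF th] in auto)
    then show "u f x \<le> u f z" using R_le[OF Ru[OF f xz(1)] Ru[OF f xz(2)]] by simp
  qed (use R_in(1)[OF Ru[OF f]] in \<open>auto simp: u_def\<close>)
  have bu: "cmp s (G c b1) (u f c)" if f: "f \<in> pw C Q" and c: "c \<in> C" for f c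
    using R_cmp[OF R_inv[OF b1(2) c] Ru[OF f c]] fa1[OF f] by simp
  define chi where "chi f = phi (u f)" for f
  have iso: "oisoon chi (pw C Q) (pw D Qb)"
  proof (rule oisoI)
    fix f assume f: "f \<in> pw C Q"
    have "cmp s (psi (cst D b1)) (u f)"
      using cmp_pw[OF psi_in[OF cst_pw[OF B]] upw[OF f]] bu[OF f] by (simp add: sw.F_def)
    then have "cmp s (cst D b1) (chi f)"
      using cmp_phi[OF psi_in[OF cst_pw[OF B]] upw[OF f]] phi_psi[OF cst_pw[OF B]] by (simp add: chi_def)
    then have cb: "\<forall>d\<in>D. cmp s b1 (chi f d)"
      using sw.cmp_pw[OF cst_pw[OF B] phi_in[OF upw[OF f]]] by (simp add: chi_def)
    have cB: "chi f \<in> pw D B" unfolding chi_def by (rule phi_in[OF upw[OF f]])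
    show "chi f \<in> pw D Qb" by (rule pw_sub[OF cB]) (use cb pwD[OF cB] in \<open>simp add: Qb_def\<close>)
    fix g assume g: "g \<in> pw C Q"
    have "f \<le> g \<longleftrightarrow> (\<forall>d\<in>D. phi f d \<le> phi g d)"
      using phi_le[OF QA[OF f] QA[OF g]] pw_le[OF phi_in[OF QA[OF f]] phi_in[OF QA[OF g]]] by simp
    also have "\<dots> \<longleftrightarrow> (\<forall>c\<in>C. phi f (th c) \<le> phi g (th c))" using thD sw.thD th_th' by metis
    also have "\<dots> \<longleftrightarrow> (\<forall>c\<in>C. u f c \<le> u g c)" using R_le[OF Ru[OF f] Ru[OF g]] by simp
    also have "\<dots> \<longleftrightarrow> chi f \<le> chi g" unfolding chi_def using phi_le[OF upw[OF f] upw[OF g]] pw_le[OF upw[OF f] upw[OF g]] by simp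
    finally show "f \<le> g \<longleftrightarrow> chi f \<le> chi g" .
  next
    fix g assume g: "g \<in> pw D Qb"
    have "cmp s (cst D b1) g" using sw.cmp_pw[OF cst_pw[OF B] QB[OF g]] pwD[OF g] by (simp add: Qb_def)
    then have "cmp s (psi (cst D b1)) (psi g)" using sw.cmp_phi[OF cst_pw[OF B] QB[OF g]] by simp
    then have gb: "cmp s (G c b1) (psi g c)" for c by (simp add: cmp_fun sw.F_def)
    have pg: "psi g \<in> pw C A" by (rule psi_in[OF QB[OF g]])
    have "\<exists>y. R (psi g c) y" if c: "c \<in> C" for c
    proof -
      have "ra m (G c b1)" by (rule ra_G[OF b1(1) c])
      then have "ra (Suc m) (psi g c)" using gb pwD[OF pg c] by auto
      then show ?thesis using P unfolding Pn_def by blast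
    qed
    then obtain y where y: "\<And>c. c \<in> C \<Longrightarrow> R (psi g c) (y c)" by metis
    let ?k = "\<lambda>d\<in>D. y (th' d)"
    have k: "?k \<in> pw D B"
    proof (rule pwI)
      fix d d' assume dd: "d \<in> D" "d' \<in> D" "d \<le> d'"
      have "psi g (th' d) \<le> psi g (th' d')" 
        by (rule pwM[OF pg]) (use dd sw.thD oisoonD(2)[OF th'] in auto)
      then show "?k d \<le> ?k d'" using R_le[OF y y] dd sw.thD by simp
    qed (use R_in(2)[OF y] sw.thD in auto)
    have "cmp s (F d a1) (?k d)" if d: "d \<in> D" for d
      using R_cmp[OF R_inv[OF b1(2) sw.thD[OF d]] y[OF sw.thD[OF d]]] gb[of "th' d"] th_th'[OF d] d by simp
    then have "cmp s (phi (cst C a1)) (phi (psi ?k))"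
      using sw.cmp_pw[OF phi_in[OF cst_pw[OF A(2)]] k] phi_psi[OF k] by (simp add: F_def)
    then have "cmp s (cst C a1) (psi ?k)" using cmp_phi[OF cst_pw[OF A(2)] psi_in[OF k]] by simp
    then have "\<forall>c\<in>C. cmp s a1 (psi ?k c)" using cmp_pw[OF cst_pw[OF A(2)] psi_in[OF k]] by simp
    then have pQ: "psi ?k \<in> pw C Q" by (intro pw_sub[OF psi_in[OF k]]) (use pwD[OF psi_in[OF k]] in \<open>simp add: Q_def\<close>)
    have "u (psi ?k) = psi g"
    proof (rule pw_eqI[OF upw[OF pQ] pg])
      fix c assume c: "c \<in> C"
      show "u (psi ?k) c = psi g c"
        using pr[OF y[OF c]] c phi_psi[OF k] thD[OF c] th'_th[OF c] by (simp add: u_def)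
    qed
    then show "\<exists>f\<in>pw C Q. chi f = g" using pQ phi_psi[OF QB[OF g]] by (intro bexI[of _ "psi ?k"]) (simp_all add: chi_def)
  qed
  have fin: "finite Q" "finite Qb" using finA finB by (auto simp: Q_def Qb_def)
  interpret x: biexp Q Qb C D chi "the_inv_into (pw C Q) chi"
    by (rule biexp_of_iso[OF fin finC finD neC neD conC conD iso])
  have aQ: "a0 \<in> Q" "a1 \<in> Q" "a2 \<in> Q" using A a2 s0 s2 by (auto simp: Q_def)
  have bQ: "b1 \<in> Qb" using B by (simp add: Qb_def)
  have xE1: "a \<in> x.E" if "a \<in> Q" "R a b" for a b
  proof (rule x.E_I[OF that(1)])
    have "u (cst C a) = psi (cst D b)"
    proof (rule pw_eqI[OF upw psi_in])
      fix c assume c: "c \<in> C"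
      show "u (cst C a) c = psi (cst D b) c" using pr[OF R_inv[OF that(2) c]] c by (simp add: u_def F_def sw.F_def)
    qed (use that R_in in auto)
    then have "chi (cst C a) = cst D b" using phi_psi[OF cst_pw[OF R_in(2)[OF that(2)]]] by (simp add: chi_def)
    then show "x.F d a = b" if "d \<in> D" for d using \<open>d \<in> D\<close> by (simp add: x.F_def)
  qed
  have QE: "Q = x.E"
  proof (rule x.bounded_cmp[OF pC pD ne aQ(2) _ bQ _ xE1[OF aQ(1) b0]])
    fix a assume a: "a \<in> Q" "a \<le> a0 \<or> a0 \<le> a"
    have "\<exists>s. cmp s a0 a" using a(2) cmp_either by blast
    then have "ra (Suc m) a" using a0 a(1) unfolding ra.simps(2) Q_def by blast
    then obtain b where "R a b" using P unfolding Pn_def by blast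
    then show "a \<in> x.E" using xE1 a(1) by blast
  qed (auto simp: Q_def Qb_def)
  have xa: "a2 \<in> x.E" using QE aQ(3) by simp
  define b2 where "b2 = x.j a2"
  have b2: "b2 \<in> Qb" using x.j_B[OF xa] by (simp add: b2_def)
  have b2B: "b2 \<in> B" using b2 by (simp add: Qb_def)
  have "chi (cst C a2) = cst D b2" using x.phi_E[OF xa] by (simp add: b2_def)
  then have ua: "u (cst C a2) = psi (cst D b2)"
    using psi_phi[OF upw[OF cst_pw[OF aQ(3)]]] by (simp add: chi_def)
  have "R a2 b2"
  proof (rule R_step[OF a2 b2B])
    fix c assume c: "c \<in> C"
    show "R (G c b2) (F (th c) a2)" using Ru[OF cst_pw[OF aQ(3)] c] ua by (simp add: F_def sw.F_def)
  qed
  moreover have "sw.ra (Suc (Suc m)) b2" using b1(1) b2 b2B unfolding sw.ra.simps(2)[of "Suc m"] Qb_def by blast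
  ultimately show ?thesis by blast
qed

lemma Pn_step:
  assumes ne: "noext C" "noext D" and P: "Pn (Suc m)" and P': "sw.Pn (Suc m)"
  shows "Pn (Suc (Suc m))"
  unfolding Pn_def
proof (intro allI impI)
  fix a2 assume "ra (Suc (Suc m)) a2"
  then obtain a1 s where a: "a2 \<in> A" "ra (Suc m) a1" "cmp s a1 a2" unfolding ra.simps(2)[of "Suc m"] by blast
  then obtain a0 s' where a0: "ra m a0" "cmp s' a0 a1" by auto
  show "\<exists>b. sw.ra (Suc (Suc m)) b \<and> R a2 b"
  proof (cases "cmp s a1 a0")
    case True then show ?thesis by (rule extend_partner[OF ne P P' a0(1) a(2) _ a(1,3)])
  next
    case False
    then have "cmp s a0 a1" using a0(2) by (auto simp: cmp_def split: if_splits)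
    then have "cmp s a0 a2" using cmp_trans a(3) by blast
    then have "ra (Suc m) a2" using a0(1) a(1) by auto
    then show ?thesis using P sw.ra_Suc unfolding Pn_def by blast
  qed
qed

end

context same_exponent
begin

text \<open>
  With an extremal element all radii are at most one; otherwise the radius is increased step by step.
\<close>

lemma partner:
  assumes a: "a \<in> A"
  shows "\<exists>b. R a b"
proof (cases "noext C \<and> noext D")
  case True
  have P: "Pn (Suc n) \<and> sw.Pn (Suc n)" for n
  proof (induction n)
    case 0 then show ?case using Pn_1 sw.Pn_1 by blast
  next
    case (Suc n) then show ?case using Pn_step[of n] sw.Pn_step[of n] True by blast
  qed
  obtain e where e: "e \<in> E" using ex_E by blast
  have "\<exists>n. ra n a"
  proof (rule connD[OF conA E_A[OF e], of "\<lambda>a. \<exists>n. ra n a"])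
    show "\<exists>n. ra n e" using e by (intro exI[of _ 0]) simp
    have st: "\<exists>n. ra n z" if "ra n y" "z \<in> A" "y \<le> z \<or> z \<le> y" for y z n
      using that cmp_either[of y z] by (intro exI[of _ "Suc n"]) auto
    show "(\<exists>n. ra n y) = (\<exists>n. ra n z)" if "y \<in> A" "z \<in> A" "y \<le> z" for y z
      using st that by blast
  qed (rule a)
  then obtain n where "ra (Suc n) a" using ra_Suc by blast
  then show ?thesis using P[of n] unfolding Pn_def by blast
next
  case False
  have "noext C \<Longrightarrow> noext D"
    unfolding noext_def using oisoonD(2)[OF th'] sw.thD thD th'_th th_th' by metis
  then have "\<not> noext D"  using False
    by (metis (mono_tags, lifting) noext_def oisoonD(2)[OF th] thD sw.thD th_th')
  from near_extremal[OF this a] have "ra (Suc 0) a" using a by auto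
  then show ?thesis using Pn_1 unfolding Pn_def by blast
qed

end

context same_exponent
begin

lemma cancel: "oiso A B"
proof -
  obtain f where f: "\<And>a. a \<in> A \<Longrightarrow> R a (f a)" using partner by metis
  have "oisoon f A B"
  proof (rule oisoI)
    fix b assume "b \<in> B"
    then obtain a where a: "R a b" using sw.partner unfolding sw_R by blast
    then show "\<exists>a\<in>A. f a = b" using f[OF R_in(1)[OF a]] R_fun1[OF _ a] R_in(1)[OF a] by blast
  qed (use f R_in R_le in blast)+
  then show ?thesis unfolding oiso_def by blast
qed

end

lemma (in prime_biexp) cancel_iso:
  assumes "oiso C D"
  shows "oiso A B"
proof -
  obtain th where th: "oisoon th C D" using assms by (auto simp: oiso_def)
  have b: "bij_betw th C D" by (rule oisoonD(4)[OF th])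
  interpret same_exponent A B C D phi psi th "the_inv_into C th"
    by (intro same_exponent.intro prime_biexp_axioms same_exponent_axioms.intro th oisoon_inv)
      (use b in \<open>auto simp: bij_betw_def the_inv_into_f_f f_the_inv_into_f\<close>)
  show ?thesis by (rule cancel)
qed

section \<open>Reduction to prime exponents\<close>

lemma conn_fst: assumes "conn (U \<times> V)" "V \<noteq> {}" shows "conn U"
  unfolding conn_def
proof (intro allI impI ballI)
  obtain v where v: "v \<in> V" using assms(2) by auto
  fix P x y assume a: "x \<in> U" "P x" "\<forall>y\<in>U. \<forall>z\<in>U. y \<le> z \<longrightarrow> P y = P z" "y \<in> U"
  have "P (fst (y, v))"
  proof (rule connD[OF assms(1), of "(x, v)" "\<lambda>s. P (fst s)"])
    show "P (fst s) = P (fst t)" if "s \<in> U \<times> V" "t \<in> U \<times> V" "s \<le> t" for s t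
      using a(3) that by (metis fst_mono mem_Times_iff)
  qed (use a(1,2,4) v in simp_all)
  then show "P y" by simp
qed

lemma oiso_finite: "oiso S T \<Longrightarrow> finite S \<longleftrightarrow> finite T"
  unfolding oiso_def oisoon_def using bij_betw_finite by blast

lemma oiso_empty: "oiso S T \<Longrightarrow> S = {} \<longleftrightarrow> T = {}"
  unfolding oiso_def oisoon_def bij_betw_def by blast

lemma pw_cong:
  assumes "oiso C C'" "oiso A A'"
  shows "oiso (pw C A) (pw C' A')"
proof -
  obtain h where h: "oisoon h C' C" using oiso_sym[OF assms(1)] by (auto simp: oiso_def)
  obtain g where g: "oisoon g A A'" using assms(2) by (auto simp: oiso_def)
  have hb: "bij_betw h C' C" and gb: "bij_betw g A A'" using oisoonD(4)[OF h] oisoonD(4)[OF g] by auto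
  let ?hi = "the_inv_into C' h" and ?gi = "the_inv_into A g"
  note hi = oisoon_inv[OF h] and gi = oisoon_inv[OF g]
  have inv: "?hi c \<in> C'" "h (?hi c) = c" if "c \<in> C" for c
    using oisoonD(1)[OF hi that] hb that by (auto simp: bij_betw_def f_the_inv_into_f)
  have inv': "?gi a \<in> A" "g (?gi a) = a" if "a \<in> A'" for a
    using oisoonD(1)[OF gi that] gb that by (auto simp: bij_betw_def f_the_inv_into_f)
  have inv2: "?hi (h c) = c" if "c \<in> C'" for c
    using hb that by (auto simp: bij_betw_def the_inv_into_f_f)
  have "oisoon (\<lambda>f. \<lambda>x\<in>C'. g (f (h x))) (pw C A) (pw C' A')"
  proof (rule oisoI)
    fix f assume f: "f \<in> pw C A"
    have im: "(\<lambda>x\<in>C'. g (f (h x))) \<in> pw C' A'" if f: "f \<in> pw C A" for f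
    proof (rule pwI)
      fix x y assume "x \<in> C'" "y \<in> C'" "x \<le> y"
      then show "(\<lambda>x\<in>C'. g (f (h x))) x \<le> (\<lambda>x\<in>C'. g (f (h x))) y"
        using oisoonD(1,2)[OF h] oisoonD(2)[OF g] pwD[OF f] pwM[OF f] by simp
    qed (use pwD[OF f] oisoonD(1)[OF h] oisoonD(1)[OF g] in auto)
    show "(\<lambda>x\<in>C'. g (f (h x))) \<in> pw C' A'" by (rule im[OF f])
    fix f' assume f': "f' \<in> pw C A"
    have "f \<le> f' \<longleftrightarrow> (\<forall>c\<in>C. f c \<le> f' c)" by (rule pw_le[OF f f'])
    also have "\<dots> \<longleftrightarrow> (\<forall>x\<in>C'. f (h x) \<le> f' (h x))" using inv oisoonD(1)[OF h] by metis
    also have "\<dots> \<longleftrightarrow> (\<forall>x\<in>C'. g (f (h x)) \<le> g (f' (h x)))"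
      using oisoonD(2)[OF g] pwD[OF f] pwD[OF f'] oisoonD(1)[OF h] by simp
    also have "\<dots> \<longleftrightarrow> (\<lambda>x\<in>C'. g (f (h x))) \<le> (\<lambda>x\<in>C'. g (f' (h x)))"
      using pw_le[OF im[OF f] im[OF f']] by simp
    finally show "f \<le> f' \<longleftrightarrow> (\<lambda>x\<in>C'. g (f (h x))) \<le> (\<lambda>x\<in>C'. g (f' (h x)))" .
  next
    fix k assume k: "k \<in> pw C' A'"
    let ?f = "\<lambda>c\<in>C. ?gi (k (?hi c))"
    have f: "?f \<in> pw C A"
    proof (rule pwI)
      fix x y assume "x \<in> C" "y \<in> C" "x \<le> y"
      then show "?f x \<le> ?f y"
        using oisoonD(1,2)[OF hi] oisoonD(2)[OF gi] pwD[OF k] pwM[OF k] by simp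
    qed (use pwD[OF k] inv inv' in auto)
    have "(\<lambda>x\<in>C'. g (?f (h x))) = k"
    proof (rule ext)
      fix x show "(\<lambda>x\<in>C'. g (?f (h x))) x = k x"
        using inv2[of x] inv'(2)[OF pwD[OF k], of x] oisoonD(1)[OF h, of x] pw_undef[OF k, of x] by (cases "x \<in> C'") simp_all
    qed
    then show "\<exists>f\<in>pw C A. (\<lambda>x\<in>C'. g (f (h x))) = k" using f by blast
  qed
  then show ?thesis unfolding oiso_def by blast
qed

lemma pw_curry: "oiso (pw (C1 \<times> C2) A) (pw C1 (pw C2 A))"
proof -
  have "oisoon (\<lambda>f. \<lambda>x\<in>C1. \<lambda>y\<in>C2. f (x, y)) (pw (C1 \<times> C2) A) (pw C1 (pw C2 A))"
  proof (rule oisoI)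
    fix f assume f: "f \<in> pw (C1 \<times> C2) A"
    have r: "(\<lambda>y\<in>C2. f (x, y)) \<in> pw C2 A" if "f \<in> pw (C1 \<times> C2) A" "x \<in> C1" for f x
      by (rule pwI) (use pwD[OF that(1)] pwM[OF that(1)] that(2) in auto)
    have im: "(\<lambda>x\<in>C1. \<lambda>y\<in>C2. f (x, y)) \<in> pw C1 (pw C2 A)" if f: "f \<in> pw (C1 \<times> C2) A" for f
      by (rule pwI) (use r[OF f] pwM[OF f] in \<open>auto simp: le_fun_def\<close>)
    show "(\<lambda>x\<in>C1. \<lambda>y\<in>C2. f (x, y)) \<in> pw C1 (pw C2 A)" by (rule im[OF f])
    fix g assume g: "g \<in> pw (C1 \<times> C2) A"
    have "f \<le> g \<longleftrightarrow> (\<forall>x\<in>C1. \<forall>y\<in>C2. f (x, y) \<le> g (x, y))" using pw_le[OF f g] by auto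
    also have "\<dots> \<longleftrightarrow> (\<forall>x\<in>C1. (\<lambda>y\<in>C2. f (x, y)) \<le> (\<lambda>y\<in>C2. g (x, y)))"
      using pw_le[OF r[OF f] r[OF g]] by simp
    also have "\<dots> \<longleftrightarrow> (\<lambda>x\<in>C1. \<lambda>y\<in>C2. f (x, y)) \<le> (\<lambda>x\<in>C1. \<lambda>y\<in>C2. g (x, y))"
      using pw_le[OF im[OF f] im[OF g]] by simp
    finally show "f \<le> g \<longleftrightarrow> (\<lambda>x\<in>C1. \<lambda>y\<in>C2. f (x, y)) \<le> (\<lambda>x\<in>C1. \<lambda>y\<in>C2. g (x, y))" .
  next
    fix k assume k: "k \<in> pw C1 (pw C2 A)"
    let ?f = "\<lambda>p\<in>C1 \<times> C2. k (fst p) (snd p)"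
    have f: "?f \<in> pw (C1 \<times> C2) A"
    proof (rule pwI)
      fix p q assume pq: "p \<in> C1 \<times> C2" "q \<in> C1 \<times> C2" "p \<le> q"
      then have "k (fst p) (snd p) \<le> k (fst p) (snd q)" "k (fst p) (snd q) \<le> k (fst q) (snd q)"
        using pwM[OF pwD[OF k]] le_funD[OF pwM[OF k]] by (auto simp: less_eq_prod_def mem_Times_iff)
      then show "?f p \<le> ?f q" using pq by simp
    qed (use pwD[OF pwD[OF k]] in auto)
    have "(\<lambda>x\<in>C1. \<lambda>y\<in>C2. ?f (x, y)) = k"
    proof (rule ext)
      fix x show "(\<lambda>x\<in>C1. \<lambda>y\<in>C2. ?f (x, y)) x = k x"
        using pw_undef[OF k, of x] pw_undef[OF pwD[OF k], of x] by (cases "x \<in> C1") (auto simp: fun_eq_iff)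
    qed
    then show "\<exists>f\<in>pw (C1 \<times> C2) A. (\<lambda>x\<in>C1. \<lambda>y\<in>C2. f (x, y)) = k" using f by blast
  qed
  then show ?thesis unfolding oiso_def by blast
qed

lemma oiso_by:
  assumes "\<And>x. x \<in> S \<Longrightarrow> h x \<in> T" "\<And>t. t \<in> T \<Longrightarrow> g t \<in> S" "\<And>t. t \<in> T \<Longrightarrow> h (g t) = t"
    "\<And>x y. x \<in> S \<Longrightarrow> y \<in> S \<Longrightarrow> x \<le> y \<longleftrightarrow> h x \<le> h y"
  shows "oiso S T"
  unfolding oiso_def by (rule exI, rule oisoI[of S h T]) (use assms in blast)+

lemma prod_swap: "oiso (U \<times> V) (V \<times> U)"
  by (rule oiso_by[of _ "\<lambda>p. (snd p, fst p)" _ "\<lambda>p. (snd p, fst p)"]) (auto simp: less_eq_prod_def)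

lemma prod_cong: assumes "oiso U U'" "oiso V V'" shows "oiso (U \<times> V) (U' \<times> V')"
proof -
  obtain g h where g: "oisoon g U U'" and h: "oisoon h V V'" using assms by (auto simp: oiso_def)
  have "oisoon (\<lambda>p. (g (fst p), h (snd p))) (U \<times> V) (U' \<times> V')"
  proof (rule oisoI)
    fix t assume "t \<in> U' \<times> V'"
    then obtain u v where "u \<in> U" "g u = fst t" "v \<in> V" "h v = snd t"
      using oisoonD(3)[OF g, of "fst t"] oisoonD(3)[OF h, of "snd t"] by (auto simp: mem_Times_iff)
    then show "\<exists>p\<in>U \<times> V. (g (fst p), h (snd p)) = t" by (intro bexI[of _ "(u, v)"]) auto
  qed (use oisoonD(1,2)[OF g] oisoonD(1,2)[OF h] in \<open>auto simp: less_eq_prod_def\<close>)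
  then show ?thesis unfolding oiso_def by blast
qed

lemma prod_one: "oiso ({z} \<times> U) U"
  by (rule oiso_by[of _ snd _ "\<lambda>u. (z, u)"]) (auto simp: less_eq_prod_def)

lemma prod_one': "oiso (U \<times> {z}) U"
  by (rule oiso_trans[OF prod_swap prod_one])

lemma prod_assoc: "oiso ((U \<times> V) \<times> Z) (U \<times> (V \<times> Z))"
  by (rule oiso_by[of _ "\<lambda>p. (fst (fst p), (snd (fst p), snd p))" _ "\<lambda>p. ((fst p, fst (snd p)), snd (snd p))"])
    (auto simp: less_eq_prod_def)

lemma prod_middle: "oiso ((U \<times> Z) \<times> (U' \<times> Z')) ((U \<times> U') \<times> (Z \<times> Z'))"
  by (rule oiso_by[of _ "\<lambda>p. ((fst (fst p), fst (snd p)), (snd (fst p), snd (snd p)))" _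
        "\<lambda>p. ((fst (fst p), fst (snd p)), (snd (fst p), snd (snd p)))"]) (auto simp: less_eq_prod_def)

lemma pw_one: "oiso (pw {z} A) A"
proof (rule oiso_by[of _ "\<lambda>f. f z" _ "cst {z}"])
  fix f g assume f: "f \<in> pw {z} A" "g \<in> pw {z} A"
  show "f \<le> g \<longleftrightarrow> f z \<le> g z" using pw_le[OF f] by simp
qed (auto dest: pwD)

text \<open>
  Principal downsets represent a poset by sets ordered by inclusion, here of codes of its elements. So one type suffices for all finite
  posets, which lets an existential statement range over them.
\<close>

lemma oiso_on_nat_set:
  assumes "finite (S :: 'a::order set)"
  shows "\<exists>S' :: nat set set. oiso S S'"
proof -
  obtain h :: "'a \<Rightarrow> nat" where h: "inj_on h S" using finite_imp_inj_to_nat_seg[OF assms] by blast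
  let ?g = "\<lambda>x. h ` {y \<in> S. y \<le> x}"
  have "x \<le> y \<longleftrightarrow> ?g x \<subseteq> ?g y" if "x \<in> S" "y \<in> S" for x y
  proof
    assume "?g x \<subseteq> ?g y"
    then have "h x \<in> ?g y" using that by blast
    then show "x \<le> y" using inj_onD[OF h] that by auto
  qed (use order_trans in blast)
  then have "oisoon ?g S (?g ` S)" by (intro oisoI) blast+
  then show ?thesis unfolding oiso_def by blast
qed

definition decomp :: "'a::order set \<Rightarrow> 'b::order set \<Rightarrow> 'c::order set \<Rightarrow> 'd::order set \<Rightarrow> bool" where
  "decomp A B C D \<longleftrightarrow> (\<exists>(E :: nat set set) (X :: nat set set) (Y :: nat set set) (Z :: nat set set). finite E \<and> finite X \<and> finite Y \<and> finite Z \<and>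
     oiso A (pw X E) \<and> oiso B (pw Y E) \<and> oiso C (Y \<times> Z) \<and> oiso D (X \<times> Z))"

lemma decompI:
  assumes "finite E" "finite X" "finite Y" "finite Z"
    "oiso A (pw X E)" "oiso B (pw Y E)" "oiso C (Y \<times> Z)" "oiso D (X \<times> Z)"
  shows "decomp A B C D"
proof -
  obtain E' X' Y' Z' :: "nat set set" where i: "oiso E E'" "oiso X X'" "oiso Y Y'" "oiso Z Z'"
    using oiso_on_nat_set assms(1-4) by metis
  have "finite E'" "finite X'" "finite Y'" "finite Z'" using i oiso_finite assms(1-4) by blast+
  moreover have "oiso A (pw X' E')" "oiso B (pw Y' E')" "oiso C (Y' \<times> Z')" "oiso D (X' \<times> Z')"
    using oiso_trans[OF assms(5) pw_cong] oiso_trans[OF assms(6) pw_cong]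
      oiso_trans[OF assms(7) prod_cong] oiso_trans[OF assms(8) prod_cong] i by blast+
  ultimately show ?thesis unfolding decomp_def by blast
qed

definition solves :: "nat set set \<Rightarrow> nat set set \<Rightarrow> bool" where
  "solves C D \<longleftrightarrow> (\<forall>(A :: nat set set) (B :: nat set set). finite A \<longrightarrow> finite B \<longrightarrow> A \<noteq> {} \<longrightarrow> conn (pw C A) \<longrightarrow>
     oiso (pw C A) (pw D B) \<longrightarrow> decomp A B C D)"

lemma prime_biexp_of_iso:
  assumes "prime C" "prime D" "finite A" "finite B" "A \<noteq> {}" "conn (pw C A)" "oisoon h (pw C A) (pw D B)"
  shows "prime_biexp A B C D h (the_inv_into (pw C A) h)"
proof (intro prime_biexp.intro prime_biexp_axioms.intro assms biexp_of_iso)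
  show "finite C" "finite D" "conn C" "conn D" using assms(1,2) by (auto simp: prime_def)
  show "C \<noteq> {}" "D \<noteq> {}" using assms(1,2) by (auto simp: prime_def)
qed

lemma pw_exchange: "oiso (pw C (pw D S)) (pw D (pw C S))"
  using oiso_trans[OF oiso_trans[OF oiso_sym[OF pw_curry] pw_cong[OF prod_swap oiso_refl]] pw_curry] .

lemma cancel_prime:
  assumes "prime D" "finite A" "finite B" "A \<noteq> {}" "conn (pw D A)" "oiso (pw D A) (pw D B)"
  shows "oiso A B"
proof -
  obtain h where h: "oisoon h (pw D A) (pw D B)" using assms(6) by (auto simp: oiso_def)
  interpret prime_biexp A B D D h "the_inv_into (pw D A) h" by (rule prime_biexp_of_iso[OF assms(1,1,2-5) h])
  show ?thesis by (rule cancel_iso[OF oiso_refl])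
qed

lemma pw_nonempty: "A \<noteq> {} \<Longrightarrow> pw C A \<noteq> {}"
  using cst_pw by (metis ex_in_conv)

text \<open>
  Exchanging exponents, \<open>B\<^sup>D \<cong> (S\<^sup>D)\<^sup>C \<cong> (S\<^sup>C)\<^sup>D\<close>, and the exponent \<open>D\<close> cancels.
\<close>

lemma other_base:
  assumes C: "prime C" and D: "prime D" and fin: "finite A" "finite B" "finite S" and ne: "B \<noteq> {}"
    and iso: "oiso (pw C A) (pw D B)" and cn: "conn (pw D B)" and A: "oiso A (pw D S)"
  shows "oiso B (pw C S)"
proof -
  have "oiso (pw D B) (pw C (pw D S))" by (rule oiso_trans[OF oiso_sym[OF iso] pw_cong[OF oiso_refl A]])
  then have "oiso (pw D B) (pw D (pw C S))" using oiso_trans pw_exchange by blast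
  then show ?thesis
    by (intro cancel_prime[OF D fin(2) _ ne cn]) (use fin C in \<open>auto simp: prime_def pw_finite\<close>)
qed

lemma solves_prime:
  assumes C: "prime C" and D: "prime D"
  shows "solves C D"
  unfolding solves_def
proof (intro allI impI)
  fix A B :: "nat set set"
  assume fin: "finite A" "finite B" and ne: "A \<noteq> {}" and cn: "conn (pw C A)" and iso: "oiso (pw C A) (pw D B)"
  have fCD: "finite C" "finite D" using C D by (auto simp: prime_def)
  obtain h where h: "oisoon h (pw C A) (pw D B)" using iso by (auto simp: oiso_def)
  interpret prime_biexp A B C D h "the_inv_into (pw C A) h" by (rule prime_biexp_of_iso[OF C D fin ne cn h])
  let ?o = "{{} :: nat set}"
  show "decomp A B C D"
  proof (cases "oiso C D")
    case True
    have AB: "oiso A B" by (rule cancel_iso[OF True])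
    show ?thesis
      by (rule decompI[of A ?o ?o C]) (use fin fCD in simp, simp, simp, use fCD in simp,
          rule oiso_sym[OF pw_one], rule oiso_trans[OF oiso_sym[OF AB] oiso_sym[OF pw_one]],
          rule oiso_sym[OF prod_one], rule oiso_trans[OF oiso_sym[OF True] oiso_sym[OF prod_one]])
  next
    case False
    have "\<exists>S :: nat set set. finite S \<and> oiso A (pw D S) \<and> oiso B (pw C S)"
      using power_cases[OF False]
    proof
      assume a: "oiso A (pw D sw.E)"
      have "finite sw.E" using finB by (simp add: sw.E_def)
      then show ?thesis using other_base[OF C D fin _ sw.neA iso sw.conP a] a by blast
    next
      assume a: "oiso B (pw C E)"
      have "finite E" using finA by (simp add: E_def)
      then show ?thesis using other_base[OF D C fin(2,1) _ ne oiso_sym[OF iso] cn a] a by blast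
    qed
    then obtain S :: "nat set set" where S: "finite S" "oiso A (pw D S)" "oiso B (pw C S)" by blast
    show ?thesis
      by (rule decompI[OF S(1) fCD(2,1) _ S(2,3), of ?o]) (simp, rule oiso_sym[OF prod_one'], rule oiso_sym[OF prod_one'])
  qed
qed

lemma solves_sym:
  assumes "solves C D" "C \<noteq> {}"
  shows "solves D C"
  unfolding solves_def
proof (intro allI impI)
  fix A B :: "nat set set"
  assume a: "finite A" "finite B" "A \<noteq> {}" "conn (pw D A)" "oiso (pw D A) (pw C B)"
  have "pw C B \<noteq> {}" using oiso_empty[OF a(5)] pw_nonempty[OF a(3)] by blast
  then have "B \<noteq> {}" using assms(2) pwD by fastforce
  then have "decomp B A C D"
    using assms(1) a conn_oiso[OF a(4,5)] oiso_sym[OF a(5)] unfolding solves_def by blast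
  then show "decomp A B D C" unfolding decomp_def by blast
qed

lemma solves_one:
  assumes "finite D" "card C = 1"
  shows "solves C D"
  unfolding solves_def
proof (intro allI impI)
  fix A B :: "nat set set"
  assume a: "finite A" "finite B" "A \<noteq> {}" "conn (pw C A)" "oiso (pw C A) (pw D B)"
  obtain z where z: "C = {z}" using assms(2) by (rule card_1_singletonE)
  show "decomp A B C D"
    unfolding z
    by (rule decompI[OF a(2) assms(1), of "{z}" "{z}"])
      (simp, simp, rule oiso_trans[OF oiso_sym[OF pw_one[of z]] a(5)[unfolded z]], rule oiso_sym[OF pw_one],
        rule oiso_sym[OF prod_one], rule oiso_sym[OF prod_one'])
qed

text \<open>
  First solve for \<open>A\<^bsub>2\<^esub> = A\<^bsup>C2\<^esup>\<close> over \<open>C1\<close>, obtaining \<open>A\<^bsub>2\<^esub> \<cong> E\<^sup>X\<close>; this is again a pair of powers, namely of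
  \<open>A\<close> and \<open>E\<close> with exponents \<open>C2\<close> and \<open>X\<close>. The factors of the two solutions multiply.
\<close>

lemma solves_times:
  assumes C: "oiso C (C1 \<times> C2)" and fin: "finite C1" "finite C2" "finite D" and ne: "C1 \<noteq> {}" "D \<noteq> {}"
    and 1: "solves C1 D" and 2: "\<And>X Z :: nat set set. oiso D (X \<times> Z) \<Longrightarrow> solves C2 X"
  shows "solves C D"
  unfolding solves_def
proof (intro allI impI)
  fix A B :: "nat set set"
  assume a: "finite A" "finite B" "A \<noteq> {}" "conn (pw C A)" "oiso (pw C A) (pw D B)"
  obtain A2 :: "nat set set" where A2: "oiso (pw C2 A) A2" using oiso_on_nat_set pw_finite[OF fin(2) a(1)] by blast
  have fA2: "finite A2" "A2 \<noteq> {}" using oiso_finite[OF A2] oiso_empty[OF A2] pw_finite[OF fin(2) a(1)] pw_nonempty[OF a(3)] by auto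
  have i1: "oiso (pw C A) (pw C1 A2)"
    by (rule oiso_trans[OF pw_cong[OF C oiso_refl] oiso_trans[OF pw_curry pw_cong[OF oiso_refl A2]]])
  have c1: "conn (pw C1 A2)" by (rule conn_oiso[OF a(4) i1])
  have "decomp A2 B C1 D"
    using 1 fA2 a(2) c1 oiso_trans[OF oiso_sym[OF i1] a(5)] unfolding solves_def by blast
  then obtain E X Y Z :: "nat set set" where s: "finite E" "finite X" "finite Y" "finite Z"
    "oiso A2 (pw X E)" "oiso B (pw Y E)" "oiso C1 (Y \<times> Z)" "oiso D (X \<times> Z)" unfolding decomp_def by blast
  have i2: "oiso (pw C2 A) (pw X E)" by (rule oiso_trans[OF A2 s(5)])
  have c2: "conn (pw C2 A)" by (rule conn_oiso[OF conn_base[OF c1 ne(1)] oiso_sym[OF A2]])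
  have "decomp A E C2 X" using 2[OF s(8)] a(1) s(1) a(3) c2 i2 unfolding solves_def by blast
  then obtain E' X' Y' Z' :: "nat set set" where t: "finite E'" "finite X'" "finite Y'" "finite Z'"
    "oiso A (pw X' E')" "oiso E (pw Y' E')" "oiso C2 (Y' \<times> Z')" "oiso X (X' \<times> Z')" unfolding decomp_def by blast
  show "decomp A B C D"
  proof (rule decompI[of E' X' "Y \<times> Y'" "Z' \<times> Z"])
    show "oiso B (pw (Y \<times> Y') E')"
      by (rule oiso_trans[OF s(6) oiso_trans[OF pw_cong[OF oiso_refl t(6)] oiso_sym[OF pw_curry]]])
    have "oiso C ((Y \<times> Y') \<times> (Z \<times> Z'))"
      by (rule oiso_trans[OF oiso_trans[OF C prod_cong[OF s(7) t(7)]] prod_middle])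
    then show "oiso C ((Y \<times> Y') \<times> (Z' \<times> Z))" using oiso_trans prod_cong[OF oiso_refl prod_swap] by blast
    show "oiso D (X' \<times> (Z' \<times> Z))"
      by (rule oiso_trans[OF s(8) oiso_trans[OF prod_cong[OF t(8) oiso_refl] prod_assoc]])
  qed (use s t in auto)
qed

lemma factor:
  assumes "oiso D (X \<times> Z)" "finite D" "conn D" "D \<noteq> {}"
  shows "finite X" "conn X" "X \<noteq> {}" "card D = card X * card Z" "1 \<le> card Z"
proof -
  have f: "finite (X \<times> Z)" "X \<times> Z \<noteq> {}" using oiso_finite[OF assms(1)] oiso_empty[OF assms(1)] assms(2,4) by auto
  show ne: "X \<noteq> {}" using f by auto
  have nz: "Z \<noteq> {}" using f by auto
  show "finite X" using finite_cartesian_productD1[OF f(1) nz] .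
  have "finite Z" using finite_cartesian_productD2[OF f(1) ne] .
  then show "1 \<le> card Z" using nz by (simp add: Suc_le_eq card_gt_0_iff)
  show "conn X" by (rule conn_fst[OF conn_oiso[OF assms(3,1)] nz])
  show "card D = card X * card Z" using oiso_card[OF assms(1)] by (simp add: card_cartesian_product)
qed

text \<open>
  Induction over the total size. The factor \<open>X\<close> of \<open>D\<close> that arises in \<open>solves_times\<close> is not larger than \<open>D\<close>, so splitting \<open>C\<close> decreases the
  total, and the symmetry of the statement allows splitting \<open>D\<close> as well.
\<close>

lemma solves_all:
  "finite C \<Longrightarrow> conn C \<Longrightarrow> C \<noteq> {} \<Longrightarrow> finite D \<Longrightarrow> conn D \<Longrightarrow> D \<noteq> {} \<Longrightarrow> solves C D"
proof (induction "card C + card D" arbitrary: C D rule: less_induct)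
  case less
  have split: "solves P R"
    if P: "finite P" "conn P" "P \<noteq> {}" and R: "finite R" "conn R" "R \<noteq> {}" and sum: "card P + card R = card C + card D"
      and two: "2 \<le> card P" and np: "\<not> prime P" for P R :: "nat set set"
  proof -
    obtain U V :: "nat set set" where UV: "oiso P (U \<times> V)" "card U \<noteq> 1" "card V \<noteq> 1"
      using np P(1,2) two unfolding prime_def by blast
    note fU = factor[OF UV(1) P] and fV = factor[OF oiso_trans[OF UV(1) prod_swap] P]
    have U2: "2 \<le> card U" "2 \<le> card V" using fU(5) fV(5) UV(2,3) by auto
    have lt: "card U < card P" "card V < card P" using U2 fU(4) by auto
    show ?thesis
    proof (rule solves_times[OF UV(1) fU(1) fV(1) R(1) fU(3) R(3)])
      have "card U + card R < card C + card D" using lt(1) sum by linarith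
      then show "solves U R" by (rule less.hyps[OF _ fU(1-3) R])
      fix X Z :: "nat set set" assume "oiso R (X \<times> Z)"
      note fX = factor[OF this R]
      have "card X \<le> card R" using fX(4,5) by simp
      then have "card V + card X < card C + card D" using lt(2) sum by linarith
      then show "solves V X" by (rule less.hyps[OF _ fV(1-3) fX(1-3)])
    qed
  qed
  have ge: "1 \<le> card C" "1 \<le> card D" using less.prems by (auto simp: Suc_le_eq card_gt_0_iff)
  consider "card C = 1" | "card D = 1" | "2 \<le> card C" "2 \<le> card D" using ge by linarith
  then show ?case
  proof cases
    case 1 then show ?thesis using solves_one less.prems by blast
  next
    case 2 then show ?thesis using solves_sym[OF solves_one] less.prems by blast
  next
    case 3
    show ?thesis
    proof (cases "prime C")
      case False then show ?thesis using split[of C D] less.prems 3 by simp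
    next
      case True
      show ?thesis
      proof (cases "prime D")
        case False
        then have "solves D C" using split[of D C] less.prems 3 by simp
        then show ?thesis using solves_sym less.prems by blast
      next
        case D: True show ?thesis by (rule solves_prime[OF True D])
      qed
    qed
  qed
qed

section \<open>Posets as relations\<close>

text \<open>
  The relation of a poset that is given as a set in an ordered type.
\<close>

definition rof :: "'a::order set \<Rightarrow> 'a rel" where
  "rof S = {(x, y). x \<in> S \<and> y \<in> S \<and> x \<le> y}"

lemma Field_rof[simp]: "Field (rof S) = S"
  by (auto simp: Field_def rof_def)

lemma Partial_order_rof: "Partial_order (rof S)"
  unfolding order_on_defs refl_on_def trans_def antisym_def Field_rof
  by (auto simp: rof_def)

lemma poset_iso_rof: "poset_iso (rof S) (rof T) \<longleftrightarrow> oiso S T"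
  unfolding poset_iso_def oiso_def oisoon_def Field_rof
  by (intro arg_cong[of _ _ Ex] ext conj_cong refl) (auto simp: rof_def dest: bij_betwE)

lemma poset_iso_sym: "poset_iso r s \<Longrightarrow> poset_iso s r"
proof -
  assume "poset_iso r s"
  then obtain f where f: "bij_betw f (Field r) (Field s)"
    "\<forall>x\<in>Field r. \<forall>y\<in>Field r. (x, y) \<in> r \<longleftrightarrow> (f x, f y) \<in> s" unfolding poset_iso_def by blast
  have "the_inv_into (Field r) f x \<in> Field r \<and> f (the_inv_into (Field r) f x) = x" if "x \<in> Field s" for x
    using f(1) that by (auto simp: bij_betw_def the_inv_into_into f_the_inv_into_f)
  then show ?thesis unfolding poset_iso_def
    using bij_betw_the_inv_into[OF f(1)] f(2) by (intro exI[of _ "the_inv_into (Field r) f"]) auto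
qed

lemma poset_iso_trans: "poset_iso r s \<Longrightarrow> poset_iso s t \<Longrightarrow> poset_iso r t"
  unfolding poset_iso_def
proof (elim exE conjE)
  fix f g assume "bij_betw f (Field r) (Field s)" "\<forall>x\<in>Field r. \<forall>y\<in>Field r. (x, y) \<in> r \<longleftrightarrow> (f x, f y) \<in> s"
    "bij_betw g (Field s) (Field t)" "\<forall>x\<in>Field s. \<forall>y\<in>Field s. (x, y) \<in> s \<longleftrightarrow> (g x, g y) \<in> t"
  then show "\<exists>f. bij_betw f (Field r) (Field t) \<and> (\<forall>x\<in>Field r. \<forall>y\<in>Field r. (x, y) \<in> r \<longleftrightarrow> (f x, f y) \<in> t)"
    by (intro exI[of _ "g \<circ> f"]) (auto intro: bij_betw_trans dest: bij_betwE)
qed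

lemma poset_on_nat_set:
  assumes "Partial_order r" "finite (Field r)"
  shows "\<exists>S :: nat set set. finite S \<and> poset_iso r (rof S)"
proof -
  obtain h :: "'a \<Rightarrow> nat" where h: "inj_on h (Field r)" using finite_imp_inj_to_nat_seg[OF assms(2)] by blast
  let ?g = "\<lambda>x. h ` {y. (y, x) \<in> r}"
  have rf: "(x, x) \<in> r" if "x \<in> Field r" for x using assms(1) that by (auto simp: order_on_defs refl_on_def)
  have iff: "(x, y) \<in> r \<longleftrightarrow> ?g x \<subseteq> ?g y" if "x \<in> Field r" "y \<in> Field r" for x y
  proof
    assume "(x, y) \<in> r"
    then show "?g x \<subseteq> ?g y" using assms(1) unfolding order_on_defs by (blast dest: transD)
  next
    assume "?g x \<subseteq> ?g y"
    then have "h x \<in> ?g y" using rf[OF that(1)] by blast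
    then obtain z where z: "(z, y) \<in> r" "h x = h z" by auto
    then have "x = z" using inj_onD[OF h z(2) that(1)] by (auto intro: FieldI1)
    then show "(x, y) \<in> r" using z(1) by simp
  qed
  have "inj_on ?g (Field r)"
  proof (rule inj_onI)
    fix x y assume xy: "x \<in> Field r" "y \<in> Field r" "?g x = ?g y"
    then have "(x, y) \<in> r" "(y, x) \<in> r" using iff by auto
    then show "x = y" using assms(1) by (auto simp: order_on_defs dest: antisymD)
  qed
  then have "poset_iso r (rof (?g ` Field r))"
    unfolding poset_iso_def Field_rof using iff by (intro exI[of _ ?g]) (auto simp: bij_betw_def rof_def)
  then show ?thesis using assms(2) by blast
qed

lemma poset_exp_rof: "poset_exp (rof A) (rof C) = rof (pw C A)"
proof -
  have "mono_maps (rof C) (rof A) = pw C A"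
    unfolding mono_maps_def pw_def monotone_on_def Field_rof by (auto simp: rof_def dest: PiE_mem)
  then show ?thesis
    unfolding poset_exp_def by (auto simp: rof_def[of A] rof_def[of "pw C A"] pw_le dest: pwD)
qed

lemma poset_prod_rof: "poset_prod (rof U) (rof V) = rof (U \<times> V)"
  by (auto simp: poset_prod_def rof_def)

lemma poset_prod_cong:
  assumes "poset_iso Y Y'" "poset_iso Z Z'" "Partial_order Y" "Partial_order Z" "Partial_order Y'" "Partial_order Z'"
  shows "poset_iso (poset_prod Y Z) (poset_prod Y' Z')"
proof -
  obtain f g where f: "bij_betw f (Field Y) (Field Y')" "\<forall>x\<in>Field Y. \<forall>y\<in>Field Y. (x, y) \<in> Y \<longleftrightarrow> (f x, f y) \<in> Y'"
    and g: "bij_betw g (Field Z) (Field Z')" "\<forall>x\<in>Field Z. \<forall>y\<in>Field Z. (x, y) \<in> Z \<longleftrightarrow> (g x, g y) \<in> Z'"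
    using assms(1,2) unfolding poset_iso_def by blast
  show ?thesis
    unfolding poset_iso_def Field_poset_prod[OF assms(3,4)] Field_poset_prod[OF assms(5,6)]
    by (intro exI[of _ "map_prod f g"] conjI bij_betw_map_prod f(1) g(1))
      (use f(2) g(2) in \<open>auto simp: poset_prod_def\<close>)
qed

lemma poset_exp_cong:
  assumes "poset_iso E E'" "poset_iso X X'" "Partial_order E" "Partial_order E'"
  shows "poset_iso (poset_exp E X) (poset_exp E' X')"
proof -
  obtain g where g: "bij_betw g (Field E) (Field E')" "\<forall>x\<in>Field E. \<forall>y\<in>Field E. (x, y) \<in> E \<longleftrightarrow> (g x, g y) \<in> E'"
    using assms(1) unfolding poset_iso_def by blast
  obtain k where k: "bij_betw k (Field X') (Field X)" "\<forall>x\<in>Field X'. \<forall>y\<in>Field X'. (x, y) \<in> X' \<longleftrightarrow> (k x, k y) \<in> X"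
    using poset_iso_sym[OF assms(2)] unfolding poset_iso_def by blast
  define gi where "gi = the_inv_into (Field E) g"
  define ki where "ki = the_inv_into (Field X') k"
  have gi: "gi y \<in> Field E" "g (gi y) = y" if "y \<in> Field E'" for y
    using g(1) that by (auto simp: gi_def bij_betw_def the_inv_into_into f_the_inv_into_f)
  have gg: "gi (g y) = y" "g y \<in> Field E'" if "y \<in> Field E" for y
    using g(1) that by (auto simp: gi_def bij_betw_def the_inv_into_f_f)
  have ki: "ki y \<in> Field X'" "k (ki y) = y" if "y \<in> Field X" for y
    using k(1) that by (auto simp: ki_def bij_betw_def the_inv_into_into f_the_inv_into_f)
  have kk: "ki (k y) = y" "k y \<in> Field X" if "y \<in> Field X'" for y
    using k(1) that by (auto simp: ki_def bij_betw_def the_inv_into_f_f)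
  let ?P = "\<lambda>f. \<lambda>x\<in>Field X'. g (f (k x))" and ?R = "\<lambda>q. \<lambda>x\<in>Field X. gi (q (ki x))"
  have mf1: "f x \<in> Field E" if "f \<in> mono_maps X E" "x \<in> Field X" for f x
    using that unfolding mono_maps_def by (auto simp: PiE_def)
  have mf3: "(f x, f y) \<in> E" if "f \<in> mono_maps X E" "x \<in> Field X" "y \<in> Field X" "(x, y) \<in> X" for f x y
    using that unfolding mono_maps_def monotone_on_def by blast
  have mq1: "q x \<in> Field E'" if "q \<in> mono_maps X' E'" "x \<in> Field X'" for q x
    using that unfolding mono_maps_def by (auto simp: PiE_def)
  have mq3: "(q x, q y) \<in> E'" if "q \<in> mono_maps X' E'" "x \<in> Field X'" "y \<in> Field X'" "(x, y) \<in> X'" for q x y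
    using that unfolding mono_maps_def monotone_on_def by blast
  have P: "?P f \<in> mono_maps X' E'" if f: "f \<in> mono_maps X E" for f
    unfolding mono_maps_def monotone_on_def using mf1[OF f] mf3[OF f] kk gg(2) k(2) g(2) by auto
  have R: "?R q \<in> mono_maps X E" if q: "q \<in> mono_maps X' E'" for q
    unfolding mono_maps_def monotone_on_def
  proof (intro CollectI conjI ballI impI)
    fix x y assume xy: "x \<in> Field X" "y \<in> Field X" "(x, y) \<in> X"
    then have "(ki x, ki y) \<in> X'" using k(2) ki by auto
    then have "(q (ki x), q (ki y)) \<in> E'" using mq3[OF q] ki xy by blast
    then show "(?R q x, ?R q y) \<in> E" using g(2) gi mq1[OF q] ki xy by auto
  qed (use gi mq1[OF q] ki in auto)
  have "bij_betw ?P (mono_maps X E) (mono_maps X' E')"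
  proof (rule bij_betw_byWitness[where f' = ?R])
    show "\<forall>f\<in>mono_maps X E. ?R (?P f) = f"
    proof
      fix f assume f: "f \<in> mono_maps X E"
      then have ex: "f \<in> extensional (Field X)" by (auto simp: mono_maps_def PiE_def)
      show "?R (?P f) = f"
        by (rule extensionalityI[OF restrict_extensional ex]) (use ki gg mf1[OF f] in auto)
    qed
    show "\<forall>q\<in>mono_maps X' E'. ?P (?R q) = q"
    proof
      fix q assume q: "q \<in> mono_maps X' E'"
      then have ex: "q \<in> extensional (Field X')" by (auto simp: mono_maps_def PiE_def)
      show "?P (?R q) = q"
        by (rule extensionalityI[OF restrict_extensional ex]) (use kk gi mq1[OF q] in auto)
    qed
  qed (use P R in auto)
  moreover have "(f, f') \<in> poset_exp E X \<longleftrightarrow> (?P f, ?P f') \<in> poset_exp E' X'"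
    if f: "f \<in> mono_maps X E" "f' \<in> mono_maps X E" for f f'
  proof -
    have "(\<forall>x\<in>Field X. (f x, f' x) \<in> E) \<longleftrightarrow> (\<forall>x\<in>Field X'. (f (k x), f' (k x)) \<in> E)"
      using ki kk by metis
    also have "\<dots> \<longleftrightarrow> (\<forall>x\<in>Field X'. (g (f (k x)), g (f' (k x))) \<in> E')"
      using g(2) mf1[OF f(1)] mf1[OF f(2)] kk(2) by simp
    finally show ?thesis using f P unfolding poset_exp_def by simp
  qed
  ultimately show ?thesis
    unfolding poset_iso_def Field_poset_exp[OF assms(3)] Field_poset_exp[OF assms(4)] by (intro exI[of _ ?P]) blast
qed

lemma conn_rof:
  assumes "poset_connected r" "poset_iso r (rof S)" "Partial_order r"
  shows "conn S"
  unfolding conn_def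
proof (intro allI impI ballI)
  obtain f where f: "bij_betw f S (Field r)" "\<forall>x\<in>S. \<forall>y\<in>S. (x, y) \<in> rof S \<longleftrightarrow> (f x, f y) \<in> r"
    using poset_iso_sym[OF assms(2)] unfolding poset_iso_def Field_rof by blast
  define fi where "fi = the_inv_into S f"
  have fi: "fi y \<in> S" "f (fi y) = y" if "y \<in> Field r" for y
    using f(1) that by (auto simp: fi_def bij_betw_def the_inv_into_into f_the_inv_into_f)
  have ff: "fi (f x) = x" "f x \<in> Field r" if "x \<in> S" for x
    using f(1) that by (auto simp: fi_def bij_betw_def the_inv_into_f_f)
  fix P x y assume a: "x \<in> S" "P x" "\<forall>y\<in>S. \<forall>z\<in>S. y \<le> z \<longrightarrow> P y = P z" "y \<in> S"
  have st: "P (fi u) = P (fi v)" if "(u, v) \<in> r" for u v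
  proof -
    have uv: "u \<in> Field r" "v \<in> Field r" using that by (auto intro: FieldI1 FieldI2)
    then have "fi u \<le> fi v" using f(2) fi that by (auto simp: rof_def)
    then show ?thesis using a(3) fi uv by blast
  qed
  have "(f x, f y) \<in> (r \<union> r\<inverse>)\<^sup>*" using assms(1) ff(2) a unfolding poset_connected_def by blast
  then have "P (fi (f y))"
  proof (induction rule: rtrancl_induct)
    case base then show ?case using a(1,2) ff by simp
  next
    case (step u v) then show ?case using st by blast
  qed
  then show "P y" using a(4) ff by simp
qed

lemma finite_base:
  assumes "Partial_order A" "finite (Field (poset_exp A C))" "Field C \<noteq> {}"
  shows "finite (Field A)"
proof -
  have rf: "(x, x) \<in> A" if "x \<in> Field A" for x using assms(1) that by (auto simp: order_on_defs refl_on_def)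
  obtain c where c: "c \<in> Field C" using assms(3) by auto
  have "(\<lambda>a. \<lambda>x\<in>Field C. a) ` Field A \<subseteq> mono_maps C A"
    using rf by (auto simp: mono_maps_def monotone_on_def)
  moreover have "inj_on (\<lambda>a. \<lambda>x\<in>Field C. a) (Field A)"
    by (rule inj_onI) (metis c restrict_apply')
  ultimately show ?thesis
    using assms(2) unfolding Field_poset_exp[OF assms(1)] by (metis finite_imageD finite_subset)
qed

theorem theorem6:
  fixes A :: "'a rel" and B :: "'b rel" and C :: "'c rel" and D :: "'d rel"
  assumes "Partial_order A" and "Partial_order B" and "Partial_order C" and "Partial_order D"
    and "Field A \<noteq> {}" and "Field B \<noteq> {}" and "Field C \<noteq> {}" and "Field D \<noteq> {}"
    and "finite (Field C)" and "poset_connected C"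
    and "finite (Field D)" and "poset_connected D"
    and "finite (Field (poset_exp A C))" and "poset_connected (poset_exp A C)"
    and "poset_iso (poset_exp A C) (poset_exp B D)"
  shows "\<exists>(E :: nat rel) (X :: nat rel) (Y :: nat rel) (Z :: nat rel).
           Partial_order E \<and> Partial_order X \<and> Partial_order Y \<and> Partial_order Z \<and>
           poset_iso A (poset_exp E X) \<and> poset_iso B (poset_exp E Y) \<and>
           poset_iso C (poset_prod Y Z) \<and> poset_iso D (poset_prod X Z)"
proof -
  note po = Partial_order_rof
  have finA: "finite (Field A)" by (rule finite_base[OF assms(1,13,7)])
  have "finite (Field (poset_exp B D))"
    using assms(13,15) bij_betw_finite unfolding poset_iso_def by blast
  then have finB: "finite (Field B)" by (rule finite_base[OF assms(2) _ assms(8)])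
  obtain SA SB SC SD :: "nat set set" where
    A: "finite SA" "poset_iso A (rof SA)" and B: "finite SB" "poset_iso B (rof SB)" and
    C: "finite SC" "poset_iso C (rof SC)" and D: "finite SD" "poset_iso D (rof SD)"
    using poset_on_nat_set[OF assms(1) finA] poset_on_nat_set[OF assms(2) finB]
      poset_on_nat_set[OF assms(3,9)] poset_on_nat_set[OF assms(4,11)] by metis
  have nonempty: "S \<noteq> {}" if "poset_iso r (rof S)" "Field r \<noteq> {}" for r :: "'x rel" and S :: "nat set set"
    using that unfolding poset_iso_def Field_rof by (auto simp: bij_betw_def)
  have AC: "poset_iso (poset_exp A C) (rof (pw SC SA))" and BD: "poset_iso (poset_exp B D) (rof (pw SD SB))"
    using poset_exp_cong[OF A(2) C(2) assms(1) po] poset_exp_cong[OF B(2) D(2) assms(2) po] by (simp_all add: poset_exp_rof)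
  have "oiso (pw SC SA) (pw SD SB)"
    using poset_iso_trans[OF poset_iso_trans[OF poset_iso_sym[OF AC] assms(15)] BD] by (simp add: poset_iso_rof)
  moreover have "conn (pw SC SA)" by (rule conn_rof[OF assms(14) AC Partial_order_poset_exp[OF assms(1)]])
  moreover have "solves SC SD"
    by (rule solves_all[OF C(1) conn_rof[OF assms(10) C(2) assms(3)] nonempty[OF C(2) assms(7)]
          D(1) conn_rof[OF assms(12) D(2) assms(4)] nonempty[OF D(2) assms(8)]])
  ultimately have "decomp SA SB SC SD"
    using A(1) B(1) nonempty[OF A(2) assms(5)] unfolding solves_def by blast
  then obtain E0 X0 Y0 Z0 :: "nat set set" where s: "finite E0" "finite X0" "finite Y0" "finite Z0"
    "oiso SA (pw X0 E0)" "oiso SB (pw Y0 E0)" "oiso SC (Y0 \<times> Z0)" "oiso SD (X0 \<times> Z0)" unfolding decomp_def by blast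
  obtain E X Y Z :: "nat rel" where
    E: "Partial_order E" "poset_iso (rof E0) E" and X: "Partial_order X" "poset_iso (rof X0) X" and
    Y: "Partial_order Y" "poset_iso (rof Y0) Y" and Z: "Partial_order Z" "poset_iso (rof Z0) Z"
    using finite_poset_on_nat[OF po] s(1-4) by (metis Field_rof)
  have "poset_iso A (poset_exp E X)"
    using poset_iso_trans[OF A(2) poset_iso_trans[OF s(5)[folded poset_iso_rof], folded poset_exp_rof,
          OF poset_exp_cong[OF E(2) X(2) po E(1)]]] .
  moreover have "poset_iso B (poset_exp E Y)"
    using poset_iso_trans[OF B(2) poset_iso_trans[OF s(6)[folded poset_iso_rof], folded poset_exp_rof,
          OF poset_exp_cong[OF E(2) Y(2) po E(1)]]] .
  moreover have "poset_iso C (poset_prod Y Z)"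
    using poset_iso_trans[OF C(2) poset_iso_trans[OF s(7)[folded poset_iso_rof], folded poset_prod_rof,
          OF poset_prod_cong[OF Y(2) Z(2) po po Y(1) Z(1)]]] .
  moreover have "poset_iso D (poset_prod X Z)"
    using poset_iso_trans[OF D(2) poset_iso_trans[OF s(8)[folded poset_iso_rof], folded poset_prod_rof,
          OF poset_prod_cong[OF X(2) Z(2) po po X(1) Z(1)]]] .
  ultimately show ?thesis using E(1) X(1) Y(1) Z(1) by blast
qed

end
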